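(* Let $X(\mathbb{R}^n)$ be a ball Banach function space, $p\in[1,\infty)$ and $\gamma\in\mathbb{R}\setminus\{0\}$. Assume that (i) $X^{1/p}(\mathbb{R}^n)$ is a ball Banach function space; (ii) both $X(\mathbb{R}^n)$ and its associate space $X'(\mathbb{R}^n)$ have absolutely continuous norms; (iii) the Hardy--Littlewood maximal operator $\mathcal{M}$ is bounded on $[X^{1/p}(\mathbb{R}^n)]'$; (iv) if $p=1$, then in addition $\mathcal{M}$ is bounded on $X(\mathbb{R}^n)$. Then $f\in\dot W^{1,X}(\mathbb{R}^n)$ if and only if $f\in L^1_{\mathrm{loc}}(\mathbb{R}^n)$ and $$\sup_{\lambda\in(0,\infty)}\lambda\left\|\left[\int_{\mathbb{R}^n}\mathbf{1}_{E_{\lambda,\gamma/p}[f]}(\cdot,y)\,|\cdot-y|^{\gamma-n}\,dy\right]^{1/p}\right\|_{X(\mathbb{R}^n)}<\infty;$$ moreover, for such $f$ this supremum is equivalent to $\|\,|\nabla f|\,\|_{X(\mathbb{R}^n)}$, with positive equivalence constants independent of $f$.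
   Context: A ball Banach function space $X(\mathbb{R}^n)$ is a Banach space of measurable functions on $\mathbb{R}^n$ whose norm $\|\cdot\|_{X(\mathbb{R}^n)}$ is defined for all measurable functions and satisfies: (a) $\|f\|_X=0$ implies $f=0$ a.e.; (b) $|g|\le|f|$ a.e. implies $\|g\|_X\le\|f\|_X$; (c) if $0\le f_m\uparrow f$ a.e. then $\|f_m\|_X\uparrow\|f\|_X$; (d) $\mathbf 1_B\in X$ for every ball $B$; (e) $\|f+g\|_X\le\|f\|_X+\|g\|_X$; (f) for every ball $B$ there is $C_{(B)}>0$ with $\int_B|f|\le C_{(B)}\|f\|_X$ for all $f\in X$. For $p\in(0,\infty)$, the convexification $X^{1/p}(\mathbb{R}^n)$ is the set of measurable $f$ with $|f|^{1/p}\in X(\mathbb{R}^n)$, normed by $\|f\|_{X^{1/p}}:=\|\,|f|^{1/p}\|_X^{p}$. The associate space $Y'$ of a ball Banach function space $Y$ is the set of measurable $f$ with $\|f\|_{Y'}:=\sup\{\|fg\|_{L^1(\mathbb{R}^n)}:\ \|g\|_Y=1\}<\infty$. A space $Y$ has an absolutely continuous norm if for every $f\in Y$ and every sequence of measurable sets $E_j$ with $\mathbf 1_{E_j}\to0$ a.e., $\|f\mathbf 1_{E_j}\|_Y\to0$. $\mathcal{M}(f)(x):=\sup_{B\ni x}|B|^{-1}\int_B|f|$ (supremum over balls). The homogeneous ball Banach Sobolev space $\dot W^{1,X}(\mathbb{R}^n)$ is the set of $f\in L^1_{\mathrm{loc}}(\mathbb{R}^n)$ whose weak gradient $\nabla f$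 exists and satisfies $|\nabla f|\in X(\mathbb{R}^n)$, with seminorm $\|\,|\nabla f|\,\|_{X}$. For an open set $\Omega$, $\lambda>0$ and $\beta\in\mathbb{R}$, $E_{\lambda,\beta}[f]:=\{(x,y)\in\Omega\times\Omega:\ x\ne y,\ |f(x)-f(y)|>\lambda|x-y|^{1+\beta}\}$; here $\Omega=\mathbb{R}^n$. *)

theory Defs
  imports "HOL-Analysis.Analysis"
begin

text \<open>Throughout, \<open>'a::euclidean_space\<close> plays the role of \<open>\<real>^n\<close> with \<open>n = DIM('a)\<close>,
  equipped with Lebesgue measure. A (ball Banach function space) norm is modelled as a
  functional \<open>N\<close> on nonnegative measurable functions (values in \<open>[0,\<infinity>]\<close>); a real
  measurable function \<open>f\<close> belongs to \<open>X\<close> iff \<open>N (\<lambda>x. ennreal \<bar>f x\<bar>) < \<infinity>\<close>, and its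
  norm is \<open>N (\<lambda>x. ennreal \<bar>f x\<bar>)\<close>.\<close>

type_synonym 'a bnorm = "('a \<Rightarrow> ennreal) \<Rightarrow> ennreal"

text \<open>Power of an extended nonnegative real with a positive real exponent.\<close>
definition epowr :: "ennreal \<Rightarrow> real \<Rightarrow> ennreal" where
  "epowr x a = (if x = \<infinity> then \<infinity> else ennreal (enn2real x powr a))"

definition ball_banach :: "('a::euclidean_space) bnorm \<Rightarrow> bool" where
  "ball_banach N \<longleftrightarrow>
    \<comment> \<open>(a)\<close>
    (\<forall>f \<in> borel_measurable lebesgue. N f = 0 \<longrightarrow> (AE x in lebesgue. f x = 0)) \<and>
    \<comment> \<open>(b)\<close>
    (\<forall>f \<in> borel_measurable lebesgue. \<forall>g \<in> borel_measurable lebesgue.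
        (AE x in lebesgue. g x \<le> f x) \<longrightarrow> N g \<le> N f) \<and>
    \<comment> \<open>(c) Fatou property\<close>
    (\<forall>F f. (\<forall>m. F m \<in> borel_measurable lebesgue) \<and> f \<in> borel_measurable lebesgue \<and>
        (AE x in lebesgue. incseq (\<lambda>m. F m x) \<and> f x = (SUP m. F m x))
        \<longrightarrow> N f = (SUP m. N (F m))) \<and>
    \<comment> \<open>(d)\<close>
    (\<forall>c r. N (\<lambda>x. indicator (ball c r) x) < \<infinity>) \<and>
    \<comment> \<open>(e) triangle inequality\<close>
    (\<forall>f \<in> borel_measurable lebesgue. \<forall>g \<in> borel_measurable lebesgue.
        N (\<lambda>x. f x + g x) \<le> N f + N g) \<and>
    \<comment> \<open>positive homogeneity of the norm\<close>
    (\<forall>f \<in> borel_measurable lebesgue. \<forall>c::real. c \<ge> 0 \<longrightarrow>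
        N (\<lambda>x. ennreal c * f x) = ennreal c * N f) \<and>
    \<comment> \<open>(f)\<close>
    (\<forall>c r. \<exists>C::real. C > 0 \<and> (\<forall>f \<in> borel_measurable lebesgue.
        (\<integral>\<^sup>+ x \<in> ball c r. f x \<partial>lebesgue) \<le> ennreal C * N f)) \<and>
    \<comment> \<open>completeness of \<open>X\<close> (Banach space)\<close>
    (\<forall>F::nat \<Rightarrow> 'a \<Rightarrow> real. (\<forall>m. F m \<in> borel_measurable lebesgue \<and>
          N (\<lambda>x. ennreal \<bar>F m x\<bar>) < \<infinity>) \<and>
        (\<forall>e>0. \<exists>M. \<forall>m\<ge>M. \<forall>k\<ge>M. N (\<lambda>x. ennreal \<bar>F m x - F k x\<bar>) < ennreal e)
      \<longrightarrow> (\<exists>f \<in> borel_measurable lebesgue. N (\<lambda>x. ennreal \<bar>f x\<bar>) < \<infinity> \<and>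
            (\<lambda>m. N (\<lambda>x. ennreal \<bar>F m x - f x\<bar>)) \<longlonglongrightarrow> 0))"

definition convexification :: "('a::euclidean_space) bnorm \<Rightarrow> real \<Rightarrow> 'a bnorm" where
  "convexification N p = (\<lambda>f. epowr (N (\<lambda>x. epowr (f x) (1 / p))) p)"

definition associate :: "('a::euclidean_space) bnorm \<Rightarrow> 'a bnorm" where
  "associate N = (\<lambda>g. SUP f \<in> {f \<in> borel_measurable lebesgue. N f = 1}.
                      \<integral>\<^sup>+ x. f x * g x \<partial>lebesgue)"

definition abs_cont_norm :: "('a::euclidean_space) bnorm \<Rightarrow> bool" where
  "abs_cont_norm N \<longleftrightarrow>
    (\<forall>f \<in> borel_measurable lebesgue. N f < \<infinity> \<longrightarrow>
      (\<forall>E::nat \<Rightarrow> 'a set. (\<forall>j. E j \<in> sets lebesgue) \<and>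
          (AE x in lebesgue. (\<lambda>j. indicator (E j) x :: real) \<longlonglongrightarrow> 0)
        \<longrightarrow> (\<lambda>j. N (\<lambda>x. f x * indicator (E j) x)) \<longlonglongrightarrow> 0))"

definition maximal :: "('a::euclidean_space \<Rightarrow> ennreal) \<Rightarrow> 'a \<Rightarrow> ennreal" where
  "maximal f x = (SUP B \<in> {ball c r | c r. r > 0 \<and> x \<in> ball c r}.
                    (\<integral>\<^sup>+ y \<in> B. f y \<partial>lebesgue) / emeasure lebesgue B)"

definition maximal_bounded :: "('a::euclidean_space) bnorm \<Rightarrow> bool" where
  "maximal_bounded N \<longleftrightarrow> (\<exists>C::real. C > 0 \<and>
     (\<forall>f \<in> borel_measurable lebesgue. N (maximal f) \<le> ennreal C * N f))"

definition loc_integrable :: "('a::euclidean_space \<Rightarrow> 'b::{banach,second_countable_topology}) \<Rightarrow> bool" where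
  "loc_integrable f \<longleftrightarrow> (\<forall>K. compact K \<longrightarrow> set_integrable lebesgue K f)"

fun iter_pd :: "'a::euclidean_space list \<Rightarrow> ('a \<Rightarrow> real) \<Rightarrow> 'a \<Rightarrow> real" where
  "iter_pd [] g = g"
| "iter_pd (b # bs) g = (\<lambda>x. frechet_derivative (iter_pd bs g) (at x) b)"

definition smooth :: "('a::euclidean_space \<Rightarrow> real) \<Rightarrow> bool" where
  "smooth g \<longleftrightarrow> (\<forall>bs. set bs \<subseteq> Basis \<longrightarrow>
      (\<forall>x. iter_pd bs g differentiable (at x)) \<and> continuous_on UNIV (iter_pd bs g))"

definition test_fun :: "('a::euclidean_space \<Rightarrow> real) \<Rightarrow> bool" where
  "test_fun \<phi> \<longleftrightarrow> smooth \<phi> \<and> compact (closure {x. \<phi> x \<noteq> 0})"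

definition weak_gradient :: "('a::euclidean_space \<Rightarrow> real) \<Rightarrow> ('a \<Rightarrow> 'a) \<Rightarrow> bool" where
  "weak_gradient f G \<longleftrightarrow> loc_integrable G \<and>
     (\<forall>\<phi>. test_fun \<phi> \<longrightarrow> (\<forall>b \<in> Basis.
        (\<integral>x. f x * frechet_derivative \<phi> (at x) b \<partial>lebesgue)
          = - (\<integral>x. (G x \<bullet> b) * \<phi> x \<partial>lebesgue)))"

definition sobolev :: "('a::euclidean_space) bnorm \<Rightarrow> ('a \<Rightarrow> real) \<Rightarrow> bool" where
  "sobolev N f \<longleftrightarrow> loc_integrable f \<and>
     (\<exists>G. weak_gradient f G \<and> N (\<lambda>x. ennreal (norm (G x))) < \<infinity>)"

definition E_set :: "real \<Rightarrow> real \<Rightarrow> ('a::euclidean_space \<Rightarrow> real) \<Rightarrow> ('a \<times> 'a) set" where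
  "E_set lam \<beta> f = {(x, y). x \<noteq> y \<and> \<bar>f x - f y\<bar> > lam * dist x y powr (1 + \<beta>)}"

definition BSVY :: "('a::euclidean_space) bnorm \<Rightarrow> real \<Rightarrow> real \<Rightarrow> ('a \<Rightarrow> real) \<Rightarrow> ennreal" where
  "BSVY N p \<gamma> f = (SUP lam \<in> {0<..}. ennreal lam *
     N (\<lambda>x. epowr (\<integral>\<^sup>+ y. indicator (E_set lam (\<gamma> / p) f) (x, y)
                         * ennreal (dist x y powr (\<gamma> - real DIM('a))) \<partial>lebesgue) (1 / p)))"

end

theory Submission
  imports Defs "HOL-Computational_Algebra.Polynomial"
begin

text \<open>Upper bound. Approximating by mollifications, \<open>\<bar>f x - f y\<bar>\<close> is at most
  \<open>C dist x y (M \<bar>\<nabla>f\<bar> x + M \<bar>\<nabla>f\<bar> y)\<close> almost everywhere. By Lorentz--Luxemburg duality in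
  \<open>X\<^bsup>1/p\<^esup>\<close> the norm of the level set integral is tested against some \<open>g\<close> of the associate
  space. After Tonelli the kernel \<open>dist x y powr (\<gamma> - n)\<close>, restricted to a level set, turns \<open>g\<close> into
  \<open>M g\<close>, and the Fefferman--Stein inequality (for \<open>p = 1\<close>: boundedness of \<open>M\<close> on \<open>X\<close>) moves \<open>M\<close>
  away from \<open>\<nabla>f\<close>.

  Lower bound. At almost every point \<open>f\<close> agrees with its first order Taylor polynomial up to a small
  mean error, so a fixed portion of a cone around \<open>\<nabla>f x\<close> lies in the level set once \<open>\<lambda>\<close> is
  close to its limit (\<open>\<infinity>\<close> if \<open>\<gamma> > 0\<close>, \<open>0\<close> if \<open>\<gamma> < 0\<close>); Fatou's lemma concludes.

  Existence of the gradient. Dyadic difference quotients of \<open>f\<close>, averaged over the scales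
  \<open>2 ^ (- j)\<close> with \<open>k \<le> j < 2 k\<close>, are bounded in \<open>X\<close> uniformly in \<open>k\<close>: the shells of different scales
  are disjoint, so together they use the level set integrals of \<open>O(k)\<close> values of \<open>\<lambda>\<close> only, and
  each of these is controlled. Absolute continuity of the norm of \<open>X'\<close> provides weak limits, which by
  summation by parts are multiples of the partial derivatives.\<close>

text \<open>Two obstacles shape the proof. The norm of X need not be invariant under translations,
  so mollifications and difference quotients cannot be bounded in X by moving \<open>f\<close>.
  Smoothing is therefore done only pointwise or in local L^1, with constants independent of the
  mollification parameter, and \<open>f\<close> itself is reached at its Lebesgue points. Secondly,
  the supremum over \<lambda> is a weak type quantity. Recovering the difference quotient of one
  scale 2 ^ (- j) from level sets takes about j dyadic levels, each of norm O(1), which loses a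
  factor j. The average over k \<le> j < 2 k spends the same O(k) levels on k disjoint shells, and
  the loss cancels. To keep the number of levels O(k), \<open>f\<close> is clipped at a height of at
  most 2 ^ k. The exponent p = 1 stands apart because the constant of the Fefferman-Stein inequality
  is of order 1 / (p - 1). Duality is applied in \<open>convexification N p\<close>, where the level
  set integral itself, not its p-th root, is tested, so that Tonelli applies.\<close>

lemma nn_integral_lborel_affine:
  fixes F :: "'a::euclidean_space \<Rightarrow> ennreal"
  assumes [measurable]: "F \<in> borel_measurable borel" and c: "c \<noteq> 0"
  shows "(\<integral>\<^sup>+x. F x \<partial>lborel) = ennreal (\<bar>c\<bar> ^ DIM('a)) * (\<integral>\<^sup>+x. F (t + c *\<^sub>R x) \<partial>lborel)"
  by (subst lborel_affine[OF c, of t])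
     (simp add: nn_integral_density nn_integral_distr nn_integral_cmult)

section \<open>Real powers of extended nonnegative numbers\<close>

lemma epowr_top [simp]: "epowr top a = top"
  by (simp add: epowr_def)

lemma epowr_ennreal [simp]: "x \<ge> 0 \<Longrightarrow> epowr (ennreal x) a = ennreal (x powr a)"
  by (simp add: epowr_def)

lemma epowr_0 [simp]: "epowr 0 a = 0"
  using epowr_ennreal[of 0 a] by simp

lemma epowr_1 [simp]: "epowr x 1 = x"
  by (cases x) auto

lemma epowr_epowr: "epowr (epowr x a) b = epowr x (a * b)"
  by (cases x) (auto simp: powr_powr)

lemma epowr_mult: "a > 0 \<Longrightarrow> epowr (x * y) a = epowr x a * epowr y a"
  by (cases x; cases y; cases "x = 0"; cases "y = 0")
     (auto simp: ennreal_mult_top ennreal_top_mult powr_mult simp flip: ennreal_mult)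

lemma epowr_mono: "a \<ge> 0 \<Longrightarrow> x \<le> y \<Longrightarrow> epowr x a \<le> epowr y a"
  by (cases x; cases y) (auto simp: powr_mono2 top_unique intro!: ennreal_leI)

lemma epowr_le_iff: "a > 0 \<Longrightarrow> epowr x a \<le> epowr y a \<longleftrightarrow> x \<le> y"
  using epowr_mono[of a x y] epowr_mono[of "1/a" "epowr x a" "epowr y a"]
  by (auto simp: epowr_epowr)

lemma epowr_less_top [simp]: "epowr x a < top \<longleftrightarrow> x < top"
  by (cases x) auto

lemma measurable_epowr [measurable (raw)]:
  assumes [measurable]: "f \<in> borel_measurable M"
  shows "(\<lambda>x. epowr (f x) a) \<in> borel_measurable M"
  unfolding epowr_def by measurable

text \<open>Bounding \<open>x + y\<close> by twice the maximum serves convex and concave powers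
  alike, at the price of a constant that is not sharp.\<close>

lemma epowr_add_le:
  assumes "a > 0"
  shows "epowr (x + y) a \<le> ennreal (2 powr a) * (epowr x a + epowr y a)"
proof -
  have "x + y \<le> 2 * max x y"
    by (metis add_mono max.cobounded1 max.cobounded2 mult_2)
  then have "epowr (x + y) a \<le> epowr (2 * max x y) a"
    using assms by (intro epowr_mono) auto
  also have "\<dots> = ennreal (2 powr a) * epowr (max x y) a"
    using assms epowr_ennreal[of 2 a] by (simp add: epowr_mult)
  also have "epowr (max x y) a \<le> epowr x a + epowr y a"
    by (auto simp: max_def)
  finally show ?thesis by (simp add: mult_left_mono)
qed

section \<open>Ball Banach function spaces and duality\<close>

text \<open>Quantitative strict convexity of j(t) = sqrt (1 + t^2): since q equals 2 j((a + b) / 2),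
  the number s + t - q is the midpoint defect of j. The function j grows linearly, so bounds in L^1
  will do; the price is a modulus of convexity that decays like the inverse cube of the
  size.\<close>

lemma sqrt_gap:
  fixes a b :: real
  defines "s \<equiv> sqrt (1 + a\<^sup>2)" and "t \<equiv> sqrt (1 + b\<^sup>2)" and "q \<equiv> sqrt (4 + (a + b)\<^sup>2)"
  shows "(a - b)\<^sup>2 \<le> 2 * (s + t) ^ 3 * (s + t - q)" "q \<le> s + t"
proof -
  have s: "s\<^sup>2 = 1 + a\<^sup>2" "s > 0" and t: "t\<^sup>2 = 1 + b\<^sup>2" "t > 0"
    and q: "q\<^sup>2 = 4 + (a + b)\<^sup>2" "q > 0"
    unfolding s_def t_def q_def by (simp_all add: add_nonneg_nonneg add_pos_nonneg)
  \<comment> \<open>This and \<open>diff\<close> rationalise differences of square roots; behind it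
    is (1 + a^2)(1 + b^2) = (1 + a b)^2 + (a - b)^2.\<close>
  have prod: "(s * t - (1 + a * b)) * (s * t + (1 + a * b)) = (a - b)\<^sup>2"
    using s t by algebra
  have st: "1 + a * b \<le> s * t"
  proof -
    have "(1 + a * b)\<^sup>2 \<le> (s * t)\<^sup>2"
      using prod zero_le_power2[of "a - b"] by (simp add: algebra_simps power2_eq_square)
    then show ?thesis using s t by (meson power2_le_imp_le less_imp_le mult_nonneg_nonneg)
  qed
  have diff: "(s + t - q) * (s + t + q) = 2 * (s * t - (1 + a * b))"
    using s t q by algebra
  show q': "q \<le> s + t"
  proof (rule power2_le_imp_le)
    show "q\<^sup>2 \<le> (s + t)\<^sup>2" using diff st by (simp add: algebra_simps power2_eq_square)
  qed (use s t in auto)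
  have "(a - b)\<^sup>2 \<le> (s * t - (1 + a * b)) * (2 * (s * t))"
    unfolding prod[symmetric] using st by (intro mult_left_mono) auto
  also have "\<dots> = (s + t - q) * (s + t + q) * (s * t)" using diff by simp
  also have "\<dots> \<le> (s + t - q) * (2 * (s + t)) * (s + t)\<^sup>2"
  proof (rule mult_mono)
    show "(s + t - q) * (s + t + q) \<le> (s + t - q) * (2 * (s + t))"
      using q' by (intro mult_left_mono) auto
    show "s * t \<le> (s + t)\<^sup>2" using s t by (simp add: power2_eq_square algebra_simps)
  qed (use s t q' in auto)
  also have "\<dots> = 2 * (s + t) ^ 3 * (s + t - q)"
    by (simp add: power2_eq_square power3_eq_cube)
  finally show "(a - b)\<^sup>2 \<le> 2 * (s + t) ^ 3 * (s + t - q)" .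
qed

text \<open>The modulus of \<open>sqrt_gap\<close> degenerates for large arguments, so sizes are cut
  at R. Above R the left side is at most 1 and is paid for by W / R; below R the cube is at most R ^
  3. For R = 2 ^ i the first and last terms are summable after integration, and a defect below
  (1/32) ^ i absorbs R ^ 4.\<close>

lemma min_one_diff_le:
  fixes a b R :: real
  assumes "R > 0"
  shows "min 1 \<bar>a - b\<bar> \<le> (sqrt (1 + a\<^sup>2) + sqrt (1 + b\<^sup>2)) / R
     + R ^ 4 * (sqrt (1 + a\<^sup>2) + sqrt (1 + b\<^sup>2) - sqrt (4 + (a + b)\<^sup>2)) + 1 / R"
proof -
  define W where "W = sqrt (1 + a\<^sup>2) + sqrt (1 + b\<^sup>2)"
  define V where "V = W - sqrt (4 + (a + b)\<^sup>2)"
  have g: "(a - b)\<^sup>2 \<le> 2 * W ^ 3 * V" "0 \<le> V"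
    using sqrt_gap[of a b] unfolding W_def V_def by auto
  have W: "W > 0" unfolding W_def by (intro add_pos_pos) (auto simp: add_pos_nonneg)
  have "min 1 \<bar>a - b\<bar> \<le> W / R + R ^ 4 * V + 1 / R"
  proof (cases "W \<le> R")
    case False
    then have "1 \<le> W / R" using assms by simp
    moreover have "0 \<le> R ^ 4 * V + 1 / R" using assms g by simp
    ultimately show ?thesis by linarith
  next
    case True
    \<comment> \<open>The defect controls only (a - b)^2; this square passes from the first power to
      the second, with an error 1 / R after division.\<close>
    have "(R * \<bar>a - b\<bar> - 1)\<^sup>2 \<ge> 0" by simp
    then have "2 * (R * \<bar>a - b\<bar>) \<le> R\<^sup>2 * (a - b)\<^sup>2 + 1"
      by (simp add: power2_eq_square algebra_simps)
    also have "\<dots> \<le> R\<^sup>2 * (2 * W ^ 3 * V) + 1"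
      using g assms by (intro add_right_mono mult_left_mono) auto
    also have "\<dots> \<le> R\<^sup>2 * (2 * R ^ 3 * V) + 1"
      using g assms W True by (intro add_right_mono mult_left_mono mult_right_mono power_mono) auto
    also have "\<dots> = R * (2 * R ^ 4 * V + 1 / R)"
      using assms by (simp add: field_simps power2_eq_square power4_eq_xxxx power3_eq_cube)
    finally have "R * (2 * \<bar>a - b\<bar>) \<le> R * (2 * R ^ 4 * V + 1 / R)" by (simp add: mult.left_commute)
    then have "2 * \<bar>a - b\<bar> \<le> 2 * R ^ 4 * V + 1 / R" using assms by simp
    moreover have "0 \<le> W / R" "0 \<le> 1 / R" "min 1 \<bar>a - b\<bar> \<le> \<bar>a - b\<bar>" using W assms by auto
    moreover have "m \<le> z + x + y" if "2 * d \<le> 2 * x + y" "0 \<le> z" "0 \<le> y" "m \<le> d" for m x y z d :: real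
      using that by linarith
    note this[of "\<bar>a - b\<bar>" "R ^ 4 * V" "1 / R" "W / R" "min 1 \<bar>a - b\<bar>"]
    ultimately show ?thesis by (simp add: mult.assoc)
  qed
  then show ?thesis unfolding W_def V_def by simp
qed

text \<open>The summands tend to 0, so from some index on the minimum is the increment itself and
  the telescoping series converges absolutely.\<close>

lemma summable_min_one_imp_convergent:
  fixes h :: "nat \<Rightarrow> real"
  assumes "summable (\<lambda>i. min 1 \<bar>h (Suc i) - h i\<bar>)"
  shows "convergent h"
proof -
  have "(\<lambda>i. min 1 \<bar>h (Suc i) - h i\<bar>) \<longlonglongrightarrow> 0" using assms by (rule summable_LIMSEQ_zero)
  then have "eventually (\<lambda>i. min 1 \<bar>h (Suc i) - h i\<bar> < 1) sequentially"
    by (rule order_tendstoD) simp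
  then have "eventually (\<lambda>i. min 1 \<bar>h (Suc i) - h i\<bar> = norm (h (Suc i) - h i)) sequentially"
    by eventually_elim auto
  then have "summable (\<lambda>i. norm (h (Suc i) - h i))" using assms summable_cong by fastforce
  then have "summable (\<lambda>i. h (Suc i) - h i)" by (rule summable_norm_cancel)
  then have "(\<lambda>k. h 0 + (\<Sum>i<k. h (Suc i) - h i)) \<longlonglongrightarrow> h 0 + (\<Sum>i. h (Suc i) - h i)"
    by (intro tendsto_add tendsto_const summable_LIMSEQ)
  then show ?thesis by (simp add: sum_lessThan_telescope convergent_def) blast
qed

text \<open>Near-minimisers of the strictly convex functional \<open>\<integral> sqrt (1 + g\<^sup>2)\<close> over midpoint-convex
  sets form a Cauchy sequence in measure; this replaces weak compactness arguments.\<close>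

lemma midpoint_convex_selection:
  fixes M :: "'b measure" and C :: "nat \<Rightarrow> ('b \<Rightarrow> real) set"
  assumes "finite_measure M"
    and meas: "\<And>k g. g \<in> C k \<Longrightarrow> g \<in> borel_measurable M"
    and ne: "\<And>k. C k \<noteq> {}"
    and dec: "\<And>k. C (Suc k) \<subseteq> C k"
    and mid: "\<And>k g h. g \<in> C k \<Longrightarrow> h \<in> C k \<Longrightarrow> (\<lambda>x. (g x + h x) / 2) \<in> C k"
    and bd: "\<And>g. g \<in> C 0 \<Longrightarrow> (\<integral>\<^sup>+x. ennreal \<bar>g x\<bar> \<partial>M) \<le> ennreal B"
  obtains h hl where "\<And>k. h k \<in> C k" "hl \<in> borel_measurable M"
    "AE x in M. (\<lambda>k. h k x) \<longlonglongrightarrow> hl x"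
proof -
  interpret finite_measure M by fact
  define m where "m = measure M (space M)"
  define B' where "B' = max B 0"
  have m0: "m \<ge> 0" unfolding m_def by simp
  define j where "j = (\<lambda>t::real. sqrt (1 + t\<^sup>2))"
  define J where "J = (\<lambda>g. \<integral>x. j (g x) \<partial>M)"
  have decC: "k \<le> l \<Longrightarrow> C l \<subseteq> C k" for k l
    using dec by (rule lift_Suc_antimono_le)
  have Int: "integrable M g" if "g \<in> C k" for g k
  proof -
    have "g \<in> C 0" using decC[of 0 k] that by auto
    from bd[OF this] show ?thesis
      by (intro integrableI_bounded) (auto simp: meas[OF that] intro: le_less_trans)
  qed
  have j_le: "j t \<le> 1 + \<bar>t\<bar>" for t
    unfolding j_def by (rule real_le_lsqrt) (auto simp: power2_eq_square algebra_simps)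
  have j0: "0 \<le> j t" for t unfolding j_def by simp
  have [measurable]: "j \<in> borel_measurable borel" unfolding j_def by measurable
  have Intj: "integrable M (\<lambda>x. j (g x))" if "g \<in> C k" for g k
  proof (rule Bochner_Integration.integrable_bound)
    show "integrable M (\<lambda>x. 1 + \<bar>g x\<bar>)" using Int[OF that] by auto
    show "(\<lambda>x. j (g x)) \<in> borel_measurable M" using meas[OF that] by measurable
    show "AE x in M. norm (j (g x)) \<le> norm (1 + \<bar>g x\<bar>)"
      using j_le j0 by (auto intro!: AE_I2)
  qed
  have Jbd: "J g \<le> m + B'" if "g \<in> C k" for g k
  proof -
    have g0: "g \<in> C 0" using decC[of 0 k] that by auto
    have "J g \<le> (\<integral>x. 1 + \<bar>g x\<bar> \<partial>M)" unfolding J_def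
      using Int[OF that] Intj[OF that] j_le by (intro integral_mono) auto
    also have "\<dots> = m + (\<integral>x. \<bar>g x\<bar> \<partial>M)"
      unfolding m_def using Int[OF that] by (subst Bochner_Integration.integral_add) auto
    also have "(\<integral>x. \<bar>g x\<bar> \<partial>M) = enn2real (\<integral>\<^sup>+x. ennreal \<bar>g x\<bar> \<partial>M)"
      using meas[OF that] by (intro integral_eq_nn_integral) auto
    also have "\<dots> \<le> B'" unfolding B'_def using bd[OF g0]
      by (intro enn2real_leI) (auto intro: order_trans ennreal_leI)
    finally show ?thesis by simp
  qed
  have J0: "0 \<le> J g" for g unfolding J_def using j0 by (intro integral_nonneg_AE) auto
  \<comment> \<open>The sets shrink and J is bounded on all of them, so these infima increase to a
    finite limit.\<close>
  define I where "I = (\<lambda>k. INF g\<in>C k. J g)"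
  have bdd: "bdd_below (J ` C k)" for k using J0 by (auto intro!: bdd_belowI)
  have I_le: "I k \<le> J g" if "g \<in> C k" for g k
    unfolding I_def using bdd that by (intro cINF_lower) auto
  have Imono: "I k \<le> I (Suc k)" for k
    unfolding I_def using ne dec bdd by (intro cINF_superset_mono) auto
  have Ibd: "I k \<le> m + B'" for k
    using ne[of k] I_le[of _ k] Jbd[of _ k] by (meson all_not_in_conv order_trans)
  have "incseq I" using Imono by (rule incseq_SucI)
  then have "convergent I"
    using Ibd by (metis incseq_convergent convergent_def)
  then have "Cauchy I" by (rule convergent_Cauchy)
  have "\<exists>g\<in>C k. J g < I k + 1 / Suc k" for k
  proof -
    have "(INF g\<in>C k. J g) < I k + 1 / Suc k" unfolding I_def by simp
    from cInf_lessD[OF _ this] show ?thesis using ne by auto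
  qed
  then obtain u where u: "\<And>k. u k \<in> C k" "\<And>k. J (u k) < I k + 1 / Suc k" by metis
  define V where "V = (\<lambda>a b::real. j a + j b - sqrt (4 + (a + b)\<^sup>2))"
  have V_eq: "V a b = j a + j b - 2 * j ((a + b) / 2)" for a b
  proof -
    have "sqrt (4 + (a + b)\<^sup>2) = sqrt (2\<^sup>2 * (1 + ((a + b) / 2)\<^sup>2))"
      by (simp add: power_divide algebra_simps)
    also have "\<dots> = 2 * j ((a + b) / 2)" unfolding j_def by (subst real_sqrt_mult) auto
    finally show ?thesis unfolding V_def by simp
  qed
  have V0: "0 \<le> V a b" for a b using sqrt_gap(2)[of a b] unfolding V_def j_def by simp
  \<comment> \<open>For k \<le> l both near-minimisers lie in \<open>C k\<close>, hence so does
    their midpoint, whose J is at least \<open>I k\<close>; the integrated defect is then controlled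
    by the gap between the infima.\<close>
  have IntV: "integrable M (\<lambda>x. V (u k x) (u l x))"
    and VI: "(\<integral>x. V (u k x) (u l x) \<partial>M) \<le> 1 / Suc k + 1 / Suc l + (I l - I k)" if "k \<le> l" for k l
  proof -
    have ul: "u l \<in> C k" using u decC[OF that] by auto
    note mm = mid[OF u(1)[of k] ul]
    show "integrable M (\<lambda>x. V (u k x) (u l x))"
      unfolding V_eq using Intj[OF mm] Intj[OF u(1)[of k]] Intj[OF ul] by auto
    have "(\<integral>x. V (u k x) (u l x) \<partial>M) = J (u k) + J (u l) - 2 * J (\<lambda>x. (u k x + u l x) / 2)"
      unfolding V_eq J_def using Intj[OF mm] Intj[OF u(1)[of k]] Intj[OF ul] by simp
    then show "(\<integral>x. V (u k x) (u l x) \<partial>M) \<le> 1 / Suc k + 1 / Suc l + (I l - I k)"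
      using u(2)[of k] u(2)[of l] I_le[OF mm] by linarith
  qed
  have ev: "\<exists>K. \<forall>k\<ge>K. \<forall>l\<ge>k. (\<integral>x. V (u k x) (u l x) \<partial>M) \<le> e" if "e > 0" for e
  proof -
    have "\<exists>K. \<forall>k\<ge>K. \<forall>l\<ge>K. norm (I k - I l) < e / 3"
      using that by (intro CauchyD[OF \<open>Cauchy I\<close>]) auto
    then obtain K1 where K1: "\<And>k l. k \<ge> K1 \<Longrightarrow> l \<ge> K1 \<Longrightarrow> norm (I k - I l) < e / 3" by metis
    have e3: "e / 3 > 0" using that by simp
    obtain K2 where K2: "inverse (real (Suc K2)) < e / 3" using reals_Archimedean[OF e3] by blast
    have small: "1 / Suc k \<le> e / 3" if "k \<ge> K2" for k
    proof -
      have "1 / real (Suc k) \<le> 1 / real (Suc K2)" using that by (intro divide_left_mono) auto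
      then show ?thesis using K2 by (simp add: inverse_eq_divide)
    qed
    have "(\<integral>x. V (u k x) (u l x) \<partial>M) \<le> e" if "k \<ge> max K1 K2" "l \<ge> k" for k l
    proof -
      have "\<bar>I k - I l\<bar> < e / 3" using K1[of k l] that by simp
      moreover have "1 / Suc k \<le> e / 3" "1 / Suc l \<le> e / 3" using small that by auto
      ultimately show ?thesis using VI[OF that(2)] by linarith
    qed
    then show ?thesis by blast
  qed
  \<comment> \<open>The rate 1/32 beats the factor R ^ 4 = 16 ^ i of \<open>min_one_diff_le\<close>
    for R = 2 ^ i and leaves (1/2) ^ i.\<close>
  have "\<exists>K. \<forall>i. (\<forall>k\<ge>K i. \<forall>l\<ge>k. (\<integral>x. V (u k x) (u l x) \<partial>M) \<le> (1/32) ^ i)"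
    using ev[of "(1/32)^_"] by (intro choice) auto
  then obtain K where K: "\<And>i k l. k \<ge> K i \<Longrightarrow> l \<ge> k \<Longrightarrow> (\<integral>x. V (u k x) (u l x) \<partial>M) \<le> (1/32) ^ i"
    by blast
  \<comment> \<open>Partial sums with the extra 1 give at once r i \<ge> K i, r i \<ge> i and
    monotonicity; r i \<ge> i puts \<open>u (r i)\<close> into \<open>C i\<close>.\<close>
  define r where "r = (\<lambda>i. (\<Sum>i'\<le>i. K i' + 1))"
  have rK: "r i \<ge> K i" for i unfolding r_def by (rule order_trans[OF _ member_le_sum[of i]]) auto
  have ri: "r i \<ge> i" for i unfolding r_def sum.distrib by simp
  have rS: "r i \<le> r (Suc i)" for i unfolding r_def by simp
  define h where "h = (\<lambda>i. u (r i))"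
  have hC: "h i \<in> C i" for i unfolding h_def using u(1) decC[OF ri[of i]] by auto
  note [measurable] = meas[OF hC]
  have Vh: "(\<integral>x. V (h i x) (h (Suc i) x) \<partial>M) \<le> (1/32) ^ i"
    and IVh: "integrable M (\<lambda>x. V (h i x) (h (Suc i) x))" for i
    unfolding h_def using K[OF rK rS, of i] IntV[OF rS, of i] by auto
  define c where "c = 3 * m + 2 * B' + 1"
  have c0: "c \<ge> 0" unfolding c_def B'_def using m0 by simp
  define D where "D = (\<lambda>i x. min 1 \<bar>h (Suc i) x - h i x\<bar>)"
  have DI: "(\<integral>\<^sup>+x. ennreal (D i x) \<partial>M) \<le> ennreal (c * (1/2) ^ i)" for i
  proof -
    define F where "F = (\<lambda>x. (j (h i x) + j (h (Suc i) x)) * (1/2)^i + 16 ^ i * V (h i x) (h (Suc i) x) + (1/2) ^ i)"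
    have "((2::real) ^ i) ^ 4 = (2 ^ 4) ^ i" by (simp only: power_mult[symmetric] mult.commute)
    then have p4: "((2::real) ^ i) ^ 4 = 16 ^ i" by simp
    have DF: "D i x \<le> F x" for x
      using min_one_diff_le[of "2 ^ i" "h i x" "h (Suc i) x"]
      unfolding D_def F_def V_def j_def p4
      by (simp add: power_divide abs_minus_commute)
    have IF: "integrable M F" unfolding F_def
      using Intj[OF hC] IVh by auto
    have "(\<integral>\<^sup>+x. ennreal (D i x) \<partial>M) \<le> (\<integral>\<^sup>+x. ennreal (F x) \<partial>M)"
      using DF by (intro nn_integral_mono ennreal_leI) auto
    also have "\<dots> = ennreal (\<integral>x. F x \<partial>M)"
      using IF by (intro nn_integral_eq_integral) (auto simp: F_def j0 V0 intro!: AE_I2 add_nonneg_nonneg mult_nonneg_nonneg)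
    finally have le: "(\<integral>\<^sup>+x. ennreal (D i x) \<partial>M) \<le> ennreal (\<integral>x. F x \<partial>M)" .
    have "(\<integral>x. F x \<partial>M) = (J (h i) + J (h (Suc i))) * (1/2)^i + 16 ^ i * (\<integral>x. V (h i x) (h (Suc i) x) \<partial>M) + (1/2)^i * m"
      unfolding F_def J_def m_def using Intj[OF hC] IVh by simp
    also have "\<dots> \<le> ((m + B') + (m + B')) * (1/2)^i + 16 ^ i * (1/32) ^ i + (1/2)^i * m"
      using Jbd[OF hC] Vh by (intro add_mono mult_right_mono mult_left_mono) auto
    also have "(16::real) ^ i * (1/32) ^ i = (1/2)^i" by (simp flip: power_mult_distrib)
    finally have "(\<integral>x. F x \<partial>M) \<le> c * (1/2) ^ i" unfolding c_def by (simp add: algebra_simps)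
    then show ?thesis using le by (meson ennreal_leI order_trans)
  qed
  have "(\<integral>\<^sup>+x. (\<Sum>i. ennreal (D i x)) \<partial>M) = (\<Sum>i. \<integral>\<^sup>+x. ennreal (D i x) \<partial>M)"
    unfolding D_def by (rule nn_integral_suminf) measurable
  also have "\<dots> \<le> (\<Sum>i. ennreal (c * (1/2) ^ i))" by (intro suminf_le DI) auto
  also have "\<dots> = ennreal (\<Sum>i. c * (1/2) ^ i)"
    using c0 by (intro suminf_ennreal2) (auto intro!: summable_mult summable_geometric)
  also have "\<dots> < \<infinity>" by simp
  finally have "AE x in M. (\<Sum>i. ennreal (D i x)) \<noteq> \<infinity>"
    unfolding D_def by (intro nn_integral_noteq_infinite) auto
  then have "AE x in M. convergent (\<lambda>k. h k x)"
  proof eventually_elim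
    case (elim x)
    have "summable (\<lambda>i. D i x)" using elim by (intro summable_suminf_not_top) (auto simp: D_def)
    then show ?case unfolding D_def by (intro summable_min_one_imp_convergent)
  qed
  then have "AE x in M. (\<lambda>k. h k x) \<longlonglongrightarrow> lim (\<lambda>k. h k x)"
    by eventually_elim (simp add: convergent_LIMSEQ_iff)
  moreover have "(\<lambda>x. lim (\<lambda>k. h k x)) \<in> borel_measurable M" by measurable
  ultimately show ?thesis using that hC by blast
qed

lemma ennreal_half_add: "0 \<le> a \<Longrightarrow> 0 \<le> b \<Longrightarrow> ennreal (1/2) * (ennreal a + ennreal b) = ennreal ((a + b) / 2)"
  by (subst ennreal_plus[symmetric], assumption, assumption, subst ennreal_mult[symmetric]) auto

lemma ennreal_half_add_self: "ennreal (1/2) * (a + a) = a"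
proof (cases a)
  case (real r) then show ?thesis using ennreal_half_add[of r r] by simp
qed (simp add: ennreal_mult_top)

section \<open>Working forms of the norm axioms, Hoelder's inequality and duality\<close>

lemma bb_zero_AE: "ball_banach N \<Longrightarrow> f \<in> borel_measurable lebesgue \<Longrightarrow> N f = 0 \<Longrightarrow> AE x in lebesgue. f x = 0"
  unfolding ball_banach_def by blast

lemma bb_mono:
  "ball_banach N \<Longrightarrow> f \<in> borel_measurable lebesgue \<Longrightarrow> g \<in> borel_measurable lebesgue \<Longrightarrow>
   AE x in lebesgue. g x \<le> f x \<Longrightarrow> N g \<le> N f"
  unfolding ball_banach_def by blast

lemma bb_cong:
  assumes "ball_banach N" "f \<in> borel_measurable lebesgue" "g \<in> borel_measurable lebesgue"
   "AE x in lebesgue. g x = f x"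
  shows "N g = N f"
proof (rule antisym)
  show "N g \<le> N f" using assms by (intro bb_mono[OF assms(1)]) (auto elim: eventually_mono)
  show "N f \<le> N g" using assms by (intro bb_mono[OF assms(1)]) (auto elim: eventually_mono)
qed

lemma bb_triangle:
  "ball_banach N \<Longrightarrow> f \<in> borel_measurable lebesgue \<Longrightarrow> g \<in> borel_measurable lebesgue \<Longrightarrow>
    N (\<lambda>x. f x + g x) \<le> N f + N g"
  unfolding ball_banach_def by blast

lemma bb_scale:
  "ball_banach N \<Longrightarrow> f \<in> borel_measurable lebesgue \<Longrightarrow> c \<ge> 0 \<Longrightarrow>
    N (\<lambda>x. ennreal c * f x) = ennreal c * N f"
  unfolding ball_banach_def by blast

lemma bb_ball: "ball_banach N \<Longrightarrow> N (indicator (ball c r)) < \<infinity>"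
  unfolding ball_banach_def by (metis (no_types))

lemma bb_local:
  assumes "ball_banach N"
  obtains C where "C > 0" "\<And>f. f \<in> borel_measurable lebesgue \<Longrightarrow>
    (\<integral>\<^sup>+ x \<in> ball c r. f x \<partial>lebesgue) \<le> ennreal C * N f"
proof -
  have "\<forall>c r. \<exists>C::real. C > 0 \<and> (\<forall>f \<in> borel_measurable lebesgue.
        (\<integral>\<^sup>+ x \<in> ball c r. f x \<partial>lebesgue) \<le> ennreal C * N f)"
    using assms unfolding ball_banach_def by (elim conjE)
  then show ?thesis using that by meson
qed

lemma bb_SUP:
  assumes "ball_banach N" "\<And>m. F m \<in> borel_measurable lebesgue" "f \<in> borel_measurable lebesgue"
    "AE x in lebesgue. incseq (\<lambda>m. F m x) \<and> f x = (SUP m. F m x)"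
  shows "N f = (SUP m. N (F m))"
  using assms unfolding ball_banach_def by blast

lemma bb_zero:
  assumes "ball_banach N" shows "N (\<lambda>_. 0) = 0"
  using bb_scale[OF assms, of "\<lambda>_. 0" 0] by simp

lemma bb_sum:
  assumes "ball_banach N" "finite I" "\<And>i. i \<in> I \<Longrightarrow> F i \<in> borel_measurable lebesgue"
  shows "N (\<lambda>x. \<Sum>i\<in>I. F i x) \<le> (\<Sum>i\<in>I. N (F i))"
  using assms(2,3)
proof (induction I rule: finite_induct)
  case (insert i I)
  have "N (\<lambda>x. F i x + (\<Sum>i\<in>I. F i x)) \<le> N (F i) + N (\<lambda>x. \<Sum>i\<in>I. F i x)"
    using insert by (intro bb_triangle assms(1)) auto
  also have "\<dots> \<le> N (F i) + (\<Sum>i\<in>I. N (F i))"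
    using insert by (intro add_left_mono) auto
  finally show ?case using insert by simp
qed (simp add: bb_zero assms)

text \<open>The infima over tails increase to the lower limit and satisfy \<open>H m\<close> \<le>
  \<open>F m\<close>, so the Fatou property (c) applies to them.\<close>

lemma bb_fatou:
  assumes N: "ball_banach N" and [measurable]: "\<And>m. F m \<in> borel_measurable lebesgue" "f \<in> borel_measurable lebesgue"
    and bd: "\<And>m. N (F m) \<le> c" and le: "AE x in lebesgue. f x \<le> liminf (\<lambda>m. F m x)"
  shows "N f \<le> c"
proof -
  define H where "H = (\<lambda>m x. INF j\<in>{m..}. F j x)"
  have [measurable]: "H m \<in> borel_measurable lebesgue" for m
    unfolding H_def by (intro borel_measurable_INF) auto
  have "N f \<le> N (\<lambda>x. SUP m. H m x)"
    using le by (intro bb_mono[OF N]) (auto simp: H_def liminf_SUP_INF)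
  also have "\<dots> = (SUP m. N (H m))"
    by (rule bb_SUP[OF N]) (auto simp: H_def incseq_def intro!: INF_superset_mono)
  also have "\<dots> \<le> c"
  proof (rule SUP_least)
    fix m
    have "N (H m) \<le> N (F m)"
      by (rule bb_mono[OF N]) (auto simp: H_def intro!: INF_lower AE_I2)
    then show "N (H m) \<le> c" using bd[of m] by simp
  qed
  finally show ?thesis .
qed

lemma associate_leI:
  "(\<And>f. f \<in> borel_measurable lebesgue \<Longrightarrow> N f = 1 \<Longrightarrow> (\<integral>\<^sup>+ x. f x * g x \<partial>lebesgue) \<le> c) \<Longrightarrow> associate N g \<le> c"
  unfolding associate_def by (intro SUP_least) auto

lemma associate_ge:
  "f \<in> borel_measurable lebesgue \<Longrightarrow> N f = 1 \<Longrightarrow> (\<integral>\<^sup>+ x. f x * g x \<partial>lebesgue) \<le> associate N g"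
  unfolding associate_def by (intro SUP_upper) auto

lemma associate_mono:
  assumes "AE x in lebesgue. g x \<le> h x"
  shows "associate N g \<le> associate N h"
proof (rule associate_leI)
  fix f :: "'a \<Rightarrow> ennreal" assume f: "f \<in> borel_measurable lebesgue" "N f = 1"
  have "(\<integral>\<^sup>+ x. f x * g x \<partial>lebesgue) \<le> (\<integral>\<^sup>+ x. f x * h x \<partial>lebesgue)"
    using assms by (intro nn_integral_mono_AE) (auto elim!: eventually_mono intro: mult_left_mono)
  also have "\<dots> \<le> associate N h" using f by (rule associate_ge)
  finally show "(\<integral>\<^sup>+ x. f x * g x \<partial>lebesgue) \<le> associate N h" .
qed

lemma associate_add:
  assumes [measurable]: "g \<in> borel_measurable lebesgue" "h \<in> borel_measurable lebesgue"
  shows "associate N (\<lambda>x. g x + h x) \<le> associate N g + associate N h"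
proof (rule associate_leI)
  fix f :: "'a \<Rightarrow> ennreal" assume [measurable]: "f \<in> borel_measurable lebesgue" and f: "N f = 1"
  have "(\<integral>\<^sup>+ x. f x * (g x + h x) \<partial>lebesgue) = (\<integral>\<^sup>+ x. f x * g x \<partial>lebesgue) + (\<integral>\<^sup>+ x. f x * h x \<partial>lebesgue)"
    by (simp add: distrib_left nn_integral_add del: nn_integral_completion)
  also have "\<dots> \<le> associate N g + associate N h" using f by (intro add_mono associate_ge) auto
  finally show "(\<integral>\<^sup>+ x. f x * (g x + h x) \<partial>lebesgue) \<le> associate N g + associate N h" .
qed

lemma associate_cmult_le:
  assumes [measurable]: "g \<in> borel_measurable lebesgue"
  shows "associate N (\<lambda>x. c * g x) \<le> c * associate N g"
proof (rule associate_leI)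
  fix f :: "'a \<Rightarrow> ennreal" assume [measurable]: "f \<in> borel_measurable lebesgue" and f: "N f = 1"
  have "(\<integral>\<^sup>+ x. f x * (c * g x) \<partial>lebesgue) = c * (\<integral>\<^sup>+ x. f x * g x \<partial>lebesgue)"
    by (subst nn_integral_cmult[symmetric]) (auto simp: mult_ac)
  also have "\<dots> \<le> c * associate N g" using f by (intro mult_left_mono associate_ge) auto
  finally show "(\<integral>\<^sup>+ x. f x * (c * g x) \<partial>lebesgue) \<le> c * associate N g" .
qed

text \<open>The associate norm only tests functions of norm one, so f is divided by its norm. If
  that is 0, property (a) makes the integrand vanish; an infinite norm could not be
  normalised.\<close>

lemma bb_Hoelder:
  assumes N: "ball_banach N" and [measurable]: "f \<in> borel_measurable lebesgue" "g \<in> borel_measurable lebesgue"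
    and fin: "N f < \<infinity>"
  shows "(\<integral>\<^sup>+ x. f x * g x \<partial>lebesgue) \<le> N f * associate N g"
proof (cases "N f = 0")
  case True
  then have "AE x in lebesgue. f x * g x = 0"
    using bb_zero_AE[OF N, of f] by (auto elim!: eventually_mono)
  then have "(\<integral>\<^sup>+ x. f x * g x \<partial>lebesgue) = 0"
    by (subst nn_integral_0_iff_AE) auto
  then show ?thesis by simp
next
  case False
  then obtain r where r: "N f = ennreal r" "r > 0"
    using fin by (cases "N f") (auto simp: less_top)
  have "N (\<lambda>x. ennreal (1/r) * f x) = 1"
    using r by (simp add: bb_scale[OF N] ennreal_mult[symmetric])
  then have "(\<integral>\<^sup>+ x. ennreal (1/r) * f x * g x \<partial>lebesgue) \<le> associate N g"
    by (intro associate_ge) auto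
  then have "ennreal r * (\<integral>\<^sup>+ x. ennreal (1/r) * f x * g x \<partial>lebesgue) \<le> N f * associate N g"
    unfolding r by (rule mult_left_mono) simp
  also have "ennreal r * (\<integral>\<^sup>+ x. ennreal (1/r) * f x * g x \<partial>lebesgue) = (\<integral>\<^sup>+ x. ennreal r * (ennreal (1/r) * f x * g x) \<partial>lebesgue)"
    by (rule nn_integral_cmult[symmetric]) auto
  also have "(\<lambda>x. ennreal r * (ennreal (1/r) * f x * g x)) = (\<lambda>x. f x * g x)"
    using r by (auto simp: mult.assoc[symmetric] ennreal_mult[symmetric])
  finally show ?thesis .
qed

text \<open>Property (f) says that integration over a ball is a bounded functional on X.\<close>

lemma associate_ball_finite:
  assumes N: "ball_banach N" shows "associate N (indicator (ball c r)) < \<infinity>"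
proof -
  obtain C where C: "C > 0" "\<And>f. f \<in> borel_measurable lebesgue \<Longrightarrow>
    (\<integral>\<^sup>+ x \<in> ball c r. f x \<partial>lebesgue) \<le> ennreal C * N f"
    using bb_local[OF N] by blast
  have "associate N (indicator (ball c r)) \<le> ennreal C"
    using C(2) by (intro associate_leI) (metis mult.right_neutral)
  then show ?thesis by (auto intro: le_less_trans)
qed

lemma integrable_bounded_ball:
  fixes g :: "'a::euclidean_space \<Rightarrow> real"
  assumes "g \<in> borel_measurable lebesgue" "\<And>x. \<bar>g x\<bar> \<le> c" "\<And>x. x \<notin> ball a r \<Longrightarrow> g x = 0"
  shows "integrable lebesgue g"
proof (rule integrableI_bounded_set[where A = "ball a r" and B = c])
  have "emeasure lborel (ball a r) < \<infinity>" by (rule emeasure_lborel_ball_finite)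
  then show "emeasure lebesgue (ball a r) < \<infinity>" by (simp add: less_top[symmetric])
qed (use assms in \<open>auto intro!: AE_I2\<close>)

text \<open>The nontrivial half of \<open>X'' = X\<close> (Lorentz--Luxemburg). The separating functional is \<open>g = F - h\<close>
  with \<open>h\<close> the \<open>L\<^sup>2\<close>-projection of \<open>F\<close> onto the ball \<open>N h \<le> A\<close>.\<close>

lemma bb_duality_bounded:
  fixes F :: "'a::euclidean_space \<Rightarrow> real"
  assumes N: "ball_banach N" and [measurable]: "F \<in> borel_measurable lebesgue"
    and F: "\<And>x. 0 \<le> F x" "\<And>x. F x \<le> m" "\<And>x. x \<notin> ball 0 m \<Longrightarrow> F x = 0"
    and A: "A > 0"
    and dual: "\<And>g. g \<in> borel_measurable lebesgue \<Longrightarrow> associate N g \<le> 1 \<Longrightarrow>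
        (\<integral>\<^sup>+ x. ennreal (F x) * g x \<partial>lebesgue) \<le> ennreal A"
  shows "N (\<lambda>x. ennreal (F x)) \<le> ennreal A"
proof -
  define B where "B = ball (0::'a) m"
  have [measurable]: "B \<in> sets lebesgue" "B \<in> sets borel" unfolding B_def by auto
  have Bfin: "emeasure lebesgue B < \<infinity>"
    using emeasure_lborel_ball_finite[of "0::'a" m] unfolding B_def by (simp add: less_top[symmetric])
  define S where "S = {h \<in> borel_measurable lebesgue. (\<forall>x. 0 \<le> h x) \<and> (\<forall>x. x \<notin> B \<longrightarrow> h x = 0)
      \<and> N (\<lambda>x. ennreal (h x)) \<le> ennreal A}"
  define J where "J = (\<lambda>h. \<integral>\<^sup>+ x. ennreal ((F x - h x)\<^sup>2) \<partial>lebesgue)"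
  define I where "I = (INF h\<in>S. J h)"
  have S0: "(\<lambda>_. 0) \<in> S" unfolding S_def using bb_zero[OF N] by simp
  have intF: "integrable lebesgue (\<lambda>x. (F x)\<^sup>2)"
  proof (rule integrable_bounded_ball[where a = 0 and r = m and c = "m\<^sup>2"])
    show "\<bar>(F x)\<^sup>2\<bar> \<le> m\<^sup>2" for x using F[of x] by (simp add: power_mono)
  qed (use F in auto)
  have "I \<le> J (\<lambda>_. 0)" unfolding I_def using S0 by (rule INF_lower)
  also have "\<dots> < \<infinity>" unfolding J_def using intF by (simp add: nn_integral_eq_integral del: nn_integral_completion)
  finally have Ifin: "I < \<infinity>" .
  have comb: "(\<lambda>x. (1 - t) * h x + t * h' x) \<in> S" if h: "h \<in> S" "h' \<in> S" and t: "0 \<le> t" "t \<le> 1" for h h' t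
  proof -
    have [measurable]: "h \<in> borel_measurable lebesgue" "h' \<in> borel_measurable lebesgue" using h S_def by auto
    have "N (\<lambda>x. ennreal ((1 - t) * h x + t * h' x)) = N (\<lambda>x. ennreal (1 - t) * ennreal (h x) + ennreal t * ennreal (h' x))"
      using h t by (intro arg_cong[where f = N] ext) (auto simp: S_def ennreal_mult)
    also have "\<dots> \<le> N (\<lambda>x. ennreal (1 - t) * ennreal (h x)) + N (\<lambda>x. ennreal t * ennreal (h' x))"
      by (rule bb_triangle[OF N]) auto
    also have "\<dots> \<le> ennreal (1 - t) * ennreal A + ennreal t * ennreal A"
      using h t by (auto simp: bb_scale[OF N] S_def intro!: add_mono mult_left_mono)
    also have "\<dots> = ennreal A" using t A by (simp flip: ennreal_mult ennreal_plus add: algebra_simps)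
    finally show ?thesis using h t unfolding S_def by auto
  qed
  \<comment> \<open>Sublevel sets of the squared distance shrink towards the projection and are
    midpoint convex, so \<open>midpoint_convex_selection\<close> produces an almost everywhere limit
    of near-minimisers.\<close>
  define C where "C = (\<lambda>k. {h \<in> S. J h \<le> I + ennreal (1 / Suc k)})"
  define M where "M = density lebesgue (indicator B)"
  obtain K where K: "\<And>f. f \<in> borel_measurable lebesgue \<Longrightarrow>
    (\<integral>\<^sup>+ x \<in> B. f x \<partial>lebesgue) \<le> ennreal K * N f" "K > 0"
    using bb_local[OF N, of 0 m] unfolding B_def by blast
  obtain h hl where h: "\<And>k. h k \<in> C k" and [measurable]: "hl \<in> borel_measurable M"
    and lim: "AE x in M. (\<lambda>k. h k x) \<longlonglongrightarrow> hl x"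
  proof (rule midpoint_convex_selection[of M C "K * A"])
    show "finite_measure M"
      by (rule finite_measureI) (use Bfin in \<open>simp add: M_def emeasure_density\<close>)
    show "g \<in> borel_measurable M" if "g \<in> C k" for k g
      using that unfolding C_def S_def M_def by simp
    show "C k \<noteq> {}" for k
    proof -
      have "I < I + ennreal (1 / Suc k)" using Ifin by (cases I) (auto simp: add_nonneg_pos simp flip: ennreal_plus intro!: ennreal_lessI)
      then obtain g where "g \<in> S" "J g < I + ennreal (1 / Suc k)" unfolding I_def INF_less_iff by auto
      then show ?thesis unfolding C_def by (auto intro: less_imp_le)
    qed
    show "C (Suc k) \<subseteq> C k" for k
      unfolding C_def by (auto elim!: order_trans intro!: add_left_mono ennreal_leI divide_left_mono)
    show "(\<lambda>x. (g x + h x) / 2) \<in> C k" if g: "g \<in> C k" and h: "h \<in> C k" for k g h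
    proof -
      have gh: "g \<in> S" "h \<in> S" using g h unfolding C_def by auto
      have [measurable]: "h \<in> borel_measurable lebesgue" "g \<in> borel_measurable lebesgue" using gh S_def by auto
      have "(\<lambda>x. (g x + h x) / 2) \<in> S" using comb[OF gh, of "1/2"] by (simp add: add_divide_distrib)
      moreover have "J (\<lambda>x. (g x + h x) / 2) \<le> ennreal (1/2) * (J g + J h)"
      proof -
        have "J (\<lambda>x. (g x + h x) / 2) \<le> (\<integral>\<^sup>+ x. ennreal (1/2) * (ennreal ((F x - g x)\<^sup>2) + ennreal ((F x - h x)\<^sup>2)) \<partial>lebesgue)"
          unfolding J_def
        proof (rule nn_integral_mono)
          fix x
          have "((F x - g x) - (F x - h x))\<^sup>2 \<ge> 0" by simp
          then have "(F x - (g x + h x) / 2)\<^sup>2 \<le> (1/2) * ((F x - g x)\<^sup>2 + (F x - h x)\<^sup>2)"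
            by (simp add: power2_eq_square field_simps)
          then have "ennreal ((F x - (g x + h x) / 2)\<^sup>2) \<le> ennreal ((1/2) * ((F x - g x)\<^sup>2 + (F x - h x)\<^sup>2))"
            by (rule ennreal_leI)
          also have "\<dots> = ennreal (1/2) * ennreal ((F x - g x)\<^sup>2 + (F x - h x)\<^sup>2)"
            by (rule ennreal_mult) auto
          finally show "ennreal ((F x - (g x + h x) / 2)\<^sup>2) \<le> ennreal (1/2) * (ennreal ((F x - g x)\<^sup>2) + ennreal ((F x - h x)\<^sup>2))"
            by (simp only: ennreal_plus zero_le_power2)
        qed
        also have "\<dots> = ennreal (1/2) * (J g + J h)"
          unfolding J_def by (subst nn_integral_cmult) (auto simp: nn_integral_add simp del: nn_integral_completion)
        finally show ?thesis .
      qed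
      moreover have "ennreal (1/2) * (J g + J h) \<le> ennreal (1/2) * ((I + ennreal (1 / Suc k)) + (I + ennreal (1 / Suc k)))"
        using g h unfolding C_def by (intro mult_left_mono add_mono) auto
      moreover have "\<dots> = I + ennreal (1 / Suc k)"
        by (rule ennreal_half_add_self)
      ultimately show ?thesis unfolding C_def by simp
    qed
    show "(\<integral>\<^sup>+ x. ennreal \<bar>g x\<bar> \<partial>M) \<le> ennreal (K * A)" if "g \<in> C 0" for g
    proof -
      have g: "g \<in> S" using that unfolding C_def by auto
      then have [measurable]: "g \<in> borel_measurable lebesgue" unfolding S_def by auto
      have "(\<integral>\<^sup>+ x. ennreal \<bar>g x\<bar> \<partial>M) = (\<integral>\<^sup>+ x \<in> B. ennreal (g x) \<partial>lebesgue)"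
        using g unfolding M_def S_def by (subst nn_integral_density) (auto simp: mult.commute)
      also have "\<dots> \<le> ennreal K * N (\<lambda>x. ennreal (g x))" by (rule K) auto
      also have "\<dots> \<le> ennreal K * ennreal A" using g unfolding S_def by (intro mult_left_mono) auto
      finally show ?thesis using K A by (simp add: ennreal_mult)
    qed
  qed blast
  have hl_meas[measurable]: "hl \<in> borel_measurable lebesgue" using \<open>hl \<in> borel_measurable M\<close> unfolding M_def by simp
  have hS: "h k \<in> S" for k using h C_def by auto
  then have [measurable]: "h k \<in> borel_measurable lebesgue" for k unfolding S_def by auto
  have lim': "AE x in lebesgue. x \<in> B \<longrightarrow> (\<lambda>k. h k x) \<longlonglongrightarrow> hl x"
    using lim unfolding M_def by (subst (asm) AE_density) (auto elim!: eventually_mono)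
  \<comment> \<open>Truncation to [0, F] increases neither the norm nor the distance to F, and it
    makes F - h0 nonnegative and bounded.\<close>
  define h0 where "h0 = (\<lambda>x. indicator B x * max 0 (min (F x) (hl x)))"
  have [measurable]: "h0 \<in> borel_measurable lebesgue" unfolding h0_def by measurable
  have h0F: "0 \<le> h0 x" "h0 x \<le> F x" "x \<notin> B \<Longrightarrow> h0 x = 0" for x
    unfolding h0_def using F[of x] by (auto simp: indicator_def)
  have h0S: "h0 \<in> S"
  proof -
    have "N (\<lambda>x. ennreal (h0 x)) \<le> ennreal A"
    proof (rule bb_fatou[OF N, where F = "\<lambda>k x. ennreal (h k x)"])
      show "N (\<lambda>x. ennreal (h k x)) \<le> ennreal A" for k using hS unfolding S_def by auto
      show "AE x in lebesgue. ennreal (h0 x) \<le> liminf (\<lambda>k. ennreal (h k x))"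
        using lim'
      proof eventually_elim
        case (elim x)
        show ?case
        proof (cases "x \<in> B")
          case True
          have nn: "0 \<le> h k x" for k using hS[of k] unfolding S_def by auto
          then have "(\<lambda>k. ennreal (h k x)) \<longlonglongrightarrow> ennreal (hl x)" using elim True by (intro tendsto_ennrealI) auto
          then have "liminf (\<lambda>k. ennreal (h k x)) = ennreal (hl x)" by (intro lim_imp_Liminf) auto
          moreover have "0 \<le> hl x" using elim True nn by (intro LIMSEQ_le_const[of "\<lambda>k. h k x"]) auto
          ultimately show ?thesis using True by (auto simp: h0_def intro!: ennreal_leI)
        qed (simp add: h0_def)
      qed
    qed auto
    then show ?thesis unfolding S_def using h0F by auto
  qed
  have "J h0 \<le> (\<integral>\<^sup>+ x. liminf (\<lambda>k. ennreal ((F x - h k x)\<^sup>2)) \<partial>lebesgue)"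
    unfolding J_def
  proof (rule nn_integral_mono_AE)
    show "AE x in lebesgue. ennreal ((F x - h0 x)\<^sup>2) \<le> liminf (\<lambda>k. ennreal ((F x - h k x)\<^sup>2))"
      using lim'
    proof eventually_elim
      case (elim x)
      show ?case
      proof (cases "x \<in> B")
        case True
        have nn: "0 \<le> h k x" for k using hS[of k] unfolding S_def by auto
        have "(\<lambda>k. ennreal ((F x - h k x)\<^sup>2)) \<longlonglongrightarrow> ennreal ((F x - hl x)\<^sup>2)"
          using elim True by (intro tendsto_ennrealI tendsto_intros) auto
        then have "liminf (\<lambda>k. ennreal ((F x - h k x)\<^sup>2)) = ennreal ((F x - hl x)\<^sup>2)" by (intro lim_imp_Liminf) auto
        moreover have "0 \<le> hl x" using elim True nn by (intro LIMSEQ_le_const[of "\<lambda>k. h k x"]) auto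
        then have "(F x - h0 x)\<^sup>2 \<le> (F x - hl x)\<^sup>2"
          using True F[of x] by (auto simp: h0_def min_def max_def)
        ultimately show ?thesis by (simp add: ennreal_leI)
      next
        case False
        then have "F x = 0" "h0 x = 0" using F(3) h0F by (auto simp: B_def)
        then show ?thesis by simp
      qed
    qed
  qed
  also have "\<dots> \<le> liminf (\<lambda>k. J (h k))" unfolding J_def by (rule nn_integral_liminf) auto
  also have "\<dots> \<le> liminf (\<lambda>k. I + ennreal (1 / Suc k))"
    using h unfolding C_def by (intro Liminf_mono always_eventually) auto
  also have "\<dots> = I + ennreal 0"
  proof (rule lim_imp_Liminf)
    have "(\<lambda>k. 1 / real (Suc k)) \<longlonglongrightarrow> 0" using LIMSEQ_inverse_real_of_nat by (simp add: inverse_eq_divide)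
    then show "(\<lambda>k. I + ennreal (1 / Suc k)) \<longlonglongrightarrow> I + ennreal 0"
      by (intro tendsto_intros)
  qed simp
  finally have Jh0: "J h0 \<le> I" by simp
  define g where "g = (\<lambda>x. F x - h0 x)"
  have [measurable]: "g \<in> borel_measurable lebesgue" unfolding g_def by measurable
  have g: "0 \<le> g x" "g x \<le> m" "x \<notin> B \<Longrightarrow> g x = 0" for x
    using h0F[of x] F[of x] by (auto simp: g_def B_def)
  have intb: "integrable lebesgue u" if "u \<in> borel_measurable lebesgue" "\<And>x. \<bar>u x\<bar> \<le> c" "\<And>x. x \<notin> B \<Longrightarrow> u x = 0" for u :: "'a \<Rightarrow> real" and c
    using integrable_bounded_ball[of u c 0 m] that unfolding B_def by auto
  define s where "s = (\<integral>x. g x * h0 x \<partial>lebesgue)"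
  have m0: "m \<ge> 0" using F(1,2)[of 0] by linarith
  have h0m: "h0 x \<le> m" for x using h0F(2)[of x] F(2)[of x] by simp
  have int_gh: "integrable lebesgue (\<lambda>x. g x * h0 x)"
    by (rule intb[where c = "m * m"]) (use g h0F h0m m0 in \<open>auto simp: abs_mult intro!: mult_mono\<close>)
  have int_gg: "integrable lebesgue (\<lambda>x. (g x)\<^sup>2)"
    by (rule intb[where c = "m * m"]) (use g m0 in \<open>auto simp: power2_eq_square abs_mult intro!: mult_mono\<close>)
  \<comment> \<open>Variational inequality of the projection: \<open>h0\<close> is compared with
    points of the segment towards u, and the term of first order in t must have the right
    sign.\<close>
  have var: "(\<integral>x. g x * u x \<partial>lebesgue) \<le> s" if u: "u \<in> S" "\<And>x. u x \<le> c" for u c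
  proof -
    have [measurable]: "u \<in> borel_measurable lebesgue" and u0: "0 \<le> u x" "x \<notin> B \<Longrightarrow> u x = 0" for x
      using u unfolding S_def by auto
    have c0: "c \<ge> 0" using u0(1)[of 0] u(2)[of 0] by linarith
    have ud: "\<bar>u x - h0 x\<bar> \<le> c + m" for x
      using u0(1)[of x] u(2)[of x] h0F(1)[of x] h0m[of x] c0 m0 by linarith
    have i1: "integrable lebesgue (\<lambda>x. g x * (u x - h0 x))"
      by (rule intb[where c = "m * (c + m)"]) (use g ud m0 in \<open>auto simp: abs_mult intro!: mult_mono\<close>)
    have i2: "integrable lebesgue (\<lambda>x. (u x - h0 x)\<^sup>2)"
    proof (rule intb[where c = "(c + m)\<^sup>2"])
      show "\<bar>(u x - h0 x)\<^sup>2\<bar> \<le> (c + m)\<^sup>2" for x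
        using power_mono[OF ud[of x], of 2] by simp
    qed (use h0F u0 in auto)
    have i3: "integrable lebesgue (\<lambda>x. g x * u x)"
      by (rule intb[where c = "m * c"]) (use g u0 u c0 m0 in \<open>auto simp: abs_mult intro!: mult_mono\<close>)
    define a where "a = (\<integral>x. g x * (u x - h0 x) \<partial>lebesgue)"
    define b where "b = (\<integral>x. (u x - h0 x)\<^sup>2 \<partial>lebesgue)"
    have b0: "b \<ge> 0" unfolding b_def by simp
    have ineq: "2 * a \<le> t * b" if t: "0 < t" "t \<le> 1" for t
    proof -
      have "(\<lambda>x. (1 - t) * h0 x + t * u x) \<in> S" using comb[OF h0S u(1)] t by auto
      then have "I \<le> J (\<lambda>x. (1 - t) * h0 x + t * u x)" unfolding I_def by (rule INF_lower)
      then have "J h0 \<le> J (\<lambda>x. (1 - t) * h0 x + t * u x)" using Jh0 by simp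
      moreover have "J h0 = ennreal (\<integral>x. (g x)\<^sup>2 \<partial>lebesgue)"
        unfolding J_def g_def[symmetric] using int_gg g_def by (subst nn_integral_eq_integral) auto
      moreover have "J (\<lambda>x. (1 - t) * h0 x + t * u x) = ennreal (\<integral>x. (g x)\<^sup>2 - 2 * t * (g x * (u x - h0 x)) + t\<^sup>2 * (u x - h0 x)\<^sup>2 \<partial>lebesgue)"
      proof -
        have eq: "(F x - ((1 - t) * h0 x + t * u x))\<^sup>2 = (g x)\<^sup>2 - 2 * t * (g x * (u x - h0 x)) + t\<^sup>2 * (u x - h0 x)\<^sup>2" for x
          unfolding g_def by (simp add: power2_eq_square algebra_simps)
        show ?thesis unfolding J_def eq[symmetric]
        proof (rule nn_integral_eq_integral)
          show "integrable lebesgue (\<lambda>x. (F x - ((1 - t) * h0 x + t * u x))\<^sup>2)"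
            unfolding eq using int_gg i1 i2 by (intro Bochner_Integration.integrable_add Bochner_Integration.integrable_diff integrable_mult_right) auto
        qed auto
      qed
      moreover have "(\<integral>x. (g x)\<^sup>2 - 2 * t * (g x * (u x - h0 x)) + t\<^sup>2 * (u x - h0 x)\<^sup>2 \<partial>lebesgue)
          = (\<integral>x. (g x)\<^sup>2 \<partial>lebesgue) - 2 * t * a + t\<^sup>2 * b"
        unfolding a_def b_def using int_gg i1 i2 by simp
      ultimately have le: "ennreal (\<integral>x. (g x)\<^sup>2 \<partial>lebesgue) \<le> ennreal ((\<integral>x. (g x)\<^sup>2 \<partial>lebesgue) - 2 * t * a + t\<^sup>2 * b)"
        by (simp only:)
      have "0 \<le> (\<integral>x. (F x - ((1 - t) * h0 x + t * u x))\<^sup>2 \<partial>lebesgue)" by simp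
      also have "\<dots> = (\<integral>x. (g x)\<^sup>2 \<partial>lebesgue) - 2 * t * a + t\<^sup>2 * b"
      proof -
        have eq: "(F x - ((1 - t) * h0 x + t * u x))\<^sup>2 = (g x)\<^sup>2 - 2 * t * (g x * (u x - h0 x)) + t\<^sup>2 * (u x - h0 x)\<^sup>2" for x
          unfolding g_def by (simp add: power2_eq_square algebra_simps)
        show ?thesis unfolding eq a_def b_def using int_gg i1 i2 by simp
      qed
      finally have "(\<integral>x. (g x)\<^sup>2 \<partial>lebesgue) \<le> (\<integral>x. (g x)\<^sup>2 \<partial>lebesgue) - 2 * t * a + t\<^sup>2 * b"
        using le by (subst (asm) ennreal_le_iff)
      then have "t * (2 * a) \<le> t * (t * b)" by (simp add: power2_eq_square)
      then show ?thesis using t by simp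
    qed
    have "a \<le> 0"
    proof (rule ccontr)
      assume "\<not> a \<le> 0"
      then have a: "a > 0" by simp
      define t where "t = min 1 (a / (b + 1))"
      have t: "0 < t" "t \<le> 1" "t \<le> a / (b + 1)" unfolding t_def using a b0 by auto
      have "2 * a \<le> t * b" by (rule ineq[OF t(1,2)])
      also have "\<dots> \<le> a / (b + 1) * b" using t b0 by (intro mult_right_mono) auto
      also have "\<dots> = a * (b / (b + 1))" by simp
      also have "\<dots> \<le> a * 1" using a b0 by (intro mult_left_mono) auto
      finally show False using a by simp
    qed
    moreover have "a = (\<integral>x. g x * u x \<partial>lebesgue) - s"
      unfolding a_def s_def right_diff_distrib using i3 int_gh by (rule Bochner_Integration.integral_diff)
    ultimately show ?thesis by simp
  qed
  have s0: "s \<ge> 0" unfolding s_def using g h0F by (intro integral_nonneg_AE) auto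
  have assoc: "associate N (\<lambda>x. ennreal (g x)) \<le> ennreal (s / A)"
  proof (rule associate_leI)
    fix f :: "'a \<Rightarrow> ennreal" assume [measurable]: "f \<in> borel_measurable lebesgue" and f: "N f = 1"
    \<comment> \<open>\<open>A * f\<close> has norm A but may be unbounded, infinite or spread over
      the whole space; its truncations are admissible in \<open>var\<close> and increase to it on
      B.\<close>
    define u where "u = (\<lambda>k x. enn2real (min (ennreal A * f x) (of_nat k)) * indicator B x)"
    have min_fin: "min (ennreal A * f x) (of_nat k) < top" for x k
      by (rule le_less_trans[OF min.cobounded2]) (simp add: of_nat_less_top)
    have u_ennreal: "ennreal (u k x) = min (ennreal A * f x) (of_nat k) * indicator B x" for k x
      using min_fin[of x k] unfolding u_def by (auto simp: indicator_def)
    have uS: "u k \<in> S" for k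
    proof -
      have "N (\<lambda>x. ennreal (u k x)) \<le> N (\<lambda>x. ennreal A * f x)"
        by (rule bb_mono[OF N]) (auto simp: u_ennreal intro!: AE_I2 split: split_indicator)
      also have "\<dots> = ennreal A" using bb_scale[OF N, of f A] A f by simp
      finally show ?thesis unfolding S_def by (auto simp: u_def)
    qed
    have uk: "u k x \<le> real k" for k x
    proof -
      have "enn2real (min (ennreal A * f x) (of_nat k)) \<le> real k"
        by (rule enn2real_leI) (auto simp: ennreal_of_nat_eq_real_of_nat)
      then show ?thesis unfolding u_def by (auto simp: indicator_def)
    qed
    have [measurable]: "u k \<in> borel_measurable lebesgue" for k unfolding u_def by measurable
    have le: "(\<integral>\<^sup>+ x. ennreal (g x) * ennreal (u k x) \<partial>lebesgue) \<le> ennreal s" for k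
    proof -
      have u0: "0 \<le> u k x" "x \<notin> B \<Longrightarrow> u k x = 0" for x unfolding u_def by auto
      have "(\<integral>\<^sup>+ x. ennreal (g x) * ennreal (u k x) \<partial>lebesgue) = (\<integral>\<^sup>+ x. ennreal (g x * u k x) \<partial>lebesgue)"
        using g u0 by (intro nn_integral_cong) (simp add: ennreal_mult)
      also have "\<dots> = ennreal (\<integral>x. g x * u k x \<partial>lebesgue)"
      proof (rule nn_integral_eq_integral)
        show "integrable lebesgue (\<lambda>x. g x * u k x)"
          by (rule intb[where c = "m * k"]) (use g u0 uk m0 in \<open>auto simp: abs_mult intro!: mult_mono\<close>)
      qed (use g u0 in auto)
      also have "\<dots> \<le> ennreal s" using var[OF uS uk] by (rule ennreal_leI)
      finally show ?thesis .
    qed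
    have "(\<integral>\<^sup>+ x. ennreal A * (f x * ennreal (g x)) \<partial>lebesgue) = (\<integral>\<^sup>+ x. (SUP k. ennreal (g x) * ennreal (u k x)) \<partial>lebesgue)"
    proof (rule nn_integral_cong)
      fix x
      have "(SUP k. ennreal (u k x)) = ennreal A * f x * indicator B x"
      proof -
        have "(\<lambda>k. min (ennreal A * f x) (of_nat k)) \<longlonglongrightarrow> min (ennreal A * f x) top"
          by (intro tendsto_min tendsto_const of_nat_tendsto_top_ennreal)
        moreover have "incseq (\<lambda>k. min (ennreal A * f x) (of_nat k))"
          by (auto simp: incseq_def intro!: min.mono min.coboundedI2 of_nat_mono)
        ultimately have "(SUP k. min (ennreal A * f x) (of_nat k)) = ennreal A * f x"
          using LIMSEQ_SUP LIMSEQ_unique by (metis min_top2)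
        then show ?thesis unfolding u_ennreal by (simp add: SUP_mult_right_ennreal[symmetric])
      qed
      then have "(SUP k. ennreal (g x) * ennreal (u k x)) = ennreal (g x) * (ennreal A * f x * indicator B x)"
        by (simp add: SUP_mult_left_ennreal[symmetric])
      then show "ennreal A * (f x * ennreal (g x)) = (SUP k. ennreal (g x) * ennreal (u k x))"
        using g(3)[of x] by (auto simp: mult_ac indicator_def)
    qed
    also have "\<dots> = (SUP k. \<integral>\<^sup>+ x. ennreal (g x) * ennreal (u k x) \<partial>lebesgue)"
    proof (rule nn_integral_monotone_convergence_SUP)
      show "incseq (\<lambda>k x. ennreal (g x) * ennreal (u k x))"
        unfolding u_ennreal incseq_def le_fun_def
        by (intro allI impI mult_left_mono mult_right_mono min.mono of_nat_mono order_refl) auto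
    qed auto
    also have "\<dots> \<le> ennreal s" using le by (intro SUP_least)
    finally have "ennreal A * (\<integral>\<^sup>+ x. f x * ennreal (g x) \<partial>lebesgue) \<le> ennreal s"
      by (subst (asm) nn_integral_cmult) auto
    then have "ennreal (1 / A) * (ennreal A * (\<integral>\<^sup>+ x. f x * ennreal (g x) \<partial>lebesgue)) \<le> ennreal (1 / A) * ennreal s"
      by (rule mult_left_mono) simp
    then show "(\<integral>\<^sup>+ x. f x * ennreal (g x) \<partial>lebesgue) \<le> ennreal (s / A)"
      using A s0 by (simp flip: ennreal_mult mult.assoc)
  qed
  have int_Fg: "integrable lebesgue (\<lambda>x. F x * g x)"
    by (rule intb[where c = "m * m"]) (use g F m0 in \<open>auto simp: abs_mult intro!: mult_mono\<close>)
  \<comment> \<open>As s may be 0, the functional is normalised by a slightly larger s', for which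
    the hypothesis \<open>dual\<close> applies; then s' decreases to s.\<close>
  have Fg: "(\<integral>x. F x * g x \<partial>lebesgue) \<le> s'" if s': "s' > s" for s'
  proof -
    have p: "s' > 0" using s' s0 by simp
    have "associate N (\<lambda>x. ennreal (A / s') * ennreal (g x)) \<le> ennreal (A / s') * associate N (\<lambda>x. ennreal (g x))"
      by (rule associate_cmult_le) auto
    also have "\<dots> \<le> ennreal (A / s') * ennreal (s / A)" by (intro mult_left_mono assoc) auto
    also have "\<dots> = ennreal (s / s')" using A p s0 by (simp flip: ennreal_mult)
    also have "\<dots> \<le> 1" using s' p by simp
    finally have "(\<integral>\<^sup>+ x. ennreal (F x) * (ennreal (A / s') * ennreal (g x)) \<partial>lebesgue) \<le> ennreal A"
      by (intro dual) auto
    also have "(\<integral>\<^sup>+ x. ennreal (F x) * (ennreal (A / s') * ennreal (g x)) \<partial>lebesgue) = (\<integral>\<^sup>+ x. ennreal (A / s' * (F x * g x)) \<partial>lebesgue)"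
      using A p F g by (intro nn_integral_cong) (simp add: ennreal_mult[symmetric] algebra_simps del: times_divide_eq_left times_divide_eq_right)
    also have "\<dots> = ennreal (\<integral>x. A / s' * (F x * g x) \<partial>lebesgue)"
      using int_Fg A p F g by (intro nn_integral_eq_integral) auto
    finally have "A / s' * (\<integral>x. F x * g x \<partial>lebesgue) \<le> A" using A by simp
    then show ?thesis using A p by (simp add: field_simps)
  qed
  have "(\<integral>x. F x * g x \<partial>lebesgue) \<le> s" using Fg by (rule dense_ge)
  \<comment> \<open>The square of g integrates to \<integral> F g - s \<le> 0, so F = h0 almost
    everywhere, and \<open>h0\<close> has norm at most A.\<close>
  moreover have "(\<integral>x. (g x)\<^sup>2 \<partial>lebesgue) = (\<integral>x. F x * g x - g x * h0 x \<partial>lebesgue)"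
    by (intro Bochner_Integration.integral_cong) (auto simp: g_def power2_eq_square algebra_simps)
  moreover have "\<dots> = (\<integral>x. F x * g x \<partial>lebesgue) - s"
    unfolding s_def using int_Fg int_gh by (rule Bochner_Integration.integral_diff)
  ultimately have "(\<integral>x. (g x)\<^sup>2 \<partial>lebesgue) \<le> 0" by simp
  then have "(\<integral>x. (g x)\<^sup>2 \<partial>lebesgue) = 0" by (simp add: order.antisym)
  then have "AE x in lebesgue. (g x)\<^sup>2 = 0"
    using int_gg by (subst (asm) integral_nonneg_eq_0_iff_AE) auto
  then have "AE x in lebesgue. ennreal (F x) = ennreal (h0 x)"
    unfolding g_def by (auto elim!: eventually_mono)
  then have "N (\<lambda>x. ennreal (F x)) = N (\<lambda>x. ennreal (h0 x))" by (intro bb_cong[OF N]) auto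
  then show ?thesis using h0S unfolding S_def by simp
qed

text \<open>Truncating F at height k and outside the ball of radius k reduces to the bounded case;
  the Fatou property (c) removes the truncation.\<close>

lemma bb_duality:
  fixes F :: "'a::euclidean_space \<Rightarrow> ennreal"
  assumes N: "ball_banach N" and [measurable]: "F \<in> borel_measurable lebesgue" and A: "A > 0"
    and dual: "\<And>g. g \<in> borel_measurable lebesgue \<Longrightarrow> associate N g \<le> 1 \<Longrightarrow>
        (\<integral>\<^sup>+ x. F x * g x \<partial>lebesgue) \<le> ennreal A"
  shows "N F \<le> ennreal A"
proof -
  define u where "u = (\<lambda>k x. enn2real (min (F x) (of_nat k)) * indicator (ball 0 (real k)) x)"
  have min_fin: "min (F x) (of_nat k) < top" for x and k :: nat
    by (rule le_less_trans[OF min.cobounded2]) (simp add: of_nat_less_top)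
  have u_ennreal: "ennreal (u k x) = min (F x) (of_nat k) * indicator (ball 0 (real k)) x" for k x
    using min_fin[of x k] unfolding u_def by (auto simp: indicator_def)
  have [measurable]: "ball 0 (real k) \<in> sets (lebesgue :: 'a measure)" for k by simp
  have [measurable]: "u k \<in> borel_measurable lebesgue" for k unfolding u_def by measurable
  have "N (\<lambda>x. ennreal (u k x)) \<le> ennreal A" for k
  proof (rule bb_duality_bounded[OF N, where m = "real k"])
    show "u k x \<le> real k" for x
    proof -
      have "enn2real (min (F x) (of_nat k)) \<le> real k"
        by (rule enn2real_leI) (auto simp: ennreal_of_nat_eq_real_of_nat)
      then show ?thesis unfolding u_def by (auto simp: indicator_def)
    qed
    fix g :: "'a \<Rightarrow> ennreal" assume g: "g \<in> borel_measurable lebesgue" "associate N g \<le> 1"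
    have "(\<integral>\<^sup>+ x. ennreal (u k x) * g x \<partial>lebesgue) \<le> (\<integral>\<^sup>+ x. F x * g x \<partial>lebesgue)"
      by (intro nn_integral_mono mult_right_mono) (auto simp: u_ennreal indicator_def)
    also have "\<dots> \<le> ennreal A" using dual g by blast
    finally show "(\<integral>\<^sup>+ x. ennreal (u k x) * g x \<partial>lebesgue) \<le> ennreal A" .
  qed (use A in \<open>auto simp: u_def\<close>)
  moreover have "N F = (SUP k. N (\<lambda>x. ennreal (u k x)))"
  proof (rule bb_SUP[OF N], measurable, intro AE_I2 conjI)
    fix x
    show inc: "incseq (\<lambda>k. ennreal (u k x))"
      unfolding u_ennreal incseq_def
      by (auto intro!: mult_mono min.mono min.coboundedI2 of_nat_mono simp: indicator_def)
    have "eventually (\<lambda>k. norm x < real k) sequentially"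
      using filterlim_real_sequentially unfolding filterlim_at_top_dense by simp
    then have "eventually (\<lambda>k. min (F x) (of_nat k) = ennreal (u k x)) sequentially"
      by eventually_elim (simp add: u_ennreal)
    moreover have "(\<lambda>k. min (F x) (of_nat k)) \<longlonglongrightarrow> min (F x) top"
      by (intro tendsto_min tendsto_const of_nat_tendsto_top_ennreal)
    ultimately have "(\<lambda>k. ennreal (u k x)) \<longlonglongrightarrow> min (F x) top"
      by (rule Lim_transform_eventually[rotated])
    then have "(\<lambda>k. ennreal (u k x)) \<longlonglongrightarrow> F x" by simp
    then show "F x = (SUP k. ennreal (u k x))" using LIMSEQ_SUP[OF inc] LIMSEQ_unique by blast
  qed
  ultimately show ?thesis by (simp add: SUP_le_iff)
qed

text \<open>\<open>midpoint_convex_selection\<close> needs a finite measure. A positive weight keeps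
  the null sets of Lebesgue measure, while its integral against f is controlled by the norm, so that
  X embeds in the weighted L^1.\<close>

lemma bb_weight:
  fixes N :: "('a::euclidean_space) bnorm"
  assumes N: "ball_banach N"
  obtains w :: "'a \<Rightarrow> ennreal" where "w \<in> borel_measurable lebesgue" "\<And>x. w x > 0"
    "(\<integral>\<^sup>+ x. w x \<partial>lebesgue) < \<infinity>"
    "\<And>f. f \<in> borel_measurable lebesgue \<Longrightarrow> (\<integral>\<^sup>+ x. w x * f x \<partial>lebesgue) \<le> 2 * N f"
proof -
  define B where "B = (\<lambda>m::nat. ball (0::'a) (real m))"
  have [measurable]: "B m \<in> sets lebesgue" for m unfolding B_def by simp
  have "\<forall>m. \<exists>K>0. \<forall>f. f \<in> borel_measurable lebesgue \<longrightarrow> (\<integral>\<^sup>+ x \<in> B m. f x \<partial>lebesgue) \<le> ennreal K * N f"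
    using bb_local[OF N] unfolding B_def by metis
  then obtain K where K: "\<And>m. K m > 0"
    "\<And>m f. f \<in> borel_measurable lebesgue \<Longrightarrow> (\<integral>\<^sup>+ x \<in> B m. f x \<partial>lebesgue) \<le> ennreal (K m) * N f"
    by metis
  define b where "b = (\<lambda>m. measure lebesgue (B m))"
  have bB: "emeasure lebesgue (B m) = ennreal (b m)" for m
    unfolding b_def using emeasure_lborel_ball_finite[of "0::'a" "real m"]
    by (intro emeasure_eq_ennreal_measure) (auto simp: B_def)
  have b0: "b m \<ge> 0" for m unfolding b_def by simp
  \<comment> \<open>The denominator dominates both the local constant \<open>K m\<close> of (f) and
    the volume \<open>b m\<close>: one gives the bound by the norm, the other the integrability of
    the weight.\<close>
  define c where "c = (\<lambda>m. (1/2) ^ m / (1 + K m + b m))"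
  have pos: "1 + K m + b m > 0" for m using K(1)[of m] b0[of m] by simp
  have c: "c m > 0" "c m * K m \<le> (1/2) ^ m" "c m * b m \<le> (1/2) ^ m" for m
  proof -
    have "K m / (1 + K m + b m) \<le> 1" "b m / (1 + K m + b m) \<le> 1"
      using K(1)[of m] b0[of m] by auto
    from this[THEN mult_left_mono, of "(1/2) ^ m"]
    show "c m > 0" "c m * K m \<le> (1/2) ^ m" "c m * b m \<le> (1/2) ^ m"
      unfolding c_def using pos[of m] by simp_all
  qed
  define w where "w = (\<lambda>x. \<Sum>m. ennreal (c m) * indicator (B m) x)"
  have [measurable]: "w \<in> borel_measurable lebesgue" unfolding w_def by measurable
  have int: "(\<integral>\<^sup>+ x. w x * f x \<partial>lebesgue) = (\<Sum>m. ennreal (c m) * (\<integral>\<^sup>+ x \<in> B m. f x \<partial>lebesgue))"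
    if [measurable]: "f \<in> borel_measurable lebesgue" for f
  proof -
    have "(\<integral>\<^sup>+ x. w x * f x \<partial>lebesgue) = (\<integral>\<^sup>+ x. (\<Sum>m. ennreal (c m) * (f x * indicator (B m) x)) \<partial>lebesgue)"
      unfolding w_def by (subst ennreal_suminf_multc[symmetric]) (simp add: mult_ac)
    also have "\<dots> = (\<Sum>m. \<integral>\<^sup>+ x. ennreal (c m) * (f x * indicator (B m) x) \<partial>lebesgue)"
      by (rule nn_integral_suminf) measurable
    also have "\<dots> = (\<Sum>m. ennreal (c m) * (\<integral>\<^sup>+ x \<in> B m. f x \<partial>lebesgue))"
      by (subst nn_integral_cmult) measurable
    finally show ?thesis .
  qed
  have geo: "(\<Sum>m. ennreal ((1/2) ^ m)) = 2"
    using suminf_geometric[of "1/2::real"] by (subst suminf_ennreal2) auto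
  show thesis
  proof (rule that)
    show "w x > 0" for x
    proof -
      obtain m :: nat where "norm x < m" using reals_Archimedean2 by blast
      then have "0 < ennreal (c m) * indicator (B m) x" using c(1)[of m] by (simp add: B_def)
      also have "\<dots> = sum (\<lambda>m. ennreal (c m) * indicator (B m) x) {m}" by (simp only: sum.insert finite.emptyI sum.empty empty_iff not_False_eq_True add_0_right)
      also have "\<dots> \<le> w x" unfolding w_def by (rule sum_le_suminf) auto
      finally show ?thesis .
    qed
    have "(\<integral>\<^sup>+ x. w x \<partial>lebesgue) = (\<Sum>m. ennreal (c m) * ennreal (b m))"
      using int[of "\<lambda>_. 1"] by (simp add: bB del: nn_integral_completion)
    also have "\<dots> \<le> (\<Sum>m. ennreal ((1/2) ^ m))"
      using c b0 by (intro suminf_le) (auto simp flip: ennreal_mult'' intro!: ennreal_leI)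
    finally show "(\<integral>\<^sup>+ x. w x \<partial>lebesgue) < \<infinity>" unfolding geo by (rule le_less_trans) simp
    show "(\<integral>\<^sup>+ x. w x * f x \<partial>lebesgue) \<le> 2 * N f" if f: "f \<in> borel_measurable lebesgue" for f
    proof -
      have "(\<integral>\<^sup>+ x. w x * f x \<partial>lebesgue) \<le> (\<Sum>m. ennreal ((1/2) ^ m) * N f)"
        unfolding int[OF f]
      proof (rule suminf_le)
        fix m
        have "ennreal (c m) * (\<integral>\<^sup>+ x \<in> B m. f x \<partial>lebesgue) \<le> ennreal (c m) * (ennreal (K m) * N f)"
          by (intro mult_left_mono K f) auto
        also have "\<dots> = ennreal (c m * K m) * N f"
          using c(1)[of m] K(1)[of m] by (simp add: ennreal_mult mult.assoc less_imp_le)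
        also have "\<dots> \<le> ennreal ((1/2) ^ m) * N f"
          using c(2) by (intro mult_right_mono ennreal_leI) auto
        finally show "ennreal (c m) * (\<integral>\<^sup>+ x \<in> B m. f x \<partial>lebesgue) \<le> ennreal ((1/2) ^ m) * N f" .
      qed auto
      also have "\<dots> = 2 * N f" by (simp add: ennreal_suminf_multc geo)
      finally show ?thesis .
    qed
  qed measurable
qed

section \<open>Weak limits of norm bounded sequences\<close>

definition bdd_supp :: "('a::euclidean_space \<Rightarrow> real) \<Rightarrow> bool" where
  "bdd_supp \<psi> \<longleftrightarrow> \<psi> \<in> borel_measurable lebesgue \<and> (\<exists>R. (\<forall>x. \<bar>\<psi> x\<bar> \<le> R) \<and> (\<forall>x. x \<notin> ball 0 R \<longrightarrow> \<psi> x = 0))"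

lemma bb_integrable_mult:
  assumes N: "ball_banach N" and [measurable]: "g \<in> borel_measurable lebesgue"
    and fin: "N (\<lambda>x. ennreal \<bar>g x\<bar>) < \<infinity>" and \<psi>: "bdd_supp \<psi>"
  shows "integrable lebesgue (\<lambda>x. g x * \<psi> x)"
proof (rule integrableI_bounded)
  obtain R where R: "\<And>x. \<bar>\<psi> x\<bar> \<le> R" "\<And>x. x \<notin> ball 0 R \<Longrightarrow> \<psi> x = 0" using \<psi> unfolding bdd_supp_def by metis
  have [measurable]: "\<psi> \<in> borel_measurable lebesgue" using \<psi> unfolding bdd_supp_def by simp
  obtain K where K: "K > 0" "\<And>f. f \<in> borel_measurable lebesgue \<Longrightarrow>
    (\<integral>\<^sup>+ x \<in> ball 0 R. f x \<partial>lebesgue) \<le> ennreal K * N f" using bb_local[OF N] by blast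
  have R0: "R \<ge> 0" using R(1)[of 0] by linarith
  have [measurable]: "ball (0::'a) R \<in> sets lebesgue" by simp
  have "(\<integral>\<^sup>+ x. ennreal (norm (g x * \<psi> x)) \<partial>lebesgue) \<le> (\<integral>\<^sup>+ x. ennreal R * (ennreal \<bar>g x\<bar> * indicator (ball 0 R) x) \<partial>lebesgue)"
  proof (rule nn_integral_mono)
    fix x
    show "ennreal (norm (g x * \<psi> x)) \<le> ennreal R * (ennreal \<bar>g x\<bar> * indicator (ball 0 R) x)"
    proof (cases "x \<in> ball 0 R")
      case True
      have "norm (g x * \<psi> x) \<le> R * \<bar>g x\<bar>" using R(1)[of x] by (simp add: abs_mult mult.commute mult_right_mono)
      then show ?thesis using True R0 by (simp flip: ennreal_mult add: ennreal_leI)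
    next
      case False then show ?thesis using R(2)[OF False] by simp
    qed
  qed
  also have "\<dots> = ennreal R * (\<integral>\<^sup>+ x \<in> ball 0 R. ennreal \<bar>g x\<bar> \<partial>lebesgue)"
    by (rule nn_integral_cmult) measurable
  also have "\<dots> \<le> ennreal R * (ennreal K * N (\<lambda>x. ennreal \<bar>g x\<bar>))" by (intro mult_left_mono K) auto
  also have "\<dots> < \<infinity>" using fin by (simp add: ennreal_mult_less_top)
  finally show "(\<integral>\<^sup>+ x. ennreal (norm (g x * \<psi> x)) \<partial>lebesgue) < \<infinity>" .
  show "(\<lambda>x. g x * \<psi> x) \<in> borel_measurable lebesgue" by measurable
qed

text \<open>A Vitali type argument. Where the difference is at most \<eta>, its integral is small by
  volume. On the rest Hoelder's inequality applies, and the associate norm of the indicator of that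
  part of the ball tends to 0 because the associate norm is absolutely continuous.\<close>

lemma bb_L1_convergence:
  fixes h :: "nat \<Rightarrow> 'a::euclidean_space \<Rightarrow> real"
  assumes N: "ball_banach N" and ac: "abs_cont_norm (associate N)"
    and [measurable]: "\<And>k. h k \<in> borel_measurable lebesgue" "g \<in> borel_measurable lebesgue"
    and hN: "\<And>k. N (\<lambda>x. ennreal \<bar>h k x\<bar>) \<le> ennreal C" and gN: "N (\<lambda>x. ennreal \<bar>g x\<bar>) \<le> ennreal C"
    and lim: "AE x in lebesgue. (\<lambda>k. h k x) \<longlonglongrightarrow> g x"
  shows "(\<lambda>k. \<integral>\<^sup>+ x \<in> ball 0 R. ennreal \<bar>h k x - g x\<bar> \<partial>lebesgue) \<longlonglongrightarrow> 0"
proof -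
  define B where "B = ball (0::'a) R"
  have [measurable]: "B \<in> sets lebesgue" unfolding B_def by simp
  obtain b where b: "emeasure lebesgue B = ennreal b" "b \<ge> 0"
    using emeasure_lborel_ball_finite[of "0::'a" R] by (cases "emeasure lebesgue B") (auto simp: B_def)
  define C' where "C' = max C 0"
  have dN: "N (\<lambda>x. ennreal \<bar>h k x - g x\<bar>) \<le> ennreal (2 * C')" for k
  proof -
    have "N (\<lambda>x. ennreal \<bar>h k x - g x\<bar>) \<le> N (\<lambda>x. ennreal \<bar>h k x\<bar> + ennreal \<bar>g x\<bar>)"
      by (rule bb_mono[OF N]) (auto simp flip: ennreal_plus intro!: AE_I2 ennreal_leI)
    also have "\<dots> \<le> N (\<lambda>x. ennreal \<bar>h k x\<bar>) + N (\<lambda>x. ennreal \<bar>g x\<bar>)"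
      by (rule bb_triangle[OF N]) auto
    also have "\<dots> \<le> ennreal C' + ennreal C'" unfolding C'_def
      by (intro add_mono order_trans[OF hN] order_trans[OF gN] ennreal_leI) auto
    finally show ?thesis unfolding C'_def by (simp flip: ennreal_plus)
  qed
  define D where "D = (\<lambda>k. \<integral>\<^sup>+ x \<in> B. ennreal \<bar>h k x - g x\<bar> \<partial>lebesgue)"
  define E where "E = (\<lambda>\<eta> k. {x. \<bar>h k x - g x\<bar> > \<eta>})"
  have [measurable]: "E \<eta> k \<in> sets lebesgue" for \<eta> k
  proof -
    have "{x \<in> space lebesgue. \<bar>h k x - g x\<bar> > \<eta>} \<in> sets lebesgue" by measurable
    then show ?thesis unfolding E_def by simp
  qed
  have Dle: "D k \<le> ennreal (\<eta> * b) + ennreal (2 * C') * associate N (\<lambda>x. indicator B x * indicator (E \<eta> k) x)"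
    if \<eta>: "\<eta> > 0" for \<eta> k
  proof -
    have "D k \<le> (\<integral>\<^sup>+ x. ennreal \<eta> * indicator B x + ennreal \<bar>h k x - g x\<bar> * (indicator B x * indicator (E \<eta> k) x) \<partial>lebesgue)"
      unfolding D_def by (rule nn_integral_mono) (auto simp: E_def indicator_def intro!: ennreal_leI)
    also have "\<dots> = (\<integral>\<^sup>+ x. ennreal \<eta> * indicator B x \<partial>lebesgue)
        + (\<integral>\<^sup>+ x. ennreal \<bar>h k x - g x\<bar> * (indicator B x * indicator (E \<eta> k) x) \<partial>lebesgue)"
      by (rule nn_integral_add) measurable
    also have "(\<integral>\<^sup>+ x. ennreal \<eta> * indicator B x \<partial>lebesgue) = ennreal (\<eta> * b)"
      using b \<eta> by (subst nn_integral_cmult_indicator) (auto simp: ennreal_mult)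
    also have "(\<integral>\<^sup>+ x. ennreal \<bar>h k x - g x\<bar> * (indicator B x * indicator (E \<eta> k) x) \<partial>lebesgue)
       \<le> N (\<lambda>x. ennreal \<bar>h k x - g x\<bar>) * associate N (\<lambda>x. indicator B x * indicator (E \<eta> k) x)"
      by (rule bb_Hoelder[OF N]) (auto intro: le_less_trans[OF dN])
    also have "\<dots> \<le> ennreal (2 * C') * associate N (\<lambda>x. indicator B x * indicator (E \<eta> k) x)"
      by (intro mult_right_mono dN) auto
    finally show ?thesis by (simp add: add_left_mono)
  qed
  have assoc0: "(\<lambda>k. associate N (\<lambda>x. indicator B x * indicator (E \<eta> k) x)) \<longlonglongrightarrow> 0" if \<eta>: "\<eta> > 0" for \<eta>
  proof -
    have "associate N (indicator B) < \<infinity>" unfolding B_def by (rule associate_ball_finite[OF N])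
    moreover have "AE x in lebesgue. (\<lambda>k. indicator (E \<eta> k) x :: real) \<longlonglongrightarrow> 0"
      using lim
    proof eventually_elim
      case (elim x)
      then have "(\<lambda>k. \<bar>h k x - g x\<bar>) \<longlonglongrightarrow> 0" by (intro tendsto_rabs_zero) (simp add: LIM_zero)
      then have "eventually (\<lambda>k. \<bar>h k x - g x\<bar> < \<eta>) sequentially" using \<eta> by (rule order_tendstoD)
      then have "eventually (\<lambda>k. indicator (E \<eta> k) x = (0::real)) sequentially"
        by eventually_elim (auto simp: E_def indicator_def)
      then show ?case by (rule tendsto_eventually)
    qed
    ultimately show ?thesis using ac unfolding abs_cont_norm_def by auto
  qed
  have "D \<longlonglongrightarrow> 0"
  proof (rule order_tendstoI)
    fix e :: ennreal assume "0 < e"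
    then obtain e' where e': "0 < ennreal e'" "ennreal e' < e" "e' > 0"
      by (metis dense ennreal_cases ennreal_less_zero_iff less_top_ennreal not_less_iff_gr_or_eq order_less_trans top.not_eq_extremum)
    define \<eta> where "\<eta> = e' / (2 * (b + 1))"
    have \<eta>: "\<eta> > 0" "\<eta> * b \<le> e' / 2" unfolding \<eta>_def using e' b by (auto simp: field_simps)
    define \<delta> where "\<delta> = e' / (4 * (C' + 1))"
    have C'0: "C' \<ge> 0" unfolding C'_def by simp
    have \<delta>: "\<delta> > 0" "2 * C' * \<delta> \<le> e' / 2" unfolding \<delta>_def using e' C'0 by (auto simp: field_simps)
    have "eventually (\<lambda>k. associate N (\<lambda>x. indicator B x * indicator (E \<eta> k) x) < ennreal \<delta>) sequentially"
      using assoc0[OF \<eta>(1)] \<delta>(1) by (intro order_tendstoD) auto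
    then show "eventually (\<lambda>k. D k < e) sequentially"
    proof eventually_elim
      case (elim k)
      have "D k \<le> ennreal (\<eta> * b) + ennreal (2 * C') * ennreal \<delta>"
        by (rule order_trans[OF Dle[OF \<eta>(1)]]) (intro add_left_mono mult_left_mono less_imp_le[OF elim], simp)
      also have "\<dots> = ennreal (\<eta> * b + 2 * C' * \<delta>)"
        using \<eta> \<delta> b C'0 by (simp add: ennreal_mult)
      also have "\<dots> \<le> ennreal e'" using \<eta> \<delta> by (intro ennreal_leI) simp
      finally show ?case using e' by simp
    qed
  qed auto
  then show ?thesis unfolding D_def B_def .
qed

text \<open>Only pairings already known to converge have to be identified, so no subsequence is
  chosen. Elements of a hull of the tails are made to converge almost everywhere, hence locally in
  L^1, and this carries the pairings to the limit.\<close>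

lemma bb_weak_limit:
  fixes q :: "nat \<Rightarrow> 'a::euclidean_space \<Rightarrow> real"
  assumes N: "ball_banach N" and ac: "abs_cont_norm (associate N)"
    and q[measurable]: "\<And>m. q m \<in> borel_measurable lebesgue"
    and qN: "\<And>m. N (\<lambda>x. ennreal \<bar>q m x\<bar>) \<le> ennreal C"
  obtains g where "g \<in> borel_measurable lebesgue" "N (\<lambda>x. ennreal \<bar>g x\<bar>) \<le> ennreal C"
    "\<And>\<psi> l. bdd_supp \<psi> \<Longrightarrow> (\<lambda>m. \<integral>x. q m x * \<psi> x \<partial>lebesgue) \<longlonglongrightarrow> l \<Longrightarrow> (\<integral>x. g x * \<psi> x \<partial>lebesgue) = l"
proof -
  obtain w :: "'a \<Rightarrow> ennreal" where [measurable]: "w \<in> borel_measurable lebesgue" and w: "\<And>x. w x > 0"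
    "(\<integral>\<^sup>+ x. w x \<partial>lebesgue) < \<infinity>"
    "\<And>f. f \<in> borel_measurable lebesgue \<Longrightarrow> (\<integral>\<^sup>+ x. w x * f x \<partial>lebesgue) \<le> 2 * N f"
    using bb_weight[OF N] by blast
  define M where "M = density lebesgue w"
  \<comment> \<open>A substitute for the closed convex hull of the tail from k on: its members obey
    every estimate of a pairing that all \<open>q m\<close> with m \<ge> k obey.\<close>
  define S where "S = (\<lambda>k. {g \<in> borel_measurable lebesgue. N (\<lambda>x. ennreal \<bar>g x\<bar>) \<le> ennreal C \<and>
     (\<forall>\<psi> l e. bdd_supp \<psi> \<longrightarrow> (\<forall>m\<ge>k. \<bar>(\<integral>x. q m x * \<psi> x \<partial>lebesgue) - l\<bar> \<le> e) \<longrightarrow>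
        \<bar>(\<integral>x. g x * \<psi> x \<partial>lebesgue) - l\<bar> \<le> e)})"
  have C': "ennreal C < \<infinity>" by simp
  obtain h g where h: "\<And>k. h k \<in> S k" and gM: "g \<in> borel_measurable M"
    and lim: "AE x in M. (\<lambda>k. h k x) \<longlonglongrightarrow> g x"
  proof (rule midpoint_convex_selection[of M S "2 * C"])
    show "finite_measure M"
      by (rule finite_measureI) (use w(2) in \<open>simp add: M_def emeasure_density del: nn_integral_completion\<close>)
    show "g \<in> borel_measurable M" if "g \<in> S k" for k g using that unfolding S_def M_def by simp
    show "S k \<noteq> {}" for k using qN unfolding S_def by (auto intro!: exI[of _ "q k"])
    show "S (Suc k) \<subseteq> S k" for k unfolding S_def by (auto dest: Suc_leD)
    show "(\<lambda>x. (g x + h x) / 2) \<in> S k" if g: "g \<in> S k" and h: "h \<in> S k" for k g h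
    proof -
      have [measurable]: "h \<in> borel_measurable lebesgue" "g \<in> borel_measurable lebesgue" using g h S_def by auto
      have Ng: "N (\<lambda>x. ennreal \<bar>g x\<bar>) \<le> ennreal C" and Nh: "N (\<lambda>x. ennreal \<bar>h x\<bar>) \<le> ennreal C" using g h S_def by auto
      have "N (\<lambda>x. ennreal \<bar>(g x + h x) / 2\<bar>) \<le> N (\<lambda>x. ennreal (1/2) * (ennreal \<bar>g x\<bar> + ennreal \<bar>h x\<bar>))"
      proof (rule bb_mono[OF N], measurable, rule AE_I2)
        fix x
        show "ennreal \<bar>(g x + h x) / 2\<bar> \<le> ennreal (1/2) * (ennreal \<bar>g x\<bar> + ennreal \<bar>h x\<bar>)"
          by (subst ennreal_half_add) (auto intro!: ennreal_leI)
      qed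
      also have "\<dots> = ennreal (1/2) * N (\<lambda>x. ennreal \<bar>g x\<bar> + ennreal \<bar>h x\<bar>)" by (rule bb_scale[OF N]) auto
      also have "\<dots> \<le> ennreal (1/2) * (N (\<lambda>x. ennreal \<bar>g x\<bar>) + N (\<lambda>x. ennreal \<bar>h x\<bar>))"
        by (intro mult_left_mono bb_triangle[OF N]) auto
      also have "\<dots> \<le> ennreal (1/2) * (ennreal C + ennreal C)" using Ng Nh by (intro mult_left_mono add_mono) auto
      also have "\<dots> = ennreal C" by (rule ennreal_half_add_self)
      finally have 1: "N (\<lambda>x. ennreal \<bar>(g x + h x) / 2\<bar>) \<le> ennreal C" .
      have 2: "\<bar>(\<integral>x. (g x + h x) / 2 * \<psi> x \<partial>lebesgue) - l\<bar> \<le> e"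
        if \<psi>: "bdd_supp \<psi>" and b: "\<forall>m\<ge>k. \<bar>(\<integral>x. q m x * \<psi> x \<partial>lebesgue) - l\<bar> \<le> e" for \<psi> l e
      proof -
        have i: "integrable lebesgue (\<lambda>x. g x * \<psi> x)" "integrable lebesgue (\<lambda>x. h x * \<psi> x)"
          using Ng Nh by (auto intro!: bb_integrable_mult[OF N _ _ \<psi>] intro: le_less_trans[OF _ C'])
        have "(\<integral>x. (g x + h x) / 2 * \<psi> x \<partial>lebesgue) = (\<integral>x. (1/2) * (g x * \<psi> x) + (1/2) * (h x * \<psi> x) \<partial>lebesgue)"
          by (intro Bochner_Integration.integral_cong) (auto simp: field_simps)
        also have "\<dots> = (1/2) * (\<integral>x. g x * \<psi> x \<partial>lebesgue) + (1/2) * (\<integral>x. h x * \<psi> x \<partial>lebesgue)"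
          using i by simp
        moreover have "\<bar>(\<integral>x. g x * \<psi> x \<partial>lebesgue) - l\<bar> \<le> e" "\<bar>(\<integral>x. h x * \<psi> x \<partial>lebesgue) - l\<bar> \<le> e"
          using g h \<psi> b unfolding S_def by blast+
        ultimately show ?thesis by linarith
      qed
      show ?thesis unfolding S_def using 1 2 by simp
    qed
    show "(\<integral>\<^sup>+ x. ennreal \<bar>g x\<bar> \<partial>M) \<le> ennreal (2 * C)" if "g \<in> S 0" for g
    proof -
      have [measurable]: "g \<in> borel_measurable lebesgue" using that S_def by auto
      have "(\<integral>\<^sup>+ x. ennreal \<bar>g x\<bar> \<partial>M) = (\<integral>\<^sup>+ x. w x * ennreal \<bar>g x\<bar> \<partial>lebesgue)"
        unfolding M_def by (rule nn_integral_density) auto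
      also have "\<dots> \<le> 2 * N (\<lambda>x. ennreal \<bar>g x\<bar>)" by (rule w) auto
      also have "\<dots> \<le> 2 * ennreal C" using that unfolding S_def by (intro mult_left_mono) auto
      also have "\<dots> = ennreal (2 * C)"
        by (cases "C \<ge> 0") (auto simp: ennreal_mult ennreal_neg)
      finally show ?thesis .
    qed
  qed blast
  have [measurable]: "g \<in> borel_measurable lebesgue" using gM unfolding M_def by simp
  have [measurable]: "h k \<in> borel_measurable lebesgue" and hN: "N (\<lambda>x. ennreal \<bar>h k x\<bar>) \<le> ennreal C" for k
    using h[of k] unfolding S_def by auto
  have lim': "AE x in lebesgue. (\<lambda>k. h k x) \<longlonglongrightarrow> g x"
    using lim w(1) unfolding M_def by (subst (asm) AE_density) auto
  have gN: "N (\<lambda>x. ennreal \<bar>g x\<bar>) \<le> ennreal C"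
  proof (rule bb_fatou[OF N, where F = "\<lambda>k x. ennreal \<bar>h k x\<bar>"])
    show "AE x in lebesgue. ennreal \<bar>g x\<bar> \<le> liminf (\<lambda>k. ennreal \<bar>h k x\<bar>)"
      using lim'
    proof eventually_elim
      case (elim x)
      then have "(\<lambda>k. ennreal \<bar>h k x\<bar>) \<longlonglongrightarrow> ennreal \<bar>g x\<bar>" by (intro tendsto_ennrealI tendsto_rabs)
      then have "liminf (\<lambda>k. ennreal \<bar>h k x\<bar>) = ennreal \<bar>g x\<bar>" by (intro lim_imp_Liminf) auto
      then show ?case by simp
    qed
  qed (use hN in auto)
  have "(\<integral>x. g x * \<psi> x \<partial>lebesgue) = l"
    if \<psi>: "bdd_supp \<psi>" and l: "(\<lambda>m. \<integral>x. q m x * \<psi> x \<partial>lebesgue) \<longlonglongrightarrow> l" for \<psi> l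
  proof -
    obtain R where R: "\<And>x. \<bar>\<psi> x\<bar> \<le> R" "\<And>x. x \<notin> ball 0 R \<Longrightarrow> \<psi> x = 0" using \<psi> unfolding bdd_supp_def by metis
    have [measurable]: "\<psi> \<in> borel_measurable lebesgue" using \<psi> unfolding bdd_supp_def by simp
    have [measurable]: "ball (0::'a) R \<in> sets lebesgue" by simp
    have R0: "R \<ge> 0" using R(1)[of 0] by linarith
    have ih: "integrable lebesgue (\<lambda>x. h k x * \<psi> x)" for k
      by (rule bb_integrable_mult[OF N _ _ \<psi>]) (auto intro: le_less_trans[OF hN])
    have ig: "integrable lebesgue (\<lambda>x. g x * \<psi> x)"
      by (rule bb_integrable_mult[OF N _ _ \<psi>]) (auto intro: le_less_trans[OF gN])
    have conv1: "(\<lambda>k. \<integral>x. h k x * \<psi> x \<partial>lebesgue) \<longlonglongrightarrow> l"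
    proof (rule LIMSEQ_I)
      fix r :: real assume r: "0 < r"
      then obtain k0 where k0: "\<forall>m\<ge>k0. \<bar>(\<integral>x. q m x * \<psi> x \<partial>lebesgue) - l\<bar> < r / 2"
        using LIMSEQ_D[OF l, of "r/2"] by auto
      have "norm ((\<integral>x. h k x * \<psi> x \<partial>lebesgue) - l) < r" if "k \<ge> k0" for k
      proof -
        have "\<forall>m\<ge>k. \<bar>(\<integral>x. q m x * \<psi> x \<partial>lebesgue) - l\<bar> \<le> r / 2" using k0 that by (auto intro: less_imp_le)
        then have "\<bar>(\<integral>x. h k x * \<psi> x \<partial>lebesgue) - l\<bar> \<le> r / 2" using h[of k] \<psi> unfolding S_def by blast
        then show ?thesis using r by simp
      qed
      then show "\<exists>no. \<forall>k\<ge>no. norm ((\<integral>x. h k x * \<psi> x \<partial>lebesgue) - l) < r" by blast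
    qed
    have "(\<lambda>k. (\<integral>x. h k x * \<psi> x \<partial>lebesgue) - (\<integral>x. g x * \<psi> x \<partial>lebesgue)) \<longlonglongrightarrow> 0"
    proof (rule tendsto_norm_zero_cancel, subst ennreal_tendsto_0_iff[symmetric], rule norm_ge_zero)
      have "(\<lambda>k. ennreal R * (\<integral>\<^sup>+ x \<in> ball 0 R. ennreal \<bar>h k x - g x\<bar> \<partial>lebesgue)) \<longlonglongrightarrow> ennreal R * 0"
        by (intro ennreal_tendsto_cmult bb_L1_convergence[OF N ac _ _ hN gN lim']) auto
      then have lim0: "(\<lambda>k. ennreal R * (\<integral>\<^sup>+ x \<in> ball 0 R. ennreal \<bar>h k x - g x\<bar> \<partial>lebesgue)) \<longlonglongrightarrow> 0" by simp
      show "(\<lambda>k. ennreal (norm ((\<integral>x. h k x * \<psi> x \<partial>lebesgue) - (\<integral>x. g x * \<psi> x \<partial>lebesgue)))) \<longlonglongrightarrow> 0"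
      proof (rule tendsto_sandwich[OF _ _ tendsto_const lim0])
        show "eventually (\<lambda>k. ennreal (norm ((\<integral>x. h k x * \<psi> x \<partial>lebesgue) - (\<integral>x. g x * \<psi> x \<partial>lebesgue)))
           \<le> ennreal R * (\<integral>\<^sup>+ x \<in> ball 0 R. ennreal \<bar>h k x - g x\<bar> \<partial>lebesgue)) sequentially"
        proof (rule always_eventually, rule allI)
          fix k
          have "ennreal (norm ((\<integral>x. h k x * \<psi> x \<partial>lebesgue) - (\<integral>x. g x * \<psi> x \<partial>lebesgue)))
            = ennreal (norm (\<integral>x. h k x * \<psi> x - g x * \<psi> x \<partial>lebesgue))"
            using ih ig by simp
          also have "\<dots> \<le> (\<integral>\<^sup>+ x. ennreal (norm (h k x * \<psi> x - g x * \<psi> x)) \<partial>lebesgue)"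
            using ih ig by (intro integral_norm_bound_ennreal Bochner_Integration.integrable_diff)
          also have "\<dots> \<le> (\<integral>\<^sup>+ x. ennreal R * (ennreal \<bar>h k x - g x\<bar> * indicator (ball 0 R) x) \<partial>lebesgue)"
          proof (rule nn_integral_mono)
            fix x
            show "ennreal (norm (h k x * \<psi> x - g x * \<psi> x)) \<le> ennreal R * (ennreal \<bar>h k x - g x\<bar> * indicator (ball 0 R) x)"
            proof (cases "x \<in> ball 0 R")
              case True
              have "norm (h k x * \<psi> x - g x * \<psi> x) \<le> R * \<bar>h k x - g x\<bar>"
                unfolding left_diff_distrib[symmetric] real_norm_def abs_mult
                using R(1)[of x] by (subst mult.commute) (intro mult_right_mono, auto)
              then show ?thesis using True R0 by (simp flip: ennreal_mult add: ennreal_leI)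
            next
              case False then show ?thesis using R(2)[OF False] by simp
            qed
          qed
          also have "\<dots> = ennreal R * (\<integral>\<^sup>+ x \<in> ball 0 R. ennreal \<bar>h k x - g x\<bar> \<partial>lebesgue)"
            by (rule nn_integral_cmult) measurable
          finally show "ennreal (norm ((\<integral>x. h k x * \<psi> x \<partial>lebesgue) - (\<integral>x. g x * \<psi> x \<partial>lebesgue)))
           \<le> ennreal R * (\<integral>\<^sup>+ x \<in> ball 0 R. ennreal \<bar>h k x - g x\<bar> \<partial>lebesgue)" .
        qed
      qed auto
    qed
    then have "(\<lambda>k. \<integral>x. h k x * \<psi> x \<partial>lebesgue) \<longlonglongrightarrow> (\<integral>x. g x * \<psi> x \<partial>lebesgue)" by (simp add: LIM_zero_iff)
    then show ?thesis using conv1 LIMSEQ_unique by blast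
  qed
  then show thesis using that[of g] gN by auto
qed

section \<open>Mollifiers\<close>

text \<open>A function together with all its derivatives, so that higher derivatives of products and
  affine substitutions stay explicit.\<close>

definition smooth_chain :: "(nat \<Rightarrow> real \<Rightarrow> real) \<Rightarrow> bool" where
  "smooth_chain D \<longleftrightarrow> (\<forall>k t. (D k has_real_derivative D (Suc k) t) (at t))"

text \<open>With s = 1 / t, differentiating P(s) exp (- s) in t gives s^2 (P(s) - P'(s)) exp (- s);
  this is the recursion.\<close>

fun flat_poly :: "nat \<Rightarrow> real poly" where
  "flat_poly 0 = 1"
| "flat_poly (Suc k) = [:0, 0, 1:] * (flat_poly k - pderiv (flat_poly k))"

definition flat :: "nat \<Rightarrow> real \<Rightarrow> real" where
  "flat k t = (if t > 0 then poly (flat_poly k) (1 / t) * exp (- (1 / t)) else 0)"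

lemma tendsto_poly_div_exp: "((\<lambda>x::real. poly q x * exp (- x)) \<longlongrightarrow> 0) at_top"
proof -
  have "((\<lambda>x::real. \<Sum>i\<le>degree q. coeff q i * (x ^ i / exp x)) \<longlongrightarrow> (\<Sum>i\<le>degree q. coeff q i * 0)) at_top"
    by (intro tendsto_intros tendsto_power_div_exp_0)
  then show ?thesis by (simp add: poly_altdef sum_distrib_right exp_minus divide_inverse mult.assoc)
qed

lemma smooth_chain_flat: "smooth_chain flat"
  unfolding smooth_chain_def
proof (intro allI)
  fix k and t :: real
  consider "t > 0" | "t = 0" | "t < 0" by linarith
  then show "(flat k has_real_derivative flat (Suc k) t) (at t)"
  proof cases
    case 1
    have "((\<lambda>t. poly (flat_poly k) (1 / t) * exp (- (1 / t))) has_real_derivative flat (Suc k) t) (at t)"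
      using 1 by (auto simp: flat_def field_simps power2_eq_square intro!: derivative_eq_intros)
    then show ?thesis
    proof (rule has_field_derivative_transform_within_open)
      show "poly (flat_poly k) (1 / x) * exp (- (1 / x)) = flat k x" if "x \<in> {0<..}" for x
        using that by (simp add: flat_def)
    qed (use 1 in auto)
  next
    case 2
    have "((\<lambda>y. flat k y / y) \<longlongrightarrow> 0) (at 0)"
    proof (rule filterlim_split_at)
      show "((\<lambda>y. flat k y / y) \<longlongrightarrow> 0) (at_left 0)"
        by (rule tendsto_eventually) (auto simp: flat_def eventually_at_filter)
      \<comment> \<open>Dividing by y multiplies the polynomial in 1 / y by one more factor, which
        the exponential still beats.\<close>
      have "((\<lambda>y. poly ([:0, 1:] * flat_poly k) (1 / y) * exp (- (1 / y))) \<longlongrightarrow> 0) (at_right (0::real))"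
        by (rule filterlim_compose[OF tendsto_poly_div_exp])
           (simp add: filterlim_inverse_at_top_right flip: inverse_eq_divide)
      then show "((\<lambda>y. flat k y / y) \<longlongrightarrow> 0) (at_right 0)"
        by (rule Lim_transform_eventually) (auto simp: flat_def eventually_at_filter)
    qed
    then show ?thesis unfolding 2 by (simp add: has_field_derivative_iff flat_def)
  next
    case 3
    have "((\<lambda>t. 0) has_real_derivative 0) (at t)" by simp
    then have "(flat k has_real_derivative 0) (at t)"
    proof (rule has_field_derivative_transform_within_open)
      show "0 = flat k x" if "x \<in> {..<0}" for x using that by (simp add: flat_def)
    qed (use 3 in auto)
    then show ?thesis using 3 by (simp add: flat_def)
  qed
qed

lemma smooth_chain_affine:
  assumes "smooth_chain D"
  shows "smooth_chain (\<lambda>k t. c ^ k * D k (a + c * t))"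
  unfolding smooth_chain_def
proof (intro allI)
  fix k t
  have D: "(D k has_real_derivative D (Suc k) (a + c * t)) (at (a + c * t))"
    using assms unfolding smooth_chain_def by blast
  have "((\<lambda>t. a + c * t) has_real_derivative c) (at t)" by (auto intro!: derivative_eq_intros)
  from DERIV_chain2[OF D this]
  have "((\<lambda>t. c ^ k * D k (a + c * t)) has_real_derivative c ^ k * (D (Suc k) (a + c * t) * c)) (at t)"
    by (rule DERIV_cmult)
  then show "((\<lambda>t. c ^ k * D k (a + c * t)) has_real_derivative c ^ Suc k * D (Suc k) (a + c * t)) (at t)"
    by (simp add: mult_ac)
qed

text \<open>Leibniz's formula at every order; one more derivative is Pascal's rule after a shift of
  the index.\<close>

lemma smooth_chain_mult:
  assumes F: "smooth_chain F" and G: "smooth_chain G"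
  shows "smooth_chain (\<lambda>k t. \<Sum>i\<le>k. of_nat (k choose i) * (F i t * G (k - i) t))"
  unfolding smooth_chain_def
proof (intro allI)
  fix k t
  define A where "A = (\<lambda>i j. F i t * G j t)"
  have "((\<lambda>t. \<Sum>i\<le>k. of_nat (k choose i) * (F i t * G (k - i) t)) has_real_derivative
      (\<Sum>i\<le>k. of_nat (k choose i) * (A (Suc i) (k - i) + A i (Suc (k - i))))) (at t)"
  proof (rule DERIV_sum)
    fix i
    have "(F i has_real_derivative F (Suc i) t) (at t)" "(G (k - i) has_real_derivative G (Suc (k - i)) t) (at t)"
      using F G unfolding smooth_chain_def by blast+
    from DERIV_mult[OF this]
    show "((\<lambda>t. of_nat (k choose i) * (F i t * G (k - i) t)) has_real_derivative of_nat (k choose i) * (A (Suc i) (k - i) + A i (Suc (k - i)))) (at t)"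
      by (intro DERIV_cmult) (simp add: A_def algebra_simps)
  qed
  also have "(\<Sum>i\<le>k. of_nat (k choose i) * (A (Suc i) (k - i) + A i (Suc (k - i))))
      = (\<Sum>i\<le>k. of_nat (k choose i) * A (Suc i) (k - i)) + (\<Sum>i\<le>k. of_nat (k choose i) * A i (Suc k - i))"
    by (simp add: distrib_left sum.distrib Suc_diff_le)
  also have "(\<Sum>i\<le>k. real (k choose i) * A i (Suc k - i)) = (\<Sum>i\<le>Suc k. real (k choose i) * A i (Suc k - i))"
    by simp
  also have "\<dots> = A 0 (Suc k) + (\<Sum>i\<le>k. of_nat (k choose Suc i) * A (Suc i) (k - i))"
    by (subst sum.atMost_Suc_shift) simp
  also have "(\<Sum>i\<le>k. of_nat (k choose i) * A (Suc i) (k - i)) + (A 0 (Suc k) + (\<Sum>i\<le>k. of_nat (k choose Suc i) * A (Suc i) (k - i)))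
     = (\<Sum>i\<le>Suc k. of_nat (Suc k choose i) * A i (Suc k - i))"
    unfolding sum.atMost_Suc_shift[of "\<lambda>i. real (Suc k choose i) * A i (Suc k - i)"]
    by (simp add: algebra_simps sum.distrib)
  finally show "((\<lambda>t. \<Sum>i\<le>k. of_nat (k choose i) * (F i t * G (k - i) t)) has_real_derivative
      (\<Sum>i\<le>Suc k. of_nat (Suc k choose i) * (F i t * G (Suc k - i) t))) (at t)"
    unfolding A_def .
qed

text \<open>The functions \<open>flat 0 (1 + t)\<close> and \<open>flat 0 (1 - t)\<close> vanish
  with all derivatives left of -1 and right of 1 respectively, so their product does so on both
  sides.\<close>

lemma bump_chain:
  obtains D where "smooth_chain D" "\<And>t. 0 \<le> D 0 t" "\<And>t. D 0 t \<le> 1" "D 0 0 > 0"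
    "\<And>k t. \<bar>t\<bar> \<ge> 1 \<Longrightarrow> D k t = 0"
proof -
  define F where "F = (\<lambda>k t. 1 ^ k * flat k (1 + 1 * t))"
  define G where "G = (\<lambda>k t. (-1) ^ k * flat k (1 + (-1) * t))"
  define D where "D = (\<lambda>k t. \<Sum>i\<le>k. of_nat (k choose i) * (F i t * G (k - i) t))"
  have "smooth_chain D" unfolding D_def F_def G_def
    by (intro smooth_chain_mult smooth_chain_affine smooth_chain_flat)
  moreover have f01: "0 \<le> flat 0 t" "flat 0 t \<le> 1" for t by (auto simp: flat_def)
  have D0: "D 0 t = flat 0 (1 + t) * flat 0 (1 - t)" for t
    unfolding D_def F_def G_def by simp
  moreover have "D k t = 0" if "\<bar>t\<bar> \<ge> 1" for k t
    unfolding D_def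
  proof (rule sum.neutral, rule ballI)
    fix i
    have "F i t = 0 \<or> G (k - i) t = 0" using that by (auto simp: F_def G_def flat_def abs_le_iff)
    then show "of_nat (k choose i) * (F i t * G (k - i) t) = 0" by auto
  qed
  moreover have "D 0 0 > 0" unfolding D0 by (simp add: flat_def)
  moreover have "D 0 t \<le> 1" for t unfolding D0 using f01 by (intro mult_le_one) auto
  moreover have "0 \<le> D 0 t" for t unfolding D0 using f01 by simp
  ultimately show thesis using that by blast
qed

text \<open>Iterated partial derivatives of a tensor product of one-dimensional smooth functions only shift
  the order of differentiation in the respective factor.\<close>

lemma tensor_has_derivative:
  fixes D :: "'a::euclidean_space \<Rightarrow> nat \<Rightarrow> real \<Rightarrow> real"
  assumes D: "\<And>b. b \<in> Basis \<Longrightarrow> smooth_chain (D b)"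
  shows "((\<lambda>x. \<Prod>b\<in>Basis. D b (\<nu> b) (x \<bullet> b)) has_derivative
    (\<lambda>v. \<Sum>b\<in>Basis. (v \<bullet> b) * (\<Prod>c\<in>Basis. D c (if c = b then Suc (\<nu> c) else \<nu> c) (x \<bullet> c)))) (at x)"
proof -
  have "((\<lambda>x. D b (\<nu> b) (x \<bullet> b)) has_derivative (\<lambda>v. D b (Suc (\<nu> b)) (x \<bullet> b) * (v \<bullet> b))) (at x)" if "b \<in> Basis" for b
  proof -
    have "(D b (\<nu> b) has_real_derivative D b (Suc (\<nu> b)) (x \<bullet> b)) (at (x \<bullet> b))"
      using D[OF that] unfolding smooth_chain_def by blast
    then have "(D b (\<nu> b) has_derivative (\<lambda>h. D b (Suc (\<nu> b)) (x \<bullet> b) * h)) (at (x \<bullet> b))"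
      by (simp add: has_field_derivative_def)
    moreover have "((\<lambda>x. x \<bullet> b) has_derivative (\<lambda>v. v \<bullet> b)) (at x)"
      by (auto intro!: derivative_eq_intros)
    ultimately show ?thesis by (rule has_derivative_compose[rotated])
  qed
  then have "((\<lambda>x. \<Prod>b\<in>Basis. D b (\<nu> b) (x \<bullet> b)) has_derivative
    (\<lambda>v. \<Sum>b\<in>Basis. (D b (Suc (\<nu> b)) (x \<bullet> b) * (v \<bullet> b)) * (\<Prod>c\<in>Basis - {b}. D c (\<nu> c) (x \<bullet> c)))) (at x)"
    by (rule has_derivative_prod)
  moreover have "(\<Prod>c\<in>Basis. D c (if c = b then Suc (\<nu> c) else \<nu> c) (x \<bullet> c))
      = D b (Suc (\<nu> b)) (x \<bullet> b) * (\<Prod>c\<in>Basis - {b}. D c (\<nu> c) (x \<bullet> c))" if "b \<in> Basis" for b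
    using that by (subst prod.remove[of _ b]) (auto intro!: prod.cong)
  ultimately show ?thesis by (simp add: mult_ac cong: sum.cong)
qed

lemma frechet_derivative_tensor:
  fixes D :: "'a::euclidean_space \<Rightarrow> nat \<Rightarrow> real \<Rightarrow> real"
  assumes D: "\<And>b. b \<in> Basis \<Longrightarrow> smooth_chain (D b)" and b: "b \<in> Basis"
  shows "frechet_derivative (\<lambda>x. \<Prod>b\<in>Basis. D b (\<nu> b) (x \<bullet> b)) (at x) b =
    (\<Prod>c\<in>Basis. D c (if c = b then Suc (\<nu> c) else \<nu> c) (x \<bullet> c))"
proof -
  have "frechet_derivative (\<lambda>x. \<Prod>b\<in>Basis. D b (\<nu> b) (x \<bullet> b)) (at x) =
    (\<lambda>v. \<Sum>b\<in>Basis. (v \<bullet> b) * (\<Prod>c\<in>Basis. D c (if c = b then Suc (\<nu> c) else \<nu> c) (x \<bullet> c)))"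
    using tensor_has_derivative[OF D] by (rule frechet_derivative_at[symmetric])
  then show ?thesis using b by (simp add: inner_Basis if_distrib if_distribR sum.delta' cong: if_cong)
qed

lemma iter_pd_tensor:
  fixes D :: "'a::euclidean_space \<Rightarrow> nat \<Rightarrow> real \<Rightarrow> real"
  assumes D: "\<And>b. b \<in> Basis \<Longrightarrow> smooth_chain (D b)" and "set bs \<subseteq> Basis"
  shows "iter_pd bs (\<lambda>x. \<Prod>b\<in>Basis. D b 0 (x \<bullet> b)) = (\<lambda>x. \<Prod>b\<in>Basis. D b (count_list bs b) (x \<bullet> b))"
  using assms(2)
proof (induction bs)
  case (Cons b bs)
  have "iter_pd (b # bs) (\<lambda>x. \<Prod>b\<in>Basis. D b 0 (x \<bullet> b)) = (\<lambda>x. frechet_derivative (\<lambda>x. \<Prod>b\<in>Basis. D b (count_list bs b) (x \<bullet> b)) (at x) b)"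
    using Cons by simp
  also have "\<dots> = (\<lambda>x. \<Prod>c\<in>Basis. D c (count_list (b # bs) c) (x \<bullet> c))"
    using Cons(2) by (subst frechet_derivative_tensor[OF D]) (auto intro!: ext prod.cong)
  finally show ?case .
qed simp

lemma smooth_tensor:
  fixes D :: "'a::euclidean_space \<Rightarrow> nat \<Rightarrow> real \<Rightarrow> real"
  assumes D: "\<And>b. b \<in> Basis \<Longrightarrow> smooth_chain (D b)"
  shows "smooth (\<lambda>x. \<Prod>b\<in>Basis. D b 0 (x \<bullet> b))"
  unfolding smooth_def
proof (intro allI impI)
  fix bs :: "'a list" assume bs: "set bs \<subseteq> Basis"
  have d: "iter_pd bs (\<lambda>x. \<Prod>b\<in>Basis. D b 0 (x \<bullet> b)) differentiable (at x)" for x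
    proof -
    have eq: "iter_pd bs (\<lambda>x. \<Prod>b\<in>Basis. D b 0 (x \<bullet> b)) = (\<lambda>x. \<Prod>b\<in>Basis. D b (count_list bs b) (x \<bullet> b))"
      by (rule iter_pd_tensor[OF _ bs]) (rule D)
    show ?thesis unfolding eq differentiable_def
      by (rule exI, rule tensor_has_derivative) (rule D)
  qed
  then have "continuous_on UNIV (iter_pd bs (\<lambda>x. \<Prod>b\<in>Basis. D b 0 (x \<bullet> b)))"
    by (intro continuous_at_imp_continuous_on ballI differentiable_imp_continuous_within)
  then show "(\<forall>x. iter_pd bs (\<lambda>x. \<Prod>b\<in>Basis. D b 0 (x \<bullet> b)) differentiable (at x)) \<and>
     continuous_on UNIV (iter_pd bs (\<lambda>x. \<Prod>b\<in>Basis. D b 0 (x \<bullet> b)))" using d by blast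
qed

text \<open>The derivatives \<open>d\<Phi>\<close> are carried along so that \<^const>\<open>test_fun\<close> need not be unfolded again
  after the existence proof.\<close>

definition mollifier :: "('a::euclidean_space \<Rightarrow> real) \<Rightarrow> ('a \<Rightarrow> 'a \<Rightarrow> real) \<Rightarrow> real \<Rightarrow> bool" where
  "mollifier \<Phi> d\<Phi> L \<longleftrightarrow> continuous_on UNIV \<Phi> \<and> (\<forall>u. 0 \<le> \<Phi> u) \<and> (\<forall>u. \<Phi> u \<le> 1) \<and>
    (\<forall>u. norm u \<ge> 1 \<longrightarrow> \<Phi> u = 0) \<and> (\<integral>u. \<Phi> u \<partial>lborel) > 0 \<and>
    (\<forall>b\<in>Basis. continuous_on UNIV (d\<Phi> b)) \<and> (\<forall>b\<in>Basis. \<forall>u. \<bar>d\<Phi> b u\<bar> \<le> L) \<and>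
    (\<forall>b\<in>Basis. \<forall>u. norm u \<ge> 1 \<longrightarrow> d\<Phi> b u = 0) \<and>
    (\<forall>u. (\<Phi> has_derivative (\<lambda>v. \<Sum>b\<in>Basis. (v \<bullet> b) * d\<Phi> b u)) (at u)) \<and>
    (\<forall>a k. k > 0 \<longrightarrow> test_fun (\<lambda>y. \<Phi> (k *\<^sub>R (a - y)))) \<and>
    (\<forall>b\<in>Basis. \<forall>a k y. frechet_derivative (\<lambda>y. \<Phi> (k *\<^sub>R (a - y))) (at y) b = - k * d\<Phi> b (k *\<^sub>R (a - y)))"

lemma mollifier_exists:
  obtains \<Phi> :: "'a::euclidean_space \<Rightarrow> real" and d\<Phi> L where "mollifier \<Phi> d\<Phi> L"
proof -
  obtain D where D: "smooth_chain D" "\<And>t. 0 \<le> D 0 t" "\<And>t. D 0 t \<le> 1" "D 0 0 > 0"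
    "\<And>k t. \<bar>t\<bar> \<ge> 1 \<Longrightarrow> D k t = 0" using bump_chain by blast
  define n where "n = real DIM('a)"
  have n: "n > 0" unfolding n_def by simp
  \<comment> \<open>The factor n = \<open>DIM('a)\<close> shrinks the support of each factor to half
    length 1 / n; the resulting cube lies in the unit ball because the norm is at most the sum of
    the moduli of the coordinates.\<close>
  define E where "E = (\<lambda>k t. n ^ k * D k (0 + n * t))"
  have E: "smooth_chain E" unfolding E_def by (rule smooth_chain_affine[OF D(1)])
  have E0: "E k t = 0" if "\<bar>t\<bar> \<ge> 1 / n" for k t
    using that n D(5)[of "n * t" k] by (simp add: E_def abs_mult field_simps)
  define \<Phi> where "\<Phi> = (\<lambda>u::'a. \<Prod>b\<in>Basis. E 0 (u \<bullet> b))"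
  define d\<Phi> where "d\<Phi> = (\<lambda>b u::'a. \<Prod>c\<in>Basis. E (if c = b then Suc 0 else 0) (u \<bullet> c))"
  have der: "(\<Phi> has_derivative (\<lambda>v. \<Sum>b\<in>Basis. (v \<bullet> b) * d\<Phi> b u)) (at u)" for u
    unfolding \<Phi>_def d\<Phi>_def using tensor_has_derivative[of "\<lambda>_. E" "\<lambda>_. 0" u] E by simp
  have contE: "continuous_on UNIV (E k)" for k
    using E unfolding smooth_chain_def
    by (meson DERIV_isCont continuous_at_imp_continuous_on)
  have cont: "continuous_on UNIV \<Phi>"
    using der by (meson continuous_at_imp_continuous_on has_derivative_continuous)
  have contd: "continuous_on UNIV (d\<Phi> b)" for b
    unfolding d\<Phi>_def by (intro continuous_intros continuous_on_compose2[OF contE]) auto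
  have big: "\<exists>b\<in>Basis. \<bar>u \<bullet> b\<bar> \<ge> 1 / n" if "norm u \<ge> 1" for u :: 'a
  proof (rule ccontr)
    assume "\<not> ?thesis"
    then have "(\<Sum>b\<in>Basis. \<bar>u \<bullet> b\<bar>) < (\<Sum>b\<in>(Basis::'a set). 1 / n)"
      by (intro sum_strict_mono) auto
    also have "\<dots> = 1" using n unfolding n_def by simp
    finally show False using norm_le_l1[of u] that by linarith
  qed
  have sup: "\<Phi> u = 0" "d\<Phi> b u = 0" if "norm u \<ge> 1" for u b
  proof -
    obtain c where c: "c \<in> Basis" "\<bar>u \<bullet> c\<bar> \<ge> 1 / n" using big \<open>norm u \<ge> 1\<close> by blast
    show "\<Phi> u = 0" "d\<Phi> b u = 0" unfolding \<Phi>_def d\<Phi>_def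
      using c by (intro prod_zero bexI[of _ c] E0; simp)+
  qed
  have \<Phi>01: "0 \<le> \<Phi> u" "\<Phi> u \<le> 1" for u
    unfolding \<Phi>_def E_def using D by (auto intro!: prod_nonneg prod_le_1)
  have "\<exists>L. \<forall>b\<in>Basis. \<forall>u. \<bar>d\<Phi> b u\<bar> \<le> L"
  proof -
    have "\<exists>L. \<forall>u. \<bar>d\<Phi> b u\<bar> \<le> L" for b
    proof -
      have "compact (d\<Phi> b ` cball 0 1)"
        by (rule compact_continuous_image[OF continuous_on_subset[OF contd]]) auto
      then obtain L where "\<forall>y\<in>d\<Phi> b ` cball 0 1. norm y \<le> L"
        using compact_imp_bounded bounded_iff by metis
      then have "\<bar>d\<Phi> b u\<bar> \<le> max L 0" for u
        using sup(2)[of u b] by (cases "norm u \<le> 1") (auto simp: le_max_iff_disj)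
      then show ?thesis by blast
    qed
    then obtain L where L: "\<And>b u. \<bar>d\<Phi> b u\<bar> \<le> L b" by metis
    have "\<bar>d\<Phi> b u\<bar> \<le> (\<Sum>b\<in>Basis. L b)" if "b \<in> Basis" for b u
    proof -
      have "0 \<le> L c" for c using L[of c 0] abs_ge_zero order_trans by blast
      then have "L b \<le> (\<Sum>b\<in>Basis. L b)" using that by (intro member_le_sum) auto
      then show ?thesis using L[of b u] by simp
    qed
    then show ?thesis by blast
  qed
  then obtain L where L: "\<And>b u. b \<in> Basis \<Longrightarrow> \<bar>d\<Phi> b u\<bar> \<le> L" by blast
  have int: "integrable lborel \<Phi>"
  proof (rule integrableI_bounded_set[where A = "ball 0 1" and B = 1])
    show "AE x in lborel. x \<in> ball 0 1 \<longrightarrow> norm (\<Phi> x) \<le> 1" "AE x in lborel. x \<notin> ball 0 1 \<longrightarrow> \<Phi> x = 0"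
      using \<Phi>01 sup(1) by auto
    show "emeasure lborel (ball (0::'a) 1) < \<infinity>" by (rule emeasure_lborel_ball_finite)
  qed (use cont in \<open>auto intro: borel_measurable_continuous_onI\<close>)
  have pos: "(\<integral>u. \<Phi> u \<partial>lborel) > 0"
  proof -
    have "\<Phi> 0 > 0" unfolding \<Phi>_def E_def using D(4) by (simp add: prod_pos)
    moreover have "isCont \<Phi> 0" using cont by (simp add: continuous_on_eq_continuous_at)
    ultimately have "eventually (\<lambda>u. \<Phi> u > \<Phi> 0 / 2) (nhds 0)"
      unfolding isCont_def by (intro order_tendstoD(1)[of _ "\<Phi> 0"]) (auto simp: tendsto_at_iff_tendsto_nhds)
    then obtain d where d: "d > 0" "\<And>u. dist u 0 < d \<Longrightarrow> \<Phi> u > \<Phi> 0 / 2" unfolding eventually_nhds_metric by blast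
    have "0 < \<Phi> 0 / 2 * measure lborel (ball (0::'a) d)"
      using \<open>\<Phi> 0 > 0\<close> d content_ball_pos[of d "0::'a"] by simp
    also have "\<dots> = (\<integral>u. \<Phi> 0 / 2 * indicator (ball (0::'a) d) u \<partial>lborel)" by simp
    also have "\<dots> \<le> (\<integral>u. \<Phi> u \<partial>lborel)"
    proof (rule integral_mono[OF _ int])
      show "integrable lborel (\<lambda>u. \<Phi> 0 / 2 * indicator (ball (0::'a) d) u)"
        using emeasure_lborel_ball_finite[of "0::'a" d] by auto
    qed (use d \<Phi>01 in \<open>auto simp: indicator_def dist_norm intro: less_imp_le\<close>)
    finally show ?thesis .
  qed
  have tf: "test_fun (\<lambda>y. \<Phi> (k *\<^sub>R (a - y)))" if k: "k > 0" for a k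
  proof -
    \<comment> \<open>Reflection, dilation and translation act on each coordinate separately, so the
      tensor structure survives.\<close>
    define F where "F = (\<lambda>(b::'a) j t. (- k) ^ j * E j (k * (a \<bullet> b) + (- k) * t))"
    have "smooth (\<lambda>x. \<Prod>b\<in>Basis. F b 0 (x \<bullet> b))"
      unfolding F_def by (intro smooth_tensor smooth_chain_affine E)
    moreover have "(\<lambda>x. \<Prod>b\<in>Basis. F b 0 (x \<bullet> b)) = (\<lambda>y. \<Phi> (k *\<^sub>R (a - y)))"
      unfolding F_def \<Phi>_def by (auto intro!: ext prod.cong simp: algebra_simps)
    moreover have "compact (closure {y. \<Phi> (k *\<^sub>R (a - y)) \<noteq> 0})"
    proof -
      have "{y. \<Phi> (k *\<^sub>R (a - y)) \<noteq> 0} \<subseteq> cball a (1 / k)"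
      proof
        fix y assume "y \<in> {y. \<Phi> (k *\<^sub>R (a - y)) \<noteq> 0}"
        then have "\<not> norm (k *\<^sub>R (a - y)) \<ge> 1" using sup(1) by auto
        then have "k * norm (a - y) < 1" using k by (simp only: norm_scaleR abs_of_pos not_le)
        then show "y \<in> cball a (1 / k)" using k by (simp add: dist_norm field_simps)
      qed
      then have "bounded {y. \<Phi> (k *\<^sub>R (a - y)) \<noteq> 0}" using bounded_cball bounded_subset by blast
      then show ?thesis by (simp add: compact_closure)
    qed
    ultimately show ?thesis unfolding test_fun_def by simp
  qed
  have fd: "frechet_derivative (\<lambda>y. \<Phi> (k *\<^sub>R (a - y))) (at y) b = - k * d\<Phi> b (k *\<^sub>R (a - y))" if b: "b \<in> Basis" for a k b y
  proof -
    have "((\<lambda>y. k *\<^sub>R (a - y)) has_derivative (\<lambda>v. - (k *\<^sub>R v))) (at y)" by (auto intro!: derivative_eq_intros)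
    from has_derivative_compose[OF this der]
    have "((\<lambda>y. \<Phi> (k *\<^sub>R (a - y))) has_derivative (\<lambda>v. \<Sum>c\<in>Basis. (- (k *\<^sub>R v) \<bullet> c) * d\<Phi> c (k *\<^sub>R (a - y)))) (at y)" .
    then have "frechet_derivative (\<lambda>y. \<Phi> (k *\<^sub>R (a - y))) (at y) = (\<lambda>v. \<Sum>c\<in>Basis. (- (k *\<^sub>R v) \<bullet> c) * d\<Phi> c (k *\<^sub>R (a - y)))"
      by (rule frechet_derivative_at[symmetric])
    then show ?thesis using b by (simp add: inner_Basis if_distrib if_distribR sum.delta' cong: if_cong)
  qed
  have "mollifier \<Phi> d\<Phi> L" unfolding mollifier_def
    using cont \<Phi>01 sup(1) pos contd L sup(2) der tf fd by simp
  then show thesis using that by blast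
qed

section \<open>The maximal operator\<close>

lemma ball_borel [measurable]: "ball (c::'a::euclidean_space) r \<in> sets borel"
  by simp

abbreviation unit_vol :: "'a::euclidean_space itself \<Rightarrow> real" where
  "unit_vol _ \<equiv> measure lborel (ball (0::'a) 1)"

lemma unit_vol_pos: "unit_vol TYPE('a::euclidean_space) > 0"
  by (rule content_ball_pos) simp

lemma emeasure_lborel_ball:
  fixes c :: "'a::euclidean_space"
  assumes "r \<ge> 0"
  shows "emeasure lborel (ball c r) = ennreal (unit_vol TYPE('a) * r ^ DIM('a))"
  using emeasure_lborel_ball_finite[of c r] content_ball_conv_unit_ball[OF assms, of c]
  by (subst emeasure_eq_ennreal_measure) (auto simp: mult.commute)

lemma maximal_ge:
  fixes f :: "'a::euclidean_space \<Rightarrow> ennreal"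
  assumes "r > 0" "x \<in> ball c r"
  shows "(\<integral>\<^sup>+ y \<in> ball c r. f y \<partial>lborel) \<le> maximal f x * ennreal (unit_vol TYPE('a) * r ^ DIM('a))"
proof -
  define b where "b = unit_vol TYPE('a) * r ^ DIM('a)"
  have b: "b > 0" "emeasure lborel (ball c r) = ennreal b"
    unfolding b_def using assms unit_vol_pos[where 'a='a] by (auto simp: emeasure_lborel_ball)
  have "(\<integral>\<^sup>+ y \<in> ball c r. f y \<partial>lebesgue) / emeasure lebesgue (ball c r) \<le> maximal f x"
    unfolding maximal_def by (rule SUP_upper) (use assms in blast)
  then have "(\<integral>\<^sup>+ y \<in> ball c r. f y \<partial>lborel) / ennreal b \<le> maximal f x" using b by (simp add: nn_integral_completion)
  then have "(\<integral>\<^sup>+ y \<in> ball c r. f y \<partial>lborel) / ennreal b * ennreal b \<le> maximal f x * ennreal b"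
    by (rule mult_right_mono) simp
  then show ?thesis using b unfolding b_def[symmetric]
    by (simp add: ennreal_divide_times)
qed

lemma maximal_leI:
  fixes f :: "'a::euclidean_space \<Rightarrow> ennreal"
  assumes "\<And>c r. r > 0 \<Longrightarrow> x \<in> ball c r \<Longrightarrow> (\<integral>\<^sup>+ y \<in> ball c r. f y \<partial>lborel) \<le> K * ennreal (unit_vol TYPE('a) * r ^ DIM('a))"
  shows "maximal f x \<le> K"
  unfolding maximal_def
proof (rule SUP_least)
  fix B assume "B \<in> {ball c r |c r. 0 < r \<and> x \<in> ball c r}"
  then obtain c r where r: "B = ball c r" "r > 0" "x \<in> ball c r" by auto
  define b where "b = unit_vol TYPE('a) * r ^ DIM('a)"
  have b: "b > 0" "emeasure lborel (ball c r) = ennreal b"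
    unfolding b_def using r unit_vol_pos[where 'a='a] by (auto simp: emeasure_lborel_ball)
  have "(\<integral>\<^sup>+ y \<in> B. f y \<partial>lborel) / ennreal b \<le> K * ennreal b / ennreal b"
    unfolding r using assms[OF r(2,3)] unfolding b_def by (rule divide_right_mono_ennreal)
  also have "\<dots> = K" using b by (subst ennreal_times_divide[symmetric]) simp
  finally show "(\<integral>\<^sup>+ y \<in> B. f y \<partial>lebesgue) / emeasure lebesgue B \<le> K" using b r by (simp add: nn_integral_completion)
qed

text \<open>The balls are not centred at x: one that witnesses a large average at x does so at all
  of its points.\<close>

lemma open_maximal: "open {x. a < maximal f x}"
proof -
  define Q where "Q = (\<lambda>B. (\<integral>\<^sup>+ y \<in> B. f y \<partial>lebesgue) / emeasure lebesgue B)"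
  have iff: "a < maximal f x \<longleftrightarrow> (\<exists>c r. 0 < r \<and> x \<in> ball c r \<and> a < Q (ball c r))" for x
    unfolding maximal_def less_SUP_iff Q_def[symmetric] by blast
  show ?thesis unfolding open_contains_ball
  proof safe
    fix x assume "a < maximal f x"
    then obtain c r where r: "0 < r" "x \<in> ball c r" "a < Q (ball c r)" unfolding iff by blast
    obtain e where e: "e > 0" "ball x e \<subseteq> ball c r" using r(2) open_contains_ball[of "ball c r"] open_ball by metis
    have "ball x e \<subseteq> {x. a < maximal f x}" unfolding iff using e r by blast
    then show "\<exists>e>0. ball x e \<subseteq> {x. a < maximal f x}" using e by blast
  qed
qed

lemma measurable_maximal [measurable]: "maximal f \<in> borel_measurable borel"
  by (rule borel_measurableI_greater) (simp add: borel_open open_maximal)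

section \<open>Weighted inequalities for the maximal operator\<close>

lemma maximal_add:
  assumes [measurable]: "f \<in> borel_measurable borel" "g \<in> borel_measurable borel"
  shows "maximal (\<lambda>x. f x + g x) x \<le> maximal f x + maximal g x"
proof (rule maximal_leI)
  fix c :: 'a and r :: real assume r: "r > 0" "x \<in> ball c r"
  have "(\<integral>\<^sup>+ y \<in> ball c r. f y + g y \<partial>lborel) = (\<integral>\<^sup>+ y. f y * indicator (ball c r) y + g y * indicator (ball c r) y \<partial>lborel)"
    by (simp add: distrib_right)
  also have "\<dots> = (\<integral>\<^sup>+ y \<in> ball c r. f y \<partial>lborel) + (\<integral>\<^sup>+ y \<in> ball c r. g y \<partial>lborel)"
    by (rule nn_integral_add) auto
  also have "\<dots> \<le> (maximal f x + maximal g x) * ennreal (unit_vol TYPE('a) * r ^ DIM('a))"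
    unfolding distrib_right by (intro add_mono maximal_ge r)
  finally show "(\<integral>\<^sup>+ y \<in> ball c r. f y + g y \<partial>lborel) \<le> (maximal f x + maximal g x) * ennreal (unit_vol TYPE('a) * r ^ DIM('a))" .
qed

lemma maximal_mono: "(\<And>x. f x \<le> g x) \<Longrightarrow> maximal f x \<le> maximal g x"
  unfolding maximal_def
  by (intro SUP_subset_mono order_refl divide_right_mono_ennreal nn_integral_mono mult_right_mono) auto

lemma maximal_const: "maximal (\<lambda>_. c) (x::'a::euclidean_space) \<le> c"
proof (rule maximal_leI)
  fix z :: 'a and r :: real assume r: "r > 0" "x \<in> ball z r"
  have "(\<integral>\<^sup>+ y \<in> ball z r. c \<partial>lborel) = c * emeasure lborel (ball z r)"
    by (rule nn_integral_cmult_indicator) simp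
  then show "(\<integral>\<^sup>+ y \<in> ball z r. c \<partial>lborel) \<le> c * ennreal (unit_vol TYPE('a) * r ^ DIM('a))"
    using r by (simp add: emeasure_lborel_ball)
qed

text \<open>The weight reappears as its maximal function because the fivefold balls of Vitali's
  covering lemma contain every point of the original ones, so the average of w over them is at most
  M w there. The case w = 1 is the usual weak type bound and serves for Lebesgue
  differentiation.\<close>

lemma maximal_weak_type:
  fixes f w :: "'a::euclidean_space \<Rightarrow> ennreal"
  assumes [measurable]: "f \<in> borel_measurable borel" "w \<in> borel_measurable borel"
  shows "t * (\<integral>\<^sup>+ x \<in> {x. t < maximal f x}. w x \<partial>lborel) \<le> 5 ^ DIM('a) * (\<integral>\<^sup>+ x. f x * maximal w x \<partial>lborel)"
    (is "_ \<le> ?R")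
proof -
  define v where "v = unit_vol TYPE('a)"
  have v: "v > 0" unfolding v_def by (rule unit_vol_pos)
  define P where "P = {(c::'a, r). r > 0 \<and> t * ennreal (v * r ^ DIM('a)) \<le> (\<integral>\<^sup>+ y \<in> ball c r. f y \<partial>lborel)}"
  define U where "U = {x. t < maximal f x}"
  have UP: "U \<subseteq> (\<Union>p\<in>P. ball (fst p) (snd p))"
  proof
    fix x assume "x \<in> U"
    then obtain c r where r: "r > 0" "x \<in> ball c r" "t < (\<integral>\<^sup>+ y \<in> ball c r. f y \<partial>lebesgue) / emeasure lebesgue (ball c r)"
      unfolding U_def maximal_def less_SUP_iff by auto
    define b where "b = v * r ^ DIM('a)"
    have b: "b > 0" "emeasure lborel (ball c r) = ennreal b"
      unfolding b_def v_def using r unit_vol_pos[where 'a='a] by (auto simp: emeasure_lborel_ball)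
    have "t * ennreal b \<le> (\<integral>\<^sup>+ y \<in> ball c r. f y \<partial>lborel) / ennreal b * ennreal b"
      using r(3) b by (intro mult_right_mono) (auto simp: nn_integral_completion)
    also have "\<dots> = (\<integral>\<^sup>+ y \<in> ball c r. f y \<partial>lborel)" using b by (simp add: ennreal_divide_times)
    finally have "(c, r) \<in> P" unfolding P_def b_def using r by auto
    then show "x \<in> (\<Union>p\<in>P. ball (fst p) (snd p))" using r by force
  qed
  have one: "t * (\<integral>\<^sup>+ x \<in> ball c (5 * r). w x \<partial>lborel) \<le> 5 ^ DIM('a) * (\<integral>\<^sup>+ x \<in> ball c r. f x * maximal w x \<partial>lborel)"
    if "(c, r) \<in> P" for c r
  proof -
    define b where "b = v * r ^ DIM('a)"
    define W where "W = (\<integral>\<^sup>+ x \<in> ball c (5 * r). w x \<partial>lborel)"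
    have r: "r > 0" and tb: "t * ennreal b \<le> (\<integral>\<^sup>+ y \<in> ball c r. f y \<partial>lborel)" using that unfolding P_def b_def by auto
    have b: "b > 0" unfolding b_def using r v by simp
    have Wle: "W \<le> maximal w z * (5 ^ DIM('a) * ennreal b)" if "z \<in> ball c r" for z
    proof -
      have "W \<le> maximal w z * ennreal (v * (5 * r) ^ DIM('a))"
        unfolding W_def v_def using r that by (intro maximal_ge) auto
      also have "ennreal (v * (5 * r) ^ DIM('a)) = 5 ^ DIM('a) * ennreal b"
        unfolding b_def using v r by (simp add: power_mult_distrib ennreal_mult ennreal_power[symmetric] mult_ac)
      finally show ?thesis .
    qed
    have "ennreal b * (t * W) = t * ennreal b * W" by (simp add: mult_ac)
    also have "\<dots> \<le> (\<integral>\<^sup>+ y \<in> ball c r. f y \<partial>lborel) * W" using tb by (rule mult_right_mono) simp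
    also have "\<dots> = (\<integral>\<^sup>+ y. f y * indicator (ball c r) y * W \<partial>lborel)" by (rule nn_integral_multc[symmetric]) auto
    also have "\<dots> \<le> (\<integral>\<^sup>+ y. ennreal b * (5 ^ DIM('a) * (f y * maximal w y * indicator (ball c r) y)) \<partial>lborel)"
    proof (rule nn_integral_mono)
      fix y
      show "f y * indicator (ball c r) y * W \<le> ennreal b * (5 ^ DIM('a) * (f y * maximal w y * indicator (ball c r) y))"
      proof (cases "y \<in> ball c r")
        case True
        then have "f y * W \<le> f y * (maximal w y * (5 ^ DIM('a) * ennreal b))" by (intro mult_left_mono Wle) auto
        then show ?thesis using True by (simp add: mult_ac)
      qed simp
    qed
    also have "\<dots> = ennreal b * (5 ^ DIM('a) * (\<integral>\<^sup>+ x \<in> ball c r. f x * maximal w x \<partial>lborel))"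
      by (subst nn_integral_cmult, measurable, subst nn_integral_cmult) auto
    finally show ?thesis using b unfolding W_def[symmetric] by (subst (asm) ennreal_mult_le_mult_iff) auto
  qed
  \<comment> \<open>On a compact subset finitely many balls suffice, so that the radii are bounded,
    as Vitali's lemma requires; the open set U is then exhausted by compact sets.\<close>
  have comp: "t * (\<integral>\<^sup>+ x \<in> K. w x \<partial>lborel) \<le> ?R" if K: "compact K" "K \<subseteq> U" for K
  proof -
    obtain P' where P': "P' \<subseteq> P" "finite P'" "K \<subseteq> (\<Union>p\<in>P'. ball (fst p) (snd p))"
    proof (rule compactE_image[OF K(1), of P "\<lambda>p. ball (fst p) (snd p)"])
      show "K \<subseteq> (\<Union>p\<in>P. ball (fst p) (snd p))" using K(2) UP by (rule subset_trans)
    qed (auto simp: that)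
    obtain B where B: "\<And>p. p \<in> P' \<Longrightarrow> snd p \<le> B"
      using bdd_above_finite[OF finite_imageI[OF P'(2)], of snd] unfolding bdd_above_def by auto
    obtain C where C: "C \<subseteq> P'" "pairwise (\<lambda>i j. disjnt (ball (fst i) (snd i)) (ball (fst j) (snd j))) C"
      "K \<subseteq> (\<Union>p\<in>C. ball (fst p) (5 * snd p))"
    proof (rule Vitali_covering_lemma_balls[OF P'(3), of B])
      show "0 < snd p \<and> snd p \<le> B" if "p \<in> P'" for p
        using that B P'(1) unfolding P_def by auto
    qed (erule that)
    have fin: "finite C" using C P' finite_subset by blast
    have "(\<integral>\<^sup>+ x \<in> K. w x \<partial>lborel) \<le> (\<integral>\<^sup>+ x. (\<Sum>p\<in>C. w x * indicator (ball (fst p) (5 * snd p)) x) \<partial>lborel)"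
    proof (rule nn_integral_mono)
      fix x
      show "w x * indicator K x \<le> (\<Sum>p\<in>C. w x * indicator (ball (fst p) (5 * snd p)) x)"
      proof (cases "x \<in> K")
        case True
        then obtain p where p: "p \<in> C" "x \<in> ball (fst p) (5 * snd p)" using C by auto
        then have "w x * indicator K x = w x * indicator (ball (fst p) (5 * snd p)) x" using True by simp
        also have "\<dots> \<le> (\<Sum>p\<in>C. w x * indicator (ball (fst p) (5 * snd p)) x)"
          using p fin by (intro member_le_sum) auto
        finally show ?thesis .
      qed simp
    qed
    also have "\<dots> = (\<Sum>p\<in>C. (\<integral>\<^sup>+ x \<in> ball (fst p) (5 * snd p). w x \<partial>lborel))"
      by (rule nn_integral_sum) auto
    finally have "t * (\<integral>\<^sup>+ x \<in> K. w x \<partial>lborel) \<le> (\<Sum>p\<in>C. t * (\<integral>\<^sup>+ x \<in> ball (fst p) (5 * snd p). w x \<partial>lborel))"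
      unfolding sum_distrib_left[symmetric] by (rule mult_left_mono) simp
    also have "\<dots> \<le> (\<Sum>p\<in>C. 5 ^ DIM('a) * (\<integral>\<^sup>+ x \<in> ball (fst p) (snd p). f x * maximal w x \<partial>lborel))"
      using C P' by (intro sum_mono one) auto
    also have "\<dots> = 5 ^ DIM('a) * (\<integral>\<^sup>+ x. (\<Sum>p\<in>C. f x * maximal w x * indicator (ball (fst p) (snd p)) x) \<partial>lborel)"
      by (subst sum_distrib_left[symmetric], subst nn_integral_sum) auto
    also have "\<dots> \<le> ?R"
    proof (intro mult_left_mono nn_integral_mono)
      fix x
      have "(\<Sum>p\<in>C. indicator (ball (fst p) (snd p)) x :: ennreal) = indicator (\<Union>p\<in>C. ball (fst p) (snd p)) x"
        using C(2) fin by (intro indicator_UN_disjoint[symmetric]) (auto simp: disjoint_family_on_def pairwise_def disjnt_def)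
      also have "\<dots> \<le> 1" by (auto simp: indicator_def)
      finally have "f x * maximal w x * (\<Sum>p\<in>C. indicator (ball (fst p) (snd p)) x) \<le> f x * maximal w x * 1"
        by (rule mult_left_mono) simp
      then show "(\<Sum>p\<in>C. f x * maximal w x * indicator (ball (fst p) (snd p)) x) \<le> f x * maximal w x"
        by (simp add: sum_distrib_left)
    qed simp
    finally show ?thesis .
  qed
  obtain C where C: "\<And>n. compact (C n)" "\<And>n. C n \<subseteq> U" "\<And>n. C n \<subseteq> interior (C (Suc n))" "\<Union>(range C) = U"
    using open_Union_compact_subsets[of U] open_maximal unfolding U_def by metis
  have inc: "incseq C" using C(3) interior_subset by (intro incseq_SucI) blast
  have [measurable]: "C n \<in> sets borel" for n using C(1) by (rule borel_compact)
  have "(\<integral>\<^sup>+ x \<in> U. w x \<partial>lborel) = (\<integral>\<^sup>+ x. (SUP n. w x * indicator (C n) x) \<partial>lborel)"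
  proof (rule nn_integral_cong)
    fix x
    show "w x * indicator U x = (SUP n. w x * indicator (C n) x)"
    proof (rule antisym)
      show "(SUP n. w x * indicator (C n) x) \<le> w x * indicator U x"
        using C(2) by (intro SUP_least mult_left_mono) (auto simp: indicator_def)
      show "w x * indicator U x \<le> (SUP n. w x * indicator (C n) x)"
      proof (cases "x \<in> U")
        case True
        then obtain n where "x \<in> C n" using C(4) by blast
        then show ?thesis using True by (intro SUP_upper2[of n]) auto
      qed simp
    qed
  qed
  also have "\<dots> = (SUP n. (\<integral>\<^sup>+ x \<in> C n. w x \<partial>lborel))"
    using inc by (intro nn_integral_monotone_convergence_SUP) (auto simp: incseq_def le_fun_def indicator_def)
  finally have "t * (\<integral>\<^sup>+ x \<in> U. w x \<partial>lborel) = (SUP n. t * (\<integral>\<^sup>+ x \<in> C n. w x \<partial>lborel))"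
    by (simp add: SUP_mult_left_ennreal)
  also have "\<dots> \<le> ?R" by (intro SUP_least comp C)
  finally show ?thesis unfolding U_def .
qed

text \<open>Layer cake formula for the power q; infinite z is included because maximal functions may
  be infinite.\<close>

lemma nn_integral_powr_below:
  assumes q: "q > 0"
  shows "(\<integral>\<^sup>+ s. ennreal (s powr (q - 1)) * indicator {s. 0 < s \<and> ennreal s < z} s \<partial>lborel) = ennreal (1 / q) * epowr z q"
proof -
  have fin: "(\<integral>\<^sup>+ s. ennreal (s powr (q - 1)) * indicator {0<..<T} s \<partial>lborel) = ennreal (T powr q / q)" if T: "T \<ge> 0" for T
  proof -
    have "((\<lambda>s. s powr (q - 1)) has_integral (T powr q / q)) {0..T}"
      using has_integral_powr_from_0[of "q - 1" T] q T by simp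
    then have "((\<lambda>s. if s \<in> {0..T} then s powr (q - 1) else 0) has_integral (T powr q / q)) UNIV"
      by (subst has_integral_restrict_UNIV)
    then have "(\<integral>\<^sup>+ s. ennreal (if s \<in> {0..T} then s powr (q - 1) else 0) \<partial>lborel) = ennreal (T powr q / q)"
      by (intro nn_integral_has_integral_lborel) auto
    also have "(\<integral>\<^sup>+ s. ennreal (if s \<in> {0..T} then s powr (q - 1) else 0) \<partial>lborel) = (\<integral>\<^sup>+ s. ennreal (s powr (q - 1)) * indicator {0<..<T} s \<partial>lborel)"
      using AE_lborel_singleton[of 0] AE_lborel_singleton[of T]
      by (intro nn_integral_cong_AE) (auto elim!: eventually_mono eventually_elim2 simp: indicator_def)
    finally show ?thesis .
  qed
  show ?thesis
  proof (cases z)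
    case (real T)
    have "{s. 0 < s \<and> ennreal s < z} = {0<..<T}" using real by (auto simp: ennreal_less_iff)
    then show ?thesis using fin[of T] real q by (simp add: ennreal_mult[symmetric])
  next
    case top
    have "(\<integral>\<^sup>+ s. ennreal (s powr (q - 1)) * indicator {s. 0 < s \<and> ennreal s < z} s \<partial>lborel) = top"
    proof -
      have "ennreal x \<le> (\<integral>\<^sup>+ s. ennreal (s powr (q - 1)) * indicator {s. 0 < s \<and> ennreal s < z} s \<partial>lborel)" if "x > 0" for x
      proof -
        \<comment> \<open>The upper limit (q x) powr (1 / q) is the one whose integral equals
          x.\<close>
        have "ennreal x = ennreal (((q * x) powr (1 / q)) powr q / q)" using that q by (simp add: powr_powr)
        also have "\<dots> = (\<integral>\<^sup>+ s. ennreal (s powr (q - 1)) * indicator {0<..<(q * x) powr (1 / q)} s \<partial>lborel)"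
          by (rule fin[symmetric]) simp
        also have "\<dots> \<le> (\<integral>\<^sup>+ s. ennreal (s powr (q - 1)) * indicator {s. 0 < s \<and> ennreal s < z} s \<partial>lborel)"
          using top by (intro nn_integral_mono mult_left_mono) (auto simp: indicator_def less_top)
        finally show ?thesis .
      qed
      from this[of "enn2real (\<integral>\<^sup>+ s. ennreal (s powr (q - 1)) * indicator {s. 0 < s \<and> ennreal s < z} s \<partial>lborel) + 1"]
      show ?thesis
        by (cases "\<integral>\<^sup>+ s. ennreal (s powr (q - 1)) * indicator {s. 0 < s \<and> ennreal s < z} s \<partial>lborel") auto
    qed
    then show ?thesis using top q by (simp add: ennreal_mult_top)
  qed
qed

text \<open>Marcinkiewicz interpolation by hand between the weak type bound and the trivial bound at
  infinity: at level s only the part of f above s / 2 counts. Integrating over s produces the factor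
  1 / (p - 1), which is why p = 1 is excluded.\<close>

theorem Fefferman_Stein:
  fixes f w :: "'a::euclidean_space \<Rightarrow> ennreal"
  assumes p: "p > 1" and [measurable]: "f \<in> borel_measurable borel" "w \<in> borel_measurable borel"
  shows "(\<integral>\<^sup>+ x. epowr (maximal f x) p * w x \<partial>lborel)
    \<le> ennreal (p / (p - 1) * 2 powr p * 5 ^ DIM('a)) * (\<integral>\<^sup>+ x. epowr (f x) p * maximal w x \<partial>lborel)"
proof -
  define K :: real where "K = 2 * 5 ^ DIM('a::euclidean_space)"
  have weak: "ennreal s * (\<integral>\<^sup>+ x \<in> {x. ennreal s < maximal f x}. w x \<partial>lborel)
      \<le> ennreal K * (\<integral>\<^sup>+ x \<in> {x. ennreal s < 2 * f x}. f x * maximal w x \<partial>lborel)" if s: "s > 0" for s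
  proof -
    define g where "g = (\<lambda>x. f x * indicator {x. ennreal s < 2 * f x} x)"
    have [measurable]: "g \<in> borel_measurable borel" unfolding g_def by measurable
    have half: "ennreal s = ennreal (s/2) + ennreal (s/2)" using s by (simp flip: ennreal_plus)
    have fg: "f x \<le> g x + ennreal (s/2)" for x
    proof (cases "ennreal s < 2 * f x")
      case False
      then have "2 * f x \<le> 2 * ennreal (s/2)" using half by (simp add: mult_2)
      then have "f x \<le> ennreal (s/2)" by (subst (asm) ennreal_mult_le_mult_iff) auto
      then show ?thesis by (simp add: add_increasing)
    qed (simp add: g_def)
    have "maximal f x \<le> maximal g x + ennreal (s/2)" for x
    proof -
      have "maximal f x \<le> maximal (\<lambda>x. g x + ennreal (s/2)) x" by (rule maximal_mono[OF fg])
      also have "\<dots> \<le> maximal g x + maximal (\<lambda>_. ennreal (s/2)) x" by (rule maximal_add) auto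
      also have "\<dots> \<le> maximal g x + ennreal (s/2)" by (intro add_left_mono maximal_const)
      finally show ?thesis .
    qed
    then have sub: "ennreal (s/2) < maximal g x" if "ennreal s < maximal f x" for x
      using that unfolding half by (meson add_right_mono leD le_less_trans not_le order_trans)
    have "ennreal s * (\<integral>\<^sup>+ x \<in> {x. ennreal s < maximal f x}. w x \<partial>lborel)
       \<le> ennreal s * (\<integral>\<^sup>+ x \<in> {x. ennreal (s/2) < maximal g x}. w x \<partial>lborel)"
      using sub by (intro mult_left_mono nn_integral_mono) (auto simp: indicator_def)
    also have "\<dots> = 2 * (ennreal (s/2) * (\<integral>\<^sup>+ x \<in> {x. ennreal (s/2) < maximal g x}. w x \<partial>lborel))"
      unfolding half by (simp add: mult_2 distrib_right)
    also have "\<dots> \<le> 2 * (5 ^ DIM('a) * (\<integral>\<^sup>+ x. g x * maximal w x \<partial>lborel))"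
      by (intro mult_left_mono maximal_weak_type) auto
    also have "\<dots> = ennreal K * (\<integral>\<^sup>+ x. g x * maximal w x \<partial>lborel)"
      unfolding K_def by (simp add: ennreal_mult ennreal_power[symmetric] mult.assoc)
    also have "(\<lambda>x. g x * maximal w x) = (\<lambda>x. f x * maximal w x * indicator {x. ennreal s < 2 * f x} x)"
      unfolding g_def by (simp add: mult_ac)
    finally show ?thesis .
  qed
  \<comment> \<open>One power of s is spent on the weak type bound; the remaining s powr (p - 2) is
    integrable at 0 precisely for p > 1.\<close>
  have weak': "ennreal (s powr (p - 1)) * (\<integral>\<^sup>+ x \<in> {x. ennreal s < maximal f x}. w x \<partial>lborel)
      \<le> ennreal K * (ennreal (s powr (p - 1 - 1)) * (\<integral>\<^sup>+ x \<in> {x. ennreal s < 2 * f x}. f x * maximal w x \<partial>lborel))"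
    if s: "s > 0" for s
  proof -
    have eq: "ennreal (s powr (p - 1)) = ennreal (s powr (p - 1 - 1)) * ennreal s"
      using s by (simp flip: ennreal_mult add: powr_mult_base mult.commute[of _ s])
    show ?thesis unfolding eq mult.assoc
      using mult_left_mono[OF weak[OF s], of "ennreal (s powr (p - 1 - 1))"] by (simp add: mult_ac)
  qed
  have layer1: "(\<integral>\<^sup>+ s. ennreal (s powr (p - 1)) * indicator {s. 0 < s \<and> ennreal s < z} s \<partial>lborel) = ennreal (1 / p) * epowr z p" for z
    using p by (intro nn_integral_powr_below) auto
  have layer2: "(\<integral>\<^sup>+ s. ennreal (s powr (p - 1 - 1)) * indicator {s. 0 < s \<and> ennreal s < z} s \<partial>lborel) = ennreal (1 / (p - 1)) * epowr z (p - 1)" for z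
    using p by (intro nn_integral_powr_below) auto
  have "ennreal (1 / p) * (\<integral>\<^sup>+ x. epowr (maximal f x) p * w x \<partial>lborel) = (\<integral>\<^sup>+ x. (ennreal (1 / p) * epowr (maximal f x) p) * w x \<partial>lborel)"
    by (subst nn_integral_cmult[symmetric]) (auto simp: mult.assoc)
  also have "\<dots> = (\<integral>\<^sup>+ x. (\<integral>\<^sup>+ s. ennreal (s powr (p - 1)) * indicator {s. 0 < s \<and> ennreal s < maximal f x} s * w x \<partial>lborel) \<partial>lborel)"
    unfolding layer1[symmetric] by (intro nn_integral_cong nn_integral_multc[symmetric]) auto
  also have "\<dots> = (\<integral>\<^sup>+ s. (\<integral>\<^sup>+ x. ennreal (s powr (p - 1)) * indicator {s. 0 < s \<and> ennreal s < maximal f x} s * w x \<partial>lborel) \<partial>lborel)"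
    by (rule lborel_pair.Fubini'[symmetric]) (simp add: indicator_def, measurable)
  also have "\<dots> \<le> (\<integral>\<^sup>+ s. ennreal K * (\<integral>\<^sup>+ x. ennreal (s powr (p - 1 - 1)) * indicator {s. 0 < s \<and> ennreal s < 2 * f x} s * (f x * maximal w x) \<partial>lborel) \<partial>lborel)"
  proof (rule nn_integral_mono)
    fix s :: real
    show "(\<integral>\<^sup>+ x. ennreal (s powr (p - 1)) * indicator {s. 0 < s \<and> ennreal s < maximal f x} s * w x \<partial>lborel)
      \<le> ennreal K * (\<integral>\<^sup>+ x. ennreal (s powr (p - 1 - 1)) * indicator {s. 0 < s \<and> ennreal s < 2 * f x} s * (f x * maximal w x) \<partial>lborel)"
    proof (cases "s > 0")
      case True
      have "(\<integral>\<^sup>+ x. ennreal (s powr (p - 1)) * indicator {s. 0 < s \<and> ennreal s < maximal f x} s * w x \<partial>lborel)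
        = (\<integral>\<^sup>+ x. ennreal (s powr (p - 1)) * (w x * indicator {x. ennreal s < maximal f x} x) \<partial>lborel)"
        using True by (intro nn_integral_cong) (auto simp: indicator_def)
      also have "\<dots> = ennreal (s powr (p - 1)) * (\<integral>\<^sup>+ x \<in> {x. ennreal s < maximal f x}. w x \<partial>lborel)"
        by (rule nn_integral_cmult) auto
      also have "\<dots> \<le> ennreal K * (ennreal (s powr (p - 1 - 1)) * (\<integral>\<^sup>+ x \<in> {x. ennreal s < 2 * f x}. f x * maximal w x \<partial>lborel))"
        by (rule weak'[OF True])
      also have "ennreal (s powr (p - 1 - 1)) * (\<integral>\<^sup>+ x \<in> {x. ennreal s < 2 * f x}. f x * maximal w x \<partial>lborel)
         = (\<integral>\<^sup>+ x. ennreal (s powr (p - 1 - 1)) * (f x * maximal w x * indicator {x. ennreal s < 2 * f x} x) \<partial>lborel)"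
        by (rule nn_integral_cmult[symmetric]) auto
      also have "\<dots> = (\<integral>\<^sup>+ x. ennreal (s powr (p - 1 - 1)) * indicator {s. 0 < s \<and> ennreal s < 2 * f x} s * (f x * maximal w x) \<partial>lborel)"
        using True by (intro nn_integral_cong) (auto simp: indicator_def)
      finally show ?thesis .
    qed simp
  qed
  also have "\<dots> = ennreal K * (\<integral>\<^sup>+ s. (\<integral>\<^sup>+ x. ennreal (s powr (p - 1 - 1)) * indicator {s. 0 < s \<and> ennreal s < 2 * f x} s * (f x * maximal w x) \<partial>lborel) \<partial>lborel)"
    by (rule nn_integral_cmult) (simp add: indicator_def, measurable)
  also have "(\<integral>\<^sup>+ s. (\<integral>\<^sup>+ x. ennreal (s powr (p - 1 - 1)) * indicator {s. 0 < s \<and> ennreal s < 2 * f x} s * (f x * maximal w x) \<partial>lborel) \<partial>lborel)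
     = (\<integral>\<^sup>+ x. (\<integral>\<^sup>+ s. ennreal (s powr (p - 1 - 1)) * indicator {s. 0 < s \<and> ennreal s < 2 * f x} s * (f x * maximal w x) \<partial>lborel) \<partial>lborel)"
    by (rule lborel_pair.Fubini') (simp add: indicator_def, measurable)
  also have "\<dots> = (\<integral>\<^sup>+ x. ennreal (1 / (p - 1)) * epowr (2 * f x) (p - 1) * (f x * maximal w x) \<partial>lborel)"
    unfolding layer2[symmetric] by (intro nn_integral_cong nn_integral_multc) auto
  also have "\<dots> = (\<integral>\<^sup>+ x. ennreal (1 / (p - 1) * 2 powr (p - 1)) * (epowr (f x) p * maximal w x) \<partial>lborel)"
  proof (rule nn_integral_cong)
    fix x
    have "epowr (f x) (p - 1) * f x = epowr (f x) p"
    proof (cases "f x")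
      case (real r)
      have "r powr (p - 1) * r = r powr p" using real by (cases "r = 0") (auto simp: powr_mult_base mult.commute[of _ r])
      then show ?thesis using real by (simp flip: ennreal_mult)
    qed simp
    moreover have "epowr (2 * f x) (p - 1) = ennreal (2 powr (p - 1)) * epowr (f x) (p - 1)"
      using p epowr_ennreal[of 2 "p - 1"] by (simp add: epowr_mult)
    moreover have "a * (b * c) * (d * e) = a * b * ((c * d) * e)" for a b c d e :: ennreal by (simp add: mult_ac)
    ultimately show "ennreal (1 / (p - 1)) * epowr (2 * f x) (p - 1) * (f x * maximal w x)
      = ennreal (1 / (p - 1) * 2 powr (p - 1)) * (epowr (f x) p * maximal w x)"
      using p by (subst ennreal_mult) auto
  qed
  also have "\<dots> = ennreal (1 / (p - 1) * 2 powr (p - 1)) * (\<integral>\<^sup>+ x. epowr (f x) p * maximal w x \<partial>lborel)"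
    by (rule nn_integral_cmult) auto
  finally have "ennreal p * (ennreal (1 / p) * (\<integral>\<^sup>+ x. epowr (maximal f x) p * w x \<partial>lborel))
     \<le> ennreal p * (ennreal K * (ennreal (1 / (p - 1) * 2 powr (p - 1)) * (\<integral>\<^sup>+ x. epowr (f x) p * maximal w x \<partial>lborel)))"
    by (rule mult_left_mono) simp
  also have "\<dots> = ennreal (p * (K * (1 / (p - 1) * 2 powr (p - 1)))) * (\<integral>\<^sup>+ x. epowr (f x) p * maximal w x \<partial>lborel)"
    unfolding mult.assoc[symmetric] using p by (simp flip: ennreal_mult add: K_def)
  also have "p * (K * (1 / (p - 1) * 2 powr (p - 1))) = p / (p - 1) * 2 powr p * 5 ^ DIM('a)"
    unfolding K_def using powr_mult_base[of 2 "p - 1"] by (simp add: field_simps)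
  also have "ennreal p * (ennreal (1 / p) * (\<integral>\<^sup>+ x. epowr (maximal f x) p * w x \<partial>lborel)) = (\<integral>\<^sup>+ x. epowr (maximal f x) p * w x \<partial>lborel)"
    unfolding mult.assoc[symmetric] using p by (simp flip: ennreal_mult)
  finally show ?thesis .
qed

section \<open>Approximation in L^1 and Lebesgue points\<close>

definition radial :: "real \<Rightarrow> 'b::real_normed_vector \<Rightarrow> 'b" where
  "radial m v = (m / max m (norm v)) *\<^sub>R v"

text \<open>The retraction \<open>radial m\<close> onto the ball of radius m is continuous. It first
  makes u bounded and then bounds the continuous functions that converge to u almost everywhere, so
  that dominated convergence applies on both occasions.\<close>

lemma continuous_on_approx_L1:
  fixes u :: "'a::euclidean_space \<Rightarrow> 'b::euclidean_space"
  assumes [measurable]: "u \<in> borel_measurable borel"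
    and fin: "(\<integral>\<^sup>+ x \<in> ball 0 R. ennreal (norm (u x)) \<partial>lborel) < \<infinity>" and e: "e > 0"
  obtains h where "continuous_on UNIV h" "(\<integral>\<^sup>+ x \<in> ball 0 R. ennreal (norm (u x - h x)) \<partial>lborel) \<le> ennreal e"
proof -
  have rad_cont: "continuous_on UNIV (radial m :: 'b \<Rightarrow> 'b)" if "m > 0" for m
    unfolding radial_def using that by (intro continuous_intros) (auto simp: max_def)
  have rad_bd: "norm (radial m v) \<le> m" if "m > 0" for m and v :: 'b
    unfolding radial_def using that by (auto simp: max_def divide_simps)
  have rad_le: "norm (v - radial m v) \<le> norm v" if "m > 0" for m and v :: 'b
  proof -
    have "v - radial m v = (1 - m / max m (norm v)) *\<^sub>R v" unfolding radial_def by (simp add: scaleR_diff_left)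
    moreover have "\<bar>1 - m / max m (norm v)\<bar> \<le> 1" using that by (auto simp: max_def divide_simps)
    ultimately show ?thesis by (simp add: mult_left_le_one_le)
  qed
  have [measurable]: "radial m \<in> borel_measurable (borel :: 'b measure)" if "m > 0" for m
    using rad_cont[OF that] by (rule borel_measurable_continuous_onI)
  have mS: "real (Suc k) > 0" for k by simp
  have "(\<lambda>k. \<integral>\<^sup>+ x. ennreal (norm (u x - radial (real (Suc k)) (u x))) * indicator (ball 0 R) x \<partial>lborel) \<longlonglongrightarrow> (\<integral>\<^sup>+ x. 0 \<partial>(lborel :: 'a measure))"
  proof (rule nn_integral_dominated_convergence[where w = "\<lambda>x. ennreal (norm (u x)) * indicator (ball 0 R) x"])
    show "AE x in lborel. ennreal (norm (u x - radial (real (Suc j)) (u x))) * indicator (ball 0 R) x \<le> ennreal (norm (u x)) * indicator (ball 0 R) x" for j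
      using rad_le[OF mS] by (intro AE_I2 mult_right_mono ennreal_leI) auto
    show "AE x in lborel. (\<lambda>i. ennreal (norm (u x - radial (real (Suc i)) (u x))) * indicator (ball 0 R) x) \<longlonglongrightarrow> 0"
    proof (rule AE_I2, rule tendsto_eventually)
      fix x
      obtain k0 :: nat where "norm (u x) < k0" using reals_Archimedean2 by blast
      then have "radial (real (Suc k)) (u x) = u x" if "k \<ge> k0" for k
        using that unfolding radial_def by (auto simp: max_def)
      then show "eventually (\<lambda>i. ennreal (norm (u x - radial (real (Suc i)) (u x))) * indicator (ball 0 R) x = 0) sequentially"
        unfolding eventually_sequentially by (auto intro!: exI[of _ k0])
    qed
    show "(\<lambda>x. ennreal (norm (u x - radial (real (Suc i)) (u x))) * indicator (ball 0 R) x) \<in> borel_measurable lborel" for i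
      using mS by measurable
  qed (use fin in auto)
  then have "(\<lambda>k. \<integral>\<^sup>+ x. ennreal (norm (u x - radial (real (Suc k)) (u x))) * indicator (ball 0 R) x \<partial>lborel) \<longlonglongrightarrow> 0" by simp
  then have "eventually (\<lambda>k. (\<integral>\<^sup>+ x. ennreal (norm (u x - radial (real (Suc k)) (u x))) * indicator (ball 0 R) x \<partial>lborel) < ennreal (e/2)) sequentially"
    by (rule order_tendstoD) (use e in simp)
  then obtain k where k: "(\<integral>\<^sup>+ x. ennreal (norm (u x - radial (real (Suc k)) (u x))) * indicator (ball 0 R) x \<partial>lborel) < ennreal (e/2)"
    by (auto simp: eventually_sequentially)
  define m where "m = real (Suc k)"
  have m: "m > 0" unfolding m_def by simp
  note [measurable] = \<open>\<And>m. m > 0 \<Longrightarrow> radial m \<in> borel_measurable borel\<close>[OF m]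
  \<comment> \<open>In this form measurability means being a limit of continuous functions off a
    negligible set.\<close>
  have "u measurable_on UNIV"
    by (rule lebesgue_measurable_imp_measurable_on) (auto simp: lebesgue_on_UNIV_eq measurable_completion)
  then obtain Z g where Z: "negligible Z" and g: "\<And>n. continuous_on UNIV (g n)" "\<And>x. x \<notin> Z \<Longrightarrow> (\<lambda>n. g n x) \<longlonglongrightarrow> u x"
    unfolding measurable_on_def by auto
  have [measurable]: "g n \<in> borel_measurable borel" for n using g(1) by (rule borel_measurable_continuous_onI)
  have aeZ: "AE x in lborel. x \<notin> Z"
    using Z unfolding negligible_iff_null_sets by (metis AE_completion_iff AE_not_in)
  have "(\<lambda>n. \<integral>\<^sup>+ x. ennreal (norm (radial m (u x) - radial m (g n x))) * indicator (ball 0 R) x \<partial>lborel) \<longlonglongrightarrow> (\<integral>\<^sup>+ x. 0 \<partial>(lborel :: 'a measure))"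
  proof (rule nn_integral_dominated_convergence[where w = "\<lambda>x. ennreal (2 * m) * indicator (ball 0 R) x"])
    show "AE x in lborel. ennreal (norm (radial m (u x) - radial m (g j x))) * indicator (ball 0 R) x \<le> ennreal (2 * m) * indicator (ball 0 R) x" for j
    proof (intro AE_I2 mult_right_mono ennreal_leI)
      show "norm (radial m (u x) - radial m (g j x)) \<le> 2 * m" for x
        using norm_triangle_ineq4[of "radial m (u x)" "radial m (g j x)"] rad_bd[OF m, of "u x"] rad_bd[OF m, of "g j x"] by linarith
    qed auto
    show "AE x in lborel. (\<lambda>n. ennreal (norm (radial m (u x) - radial m (g n x))) * indicator (ball 0 R) x) \<longlonglongrightarrow> 0"
      using aeZ
    proof eventually_elim
      case (elim x)
      have "isCont (radial m) (u x)" using rad_cont[OF m] by (simp add: continuous_on_eq_continuous_at)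
      then have "(\<lambda>n. radial m (g n x)) \<longlonglongrightarrow> radial m (u x)" using g(2)[OF elim] by (rule isCont_tendsto_compose)
      then have "(\<lambda>n. radial m (u x) - radial m (g n x)) \<longlonglongrightarrow> radial m (u x) - radial m (u x)" by (intro tendsto_diff tendsto_const)
      then have "(\<lambda>n. norm (radial m (u x) - radial m (g n x))) \<longlonglongrightarrow> 0" by (intro tendsto_norm_zero) simp
      then have "(\<lambda>n. ennreal (norm (radial m (u x) - radial m (g n x)))) \<longlonglongrightarrow> 0"
        by (subst ennreal_tendsto_0_iff) auto
      then show ?case by (cases "x \<in> ball 0 R") auto
    qed
    show "(\<integral>\<^sup>+ x. ennreal (2 * m) * indicator (ball 0 R) x \<partial>(lborel :: 'a measure)) < \<infinity>"
      using emeasure_lborel_ball_finite[of "0::'a" R] by (subst nn_integral_cmult_indicator) (auto simp: ennreal_mult_less_top)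
  qed auto
  then have "(\<lambda>n. \<integral>\<^sup>+ x. ennreal (norm (radial m (u x) - radial m (g n x))) * indicator (ball 0 R) x \<partial>lborel) \<longlonglongrightarrow> 0" by simp
  then have "eventually (\<lambda>n. (\<integral>\<^sup>+ x. ennreal (norm (radial m (u x) - radial m (g n x))) * indicator (ball 0 R) x \<partial>lborel) < ennreal (e/2)) sequentially"
    by (rule order_tendstoD) (use e in simp)
  then obtain n where n: "(\<integral>\<^sup>+ x. ennreal (norm (radial m (u x) - radial m (g n x))) * indicator (ball 0 R) x \<partial>lborel) < ennreal (e/2)"
    by (auto simp: eventually_sequentially)
  show thesis
  proof (rule that)
    show "continuous_on UNIV (\<lambda>x. radial m (g n x))"
      using continuous_on_compose2[OF rad_cont[OF m] g(1)] by auto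
    have "(\<integral>\<^sup>+ x \<in> ball 0 R. ennreal (norm (u x - radial m (g n x))) \<partial>lborel)
      \<le> (\<integral>\<^sup>+ x. ennreal (norm (u x - radial m (u x))) * indicator (ball 0 R) x + ennreal (norm (radial m (u x) - radial m (g n x))) * indicator (ball 0 R) x \<partial>lborel)"
      unfolding distrib_right[symmetric]
      by (intro nn_integral_mono mult_right_mono) (auto simp flip: ennreal_plus intro!: ennreal_leI norm_diff_triangle_le)
    also have "\<dots> = (\<integral>\<^sup>+ x. ennreal (norm (u x - radial m (u x))) * indicator (ball 0 R) x \<partial>lborel) + (\<integral>\<^sup>+ x. ennreal (norm (radial m (u x) - radial m (g n x))) * indicator (ball 0 R) x \<partial>lborel)"
      by (rule nn_integral_add) auto
    also have "\<dots> \<le> ennreal (e/2) + ennreal (e/2)" using k n unfolding m_def by (intro add_mono less_imp_le)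
    also have "\<dots> = ennreal e" using e by (simp flip: ennreal_plus)
    finally show "(\<integral>\<^sup>+ x \<in> ball 0 R. ennreal (norm (u x - radial m (g n x))) \<partial>lborel) \<le> ennreal e" .
  qed
qed

text \<open>Approximation error (1/4) ^ j against threshold (1/2) ^ j leaves exceptional sets of
  measure O((1/2) ^ j), both for the maximal function of the error and for the error itself. By
  Borel-Cantelli almost every x avoids all but finitely many of them.\<close>

theorem Lebesgue_differentiation:
  fixes u :: "'a::euclidean_space \<Rightarrow> 'b::euclidean_space"
  assumes u[measurable]: "u \<in> borel_measurable borel"
    and fin: "\<And>R. (\<integral>\<^sup>+ x \<in> ball 0 R. ennreal (norm (u x)) \<partial>lborel) < \<infinity>"
  shows "AE x in lborel. \<forall>e>0. \<exists>d>0. \<forall>s. 0 < s \<and> s < d \<longrightarrow>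
     (\<integral>\<^sup>+ y \<in> ball x s. ennreal (norm (u y - u x)) \<partial>lborel) \<le> ennreal (e * s ^ DIM('a))"
proof -
  define v where "v = unit_vol TYPE('a)"
  have v: "v > 0" unfolding v_def by (rule unit_vol_pos)
  have local: "AE x in lborel. x \<in> ball 0 R \<longrightarrow> (\<forall>e>0. \<exists>d>0. \<forall>s. 0 < s \<and> s < d \<longrightarrow>
     (\<integral>\<^sup>+ y \<in> ball x s. ennreal (norm (u y - u x)) \<partial>lborel) \<le> ennreal (e * s ^ DIM('a)))" for R
  proof -
    have "\<exists>h. continuous_on UNIV h \<and> (\<integral>\<^sup>+ x \<in> ball 0 R. ennreal (norm (u x - h x)) \<partial>lborel) \<le> ennreal ((1/4) ^ j)" for j
      by (rule continuous_on_approx_L1[OF u fin, of "(1/4) ^ j" R]) auto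
    then obtain h where h: "\<And>j. continuous_on UNIV (h j)"
      "\<And>j. (\<integral>\<^sup>+ x \<in> ball 0 R. ennreal (norm (u x - h j x)) \<partial>lborel) \<le> ennreal ((1/4) ^ j)" by metis
    have [measurable]: "h j \<in> borel_measurable borel" for j using h(1) by (rule borel_measurable_continuous_onI)
    define d where "d = (\<lambda>j x. ennreal (norm (u x - h j x)) * indicator (ball 0 R) x)"
    have [measurable]: "d j \<in> borel_measurable borel" for j unfolding d_def by measurable
    have d_int: "(\<integral>\<^sup>+ x. d j x \<partial>lborel) \<le> ennreal ((1/4) ^ j)" for j unfolding d_def by (rule h(2))
    define A1 where "A1 = (\<lambda>j. {x. ennreal ((1/2) ^ j) < maximal (d j) x})"
    define A2 where "A2 = (\<lambda>j. {x. ennreal ((1/2) ^ j) < d j x})"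
    have [measurable]: "A1 j \<in> sets borel" "A2 j \<in> sets borel" for j unfolding A1_def A2_def by measurable
    have A1: "ennreal ((1/2) ^ j) * emeasure lborel (A1 j) \<le> ennreal (5 ^ DIM('a) * (1/4) ^ j)" for j
    proof -
      have "ennreal ((1/2) ^ j) * emeasure lborel (A1 j) \<le> 5 ^ DIM('a) * (\<integral>\<^sup>+ x. d j x * maximal (\<lambda>_. 1) x \<partial>lborel)"
        using maximal_weak_type[of "d j" "\<lambda>_. 1" "ennreal ((1/2) ^ j)"] unfolding A1_def by simp
      also have "\<dots> \<le> 5 ^ DIM('a) * (\<integral>\<^sup>+ x. d j x * 1 \<partial>lborel)"
        by (intro mult_left_mono nn_integral_mono maximal_const) auto
      also have "\<dots> \<le> 5 ^ DIM('a) * ennreal ((1/4) ^ j)" using d_int by (intro mult_left_mono) auto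
      finally show ?thesis by (simp add: ennreal_mult ennreal_power[symmetric])
    qed
    have A2: "ennreal ((1/2) ^ j) * emeasure lborel (A2 j) \<le> ennreal ((1/4) ^ j)" for j
    proof -
      have "ennreal ((1/2) ^ j) * emeasure lborel (A2 j) = (\<integral>\<^sup>+ x. ennreal ((1/2) ^ j) * indicator (A2 j) x \<partial>lborel)"
        by (rule nn_integral_cmult_indicator[symmetric]) simp
      also have "\<dots> \<le> (\<integral>\<^sup>+ x. d j x \<partial>lborel)"
        by (intro nn_integral_mono) (auto simp: A2_def indicator_def)
      finally show ?thesis using d_int order_trans by blast
    qed
    define A where "A = (\<lambda>j. A1 j \<union> A2 j)"
    define K where "K = 5 ^ DIM('a) + (1::real)"
    have A_le: "emeasure lborel (A j) \<le> ennreal (K * (1/2) ^ j)" for j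
    proof -
      have "ennreal ((1/2) ^ j) * emeasure lborel (A j) \<le> ennreal ((1/2) ^ j) * (emeasure lborel (A1 j) + emeasure lborel (A2 j))"
        unfolding A_def by (intro mult_left_mono emeasure_subadditive) auto
      also have "\<dots> \<le> ennreal (5 ^ DIM('a) * (1/4) ^ j) + ennreal ((1/4) ^ j)"
        unfolding distrib_left by (intro add_mono A1 A2)
      also have "\<dots> = ennreal (K * (1/4) ^ j)" unfolding K_def by (simp flip: ennreal_plus add: distrib_right)
      also have "K * (1/4) ^ j = (1/2) ^ j * (K * (1/2) ^ j)" by (simp flip: power_mult_distrib add: mult.left_commute)
      also have "ennreal \<dots> = ennreal ((1/2) ^ j) * ennreal (K * (1/2) ^ j)" by (rule ennreal_mult) (auto simp: K_def)
      finally show ?thesis by (subst (asm) ennreal_mult_le_mult_iff) auto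
    qed
    have "AE x in lborel. eventually (\<lambda>j. x \<in> space lborel - A j) sequentially"
    proof (rule borel_cantelli_AE1)
      show "A j \<in> sets lborel" for j unfolding A_def by simp
      show "emeasure lborel (A j) < \<infinity>" for j by (rule le_less_trans[OF A_le]) simp
      show "summable (\<lambda>j. measure lborel (A j))"
      proof (rule summable_comparison_test)
        show "\<exists>N. \<forall>j\<ge>N. norm (measure lborel (A j)) \<le> K * (1/2) ^ j"
          using A_le by (auto simp: measure_def K_def intro!: enn2real_leI)
      qed (auto intro!: summable_mult summable_geometric)
    qed
    then show ?thesis
    proof (eventually_elim, intro impI allI)
      fix x and e :: real
      assume ev: "eventually (\<lambda>j. x \<in> space lborel - A j) sequentially" and x: "x \<in> ball 0 R" and e: "e > 0"
      \<comment> \<open>Three errors of size (1/2) ^ j: the average of u - h j, the oscillation of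
        the continuous h j, and u - h j at x.\<close>
      have "(\<lambda>j. 3 * (1/2) ^ j * v) \<longlonglongrightarrow> 3 * 0 * v" by (intro tendsto_intros) auto
      then have "eventually (\<lambda>j. 3 * (1/2) ^ j * v < e) sequentially"
        using e by (intro order_tendstoD) auto
      with ev have "eventually (\<lambda>j. x \<notin> A j \<and> 3 * (1/2) ^ j * v < e) sequentially" by eventually_elim auto
      then obtain j where j: "x \<notin> A j" "3 * (1/2) ^ j * v < e" by (auto simp: eventually_sequentially)
      define \<eta> where "\<eta> = (1/2::real) ^ j"
      have \<eta>: "\<eta> > 0" unfolding \<eta>_def by simp
      obtain d1 where d1: "d1 > 0" "\<And>y. dist y x < d1 \<Longrightarrow> dist (h j y) (h j x) < \<eta>"
        using h(1)[of j] \<eta> unfolding continuous_on_iff by (metis UNIV_I)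
      obtain d2 where d2: "d2 > 0" "ball x d2 \<subseteq> ball 0 R" using x open_contains_ball[of "ball 0 R"] open_ball by metis
      have mx: "maximal (d j) x \<le> ennreal \<eta>" "d j x \<le> ennreal \<eta>" using j(1) unfolding A_def A1_def A2_def \<eta>_def by (auto simp: not_less)
      have "(\<integral>\<^sup>+ y \<in> ball x s. ennreal (norm (u y - u x)) \<partial>lborel) \<le> ennreal (e * s ^ DIM('a))"
        if s: "0 < s" "s < min d1 d2" for s
      proof -
        have "(\<integral>\<^sup>+ y \<in> ball x s. ennreal (norm (u y - u x)) \<partial>lborel)
           \<le> (\<integral>\<^sup>+ y. d j y * indicator (ball x s) y + ennreal (2 * \<eta>) * indicator (ball x s) y \<partial>lborel)"
        proof (rule nn_integral_mono)
          fix y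
          show "ennreal (norm (u y - u x)) * indicator (ball x s) y \<le> d j y * indicator (ball x s) y + ennreal (2 * \<eta>) * indicator (ball x s) y"
          proof (cases "y \<in> ball x s")
            case True
            then have "y \<in> ball x d2" using s by simp
            then have yB: "y \<in> ball 0 R" using d2(2) by blast
            have hh: "norm (h j y - h j x) \<le> \<eta>" using d1(2)[of y] True s by (simp add: dist_norm[symmetric] dist_commute)
            have hx: "norm (u x - h j x) \<le> \<eta>" using mx(2) x \<eta> unfolding d_def by simp
            have "norm (u y - u x) = norm ((u y - h j y) + (h j y - h j x) + (h j x - u x))" by simp
            also have "\<dots> \<le> norm (u y - h j y) + norm (h j y - h j x) + norm (h j x - u x)"
              by (intro norm_triangle_le add_mono norm_triangle_ineq) auto
            also have "\<dots> \<le> norm (u y - h j y) + 2 * \<eta>" using hh hx by (simp add: norm_minus_commute)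
            finally have "ennreal (norm (u y - u x)) \<le> ennreal (norm (u y - h j y)) + ennreal (2 * \<eta>)"
              using \<eta> by (simp flip: ennreal_plus add: ennreal_leI)
            then show ?thesis using True yB unfolding d_def by simp
          qed simp
        qed
        also have "\<dots> = (\<integral>\<^sup>+ y \<in> ball x s. d j y \<partial>lborel) + (\<integral>\<^sup>+ y. ennreal (2 * \<eta>) * indicator (ball x s) y \<partial>lborel)"
          by (rule nn_integral_add) auto
        also have "(\<integral>\<^sup>+ y. ennreal (2 * \<eta>) * indicator (ball x s) y \<partial>lborel) = ennreal (2 * \<eta>) * ennreal (v * s ^ DIM('a))"
          using s unfolding v_def by (subst nn_integral_cmult_indicator) (auto simp: emeasure_lborel_ball)
        also have "(\<integral>\<^sup>+ y \<in> ball x s. d j y \<partial>lborel) \<le> maximal (d j) x * ennreal (v * s ^ DIM('a))"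
          unfolding v_def using s by (intro maximal_ge) auto
        also have "\<dots> \<le> ennreal \<eta> * ennreal (v * s ^ DIM('a))" by (intro mult_right_mono mx) auto
        also have "ennreal \<eta> * ennreal (v * s ^ DIM('a)) + ennreal (2 * \<eta>) * ennreal (v * s ^ DIM('a)) = ennreal (3 * \<eta> * v * s ^ DIM('a))"
          using \<eta> v s by (simp flip: ennreal_mult ennreal_plus add: algebra_simps)
        also have "\<dots> \<le> ennreal (e * s ^ DIM('a))"
          using j(2) s unfolding \<eta>_def by (intro ennreal_leI mult_right_mono) auto
        finally show ?thesis by (simp add: add_right_mono)
      qed
      then show "\<exists>d>0. \<forall>s. 0 < s \<and> s < d \<longrightarrow>
         (\<integral>\<^sup>+ y \<in> ball x s. ennreal (norm (u y - u x)) \<partial>lborel) \<le> ennreal (e * s ^ DIM('a))"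
        using d1(1) d2(1) by (intro exI[of _ "min d1 d2"]) auto
    qed
  qed
  have "AE x in lborel. \<forall>R::nat. x \<in> ball 0 (real R) \<longrightarrow> (\<forall>e>0. \<exists>d>0. \<forall>s. 0 < s \<and> s < d \<longrightarrow>
     (\<integral>\<^sup>+ y \<in> ball x s. ennreal (norm (u y - u x)) \<partial>lborel) \<le> ennreal (e * s ^ DIM('a)))"
    unfolding AE_all_countable using local by blast
  then show ?thesis
  proof eventually_elim
    case (elim x)
    obtain R :: nat where "norm x < R" using reals_Archimedean2 by blast
    then have "x \<in> ball 0 (real R)" by simp
    then show ?case using elim by blast
  qed
qed

section \<open>Local estimates for weakly differentiable functions\<close>

text \<open>Borel measurability is demanded so that Fubini works on products of
  \<open>lborel\<close>; functions that are merely Lebesgue measurable are replaced by such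
  representatives at the end.\<close>

definition loc_L1 :: "('a::euclidean_space \<Rightarrow> 'b::euclidean_space) \<Rightarrow> bool" where
  "loc_L1 u \<longleftrightarrow> u \<in> borel_measurable borel \<and> (\<forall>R. (\<integral>\<^sup>+ x \<in> ball 0 R. ennreal (norm (u x)) \<partial>lborel) < \<infinity>)"

lemma loc_L1_measurable [measurable_dest]: "loc_L1 u \<Longrightarrow> u \<in> borel_measurable borel"
  by (simp add: loc_L1_def)

lemma loc_L1_ball:
  assumes "loc_L1 u" shows "(\<integral>\<^sup>+ x \<in> ball c r. ennreal (norm (u x)) \<partial>lborel) < \<infinity>"
proof -
  have sub: "ball c r \<subseteq> ball 0 (norm c + r)"
  proof
    fix x assume "x \<in> ball c r"
    then have "norm (x - c) < r" by (simp add: dist_norm norm_minus_commute)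
    then show "x \<in> ball 0 (norm c + r)" using norm_triangle_ineq[of "x - c" c] by simp
  qed
  have "(\<integral>\<^sup>+ x \<in> ball c r. ennreal (norm (u x)) \<partial>lborel) \<le> (\<integral>\<^sup>+ x \<in> ball 0 (norm c + r). ennreal (norm (u x)) \<partial>lborel)"
    using sub by (intro nn_integral_mono) (auto simp: indicator_def)
  also have "\<dots> < \<infinity>" using assms unfolding loc_L1_def by blast
  finally show ?thesis .
qed

lemma loc_L1_integrable_mult:
  fixes u :: "'a::euclidean_space \<Rightarrow> real"
  assumes u: "loc_L1 u" and [measurable]: "\<psi> \<in> borel_measurable borel"
    and bd: "\<And>x. \<bar>\<psi> x\<bar> \<le> M" and supp: "\<And>x. x \<notin> ball c r \<Longrightarrow> \<psi> x = 0"
  shows "integrable lborel (\<lambda>x. u x * \<psi> x)"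
proof (rule integrableI_bounded)
  have [measurable]: "u \<in> borel_measurable borel" using u by (rule loc_L1_measurable)
  show "(\<lambda>x. u x * \<psi> x) \<in> borel_measurable lborel" by measurable
  have M: "M \<ge> 0" using bd[of 0] by linarith
  have "(\<integral>\<^sup>+ x. ennreal (norm (u x * \<psi> x)) \<partial>lborel) \<le> (\<integral>\<^sup>+ x. ennreal M * (ennreal (norm (u x)) * indicator (ball c r) x) \<partial>lborel)"
  proof (rule nn_integral_mono)
    fix x
    show "ennreal (norm (u x * \<psi> x)) \<le> ennreal M * (ennreal (norm (u x)) * indicator (ball c r) x)"
    proof (cases "x \<in> ball c r")
      case True
      have "norm (u x * \<psi> x) \<le> M * norm (u x)" using bd[of x] by (simp add: abs_mult mult.commute mult_right_mono)
      then show ?thesis using True M by (simp flip: ennreal_mult add: ennreal_leI)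
    qed (simp add: supp)
  qed
  also have "\<dots> = ennreal M * (\<integral>\<^sup>+ x \<in> ball c r. ennreal (norm (u x)) \<partial>lborel)" by (rule nn_integral_cmult) measurable
  also have "\<dots> < \<infinity>" using loc_L1_ball[OF u] by (simp add: ennreal_mult_less_top)
  finally show "(\<integral>\<^sup>+ x. ennreal (norm (u x * \<psi> x)) \<partial>lborel) < \<infinity>" .
qed

lemma mollifier_scaled:
  assumes m: "mollifier \<Phi> d\<Phi> L" and k: "k > 0"
  shows "(\<lambda>z. \<Phi> (k *\<^sub>R (x - z))) \<in> borel_measurable borel" "\<bar>\<Phi> (k *\<^sub>R (x - z))\<bar> \<le> 1"
    "z \<notin> ball x (1 / k) \<Longrightarrow> \<Phi> (k *\<^sub>R (x - z)) = 0"
    "b \<in> Basis \<Longrightarrow> (\<lambda>z. d\<Phi> b (k *\<^sub>R (x - z))) \<in> borel_measurable borel"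
    "b \<in> Basis \<Longrightarrow> \<bar>d\<Phi> b (k *\<^sub>R (x - z))\<bar> \<le> L"
    "b \<in> Basis \<Longrightarrow> z \<notin> ball x (1 / k) \<Longrightarrow> d\<Phi> b (k *\<^sub>R (x - z)) = 0"
proof -
  have [measurable]: "\<Phi> \<in> borel_measurable borel"
    using m unfolding mollifier_def by (intro borel_measurable_continuous_onI) blast
  show "(\<lambda>z. \<Phi> (k *\<^sub>R (x - z))) \<in> borel_measurable borel" by measurable
  show "\<bar>\<Phi> (k *\<^sub>R (x - z))\<bar> \<le> 1" using m unfolding mollifier_def by simp
  have out: "norm (k *\<^sub>R (x - z)) \<ge> 1" if "z \<notin> ball x (1 / k)"
  proof -
    have "norm (x - z) \<ge> 1 / k" using that by (simp add: dist_norm)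
    then show ?thesis unfolding norm_scaleR using k by (simp add: field_simps)
  qed
  show "z \<notin> ball x (1 / k) \<Longrightarrow> \<Phi> (k *\<^sub>R (x - z)) = 0" using m out unfolding mollifier_def by blast
  assume b: "b \<in> Basis"
  have [measurable]: "d\<Phi> b \<in> borel_measurable borel"
    using m b unfolding mollifier_def by (intro borel_measurable_continuous_onI) blast
  show "(\<lambda>z. d\<Phi> b (k *\<^sub>R (x - z))) \<in> borel_measurable borel" by measurable
  show "\<bar>d\<Phi> b (k *\<^sub>R (x - z))\<bar> \<le> L" using m b unfolding mollifier_def by blast
  show "z \<notin> ball x (1 / k) \<Longrightarrow> d\<Phi> b (k *\<^sub>R (x - z)) = 0" using m b out unfolding mollifier_def by blast
qed

lemma mollifier_mass:
  fixes x :: "'a::euclidean_space"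
  assumes m: "mollifier \<Phi> d\<Phi> L" and k: "k > 0"
  shows "integrable lborel (\<lambda>z. \<Phi> (k *\<^sub>R (x - z)))"
    "(\<integral>z. \<Phi> (k *\<^sub>R (x - z)) \<partial>lborel) = (\<integral>u. \<Phi> u \<partial>lborel) / k ^ DIM('a)"
proof -
  have [measurable]: "\<Phi> \<in> borel_measurable borel"
    using m unfolding mollifier_def by (intro borel_measurable_continuous_onI) blast
  have nn: "0 \<le> \<Phi> u" for u using m unfolding mollifier_def by blast
  have L1: "loc_L1 (\<lambda>_::'a. 1::real)" unfolding loc_L1_def
    using emeasure_lborel_ball_finite[of "0::'a"] by simp
  show "integrable lborel (\<lambda>z. \<Phi> (k *\<^sub>R (x - z)))"
    using loc_L1_integrable_mult[OF L1 mollifier_scaled(1-3)[OF m k]] by simp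
  have "(\<integral>\<^sup>+ u. ennreal (\<Phi> u) \<partial>lborel) = ennreal (\<bar>- k\<bar> ^ DIM('a)) * (\<integral>\<^sup>+ z. ennreal (\<Phi> (k *\<^sub>R x + (- k) *\<^sub>R z)) \<partial>lborel)"
    using k by (intro nn_integral_lborel_affine) auto
  then have "enn2real (\<integral>\<^sup>+ u. ennreal (\<Phi> u) \<partial>lborel) = k ^ DIM('a) * enn2real (\<integral>\<^sup>+ z. ennreal (\<Phi> (k *\<^sub>R (x - z))) \<partial>lborel)"
    using k by (simp add: enn2real_mult scaleR_diff_right)
  then show "(\<integral>z. \<Phi> (k *\<^sub>R (x - z)) \<partial>lborel) = (\<integral>u. \<Phi> u \<partial>lborel) / k ^ DIM('a)"
    using k nn by (subst (1 2) integral_eq_nn_integral) auto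
qed

text \<open>The test function is the reflected kernel centred at w; the sign from its chain rule
  cancels the sign in the definition of the weak gradient.\<close>

lemma weak_gradient_mollifier:
  fixes f :: "'a::euclidean_space \<Rightarrow> real"
  assumes m: "mollifier \<Phi> d\<Phi> L" and k: "k > 0" and b: "b \<in> Basis"
    and f: "loc_L1 f" and G: "loc_L1 G" and wg: "weak_gradient f G"
  shows "(\<integral>z. f z * (k * d\<Phi> b (k *\<^sub>R (w - z))) \<partial>lborel) = (\<integral>z. (G z \<bullet> b) * \<Phi> (k *\<^sub>R (w - z)) \<partial>lborel)"
proof -
  have [measurable]: "f \<in> borel_measurable borel" "G \<in> borel_measurable borel" using f G by (auto dest: loc_L1_measurable)
  note [measurable] = mollifier_scaled(1)[OF m k] mollifier_scaled(4)[OF m k b]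
  have tf: "test_fun (\<lambda>y. \<Phi> (k *\<^sub>R (w - y)))" using m k unfolding mollifier_def by blast
  have "(\<integral>z. f z * frechet_derivative (\<lambda>y. \<Phi> (k *\<^sub>R (w - y))) (at z) b \<partial>lebesgue)
     = - (\<integral>z. (G z \<bullet> b) * \<Phi> (k *\<^sub>R (w - z)) \<partial>lebesgue)"
    using wg tf b unfolding weak_gradient_def by blast
  also have "(\<lambda>z. f z * frechet_derivative (\<lambda>y. \<Phi> (k *\<^sub>R (w - y))) (at z) b) = (\<lambda>z. - (f z * (k * d\<Phi> b (k *\<^sub>R (w - z)))))"
    using m b unfolding mollifier_def by simp
  finally show ?thesis by (simp add: integral_completion)
qed

text \<open>Fundamental theorem of calculus for the mollification \<open>F\<close> of \<open>f\<close> along the segment from \<open>x\<close> to \<open>y\<close>.\<close>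

lemma mollified_difference:
  fixes f :: "'a::euclidean_space \<Rightarrow> real" and v :: 'a
  assumes m: "mollifier \<Phi> d\<Phi> L" and k: "k > 0"
    and f: "loc_L1 f" and G: "loc_L1 G" and wg: "weak_gradient f G"
  defines "Z \<equiv> (\<integral>u. \<Phi> u \<partial>lborel)"
  defines "F \<equiv> (\<lambda>x. k ^ DIM('a) / Z * (\<integral>z. f z * \<Phi> (k *\<^sub>R (x - z)) \<partial>lborel))"
  shows "ennreal \<bar>F y - F x - v \<bullet> (y - x)\<bar> \<le> ennreal (k ^ DIM('a) / Z * norm (y - x)) *
     (\<integral>\<^sup>+ t \<in> {0..1}. (\<integral>\<^sup>+ z \<in> ball (x + t *\<^sub>R (y - x)) (1 / k). ennreal (norm (G z - v)) \<partial>lborel) \<partial>lborel)"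
proof -
  have Z: "Z > 0" unfolding Z_def using m unfolding mollifier_def by blast
  have [measurable]: "f \<in> borel_measurable borel" "G \<in> borel_measurable borel" using f G by (auto dest: loc_L1_measurable)
  have [measurable]: "\<Phi> \<in> borel_measurable borel"
    using m unfolding mollifier_def by (intro borel_measurable_continuous_onI) blast
  have dm[measurable]: "d\<Phi> b \<in> borel_measurable borel" if "b \<in> Basis" for b
    using m that unfolding mollifier_def by (intro borel_measurable_continuous_onI) blast
  define c where "c = (\<lambda>t::real. x + t *\<^sub>R (y - x))"
  have [measurable]: "c \<in> borel_measurable borel" unfolding c_def by measurable
  \<comment> \<open>The derivative in t of the kernel centred at the moving point
    \<open>c t\<close>.\<close>
  define S where "S = (\<lambda>z t. \<Sum>b\<in>Basis. ((y - x) \<bullet> b) * (k * d\<Phi> b (k *\<^sub>R (c t - z))))"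
  have [measurable]: "(\<lambda>(z, t). S z t) \<in> borel_measurable (borel \<Otimes>\<^sub>M borel)"
    unfolding S_def split_beta by (intro borel_measurable_sum borel_measurable_times) (auto intro!: measurable_compose[OF _ dm])
  have ftc: "(\<integral>t. indicator {0..1} t *\<^sub>R S z t \<partial>lborel) = \<Phi> (k *\<^sub>R (y - z)) - \<Phi> (k *\<^sub>R (x - z))" for z
  proof -
    have der: "((\<lambda>t. \<Phi> (k *\<^sub>R (c t - z))) has_vector_derivative S z t) (at t within A)" for t A
    proof -
      have 1: "((\<lambda>t. k *\<^sub>R (c t - z)) has_derivative (\<lambda>h. k *\<^sub>R (h *\<^sub>R (y - x)))) (at t within A)"
        unfolding c_def by (auto intro!: derivative_eq_intros)
      have 2: "(\<Phi> has_derivative (\<lambda>v. \<Sum>b\<in>Basis. (v \<bullet> b) * d\<Phi> b (k *\<^sub>R (c t - z)))) (at (k *\<^sub>R (c t - z)))"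
        using m unfolding mollifier_def by blast
      have "((\<lambda>t. \<Phi> (k *\<^sub>R (c t - z))) has_derivative (\<lambda>h. \<Sum>b\<in>Basis. (k *\<^sub>R (h *\<^sub>R (y - x)) \<bullet> b) * d\<Phi> b (k *\<^sub>R (c t - z)))) (at t within A)"
        by (rule has_derivative_compose[OF 1 2])
      moreover have "(\<lambda>h. \<Sum>b\<in>Basis. (k *\<^sub>R (h *\<^sub>R (y - x)) \<bullet> b) * d\<Phi> b (k *\<^sub>R (c t - z))) = (\<lambda>h. h *\<^sub>R S z t)"
        unfolding S_def by (auto simp: sum_distrib_left mult_ac intro!: ext sum.cong)
      ultimately show ?thesis unfolding has_vector_derivative_def by simp
    qed
    have "continuous_on {0..1} (S z)" unfolding S_def c_def
    proof (intro continuous_intros)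
      fix b :: 'a assume "b \<in> Basis"
      then have "continuous_on UNIV (d\<Phi> b)" using m unfolding mollifier_def by blast
      then show "continuous_on {0..1} (\<lambda>t. d\<Phi> b (k *\<^sub>R (x + t *\<^sub>R (y - x) - z)))"
        by (rule continuous_on_compose2) (auto intro!: continuous_intros)
    qed
    then have "(\<integral>t. indicator {0..1} t *\<^sub>R S z t \<partial>lborel) = \<Phi> (k *\<^sub>R (c 1 - z)) - \<Phi> (k *\<^sub>R (c 0 - z))"
      using der by (intro integral_FTC_atLeastAtMost) auto
    then show ?thesis unfolding c_def by simp
  qed
  have L0: "L \<ge> 0"
  proof -
    have "\<bar>d\<Phi> (SOME b. b \<in> Basis) 0\<bar> \<le> L" using m unfolding mollifier_def by (metis SOME_Basis)
    then show ?thesis by linarith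
  qed
  define M where "M = (\<Sum>b\<in>(Basis::'a set). \<bar>(y - x) \<bullet> b\<bar> * (k * L))"
  have M0: "M \<ge> 0" unfolding M_def using k L0 by (intro sum_nonneg) auto
  have S_bd: "\<bar>S z t\<bar> \<le> M" for z t
    unfolding S_def M_def
  proof (rule order_trans[OF sum_abs], rule sum_mono)
    fix b :: 'a assume "b \<in> Basis"
    then have "\<bar>d\<Phi> b (k *\<^sub>R (c t - z))\<bar> \<le> L" using m unfolding mollifier_def by blast
    then show "\<bar>(y - x) \<bullet> b * (k * d\<Phi> b (k *\<^sub>R (c t - z)))\<bar> \<le> \<bar>(y - x) \<bullet> b\<bar> * (k * L)"
      unfolding abs_mult using k by (intro mult_left_mono) auto
  qed
  \<comment> \<open>Large enough for the ball to contain the supports of all kernels centred on the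
    segment.\<close>
  define R where "R = norm x + norm (y - x) + 1 / k"
  have S_supp: "S z t = 0" if t: "t \<in> {0..1}" and z: "z \<notin> ball 0 R" for z t
    unfolding S_def
  proof (rule sum.neutral, rule ballI)
    fix b :: 'a assume b: "b \<in> Basis"
    have "z \<notin> ball (c t) (1 / k)"
    proof
      assume "z \<in> ball (c t) (1 / k)"
      then have "norm (z - c t) < 1 / k" by (simp add: dist_norm norm_minus_commute)
      moreover have "norm z \<le> norm (z - c t) + norm (c t)" using norm_triangle_ineq[of "z - c t" "c t"] by simp
      moreover have "norm (c t) \<le> norm x + norm (t *\<^sub>R (y - x))" unfolding c_def by (rule norm_triangle_ineq)
      moreover have "norm (t *\<^sub>R (y - x)) \<le> norm (y - x)" using t by (simp add: mult_left_le_one_le)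
      ultimately show False using z unfolding R_def by simp
    qed
    then show "(y - x) \<bullet> b * (k * d\<Phi> b (k *\<^sub>R (c t - z))) = 0" using mollifier_scaled(6)[OF m k b] by simp
  qed
  \<comment> \<open>Joint integrability, which permits exchanging the kernel variable z and the
    position t.\<close>
  have intS: "integrable (lborel \<Otimes>\<^sub>M lborel) (\<lambda>(z, t). f z * (indicator {0..1} t *\<^sub>R S z t))"
  proof (rule integrableI_bounded)
    show "(\<lambda>(z, t). f z * (indicator {0..1} t *\<^sub>R S z t)) \<in> borel_measurable (lborel \<Otimes>\<^sub>M lborel)" by measurable
    have "(\<integral>\<^sup>+ p. ennreal (norm (case p of (z, t) \<Rightarrow> f z * (indicator {0..1} t *\<^sub>R S z t))) \<partial>(lborel \<Otimes>\<^sub>M lborel))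
      \<le> (\<integral>\<^sup>+ p. (case p of (z, t) \<Rightarrow> ennreal M * (ennreal (norm (f z)) * indicator (ball 0 R) z) * indicator {0..1::real} t) \<partial>(lborel \<Otimes>\<^sub>M lborel))"
    proof (rule nn_integral_mono)
      fix p :: "'a \<times> real"
      obtain z t where p: "p = (z, t)" by (cases p)
      have "ennreal (norm (f z * (indicator {0..1} t *\<^sub>R S z t))) \<le> ennreal M * (ennreal (norm (f z)) * indicator (ball 0 R) z) * indicator {0..1::real} t"
      proof (cases "t \<in> {0..1} \<and> z \<in> ball 0 R")
        case True
        have "\<bar>f z * S z t\<bar> \<le> M * \<bar>f z\<bar>" unfolding abs_mult using S_bd[of z t] by (subst mult.commute) (intro mult_right_mono, auto)
        then show ?thesis using True M0 by (simp flip: ennreal_mult add: ennreal_leI)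
      next
        case False
        then show ?thesis using S_supp[of t z] by (cases "t \<in> {0..1}") auto
      qed
      then show "ennreal (norm (case p of (z, t) \<Rightarrow> f z * (indicator {0..1} t *\<^sub>R S z t))) \<le> (case p of (z, t) \<Rightarrow> ennreal M * (ennreal (norm (f z)) * indicator (ball 0 R) z) * indicator {0..1::real} t)"
        unfolding p by simp
    qed
    also have "\<dots> = (\<integral>\<^sup>+ z. (\<integral>\<^sup>+ t. ennreal M * (ennreal (norm (f z)) * indicator (ball 0 R) z) * indicator {0..1::real} t \<partial>lborel) \<partial>lborel)"
      by (subst lborel.nn_integral_fst[symmetric]) auto
    also have "\<dots> = (\<integral>\<^sup>+ z. ennreal M * (ennreal (norm (f z)) * indicator (ball 0 R) z) \<partial>lborel)"
      by (subst nn_integral_cmult_indicator) auto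
    also have "\<dots> = ennreal M * (\<integral>\<^sup>+ z \<in> ball 0 R. ennreal (norm (f z)) \<partial>lborel)" by (rule nn_integral_cmult) measurable
    also have "\<dots> < \<infinity>" using loc_L1_ball[OF f] by (simp add: ennreal_mult_less_top)
    finally show "(\<integral>\<^sup>+ p. ennreal (norm (case p of (z, t) \<Rightarrow> f z * (indicator {0..1} t *\<^sub>R S z t))) \<partial>(lborel \<Otimes>\<^sub>M lborel)) < \<infinity>" .
  qed
  have int_f: "integrable lborel (\<lambda>z. f z * \<Phi> (k *\<^sub>R (w - z)))" for w
    using loc_L1_integrable_mult[OF f mollifier_scaled(1-3)[OF m k]] .
  have Gb: "loc_L1 (\<lambda>z. (G z - v) \<bullet> b)" "loc_L1 (\<lambda>z. G z \<bullet> b)" if b: "b \<in> Basis" for b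
  proof -
    have "(\<integral>\<^sup>+ z \<in> ball 0 R. ennreal (norm ((G z - w) \<bullet> b)) \<partial>lborel) < \<infinity>" for R w
    proof -
      have "(\<integral>\<^sup>+ z \<in> ball 0 R. ennreal (norm ((G z - w) \<bullet> b)) \<partial>lborel) \<le> (\<integral>\<^sup>+ z. ennreal (norm (G z)) * indicator (ball 0 R) z + ennreal (norm w) * indicator (ball 0 R) z \<partial>lborel)"
        unfolding distrib_right[symmetric]
      proof (intro nn_integral_mono mult_right_mono)
        fix z
        have "norm ((G z - w) \<bullet> b) \<le> norm (G z - w)" using Basis_le_norm[OF b] by simp
        also have "\<dots> \<le> norm (G z) + norm w" by (rule norm_triangle_ineq4)
        finally show "ennreal (norm ((G z - w) \<bullet> b)) \<le> ennreal (norm (G z)) + ennreal (norm w)"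
          by (simp flip: ennreal_plus add: ennreal_leI)
      qed simp
      also have "\<dots> = (\<integral>\<^sup>+ z \<in> ball 0 R. ennreal (norm (G z)) \<partial>lborel) + ennreal (norm w) * emeasure lborel (ball (0::'a) R)"
        by (subst nn_integral_add) (auto simp: nn_integral_cmult_indicator)
      also have "\<dots> < \<infinity>" using loc_L1_ball[OF G] emeasure_lborel_ball_finite[of "0::'a" R] by (auto simp: ennreal_mult_less_top)
      finally show ?thesis .
    qed
    from this[of v] this[of 0] show "loc_L1 (\<lambda>z. (G z - v) \<bullet> b)" "loc_L1 (\<lambda>z. G z \<bullet> b)"
      unfolding loc_L1_def by auto
  qed
  define kn where "kn = k ^ DIM('a) / Z"
  have kn: "kn > 0" unfolding kn_def using k Z by simp
  have inner: "(\<integral>z. f z * S z t \<partial>lborel) = (\<Sum>b\<in>Basis. ((y - x) \<bullet> b) * (\<integral>z. (G z \<bullet> b) * \<Phi> (k *\<^sub>R (c t - z)) \<partial>lborel))" for t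
  proof -
    have i: "integrable lborel (\<lambda>z. f z * (k * d\<Phi> b (k *\<^sub>R (c t - z))))" if "b \<in> Basis" for b
      using integrable_mult_right[OF loc_L1_integrable_mult[OF f mollifier_scaled(4-6)[OF m k that]], of k "c t"] by (simp add: mult.left_commute)
    have "(\<integral>z. f z * S z t \<partial>lborel) = (\<integral>z. (\<Sum>b\<in>Basis. ((y - x) \<bullet> b) * (f z * (k * d\<Phi> b (k *\<^sub>R (c t - z))))) \<partial>lborel)"
      unfolding S_def sum_distrib_left by (simp add: mult.left_commute)
    also have "\<dots> = (\<Sum>b\<in>Basis. ((y - x) \<bullet> b) * (\<integral>z. f z * (k * d\<Phi> b (k *\<^sub>R (c t - z))) \<partial>lborel))"
      using i by (subst Bochner_Integration.integral_sum) (auto intro!: integrable_mult_right)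
    also have "\<dots> = (\<Sum>b\<in>Basis. ((y - x) \<bullet> b) * (\<integral>z. (G z \<bullet> b) * \<Phi> (k *\<^sub>R (c t - z)) \<partial>lborel))"
      by (intro sum.cong refl) (simp add: weak_gradient_mollifier[OF m k _ f G wg])
    finally show ?thesis .
  qed
  \<comment> \<open>The normalised kernel has mass one, so the constant vector v can be subtracted
    under the integral.\<close>
  have inner2: "kn * (\<integral>z. f z * S z t \<partial>lborel) - v \<bullet> (y - x) = kn * (\<integral>z. ((G z - v) \<bullet> (y - x)) * \<Phi> (k *\<^sub>R (c t - z)) \<partial>lborel)" for t
  proof -
    have mass: "kn * (\<integral>z. \<Phi> (k *\<^sub>R (c t - z)) \<partial>lborel) = 1"
      unfolding mollifier_mass(2)[OF m k] kn_def Z_def[symmetric] using k Z by simp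
    have iG: "integrable lborel (\<lambda>z. (G z \<bullet> b) * \<Phi> (k *\<^sub>R (c t - z)))" if "b \<in> Basis" for b
      using loc_L1_integrable_mult[OF Gb(2)[OF that] mollifier_scaled(1-3)[OF m k]] .
    have i1: "integrable lborel (\<lambda>z. \<Sum>b\<in>Basis. ((y - x) \<bullet> b) * ((G z \<bullet> b) * \<Phi> (k *\<^sub>R (c t - z))))"
      using iG by (intro Bochner_Integration.integrable_sum integrable_mult_right) auto
    have eq: "(G z - v) \<bullet> (y - x) * \<Phi> (k *\<^sub>R (c t - z)) = (\<Sum>b\<in>Basis. ((y - x) \<bullet> b) * ((G z \<bullet> b) * \<Phi> (k *\<^sub>R (c t - z)))) - (v \<bullet> (y - x)) * \<Phi> (k *\<^sub>R (c t - z))" for z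
      unfolding inner_diff_left left_diff_distrib euclidean_inner[of "G z" "y - x"] sum_distrib_right by (simp add: algebra_simps)
    have "(\<integral>z. ((G z - v) \<bullet> (y - x)) * \<Phi> (k *\<^sub>R (c t - z)) \<partial>lborel)
      = (\<integral>z. f z * S z t \<partial>lborel) - (v \<bullet> (y - x)) * (\<integral>z. \<Phi> (k *\<^sub>R (c t - z)) \<partial>lborel)"
      unfolding eq inner using i1 iG mollifier_mass(1)[OF m k, of "c t"]
      by (subst Bochner_Integration.integral_diff) (auto simp: Bochner_Integration.integral_sum)
    moreover have "kn * A - C = kn * B" if "B = A - C * D" "kn * D = 1" for A B C D
    proof -
      have "kn * B = kn * A - C * (kn * D)" unfolding that(1) by (simp add: algebra_simps)
      then show ?thesis using that(2) by simp
    qed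
    ultimately show ?thesis using mass by blast
  qed
  have il: "(\<integral>z. f z * (indicator {0..1} t *\<^sub>R S z t) \<partial>lborel) = indicator {0..1} t * (\<integral>z. f z * S z t \<partial>lborel)" for t :: real
  proof -
    have "(\<lambda>z. f z * (indicator {0..1} t *\<^sub>R S z t)) = (\<lambda>z. indicator {0..1} t * (f z * S z t))" by (simp add: fun_eq_iff)
    then show ?thesis by (simp only: integral_mult_right_zero)
  qed
  have diff1: "F y - F x = kn * (\<integral>t. indicator {0..1} t * (\<integral>z. f z * S z t \<partial>lborel) \<partial>lborel)"
  proof -
    have "F y - F x = kn * (\<integral>z. f z * (\<Phi> (k *\<^sub>R (y - z)) - \<Phi> (k *\<^sub>R (x - z))) \<partial>lborel)"
      unfolding F_def kn_def[symmetric] using int_f by (simp add: right_diff_distrib)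
    also have "(\<integral>z. f z * (\<Phi> (k *\<^sub>R (y - z)) - \<Phi> (k *\<^sub>R (x - z))) \<partial>lborel)
        = (\<integral>z. (\<integral>t. f z * (indicator {0..1} t *\<^sub>R S z t) \<partial>lborel) \<partial>lborel)"
      unfolding ftc[symmetric] by simp
    also have "\<dots> = (\<integral>t. (\<integral>z. f z * (indicator {0..1} t *\<^sub>R S z t) \<partial>lborel) \<partial>lborel)"
      using lborel_pair.Fubini_integral[OF intS] by simp
    also have "\<dots> = (\<integral>t. indicator {0..1} t * (\<integral>z. f z * S z t \<partial>lborel) \<partial>lborel)"
      unfolding il by simp
    finally show ?thesis .
  qed
  have intt: "integrable lborel (\<lambda>t. indicator {0..1} t * (\<integral>z. f z * S z t \<partial>lborel))"
    using lborel_pair.integrable_snd[OF intS] unfolding il by simp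
  define Q where "Q = (\<lambda>t. (\<integral>z. ((G z - v) \<bullet> (y - x)) * \<Phi> (k *\<^sub>R (c t - z)) \<partial>lborel))"
  have "F y - F x - v \<bullet> (y - x) = (\<integral>t. kn * (indicator {0..1} t * (\<integral>z. f z * S z t \<partial>lborel)) - indicator {0..1} t * (v \<bullet> (y - x)) \<partial>lborel)"
  proof -
    have "integrable lborel (\<lambda>t. indicator {0..1::real} t * (v \<bullet> (y - x)))" by simp
    then show ?thesis unfolding diff1 using intt by (subst Bochner_Integration.integral_diff) auto
  qed
  also have "(\<lambda>t. kn * (indicator {0..1} t * (\<integral>z. f z * S z t \<partial>lborel)) - indicator {0..1} t * (v \<bullet> (y - x))) = (\<lambda>t. indicator {0..1} t * (kn * Q t))"
    unfolding Q_def inner2[symmetric] by (simp add: indicator_def fun_eq_iff)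
  finally have eqF: "F y - F x - v \<bullet> (y - x) = (\<integral>t. indicator {0..1} t * (kn * Q t) \<partial>lborel)" .
  have "integrable lborel (\<lambda>t. kn * (indicator {0..1} t * (\<integral>z. f z * S z t \<partial>lborel)) - indicator {0..1} t * (v \<bullet> (y - x)))"
    using intt by (intro Bochner_Integration.integrable_diff integrable_mult_right) auto
  moreover have "(\<lambda>t. kn * (indicator {0..1} t * (\<integral>z. f z * S z t \<partial>lborel)) - indicator {0..1} t * (v \<bullet> (y - x))) = (\<lambda>t. indicator {0..1} t * (kn * Q t))"
    unfolding Q_def inner2[symmetric] by (simp add: indicator_def fun_eq_iff)
  ultimately have intQ: "integrable lborel (\<lambda>t. indicator {0..1} t * (kn * Q t))" by simp
  have Qle: "ennreal (norm (kn * Q t)) \<le> ennreal (kn * norm (y - x)) * (\<integral>\<^sup>+ z \<in> ball (c t) (1 / k). ennreal (norm (G z - v)) \<partial>lborel)" for t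
  proof -
    have iQ: "integrable lborel (\<lambda>z. ((G z - v) \<bullet> (y - x)) * \<Phi> (k *\<^sub>R (c t - z)))"
    proof -
      have "integrable lborel (\<lambda>z. \<Sum>b\<in>Basis. ((y - x) \<bullet> b) * (((G z - v) \<bullet> b) * \<Phi> (k *\<^sub>R (c t - z))))"
        using loc_L1_integrable_mult[OF Gb(1) mollifier_scaled(1-3)[OF m k]]
        by (intro Bochner_Integration.integrable_sum integrable_mult_right) auto
      moreover have "(\<Sum>b\<in>Basis. ((y - x) \<bullet> b) * (((G z - v) \<bullet> b) * \<Phi> (k *\<^sub>R (c t - z)))) = ((G z - v) \<bullet> (y - x)) * \<Phi> (k *\<^sub>R (c t - z))" for z
        unfolding euclidean_inner[of "G z - v" "y - x"] sum_distrib_right by (simp add: algebra_simps)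
      ultimately show ?thesis by simp
    qed
    have "ennreal (norm (kn * Q t)) = ennreal kn * ennreal (norm (Q t))" using kn by (simp add: abs_mult ennreal_mult)
    also have "\<dots> \<le> ennreal kn * (\<integral>\<^sup>+ z. ennreal (norm (((G z - v) \<bullet> (y - x)) * \<Phi> (k *\<^sub>R (c t - z)))) \<partial>lborel)"
      unfolding Q_def by (intro mult_left_mono integral_norm_bound_ennreal iQ) simp
    also have "\<dots> \<le> ennreal kn * (\<integral>\<^sup>+ z. ennreal (norm (y - x)) * (ennreal (norm (G z - v)) * indicator (ball (c t) (1 / k)) z) \<partial>lborel)"
    proof (intro mult_left_mono nn_integral_mono)
      fix z
      show "ennreal (norm (((G z - v) \<bullet> (y - x)) * \<Phi> (k *\<^sub>R (c t - z)))) \<le> ennreal (norm (y - x)) * (ennreal (norm (G z - v)) * indicator (ball (c t) (1 / k)) z)"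
      proof (cases "z \<in> ball (c t) (1 / k)")
        case True
        have "\<bar>((G z - v) \<bullet> (y - x)) * \<Phi> (k *\<^sub>R (c t - z))\<bar> \<le> (norm (G z - v) * norm (y - x)) * 1"
          unfolding abs_mult by (intro mult_mono Cauchy_Schwarz_ineq2 mollifier_scaled(2)[OF m k]) auto
        then show ?thesis using True by (simp flip: ennreal_mult add: ennreal_leI mult.commute)
      next
        case False
        then show ?thesis using mollifier_scaled(3)[OF m k False] by simp
      qed
    qed simp
    also have "\<dots> = ennreal kn * (ennreal (norm (y - x)) * (\<integral>\<^sup>+ z \<in> ball (c t) (1 / k). ennreal (norm (G z - v)) \<partial>lborel))"
      by (subst nn_integral_cmult) auto
    finally show ?thesis using kn by (simp add: ennreal_mult mult.assoc)
  qed
  have "ennreal \<bar>F y - F x - v \<bullet> (y - x)\<bar> \<le> (\<integral>\<^sup>+ t. ennreal (norm (indicator {0..1} t * (kn * Q t))) \<partial>lborel)"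
    unfolding eqF using integral_norm_bound_ennreal[OF intQ] by simp
  also have "\<dots> \<le> (\<integral>\<^sup>+ t. ennreal (kn * norm (y - x)) * ((\<integral>\<^sup>+ z \<in> ball (c t) (1 / k). ennreal (norm (G z - v)) \<partial>lborel) * indicator {0..1} t) \<partial>lborel)"
    using Qle by (intro nn_integral_mono) (auto simp: indicator_def)
  also have "\<dots> = ennreal (kn * norm (y - x)) * (\<integral>\<^sup>+ t \<in> {0..1}. (\<integral>\<^sup>+ z \<in> ball (c t) (1 / k). ennreal (norm (G z - v)) \<partial>lborel) \<partial>lborel)"
  proof (rule nn_integral_cmult)
    have "(\<lambda>(t, z). ennreal (norm (G z - v)) * indicator (ball (c t) (1 / k)) z) = (\<lambda>(t, z). ennreal (norm (G z - v)) * (if dist (c t) z < 1 / k then 1 else 0))"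
      by (auto simp: indicator_def)
    moreover have "\<dots> \<in> borel_measurable (borel \<Otimes>\<^sub>M borel)" by measurable
    ultimately have [measurable]: "(\<lambda>(t, z). ennreal (norm (G z - v)) * indicator (ball (c t) (1 / k)) z) \<in> borel_measurable (borel \<Otimes>\<^sub>M borel)" by simp
    show "(\<lambda>t. (\<integral>\<^sup>+ z \<in> ball (c t) (1 / k). ennreal (norm (G z - v)) \<partial>lborel) * indicator {0..1} t) \<in> borel_measurable lborel"
      by measurable
  qed
  finally show ?thesis unfolding c_def kn_def .
qed

lemma measurable_ball_integral [measurable]:
  fixes h :: "'a::euclidean_space \<Rightarrow> ennreal"
  assumes [measurable]: "h \<in> borel_measurable borel"
  shows "(\<lambda>w. \<integral>\<^sup>+ z \<in> ball w \<delta>. h z \<partial>lborel) \<in> borel_measurable borel"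
proof -
  have "(\<lambda>(w, z). h z * indicator (ball w \<delta>) z) = (\<lambda>(w, z). h z * (if dist w z < \<delta> then 1 else 0))"
    by (auto simp: indicator_def)
  moreover have "\<dots> \<in> borel_measurable (borel \<Otimes>\<^sub>M borel)" by measurable
  ultimately have [measurable]: "(\<lambda>(w, z). h z * indicator (ball w \<delta>) z) \<in> borel_measurable (borel \<Otimes>\<^sub>M borel)" by simp
  show ?thesis by measurable
qed

text \<open>Two regimes. If s \<le> \<delta>, every inner ball lies in the ball of radius 2 \<delta>
  about x. Otherwise Tonelli counts each z with the volume of a ball of radius \<delta>, and z lies
  within 2 s of x. The factor \<delta> ^ n obtained in both cases later cancels the normalisation of
  the mollifier.\<close>

lemma iterated_ball_bound:
  fixes h :: "'a::euclidean_space \<Rightarrow> ennreal"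
  assumes [measurable]: "h \<in> borel_measurable borel" and \<delta>: "0 < \<delta>" "\<delta> \<le> r" and K: "K \<ge> 0"
    and bd: "\<And>s. 0 < s \<Longrightarrow> s \<le> 2 * r \<Longrightarrow> (\<integral>\<^sup>+ z \<in> ball x s. h z \<partial>lborel) \<le> ennreal (K * s ^ DIM('a))"
    and s: "0 < s" "s \<le> r"
  shows "(\<integral>\<^sup>+ w \<in> ball x s. (\<integral>\<^sup>+ z \<in> ball w \<delta>. h z \<partial>lborel) \<partial>lborel)
     \<le> ennreal (unit_vol TYPE('a) * 2 ^ DIM('a) * K * \<delta> ^ DIM('a)) * ennreal (s ^ DIM('a))"
proof -
  define V where "V = unit_vol TYPE('a)"
  have V: "V > 0" unfolding V_def by (rule unit_vol_pos)
  show ?thesis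
  proof (cases "s \<le> \<delta>")
    case True
    have H: "(\<integral>\<^sup>+ z \<in> ball w \<delta>. h z \<partial>lborel) \<le> ennreal (K * (2 * \<delta>) ^ DIM('a))" if "w \<in> ball x s" for w
    proof -
      have "ball w \<delta> \<subseteq> ball x (2 * \<delta>)"
      proof
        fix z assume "z \<in> ball w \<delta>"
        then show "z \<in> ball x (2 * \<delta>)" using that True dist_triangle[of x z w] by simp
      qed
      then have "(\<integral>\<^sup>+ z \<in> ball w \<delta>. h z \<partial>lborel) \<le> (\<integral>\<^sup>+ z \<in> ball x (2 * \<delta>). h z \<partial>lborel)"
        by (intro nn_integral_mono) (auto simp: indicator_def)
      also have "\<dots> \<le> ennreal (K * (2 * \<delta>) ^ DIM('a))" using \<delta> by (intro bd) auto
      finally show ?thesis .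
    qed
    have "(\<integral>\<^sup>+ w \<in> ball x s. (\<integral>\<^sup>+ z \<in> ball w \<delta>. h z \<partial>lborel) \<partial>lborel)
      \<le> (\<integral>\<^sup>+ w. ennreal (K * (2 * \<delta>) ^ DIM('a)) * indicator (ball x s) w \<partial>lborel)"
      using H by (intro nn_integral_mono) (auto simp: indicator_def)
    also have "\<dots> = ennreal (K * (2 * \<delta>) ^ DIM('a)) * ennreal (V * s ^ DIM('a))"
      using s unfolding V_def by (subst nn_integral_cmult_indicator) (auto simp: emeasure_lborel_ball)
    also have "\<dots> = ennreal (V * 2 ^ DIM('a) * K * \<delta> ^ DIM('a)) * ennreal (s ^ DIM('a))"
      using V K \<delta> s by (simp flip: ennreal_mult add: power_mult_distrib mult_ac)
    finally show ?thesis unfolding V_def .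
  next
    case False
    have meas: "(\<lambda>(w, z). indicator (ball x s) w * (h z * indicator (ball w \<delta>) z)) \<in> borel_measurable (lborel \<Otimes>\<^sub>M lborel)"
    proof -
      have "(\<lambda>(w, z). indicator (ball x s) w * (h z * indicator (ball w \<delta>) z)) = (\<lambda>(w, z). indicator (ball x s) w * (h z * (if dist w z < \<delta> then 1 else 0)))"
        by (auto simp: indicator_def)
      moreover have "\<dots> \<in> borel_measurable (borel \<Otimes>\<^sub>M borel)" by measurable
      ultimately show ?thesis by simp
    qed
    have "(\<integral>\<^sup>+ w \<in> ball x s. (\<integral>\<^sup>+ z \<in> ball w \<delta>. h z \<partial>lborel) \<partial>lborel)
      = (\<integral>\<^sup>+ w. (\<integral>\<^sup>+ z. indicator (ball x s) w * (h z * indicator (ball w \<delta>) z) \<partial>lborel) \<partial>lborel)"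
      by (subst nn_integral_cmult) (auto simp: mult.commute)
    also have "\<dots> = (\<integral>\<^sup>+ z. (\<integral>\<^sup>+ w. indicator (ball x s) w * (h z * indicator (ball w \<delta>) z) \<partial>lborel) \<partial>lborel)"
      by (rule lborel_pair.Fubini'[symmetric, OF meas])
    also have "\<dots> \<le> (\<integral>\<^sup>+ z. ennreal (V * \<delta> ^ DIM('a)) * (h z * indicator (ball x (2 * s)) z) \<partial>lborel)"
    proof (rule nn_integral_mono)
      fix z
      have "(\<integral>\<^sup>+ w. indicator (ball x s) w * (h z * indicator (ball w \<delta>) z) \<partial>lborel)
        \<le> (\<integral>\<^sup>+ w. (h z * indicator (ball x (2 * s)) z) * indicator (ball z \<delta>) w \<partial>lborel)"
      proof (rule nn_integral_mono)
        fix w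
        show "indicator (ball x s) w * (h z * indicator (ball w \<delta>) z) \<le> (h z * indicator (ball x (2 * s)) z) * indicator (ball z \<delta>) w"
        proof (cases "w \<in> ball x s \<and> z \<in> ball w \<delta>")
          case True
          then have "z \<in> ball x (2 * s)" using False dist_triangle[of x z w] by simp
          then show ?thesis using True by (simp add: dist_commute)
        next
          case False
          then show ?thesis by (auto simp: indicator_def)
        qed
      qed
      also have "\<dots> = ennreal (V * \<delta> ^ DIM('a)) * (h z * indicator (ball x (2 * s)) z)"
        using \<delta> unfolding V_def by (subst nn_integral_cmult_indicator) (auto simp: emeasure_lborel_ball mult.commute)
      finally show "(\<integral>\<^sup>+ w. indicator (ball x s) w * (h z * indicator (ball w \<delta>) z) \<partial>lborel)
        \<le> ennreal (V * \<delta> ^ DIM('a)) * (h z * indicator (ball x (2 * s)) z)" .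
    qed
    also have "\<dots> = ennreal (V * \<delta> ^ DIM('a)) * (\<integral>\<^sup>+ z \<in> ball x (2 * s). h z \<partial>lborel)"
      by (rule nn_integral_cmult) auto
    also have "\<dots> \<le> ennreal (V * \<delta> ^ DIM('a)) * ennreal (K * (2 * s) ^ DIM('a))"
      using s by (intro mult_left_mono bd) auto
    also have "\<dots> = ennreal (V * 2 ^ DIM('a) * K * \<delta> ^ DIM('a)) * ennreal (s ^ DIM('a))"
      using V K \<delta> s by (simp flip: ennreal_mult add: power_mult_distrib mult_ac)
    finally show ?thesis unfolding V_def .
  qed
qed

text \<open>Substituting \<open>w = x + t (y - x)\<close> turns line integrals over a ball into averages over the
  shrunken balls \<open>ball x (t r)\<close>.\<close>

lemma segment_integral_bound:
  fixes H :: "'a::euclidean_space \<Rightarrow> ennreal"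
  assumes [measurable]: "H \<in> borel_measurable borel" and r: "r > 0"
    and bd: "\<And>s. 0 < s \<Longrightarrow> s \<le> r \<Longrightarrow> (\<integral>\<^sup>+ w \<in> ball x s. H w \<partial>lborel) \<le> B * ennreal (s ^ DIM('a))"
  shows "(\<integral>\<^sup>+ y \<in> ball x r. (\<integral>\<^sup>+ t \<in> {0..1}. H (x + t *\<^sub>R (y - x)) \<partial>lborel) \<partial>lborel) \<le> B * ennreal (r ^ DIM('a))"
proof -
  have "(\<integral>\<^sup>+ y \<in> ball x r. (\<integral>\<^sup>+ t \<in> {0..1}. H (x + t *\<^sub>R (y - x)) \<partial>lborel) \<partial>lborel)
    = (\<integral>\<^sup>+ y. (\<integral>\<^sup>+ t. indicator (ball x r) y * (H (x + t *\<^sub>R (y - x)) * indicator {0..1} t) \<partial>lborel) \<partial>lborel)"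
    by (subst nn_integral_cmult) (auto simp: mult.commute)
  also have "\<dots> = (\<integral>\<^sup>+ t. (\<integral>\<^sup>+ y. indicator (ball x r) y * (H (x + t *\<^sub>R (y - x)) * indicator {0..1} t) \<partial>lborel) \<partial>lborel)"
    by (rule lborel_pair.Fubini'[symmetric]) measurable
  also have "\<dots> \<le> (\<integral>\<^sup>+ t. B * ennreal (r ^ DIM('a)) * indicator {0..1::real} t \<partial>lborel)"
  proof (rule nn_integral_mono_AE)
    show "AE t in lborel. (\<integral>\<^sup>+ y. indicator (ball x r) y * (H (x + t *\<^sub>R (y - x)) * indicator {0..1} t) \<partial>lborel) \<le> B * ennreal (r ^ DIM('a)) * indicator {0..1::real} t"
      using AE_lborel_singleton[of "0::real"]
    proof eventually_elim
      case (elim t)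
      show ?case
      proof (cases "t \<in> {0..1}")
        case True
        then have t: "0 < t" "t \<le> 1" using elim by auto
        define T where "T = (\<integral>\<^sup>+ y. indicator (ball x r) y * H (x + t *\<^sub>R (y - x)) \<partial>lborel)"
        have "(\<integral>\<^sup>+ w \<in> ball x (t * r). H w \<partial>lborel)
          = ennreal (\<bar>t\<bar> ^ DIM('a)) * (\<integral>\<^sup>+ y. H ((x - t *\<^sub>R x) + t *\<^sub>R y) * indicator (ball x (t * r)) ((x - t *\<^sub>R x) + t *\<^sub>R y) \<partial>lborel)"
          using t by (intro nn_integral_lborel_affine) auto
        also have "(\<lambda>y. H ((x - t *\<^sub>R x) + t *\<^sub>R y) * indicator (ball x (t * r)) ((x - t *\<^sub>R x) + t *\<^sub>R y)) = (\<lambda>y. indicator (ball x r) y * H (x + t *\<^sub>R (y - x)))"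
        proof
          fix y
          have e: "(x - t *\<^sub>R x) + t *\<^sub>R y = x + t *\<^sub>R (y - x)" by (simp add: algebra_simps)
          have "dist x (x + t *\<^sub>R (y - x)) = t * dist x y" using t by (simp add: dist_norm norm_minus_commute)
          then have "indicator (ball x (t * r)) (x + t *\<^sub>R (y - x)) = (indicator (ball x r) y :: ennreal)"
            using t by (simp add: indicator_def)
          then show "H ((x - t *\<^sub>R x) + t *\<^sub>R y) * indicator (ball x (t * r)) ((x - t *\<^sub>R x) + t *\<^sub>R y) = indicator (ball x r) y * H (x + t *\<^sub>R (y - x))"
            unfolding e by (simp add: mult.commute)
        qed
        finally have "ennreal (t ^ DIM('a)) * T = (\<integral>\<^sup>+ w \<in> ball x (t * r). H w \<partial>lborel)" unfolding T_def using t by simp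
        also have "\<dots> \<le> B * ennreal ((t * r) ^ DIM('a))"
          using t r by (intro bd) (auto simp: mult_le_cancel_right1)
        also have "\<dots> = ennreal (t ^ DIM('a)) * (B * ennreal (r ^ DIM('a)))"
          using t r by (simp add: power_mult_distrib ennreal_mult mult_ac)
        finally have "T \<le> B * ennreal (r ^ DIM('a))" using t by (subst (asm) ennreal_mult_le_mult_iff) auto
        then show ?thesis using True unfolding T_def by simp
      qed simp
    qed
  qed
  also have "\<dots> = B * ennreal (r ^ DIM('a))" by (subst nn_integral_cmult_indicator) auto
  finally show ?thesis .
qed

text \<open>The point is a constant independent of k: the factor k ^ n of the kernel meets (1 / k) ^
  n from \<open>iterated_ball_bound\<close> with \<delta> = 1 / k.\<close>

lemma mollified_L1_bound:
  fixes f :: "'a::euclidean_space \<Rightarrow> real" and v :: 'a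
  assumes m: "mollifier \<Phi> d\<Phi> L" and k: "k > 0" "1 / k \<le> r"
    and f: "loc_L1 f" and G: "loc_L1 G" and wg: "weak_gradient f G" and K: "K \<ge> 0"
    and bd: "\<And>s. 0 < s \<Longrightarrow> s \<le> 2 * r \<Longrightarrow> (\<integral>\<^sup>+ z \<in> ball x s. ennreal (norm (G z - v)) \<partial>lborel) \<le> ennreal (K * s ^ DIM('a))"
  defines "Z \<equiv> (\<integral>u. \<Phi> u \<partial>lborel)"
  defines "F \<equiv> (\<lambda>x. k ^ DIM('a) / Z * (\<integral>z. f z * \<Phi> (k *\<^sub>R (x - z)) \<partial>lborel))"
  shows "(\<integral>\<^sup>+ y \<in> ball x r. ennreal \<bar>F y - F x - v \<bullet> (y - x)\<bar> \<partial>lborel)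
    \<le> ennreal (unit_vol TYPE('a) * 2 ^ DIM('a) / Z * K * r ^ Suc (DIM('a)))"
proof -
  have Z: "Z > 0" unfolding Z_def using m unfolding mollifier_def by blast
  have r: "r > 0" using k by (meson less_le_trans zero_less_divide_1_iff)
  have [measurable]: "G \<in> borel_measurable borel" using G by (rule loc_L1_measurable)
  define H where "H = (\<lambda>w. \<integral>\<^sup>+ z \<in> ball w (1 / k). ennreal (norm (G z - v)) \<partial>lborel)"
  have [measurable]: "H \<in> borel_measurable borel" unfolding H_def by measurable
  define I where "I = (\<lambda>y. \<integral>\<^sup>+ t \<in> {0..1}. H (x + t *\<^sub>R (y - x)) \<partial>lborel)"
  have [measurable]: "I \<in> borel_measurable borel" unfolding I_def by measurable
  define B where "B = unit_vol TYPE('a) * 2 ^ DIM('a) * K * (1 / k) ^ DIM('a)"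
  have B: "B \<ge> 0" unfolding B_def using K k unit_vol_pos[where 'a='a] by simp
  have I_bd: "(\<integral>\<^sup>+ y \<in> ball x r. I y \<partial>lborel) \<le> ennreal B * ennreal (r ^ DIM('a))"
    unfolding I_def
  proof (rule segment_integral_bound[OF _ r])
    show "(\<integral>\<^sup>+ w \<in> ball x s. H w \<partial>lborel) \<le> ennreal B * ennreal (s ^ DIM('a))" if "0 < s" "s \<le> r" for s
      unfolding H_def B_def using k K bd that by (intro iterated_ball_bound) auto
  qed measurable
  define kn where "kn = k ^ DIM('a) / Z"
  have kn: "kn > 0" unfolding kn_def using k Z by simp
  have "(\<integral>\<^sup>+ y \<in> ball x r. ennreal \<bar>F y - F x - v \<bullet> (y - x)\<bar> \<partial>lborel)
     \<le> (\<integral>\<^sup>+ y. ennreal (kn * r) * (I y * indicator (ball x r) y) \<partial>lborel)"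
  proof (rule nn_integral_mono)
    fix y
    show "ennreal \<bar>F y - F x - v \<bullet> (y - x)\<bar> * indicator (ball x r) y \<le> ennreal (kn * r) * (I y * indicator (ball x r) y)"
    proof (cases "y \<in> ball x r")
      case True
      have "ennreal \<bar>F y - F x - v \<bullet> (y - x)\<bar> \<le> ennreal (kn * norm (y - x)) * I y"
        using mollified_difference[OF m k(1) f G wg, of y x v] unfolding F_def Z_def kn_def I_def H_def by simp
      also have "\<dots> \<le> ennreal (kn * r) * I y"
        using True kn by (intro mult_right_mono ennreal_leI mult_left_mono) (auto simp: dist_norm norm_minus_commute)
      finally show ?thesis using True by simp
    qed simp
  qed
  also have "\<dots> = ennreal (kn * r) * (\<integral>\<^sup>+ y \<in> ball x r. I y \<partial>lborel)" by (rule nn_integral_cmult) measurable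
  also have "\<dots> \<le> ennreal (kn * r) * (ennreal B * ennreal (r ^ DIM('a)))" by (intro mult_left_mono I_bd) auto
  also have "\<dots> = ennreal (kn * r * (B * r ^ DIM('a)))" using kn r B by (simp flip: ennreal_mult)
  also have "kn * r * (B * r ^ DIM('a)) = unit_vol TYPE('a) * 2 ^ DIM('a) / Z * K * r ^ Suc (DIM('a))"
    unfolding kn_def B_def using k by (simp add: field_simps power_divide)
  finally show ?thesis .
qed

definition lebesgue_point :: "('a::euclidean_space \<Rightarrow> 'b::real_normed_vector) \<Rightarrow> 'a \<Rightarrow> bool" where
  "lebesgue_point u x \<longleftrightarrow> (\<forall>e>0. \<exists>d>0. \<forall>s. 0 < s \<and> s < d \<longrightarrow>
     (\<integral>\<^sup>+ y \<in> ball x s. ennreal (norm (u y - u x)) \<partial>lborel) \<le> ennreal (e * s ^ DIM('a)))"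

lemma AE_lebesgue_point: "loc_L1 u \<Longrightarrow> AE x in lborel. lebesgue_point u x"
  unfolding loc_L1_def lebesgue_point_def by (intro Lebesgue_differentiation) auto

lemma mollified_tendsto:
  fixes f :: "'a::euclidean_space \<Rightarrow> real"
  assumes m: "mollifier \<Phi> d\<Phi> L" and f: "loc_L1 f" and x: "lebesgue_point f x"
  defines "Z \<equiv> (\<integral>u. \<Phi> u \<partial>lborel)"
  shows "(\<lambda>i. real (Suc i) ^ DIM('a) / Z * (\<integral>z. f z * \<Phi> (real (Suc i) *\<^sub>R (x - z)) \<partial>lborel)) \<longlonglongrightarrow> f x"
proof (rule LIMSEQ_I)
  fix e :: real assume e: "e > 0"
  have [measurable]: "f \<in> borel_measurable borel" using f by (rule loc_L1_measurable)
  have Z: "Z > 0" unfolding Z_def using m unfolding mollifier_def by blast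
  have "e * Z / 2 > 0" using e Z by simp
  then obtain d where d: "d > 0" "\<And>s. 0 < s \<Longrightarrow> s < d \<Longrightarrow>
     (\<integral>\<^sup>+ y \<in> ball x s. ennreal (norm (f y - f x)) \<partial>lborel) \<le> ennreal (e * Z / 2 * s ^ DIM('a))"
    using x unfolding lebesgue_point_def by meson
  obtain N where N: "inverse (real (Suc N)) < d" using reals_Archimedean[OF d(1)] by blast
  have "norm (real (Suc i) ^ DIM('a) / Z * (\<integral>z. f z * \<Phi> (real (Suc i) *\<^sub>R (x - z)) \<partial>lborel) - f x) < e" if i: "i \<ge> N" for i
  proof -
    define k where "k = real (Suc i)"
    have k: "k > 0" unfolding k_def by simp
    have "1 / k \<le> inverse (real (Suc N))" unfolding k_def using i by (simp add: inverse_eq_divide frac_le)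
    then have kd: "0 < 1 / k" "1 / k < d" using N k by auto
    define kn where "kn = k ^ DIM('a) / Z"
    have kn: "kn > 0" unfolding kn_def using k Z by simp
    note [measurable] = mollifier_scaled(1)[OF m k]
    have mass: "kn * (\<integral>z. \<Phi> (k *\<^sub>R (x - z)) \<partial>lborel) = 1"
      unfolding mollifier_mass(2)[OF m k] kn_def Z_def[symmetric] using k Z by simp
    have i1: "integrable lborel (\<lambda>z. f z * \<Phi> (k *\<^sub>R (x - z)))"
      using loc_L1_integrable_mult[OF f mollifier_scaled(1-3)[OF m k]] .
    have i2: "integrable lborel (\<lambda>z. (f z - f x) * \<Phi> (k *\<^sub>R (x - z)))"
      unfolding left_diff_distrib using i1 mollifier_mass(1)[OF m k] by auto
    have "(\<integral>z. (f z - f x) * \<Phi> (k *\<^sub>R (x - z)) \<partial>lborel)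
        = (\<integral>z. f z * \<Phi> (k *\<^sub>R (x - z)) \<partial>lborel) - f x * (\<integral>z. \<Phi> (k *\<^sub>R (x - z)) \<partial>lborel)"
      unfolding left_diff_distrib using i1 mollifier_mass(1)[OF m k] by simp
    moreover have "kn * A - c = kn * B" if "B = A - c * D" "kn * D = 1" for A B c D
    proof -
      have "kn * B = kn * A - c * (kn * D)" unfolding that(1) by (simp add: algebra_simps)
      then show ?thesis using that(2) by simp
    qed
    ultimately have eq: "kn * (\<integral>z. f z * \<Phi> (k *\<^sub>R (x - z)) \<partial>lborel) - f x = kn * (\<integral>z. (f z - f x) * \<Phi> (k *\<^sub>R (x - z)) \<partial>lborel)"
      using mass by blast
    have "ennreal (norm (\<integral>z. (f z - f x) * \<Phi> (k *\<^sub>R (x - z)) \<partial>lborel)) \<le> (\<integral>\<^sup>+ z. ennreal (norm ((f z - f x) * \<Phi> (k *\<^sub>R (x - z)))) \<partial>lborel)"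
      by (rule integral_norm_bound_ennreal[OF i2])
    also have "\<dots> \<le> (\<integral>\<^sup>+ z \<in> ball x (1 / k). ennreal (norm (f z - f x)) \<partial>lborel)"
    proof (rule nn_integral_mono)
      fix z
      show "ennreal (norm ((f z - f x) * \<Phi> (k *\<^sub>R (x - z)))) \<le> ennreal (norm (f z - f x)) * indicator (ball x (1 / k)) z"
      proof (cases "z \<in> ball x (1 / k)")
        case True
        have "\<bar>(f z - f x) * \<Phi> (k *\<^sub>R (x - z))\<bar> \<le> \<bar>f z - f x\<bar> * 1"
          unfolding abs_mult by (intro mult_left_mono mollifier_scaled(2)[OF m k]) auto
        then show ?thesis using True by (simp add: ennreal_leI)
      next
        case False then show ?thesis using mollifier_scaled(3)[OF m k False] by simp
      qed
    qed
    also have "\<dots> \<le> ennreal (e * Z / 2 * (1 / k) ^ DIM('a))" using kd by (intro d(2)) auto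
    finally have "norm (\<integral>z. (f z - f x) * \<Phi> (k *\<^sub>R (x - z)) \<partial>lborel) \<le> e * Z / 2 * (1 / k) ^ DIM('a)"
      using e Z k by (subst (asm) ennreal_le_iff) auto
    then have "norm (kn * (\<integral>z. (f z - f x) * \<Phi> (k *\<^sub>R (x - z)) \<partial>lborel)) \<le> kn * (e * Z / 2 * (1 / k) ^ DIM('a))"
    proof -
      assume le: "norm (\<integral>z. (f z - f x) * \<Phi> (k *\<^sub>R (x - z)) \<partial>lborel) \<le> e * Z / 2 * (1 / k) ^ DIM('a)"
      have "norm (kn * (\<integral>z. (f z - f x) * \<Phi> (k *\<^sub>R (x - z)) \<partial>lborel)) = kn * norm (\<integral>z. (f z - f x) * \<Phi> (k *\<^sub>R (x - z)) \<partial>lborel)"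
        using kn by (simp add: abs_mult)
      also have "\<dots> \<le> kn * (e * Z / 2 * (1 / k) ^ DIM('a))" using kn le by (intro mult_left_mono) auto
      finally show ?thesis .
    qed
    also have "\<dots> = e / 2" unfolding kn_def using k Z by (simp add: field_simps power_divide)
    also have "\<dots> < e" using e by simp
    finally show ?thesis unfolding eq[symmetric] unfolding kn_def k_def .
  qed
  then show "\<exists>no. \<forall>n\<ge>no. norm (real (Suc n) ^ DIM('a) / Z * (\<integral>z. f z * \<Phi> (real (Suc n) *\<^sub>R (x - z)) \<partial>lborel) - f x) < e" by blast
qed

text \<open>Fatou's lemma along mollifications, which converge at Lebesgue points. With v = 0 and K
  from the maximal function this yields the pointwise estimate for the upper bound; with v = G x and
  small K it is the Taylor expansion for the lower bound.\<close>

theorem weak_gradient_affine_bound: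
  obtains C :: real where "C > 0"
    "\<And>(f :: 'a::euclidean_space \<Rightarrow> real) G x v r K. loc_L1 f \<Longrightarrow> loc_L1 G \<Longrightarrow> weak_gradient f G \<Longrightarrow> lebesgue_point f x \<Longrightarrow>
       r > 0 \<Longrightarrow> K \<ge> 0 \<Longrightarrow>
       (\<And>s. 0 < s \<Longrightarrow> s \<le> 2 * r \<Longrightarrow> (\<integral>\<^sup>+ z \<in> ball x s. ennreal (norm (G z - v)) \<partial>lborel) \<le> ennreal (K * s ^ DIM('a))) \<Longrightarrow>
       (\<integral>\<^sup>+ y \<in> ball x r. ennreal \<bar>f y - f x - v \<bullet> (y - x)\<bar> \<partial>lborel) \<le> ennreal (C * K * r ^ Suc (DIM('a)))"
proof -
  obtain \<Phi> :: "'a \<Rightarrow> real" and d\<Phi> L where m: "mollifier \<Phi> d\<Phi> L" using mollifier_exists by blast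
  define Z where "Z = (\<integral>u. \<Phi> u \<partial>lborel)"
  have Z: "Z > 0" unfolding Z_def using m unfolding mollifier_def by blast
  define C where "C = unit_vol TYPE('a) * 2 ^ DIM('a) / Z"
  have C: "C > 0" unfolding C_def using Z unit_vol_pos[where 'a='a] by simp
  have main: "(\<integral>\<^sup>+ y \<in> ball x r. ennreal \<bar>f y - f x - v \<bullet> (y - x)\<bar> \<partial>lborel) \<le> ennreal (C * K * r ^ Suc (DIM('a)))"
    if f: "loc_L1 f" and G: "loc_L1 G" and wg: "weak_gradient f G" and x: "lebesgue_point f x"
      and r: "r > 0" and K: "K \<ge> 0"
      and bd: "\<And>s. 0 < s \<Longrightarrow> s \<le> 2 * r \<Longrightarrow> (\<integral>\<^sup>+ z \<in> ball x s. ennreal (norm (G z - v)) \<partial>lborel) \<le> ennreal (K * s ^ DIM('a))"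
    for f :: "'a \<Rightarrow> real" and G x v r K
  proof -
    have [measurable]: "f \<in> borel_measurable borel" using f by (rule loc_L1_measurable)
    have [measurable]: "\<Phi> \<in> borel_measurable borel"
      using m unfolding mollifier_def by (intro borel_measurable_continuous_onI) blast
    define F where "F = (\<lambda>i x. real (Suc i) ^ DIM('a) / Z * (\<integral>z. f z * \<Phi> (real (Suc i) *\<^sub>R (x - z)) \<partial>lborel))"
    have [measurable]: "F i \<in> borel_measurable borel" for i unfolding F_def by measurable
    have conv: "(\<lambda>i. F i y) \<longlonglongrightarrow> f y" if "lebesgue_point f y" for y
      unfolding F_def Z_def using m f that by (rule mollified_tendsto)
    have "(\<integral>\<^sup>+ y \<in> ball x r. ennreal \<bar>f y - f x - v \<bullet> (y - x)\<bar> \<partial>lborel)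
      \<le> (\<integral>\<^sup>+ y. liminf (\<lambda>i. ennreal \<bar>F i y - F i x - v \<bullet> (y - x)\<bar> * indicator (ball x r) y) \<partial>lborel)"
    proof (rule nn_integral_mono_AE)
      show "AE y in lborel. ennreal \<bar>f y - f x - v \<bullet> (y - x)\<bar> * indicator (ball x r) y
        \<le> liminf (\<lambda>i. ennreal \<bar>F i y - F i x - v \<bullet> (y - x)\<bar> * indicator (ball x r) y)"
        using AE_lebesgue_point[OF f]
      proof eventually_elim
        case (elim y)
        have "(\<lambda>i. ennreal \<bar>F i y - F i x - v \<bullet> (y - x)\<bar>) \<longlonglongrightarrow> ennreal \<bar>f y - f x - v \<bullet> (y - x)\<bar>"
          by (intro tendsto_ennrealI tendsto_rabs tendsto_diff conv elim x tendsto_const)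
        then have "(\<lambda>i. ennreal \<bar>F i y - F i x - v \<bullet> (y - x)\<bar> * indicator (ball x r) y) \<longlonglongrightarrow> ennreal \<bar>f y - f x - v \<bullet> (y - x)\<bar> * indicator (ball x r) y"
          by (cases "y \<in> ball x r") auto
        then show ?case by (simp add: lim_imp_Liminf)
      qed
    qed
    also have "\<dots> \<le> liminf (\<lambda>i. \<integral>\<^sup>+ y \<in> ball x r. ennreal \<bar>F i y - F i x - v \<bullet> (y - x)\<bar> \<partial>lborel)"
      by (rule nn_integral_liminf) measurable
    also have "\<dots> \<le> limsup (\<lambda>i. \<integral>\<^sup>+ y \<in> ball x r. ennreal \<bar>F i y - F i x - v \<bullet> (y - x)\<bar> \<partial>lborel)"
      by (rule Liminf_le_Limsup) simp
    also have "\<dots> \<le> ennreal (C * K * r ^ Suc (DIM('a)))"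
    proof (rule Limsup_bounded)
      obtain N where N: "inverse (real (Suc N)) < r" using reals_Archimedean[OF r] by blast
      have "(\<integral>\<^sup>+ y \<in> ball x r. ennreal \<bar>F i y - F i x - v \<bullet> (y - x)\<bar> \<partial>lborel) \<le> ennreal (C * K * r ^ Suc (DIM('a)))" if "i \<ge> N" for i
      proof -
        have "1 / real (Suc i) \<le> inverse (real (Suc N))" using that by (simp add: inverse_eq_divide frac_le)
        then have "1 / real (Suc i) \<le> r" using N by simp
        then show ?thesis unfolding F_def C_def Z_def
          by (intro mollified_L1_bound[OF m _ _ f G wg K bd]) auto
      qed
      then show "eventually (\<lambda>i. (\<integral>\<^sup>+ y \<in> ball x r. ennreal \<bar>F i y - F i x - v \<bullet> (y - x)\<bar> \<partial>lborel) \<le> ennreal (C * K * r ^ Suc (DIM('a)))) sequentially"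
        unfolding eventually_sequentially by blast
    qed
    finally show ?thesis .
  qed
  show thesis using C main by (rule that)
qed

lemma borel_imp_lebesgue_measurable: "f \<in> borel_measurable borel \<Longrightarrow> f \<in> borel_measurable lebesgue"
  by (simp add: measurable_completion)

text \<open>A Hajlasz type inequality. With r = dist x y, both f x and f y are compared with f z for
  z in the ball of radius r / 2 about the midpoint, which lies in the balls of radius r about x and
  about y.\<close>

lemma weak_gradient_pointwise:
  obtains C :: real where "C > 0"
    "\<And>(f :: 'a::euclidean_space \<Rightarrow> real) G x y. loc_L1 f \<Longrightarrow> loc_L1 G \<Longrightarrow> weak_gradient f G \<Longrightarrow>
       lebesgue_point f x \<Longrightarrow> lebesgue_point f y \<Longrightarrow>
       ennreal \<bar>f x - f y\<bar> \<le> ennreal (C * dist x y) *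
         (maximal (\<lambda>z. ennreal (norm (G z))) x + maximal (\<lambda>z. ennreal (norm (G z))) y)"
proof -
  obtain C :: real where C: "C > 0"
    "\<And>(f :: 'a \<Rightarrow> real) G x v r K. loc_L1 f \<Longrightarrow> loc_L1 G \<Longrightarrow> weak_gradient f G \<Longrightarrow> lebesgue_point f x \<Longrightarrow>
       r > 0 \<Longrightarrow> K \<ge> 0 \<Longrightarrow>
       (\<And>s. 0 < s \<Longrightarrow> s \<le> 2 * r \<Longrightarrow> (\<integral>\<^sup>+ z \<in> ball x s. ennreal (norm (G z - v)) \<partial>lborel) \<le> ennreal (K * s ^ DIM('a))) \<Longrightarrow>
       (\<integral>\<^sup>+ y \<in> ball x r. ennreal \<bar>f y - f x - v \<bullet> (y - x)\<bar> \<partial>lborel) \<le> ennreal (C * K * r ^ Suc (DIM('a)))"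
    using weak_gradient_affine_bound[where 'a='a] by blast
  define V where "V = unit_vol TYPE('a)"
  have V: "V > 0" unfolding V_def by (rule unit_vol_pos)
  have main: "ennreal \<bar>f x - f y\<bar> \<le> ennreal (C * 2 ^ DIM('a) * dist x y) *
         (maximal (\<lambda>z. ennreal (norm (G z))) x + maximal (\<lambda>z. ennreal (norm (G z))) y)"
    if f: "loc_L1 f" and G: "loc_L1 G" and wg: "weak_gradient f G" and x: "lebesgue_point f x" and y: "lebesgue_point f y"
    for f :: "'a \<Rightarrow> real" and G x y
  proof (cases "x = y")
    case False
    define r where "r = dist x y"
    have r: "r > 0" unfolding r_def using False by simp
    have [measurable]: "f \<in> borel_measurable borel" using f by (rule loc_L1_measurable)
    define M where "M = maximal (\<lambda>z. ennreal (norm (G z)))"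
    \<comment> \<open>The maximal function bounds the averages of \<open>norm (G z)\<close> over all
      balls about a, so v = 0 and K = m V are admissible at every radius.\<close>
    have avg: "(\<integral>\<^sup>+ z \<in> ball a r. ennreal \<bar>f z - f a\<bar> \<partial>lborel) \<le> ennreal (C * V * r ^ Suc (DIM('a))) * M a"
      if a: "lebesgue_point f a" for a
    proof (cases "M a")
      case (real m)
      have "(\<integral>\<^sup>+ z \<in> ball a r. ennreal \<bar>f z - f a - 0 \<bullet> (z - a)\<bar> \<partial>lborel) \<le> ennreal (C * (m * V) * r ^ Suc (DIM('a)))"
      proof (rule C(2)[OF f G wg a r])
        show "(\<integral>\<^sup>+ z \<in> ball a s. ennreal (norm (G z - 0)) \<partial>lborel) \<le> ennreal (m * V * s ^ DIM('a))" if "0 < s" for s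
          using maximal_ge[of s a a "\<lambda>z. ennreal (norm (G z))"] that real V
          by (simp add: M_def[symmetric] V_def[symmetric] ennreal_mult[symmetric] mult.assoc)
      qed (use real V in auto)
      also have "\<dots> = ennreal (C * V * r ^ Suc (DIM('a))) * M a"
        using real V C r by (simp flip: ennreal_mult add: mult_ac)
      finally show ?thesis by simp
    next
      case top
      then show ?thesis using C V r by (simp add: ennreal_mult_top)
    qed
    define c where "c = midpoint x y"
    have sub: "ball c (r/2) \<subseteq> ball x r" "ball c (r/2) \<subseteq> ball y r"
    proof -
      have d: "dist x c = r/2" "dist y c = r/2" unfolding c_def r_def by (simp_all add: dist_midpoint)
      show "ball c (r/2) \<subseteq> ball x r"
      proof
        fix z assume "z \<in> ball c (r/2)" then show "z \<in> ball x r" using d(1) dist_triangle[of x z c] by simp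
      qed
      show "ball c (r/2) \<subseteq> ball y r"
      proof
        fix z assume "z \<in> ball c (r/2)" then show "z \<in> ball y r" using d(2) dist_triangle[of y z c] by simp
      qed
    qed
    have "ennreal \<bar>f x - f y\<bar> * ennreal (V * (r/2) ^ DIM('a)) = (\<integral>\<^sup>+ z. ennreal \<bar>f x - f y\<bar> * indicator (ball c (r/2)) z \<partial>lborel)"
      using r unfolding V_def by (subst nn_integral_cmult_indicator) (auto simp: emeasure_lborel_ball)
    also have "\<dots> \<le> (\<integral>\<^sup>+ z. ennreal \<bar>f z - f x\<bar> * indicator (ball x r) z + ennreal \<bar>f z - f y\<bar> * indicator (ball y r) z \<partial>lborel)"
    proof (rule nn_integral_mono)
      fix z
      show "ennreal \<bar>f x - f y\<bar> * indicator (ball c (r/2)) z \<le> ennreal \<bar>f z - f x\<bar> * indicator (ball x r) z + ennreal \<bar>f z - f y\<bar> * indicator (ball y r) z"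
      proof (cases "z \<in> ball c (r/2)")
        case True
        then have "z \<in> ball x r" "z \<in> ball y r" using sub by auto
        then show ?thesis using True by (simp flip: ennreal_plus add: ennreal_leI)
      qed simp
    qed
    also have "\<dots> = (\<integral>\<^sup>+ z \<in> ball x r. ennreal \<bar>f z - f x\<bar> \<partial>lborel) + (\<integral>\<^sup>+ z \<in> ball y r. ennreal \<bar>f z - f y\<bar> \<partial>lborel)"
      by (rule nn_integral_add) auto
    also have "\<dots> \<le> ennreal (C * V * r ^ Suc (DIM('a))) * (M x + M y)"
      unfolding distrib_left by (intro add_mono avg x y)
    also have "ennreal (C * V * r ^ Suc (DIM('a))) = ennreal (V * (r/2) ^ DIM('a)) * ennreal (C * 2 ^ DIM('a) * r)"
      using C V r by (simp flip: ennreal_mult add: power_divide field_simps)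
    finally have "ennreal (V * (r/2) ^ DIM('a)) * ennreal \<bar>f x - f y\<bar> \<le> ennreal (V * (r/2) ^ DIM('a)) * (ennreal (C * 2 ^ DIM('a) * r) * (M x + M y))"
      by (simp add: mult_ac)
    moreover have "ennreal (V * (r/2) ^ DIM('a)) \<noteq> 0" using V r by (simp add: ennreal_eq_0_iff not_le)
    ultimately have "ennreal \<bar>f x - f y\<bar> \<le> ennreal (C * 2 ^ DIM('a) * r) * (M x + M y)"
      by (subst (asm) ennreal_mult_le_mult_iff) (auto simp: less_top[symmetric])
    then show ?thesis unfolding M_def r_def .
  qed simp
  show thesis by (rule that[of "C * 2 ^ DIM('a)"]) (use C main in auto)
qed

section \<open>The upper bound\<close>

text \<open>For \<gamma> > 0 the set is an interval at 0, for \<gamma> < 0 it lies in a half-line at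
  infinity; in both cases the primitive s powr \<gamma> / \<gamma> contributes from one end point
  only.\<close>

lemma nn_integral_powr_level:
  assumes \<gamma>: "\<gamma> \<noteq> 0"
  shows "(\<integral>\<^sup>+ s. ennreal (s powr (\<gamma> - 1)) * indicator {s. 0 < s \<and> ennreal (s powr \<gamma>) < \<sigma>} s \<partial>lborel) \<le> ennreal (1 / \<bar>\<gamma>\<bar>) * \<sigma>"
proof (cases \<sigma>)
  case top then show ?thesis using \<gamma> by (simp add: ennreal_mult_top)
next
  case (real T)
  show ?thesis
  proof (cases "T = 0")
    case True
    then show ?thesis using real by simp
  next
    case False
    then have T: "T > 0" using real by simp
    define a where "a = T powr (1 / \<gamma>)"
    have a: "a > 0" "a powr \<gamma> = T" unfolding a_def using T \<gamma> by (auto simp: powr_powr)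
    show ?thesis
    proof (cases "\<gamma> > 0")
      case True
      have "{s. 0 < s \<and> ennreal (s powr \<gamma>) < \<sigma>} = {s. 0 < s \<and> ennreal s < ennreal a}"
      proof -
        have "s powr \<gamma> < T \<longleftrightarrow> s < a" if "s > 0" for s
          unfolding a(2)[symmetric] using True that a by (meson linorder_not_less powr_less_mono2 powr_mono2 less_imp_le)
        then show ?thesis using real a by (auto simp: ennreal_less_iff)
      qed
      then show ?thesis using nn_integral_powr_below[OF True, of "ennreal a"] a real True by (simp flip: ennreal_mult)
    next
      case neg: False
      then have g: "\<gamma> < 0" using \<gamma> by simp
      have "((\<lambda>s. s powr (\<gamma> - 1)) has_integral -(a powr (\<gamma> - 1 + 1)) / (\<gamma> - 1 + 1)) {a..}"
        using g a by (intro has_integral_powr_to_inf) auto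
      then have "((\<lambda>s. s powr (\<gamma> - 1)) has_integral (T / \<bar>\<gamma>\<bar>)) {a..}" using a g by simp
      then have "((\<lambda>s. if s \<in> {a..} then s powr (\<gamma> - 1) else 0) has_integral (T / \<bar>\<gamma>\<bar>)) UNIV"
        by (subst has_integral_restrict_UNIV)
      then have i: "(\<integral>\<^sup>+ s. ennreal (if s \<in> {a..} then s powr (\<gamma> - 1) else 0) \<partial>lborel) = ennreal (T / \<bar>\<gamma>\<bar>)"
        by (intro nn_integral_has_integral_lborel) auto
      have "(\<integral>\<^sup>+ s. ennreal (s powr (\<gamma> - 1)) * indicator {s. 0 < s \<and> ennreal (s powr \<gamma>) < \<sigma>} s \<partial>lborel)
        \<le> (\<integral>\<^sup>+ s. ennreal (if s \<in> {a..} then s powr (\<gamma> - 1) else 0) \<partial>lborel)"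
      proof (rule nn_integral_mono)
        fix s
        have "a \<le> s" if "0 < s" "s powr \<gamma> < T"
        proof (rule ccontr)
          assume "\<not> a \<le> s"
          then have "a powr \<gamma> \<le> s powr \<gamma>" using g that a by (intro powr_mono2') auto
          then show False using that a by simp
        qed
        then show "ennreal (s powr (\<gamma> - 1)) * indicator {s. 0 < s \<and> ennreal (s powr \<gamma>) < \<sigma>} s \<le> ennreal (if s \<in> {a..} then s powr (\<gamma> - 1) else 0)"
          using real by (auto simp: indicator_def ennreal_less_iff)
      qed
      also have "\<dots> = ennreal (1 / \<bar>\<gamma>\<bar>) * \<sigma>" unfolding i using real by (simp flip: ennreal_mult)
      finally show ?thesis .
    qed
  qed
qed

text \<open>The kernel at distance u is spread over the radii u < s < 2 u, which turns the integral
  into one of ball averages of w around x, each at most M w x. What remains is the one-dimensional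
  integral of s powr (\<gamma> - 1) over a level set.\<close>

lemma kernel_level_bound:
  assumes \<gamma>: "\<gamma> \<noteq> 0"
  obtains C :: real where "C > 0"
    "\<And>(w :: 'a::euclidean_space \<Rightarrow> ennreal) x \<tau>. w \<in> borel_measurable borel \<Longrightarrow>
      (\<integral>\<^sup>+ y. indicator {y. y \<noteq> x \<and> ennreal (dist x y powr \<gamma>) < \<tau>} y * ennreal (dist x y powr (\<gamma> - real DIM('a))) * w y \<partial>lborel)
      \<le> ennreal C * \<tau> * maximal w x"
proof -
  define n where "n = DIM('a)"
  define a where "a = \<gamma> - real n - 1"
  define V where "V = unit_vol TYPE('a)"
  have V: "V > 0" unfolding V_def by (rule unit_vol_pos)
  \<comment> \<open>\<open>c1\<close> and \<open>c2\<close> measure how far s powr a can fall below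
    u powr a, and s powr \<gamma> rise above u powr \<gamma>, for u < s < 2 u and either sign of the
    exponents.\<close>
  define c1 where "c1 = max 1 (2 powr (- a))"
  define c2 where "c2 = max 1 (2 powr \<gamma>)"
  have c: "c1 > 0" "c2 > 0" unfolding c1_def c2_def by auto
  have lower: "ennreal (u powr (\<gamma> - real n)) \<le> ennreal c1 * (\<integral>\<^sup>+ s. ennreal (s powr a) * indicator {u<..<2*u} s \<partial>lborel)" if u: "u > 0" for u
  proof -
    have "u powr a \<le> c1 * s powr a" if s: "s \<in> {u<..<2*u}" for s
    proof (cases "a \<ge> 0")
      case True
      have "u powr a \<le> s powr a" using u s True by (intro powr_mono2) auto
      also have "\<dots> \<le> c1 * s powr a" unfolding c1_def by (simp add: mult_le_cancel_right1)
      finally show ?thesis .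
    next
      case False
      have "(2 * u) powr a \<le> s powr a" using u s False by (intro powr_mono2') auto
      then have "2 powr (- a) * (2 * u) powr a \<le> 2 powr (- a) * s powr a" by (intro mult_left_mono) auto
      also have "2 powr (- a) * (2 * u) powr a = u powr a" using u by (simp add: powr_mult powr_minus field_simps)
      also have "2 powr (- a) * s powr a \<le> c1 * s powr a" unfolding c1_def by (intro mult_right_mono) auto
      finally show ?thesis .
    qed
    then have "(\<integral>\<^sup>+ s. ennreal (u powr a) * indicator {u<..<2*u} s \<partial>lborel) \<le> (\<integral>\<^sup>+ s. ennreal c1 * (ennreal (s powr a) * indicator {u<..<2*u} s) \<partial>lborel)"
      using c by (intro nn_integral_mono) (auto simp: indicator_def simp flip: ennreal_mult intro!: ennreal_leI)
    also have "(\<integral>\<^sup>+ s. ennreal (u powr a) * indicator {u<..<2*u} s \<partial>lborel) = ennreal (u powr a * u)"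
      using u by (subst nn_integral_cmult_indicator) (auto simp: ennreal_mult)
    also have "u powr a * u = u powr (\<gamma> - real n)" using u unfolding a_def by (simp add: powr_diff)
    also have "(\<integral>\<^sup>+ s. ennreal c1 * (ennreal (s powr a) * indicator {u<..<2*u} s) \<partial>lborel) = ennreal c1 * (\<integral>\<^sup>+ s. ennreal (s powr a) * indicator {u<..<2*u} s \<partial>lborel)"
      by (rule nn_integral_cmult) auto
    finally show ?thesis .
  qed
  have level: "ennreal (s powr \<gamma>) < ennreal c2 * \<tau>" if u: "u > 0" "s \<in> {u<..<2*u}" "ennreal (u powr \<gamma>) < \<tau>" for u s \<tau>
  proof -
    have "s powr \<gamma> \<le> c2 * u powr \<gamma>"
    proof (cases "\<gamma> \<ge> 0")
      case True
      have "s powr \<gamma> \<le> (2 * u) powr \<gamma>" using u True by (intro powr_mono2) auto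
      also have "\<dots> = 2 powr \<gamma> * u powr \<gamma>" using u by (simp add: powr_mult)
      also have "\<dots> \<le> c2 * u powr \<gamma>" unfolding c2_def by (intro mult_right_mono) auto
      finally show ?thesis .
    next
      case False
      have "s powr \<gamma> \<le> u powr \<gamma>" using u False by (intro powr_mono2') auto
      also have "\<dots> \<le> c2 * u powr \<gamma>" unfolding c2_def by (simp add: mult_le_cancel_right1)
      finally show ?thesis .
    qed
    then have "ennreal (s powr \<gamma>) \<le> ennreal c2 * ennreal (u powr \<gamma>)" using c by (simp flip: ennreal_mult add: ennreal_leI)
    also have "\<dots> < ennreal c2 * \<tau>" using u(3) c by (intro ennreal_mult_strict_left_mono) auto
    finally show ?thesis .
  qed
  define C where "C = c1 * V * (1 / \<bar>\<gamma>\<bar>) * c2"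
  have C: "C > 0" unfolding C_def using c V \<gamma> by simp
  have main: "(\<integral>\<^sup>+ y. indicator {y. y \<noteq> x \<and> ennreal (dist x y powr \<gamma>) < \<tau>} y * ennreal (dist x y powr (\<gamma> - real DIM('a))) * w y \<partial>lborel)
      \<le> ennreal C * \<tau> * maximal w x" if [measurable]: "w \<in> borel_measurable borel" for w :: "'a \<Rightarrow> ennreal" and x \<tau>
  proof -
    define q where "q = (\<lambda>s. ennreal c1 * (ennreal (s powr a) * indicator {s. 0 < s \<and> ennreal (s powr \<gamma>) < ennreal c2 * \<tau>} s))"
    have [measurable]: "q \<in> borel_measurable borel" unfolding q_def by measurable
    have "(\<integral>\<^sup>+ y. indicator {y. y \<noteq> x \<and> ennreal (dist x y powr \<gamma>) < \<tau>} y * ennreal (dist x y powr (\<gamma> - real DIM('a))) * w y \<partial>lborel)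
      \<le> (\<integral>\<^sup>+ y. (\<integral>\<^sup>+ s. q s * (w y * (if dist x y < s then 1 else 0)) \<partial>lborel) \<partial>lborel)"
    proof (rule nn_integral_mono)
      fix y
      show "indicator {y. y \<noteq> x \<and> ennreal (dist x y powr \<gamma>) < \<tau>} y * ennreal (dist x y powr (\<gamma> - real DIM('a))) * w y
        \<le> (\<integral>\<^sup>+ s. q s * (w y * (if dist x y < s then 1 else 0)) \<partial>lborel)"
      proof (cases "y \<noteq> x \<and> ennreal (dist x y powr \<gamma>) < \<tau>")
        case True
        define u where "u = dist x y"
        have u: "u > 0" "ennreal (u powr \<gamma>) < \<tau>" unfolding u_def using True by auto
        have "ennreal (u powr (\<gamma> - real n)) * w y \<le> (ennreal c1 * (\<integral>\<^sup>+ s. ennreal (s powr a) * indicator {u<..<2*u} s \<partial>lborel)) * w y"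
          by (intro mult_right_mono lower u) simp
        also have "\<dots> = (\<integral>\<^sup>+ s. ennreal c1 * (ennreal (s powr a) * indicator {u<..<2*u} s) * w y \<partial>lborel)"
          by (simp add: nn_integral_cmult nn_integral_multc)
        also have "\<dots> \<le> (\<integral>\<^sup>+ s. q s * (w y * (if u < s then 1 else 0)) \<partial>lborel)"
        proof (rule nn_integral_mono)
          fix s
          show "ennreal c1 * (ennreal (s powr a) * indicator {u<..<2*u} s) * w y \<le> q s * (w y * (if u < s then 1 else 0))"
            using level[OF u(1) _ u(2), of s] u(1) unfolding q_def by (cases "s \<in> {u<..<2*u}") auto
        qed
        finally show ?thesis using True unfolding u_def n_def by simp
      qed simp
    qed
    also have "\<dots> = (\<integral>\<^sup>+ s. (\<integral>\<^sup>+ y. q s * (w y * (if dist x y < s then 1 else 0)) \<partial>lborel) \<partial>lborel)"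
      by (rule lborel_pair.Fubini'[symmetric]) measurable
    also have "\<dots> \<le> (\<integral>\<^sup>+ s. ennreal (c1 * V) * maximal w x * (ennreal (s powr (\<gamma> - 1)) * indicator {s. 0 < s \<and> ennreal (s powr \<gamma>) < ennreal c2 * \<tau>} s) \<partial>lborel)"
    proof (rule nn_integral_mono)
      fix s :: real
      show "(\<integral>\<^sup>+ y. q s * (w y * (if dist x y < s then 1 else 0)) \<partial>lborel) \<le> ennreal (c1 * V) * maximal w x * (ennreal (s powr (\<gamma> - 1)) * indicator {s. 0 < s \<and> ennreal (s powr \<gamma>) < ennreal c2 * \<tau>} s)"
      proof (cases "0 < s \<and> ennreal (s powr \<gamma>) < ennreal c2 * \<tau>")
        case True
        have "(\<integral>\<^sup>+ y. q s * (w y * (if dist x y < s then 1 else 0)) \<partial>lborel) = q s * (\<integral>\<^sup>+ y. w y * (if dist x y < s then 1 else 0) \<partial>lborel)"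
          by (rule nn_integral_cmult) auto
        also have "(\<integral>\<^sup>+ y. w y * (if dist x y < s then 1 else 0) \<partial>lborel) = (\<integral>\<^sup>+ y \<in> ball x s. w y \<partial>lborel)"
          by (intro nn_integral_cong) (auto simp: indicator_def)
        also have "q s * \<dots> \<le> q s * (maximal w x * ennreal (V * s ^ n))"
          unfolding V_def n_def using True by (intro mult_left_mono maximal_ge) auto
        also have "\<dots> = ennreal c1 * ennreal (s powr a) * ennreal (V * s ^ n) * maximal w x"
          using True unfolding q_def by (simp add: mult_ac)
        also have "ennreal c1 * ennreal (s powr a) * ennreal (V * s ^ n) = ennreal (c1 * V) * ennreal (s powr (\<gamma> - 1))"
        proof -
          have "s powr a * s ^ n = s powr (\<gamma> - 1)" using True unfolding a_def
            by (simp add: powr_realpow[symmetric] powr_add[symmetric])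
          then have "c1 * s powr a * (V * s ^ n) = c1 * V * s powr (\<gamma> - 1)" by (metis mult.assoc mult.left_commute)
          then show ?thesis using c V True by (simp flip: ennreal_mult)
        qed
        finally show ?thesis using True by (simp add: mult_ac)
      next
        case False
        then have "q s = 0" unfolding q_def by auto
        then show ?thesis by simp
      qed
    qed
    also have "\<dots> = ennreal (c1 * V) * maximal w x * (\<integral>\<^sup>+ s. ennreal (s powr (\<gamma> - 1)) * indicator {s. 0 < s \<and> ennreal (s powr \<gamma>) < ennreal c2 * \<tau>} s \<partial>lborel)"
      by (rule nn_integral_cmult) measurable
    also have "\<dots> \<le> ennreal (c1 * V) * maximal w x * (ennreal (1 / \<bar>\<gamma>\<bar>) * (ennreal c2 * \<tau>))"
      by (intro mult_left_mono nn_integral_powr_level \<gamma>) simp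
    also have "\<dots> = ennreal C * \<tau> * maximal w x"
    proof -
      have "ennreal C = ennreal (c1 * V) * (ennreal (1 / \<bar>\<gamma>\<bar>) * ennreal c2)"
        unfolding C_def using c V by (subst ennreal_mult[symmetric], simp, simp, subst ennreal_mult[symmetric]) (auto simp: mult.assoc)
      then show ?thesis by (simp only: mult_ac)
    qed
    finally show ?thesis .
  qed
  show thesis using C main by (rule that)
qed

lemma measurable_E_set [measurable]:
  fixes f :: "'a::euclidean_space \<Rightarrow> real"
  assumes [measurable]: "f \<in> borel_measurable borel"
  shows "E_set lam \<beta> f \<in> sets (borel \<Otimes>\<^sub>M borel)"
proof -
  have "{p \<in> space (borel \<Otimes>\<^sub>M borel :: ('a \<times> 'a) measure). fst p \<noteq> snd p \<and> \<bar>f (fst p) - f (snd p)\<bar> > lam * dist (fst p) (snd p) powr (1 + \<beta>)} \<in> sets (borel \<Otimes>\<^sub>M borel)"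
    by measurable
  also have "{p \<in> space (borel \<Otimes>\<^sub>M borel :: ('a \<times> 'a) measure). fst p \<noteq> snd p \<and> \<bar>f (fst p) - f (snd p)\<bar> > lam * dist (fst p) (snd p) powr (1 + \<beta>)} = E_set lam \<beta> f"
    by (auto simp: E_set_def space_pair_measure)
  finally show ?thesis .
qed

text \<open>Dividing the level set inequality by dist x y bounds dist x y powr (\<gamma> / p) by a
  multiple of \<open>Mx + My\<close>. The p-th power of the sum costs 2 powr p, and one of the two
  summands carries at least half, whence the leading 2 in K.\<close>

lemma E_set_level:
  fixes Mx My :: ennreal
  assumes p: "p > 0" and C: "C > 0" and lam: "lam > 0" and E: "(x, y) \<in> E_set lam (\<gamma> / p) f"
    and le: "ennreal \<bar>f x - f y\<bar> \<le> ennreal (C * dist x y) * (Mx + My)"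
  defines "K \<equiv> 2 * (2 powr p * (C / lam) powr p)"
  shows "ennreal (dist x y powr \<gamma>) < ennreal K * epowr Mx p \<or> ennreal (dist x y powr \<gamma>) < ennreal K * epowr My p"
proof (rule ccontr)
  define u where "u = dist x y"
  define K2 where "K2 = 2 powr p * (C / lam) powr p"
  have u: "u > 0" and big: "lam * u powr (1 + \<gamma> / p) < \<bar>f x - f y\<bar>" using E unfolding E_set_def u_def by auto
  define U where "U = ennreal (u powr \<gamma>)"
  assume "\<not> ?thesis"
  then have "ennreal K * epowr Mx p + ennreal K * epowr My p \<le> U + U"
    unfolding U_def u_def by (intro add_mono) (auto simp: not_less)
  then have "ennreal (1/2) * (ennreal K * (epowr Mx p + epowr My p)) \<le> ennreal (1/2) * (U + U)"
    unfolding distrib_left[of "ennreal K"] by (rule mult_left_mono) simp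
  also have "\<dots> = U" by (rule ennreal_half_add_self)
  also have "ennreal (1/2) * (ennreal K * (epowr Mx p + epowr My p)) = ennreal K2 * (epowr Mx p + epowr My p)"
  proof -
    have "ennreal (1/2) * ennreal K = ennreal K2" unfolding K_def K2_def by (subst ennreal_mult[symmetric]) auto
    then show ?thesis by (simp add: mult.assoc[symmetric])
  qed
  finally have 1: "ennreal K2 * (epowr Mx p + epowr My p) \<le> U" .
  have "epowr (Mx + My) p \<le> ennreal (2 powr p) * (epowr Mx p + epowr My p)" by (rule epowr_add_le[OF p])
  also have "\<dots> = ennreal ((lam / C) powr p) * (ennreal K2 * (epowr Mx p + epowr My p))"
  proof -
    have "(lam / C) powr p * K2 = 2 powr p" unfolding K2_def using lam C by (simp add: powr_divide)
    then have "ennreal ((lam / C) powr p) * ennreal K2 = ennreal (2 powr p)"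
      by (subst ennreal_mult[symmetric]) (auto simp: K2_def)
    then show ?thesis by (simp add: mult.assoc[symmetric])
  qed
  also have "\<dots> \<le> ennreal ((lam / C) powr p) * U" by (intro mult_left_mono 1) simp
  also have "\<dots> = epowr (ennreal (lam / C * u powr (\<gamma> / p))) p"
  proof -
    have "(lam / C * u powr (\<gamma> / p)) powr p = (lam / C) powr p * u powr \<gamma>"
      using lam C u p by (subst powr_mult) (auto simp: powr_powr)
    moreover have "epowr (ennreal (lam / C * u powr (\<gamma> / p))) p = ennreal ((lam / C * u powr (\<gamma> / p)) powr p)"
      using lam C by (intro epowr_ennreal) auto
    ultimately show ?thesis unfolding U_def by (simp only: ennreal_mult powr_ge_zero)
  qed
  finally have "Mx + My \<le> ennreal (lam / C * u powr (\<gamma> / p))" using p by (simp add: epowr_le_iff)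
  then have "ennreal \<bar>f x - f y\<bar> \<le> ennreal (C * u) * ennreal (lam / C * u powr (\<gamma> / p))"
    using le unfolding u_def[symmetric] by (meson mult_left_mono order_trans zero_le)
  also have "\<dots> = ennreal (lam * u powr (1 + \<gamma> / p))"
    using C u lam by (simp flip: ennreal_mult add: powr_add mult_ac)
  finally show False using big lam u by (simp add: ennreal_le_iff)
qed

text \<open>By \<open>E_set_level\<close> the level set splits into pairs governed by x and pairs
  governed by y. In the first part y is integrated freely and leaves g x; in the second the order is
  exchanged, and \<open>kernel_level_bound\<close> with weight g leaves the maximal function of
  g.\<close>

lemma level_set_dual_bound:
  assumes p: "p > 0" and \<gamma>: "\<gamma> \<noteq> 0"
  obtains C :: real where "C > 0"
    "\<And>(f :: 'a::euclidean_space \<Rightarrow> real) G g lam. loc_L1 f \<Longrightarrow> loc_L1 G \<Longrightarrow> weak_gradient f G \<Longrightarrow>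
       g \<in> borel_measurable borel \<Longrightarrow> lam > 0 \<Longrightarrow>
       (\<integral>\<^sup>+ x. (\<integral>\<^sup>+ y. indicator (E_set lam (\<gamma> / p) f) (x, y) * ennreal (dist x y powr (\<gamma> - real DIM('a))) \<partial>lborel) * g x \<partial>lborel)
       \<le> ennreal (C * lam powr (- p)) * (\<integral>\<^sup>+ x. epowr (maximal (\<lambda>z. ennreal (norm (G z))) x) p * (g x + maximal g x) \<partial>lborel)"
proof -
  obtain C1 :: real where C1: "C1 > 0"
    "\<And>(f :: 'a \<Rightarrow> real) G x y. loc_L1 f \<Longrightarrow> loc_L1 G \<Longrightarrow> weak_gradient f G \<Longrightarrow>
       lebesgue_point f x \<Longrightarrow> lebesgue_point f y \<Longrightarrow>
       ennreal \<bar>f x - f y\<bar> \<le> ennreal (C1 * dist x y) *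
         (maximal (\<lambda>z. ennreal (norm (G z))) x + maximal (\<lambda>z. ennreal (norm (G z))) y)"
    using weak_gradient_pointwise[where 'a='a] by blast
  obtain C2 :: real where C2: "C2 > 0"
    "\<And>(w :: 'a \<Rightarrow> ennreal) x \<tau>. w \<in> borel_measurable borel \<Longrightarrow>
      (\<integral>\<^sup>+ y. indicator {y. y \<noteq> x \<and> ennreal (dist x y powr \<gamma>) < \<tau>} y * ennreal (dist x y powr (\<gamma> - real DIM('a))) * w y \<partial>lborel)
      \<le> ennreal C2 * \<tau> * maximal w x"
    using kernel_level_bound[OF \<gamma>, where 'a='a] by blast
  define C where "C = C2 * (2 * (2 powr p * C1 powr p))"
  have C: "C > 0" unfolding C_def using C1(1) C2(1) by simp
  have main: "(\<integral>\<^sup>+ x. (\<integral>\<^sup>+ y. indicator (E_set lam (\<gamma> / p) f) (x, y) * ennreal (dist x y powr (\<gamma> - real DIM('a))) \<partial>lborel) * g x \<partial>lborel)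
       \<le> ennreal (C * lam powr (- p)) * (\<integral>\<^sup>+ x. epowr (maximal (\<lambda>z. ennreal (norm (G z))) x) p * (g x + maximal g x) \<partial>lborel)"
    if f: "loc_L1 f" and G: "loc_L1 G" and wg: "weak_gradient f G" and [measurable]: "g \<in> borel_measurable borel" and lam: "lam > 0"
    for f :: "'a \<Rightarrow> real" and G g lam
  proof -
    have [measurable]: "f \<in> borel_measurable borel" using f by (rule loc_L1_measurable)
    define M where "M = maximal (\<lambda>z. ennreal (norm (G z)))"
    have [measurable]: "M \<in> borel_measurable borel" unfolding M_def by measurable
    define K where "K = 2 * (2 powr p * (C1 / lam) powr p)"
    define \<tau> where "\<tau> = (\<lambda>x. ennreal K * epowr (M x) p)"
    have [measurable]: "\<tau> \<in> borel_measurable borel" unfolding \<tau>_def by measurable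
    define k where "k = (\<lambda>x y :: 'a. ennreal (dist x y powr (\<gamma> - real DIM('a))))"
    have [measurable]: "(\<lambda>(x, y). k x y) \<in> borel_measurable (borel \<Otimes>\<^sub>M borel)" unfolding k_def by measurable
    define A where "A = (\<lambda>x y. if y \<noteq> x \<and> ennreal (dist x y powr \<gamma>) < \<tau> x then k x y else 0)"
    have A_meas[measurable]: "(\<lambda>(x, y). A x y) \<in> borel_measurable (borel \<Otimes>\<^sub>M borel)" unfolding A_def by measurable
    have A_int: "(\<integral>\<^sup>+ y. A x y * w y \<partial>lborel) \<le> ennreal C2 * \<tau> x * maximal w x" if "w \<in> borel_measurable borel" for x w
    proof -
      have "(\<integral>\<^sup>+ y. A x y * w y \<partial>lborel) = (\<integral>\<^sup>+ y. indicator {y. y \<noteq> x \<and> ennreal (dist x y powr \<gamma>) < \<tau> x} y * ennreal (dist x y powr (\<gamma> - real DIM('a))) * w y \<partial>lborel)"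
        by (intro nn_integral_cong) (auto simp: A_def k_def indicator_def)
      also have "\<dots> \<le> ennreal C2 * \<tau> x * maximal w x" by (rule C2(2)[OF that])
      finally show ?thesis .
    qed
    have E_le: "indicator (E_set lam (\<gamma> / p) f) (x, y) * k x y \<le> A x y + A y x"
      if "lebesgue_point f x" "lebesgue_point f y" for x y
    proof (cases "(x, y) \<in> E_set lam (\<gamma> / p) f")
      case True
      then have "y \<noteq> x" unfolding E_set_def by auto
      moreover have "ennreal (dist x y powr \<gamma>) < \<tau> x \<or> ennreal (dist x y powr \<gamma>) < \<tau> y"
        unfolding \<tau>_def K_def M_def using p C1(1) lam True C1(2)[OF f G wg that] by (rule E_set_level)
      ultimately show ?thesis using True unfolding A_def k_def by (auto simp: dist_commute)
    qed simp
    have "(\<integral>\<^sup>+ x. (\<integral>\<^sup>+ y. indicator (E_set lam (\<gamma> / p) f) (x, y) * k x y \<partial>lborel) * g x \<partial>lborel)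
      \<le> (\<integral>\<^sup>+ x. (\<integral>\<^sup>+ y. A x y + A y x \<partial>lborel) * g x \<partial>lborel)"
    proof (rule nn_integral_mono_AE, rule eventually_mono[OF AE_lebesgue_point[OF f]])
      fix x assume elim: "lebesgue_point f x"
      have "(\<integral>\<^sup>+ y. indicator (E_set lam (\<gamma> / p) f) (x, y) * k x y \<partial>lborel) \<le> (\<integral>\<^sup>+ y. A x y + A y x \<partial>lborel)"
        using AE_lebesgue_point[OF f] E_le[OF elim] by (intro nn_integral_mono_AE) (auto elim: eventually_mono)
      then show "(\<integral>\<^sup>+ y. indicator (E_set lam (\<gamma> / p) f) (x, y) * k x y \<partial>lborel) * g x \<le> (\<integral>\<^sup>+ y. A x y + A y x \<partial>lborel) * g x"
        by (rule mult_right_mono) simp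
    qed
    also have "\<dots> = (\<integral>\<^sup>+ x. (\<integral>\<^sup>+ y. A x y \<partial>lborel) * g x + (\<integral>\<^sup>+ y. A y x \<partial>lborel) * g x \<partial>lborel)"
      by (simp add: nn_integral_add distrib_right)
    also have "\<dots> = (\<integral>\<^sup>+ x. (\<integral>\<^sup>+ y. A x y \<partial>lborel) * g x \<partial>lborel) + (\<integral>\<^sup>+ x. (\<integral>\<^sup>+ y. A y x \<partial>lborel) * g x \<partial>lborel)"
      by (rule nn_integral_add) measurable
    also have "(\<integral>\<^sup>+ x. (\<integral>\<^sup>+ y. A x y \<partial>lborel) * g x \<partial>lborel) \<le> (\<integral>\<^sup>+ x. ennreal C2 * (\<tau> x * g x) \<partial>lborel)"
    proof (rule nn_integral_mono)
      fix x
      have "(\<integral>\<^sup>+ y. A x y \<partial>lborel) \<le> ennreal C2 * \<tau> x * maximal (\<lambda>_. 1) x" using A_int[of "\<lambda>_. 1" x] by simp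
      also have "\<dots> \<le> ennreal C2 * \<tau> x * 1" by (intro mult_left_mono maximal_const) simp
      finally have "(\<integral>\<^sup>+ y. A x y \<partial>lborel) * g x \<le> ennreal C2 * \<tau> x * 1 * g x" by (rule mult_right_mono) simp
      then show "(\<integral>\<^sup>+ y. A x y \<partial>lborel) * g x \<le> ennreal C2 * (\<tau> x * g x)" by (simp add: mult.assoc)
    qed
    also have "(\<integral>\<^sup>+ x. (\<integral>\<^sup>+ y. A y x \<partial>lborel) * g x \<partial>lborel) = (\<integral>\<^sup>+ x. (\<integral>\<^sup>+ y. A y x * g x \<partial>lborel) \<partial>lborel)"
      by (simp add: nn_integral_multc)
    also have "\<dots> = (\<integral>\<^sup>+ y. (\<integral>\<^sup>+ x. A y x * g x \<partial>lborel) \<partial>lborel)"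
      by (rule lborel_pair.Fubini') measurable
    also have "\<dots> \<le> (\<integral>\<^sup>+ y. ennreal C2 * (\<tau> y * maximal g y) \<partial>lborel)"
      using A_int[of g] by (intro nn_integral_mono) (simp add: mult.assoc)
    also have "(\<integral>\<^sup>+ x. ennreal C2 * (\<tau> x * g x) \<partial>lborel) + (\<integral>\<^sup>+ y. ennreal C2 * (\<tau> y * maximal g y) \<partial>lborel)
      = (\<integral>\<^sup>+ x. ennreal C2 * ennreal K * (epowr (M x) p * (g x + maximal g x)) \<partial>lborel)"
      unfolding \<tau>_def by (subst nn_integral_add[symmetric]) (auto simp: distrib_left mult.assoc)
    also have "\<dots> = ennreal C2 * ennreal K * (\<integral>\<^sup>+ x. epowr (M x) p * (g x + maximal g x) \<partial>lborel)"
      by (rule nn_integral_cmult) measurable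
    also have "ennreal C2 * ennreal K = ennreal (C * lam powr (- p))"
      unfolding C_def K_def using C1(1) C2(1) lam by (simp flip: ennreal_mult add: powr_divide powr_minus field_simps)
    finally show ?thesis unfolding k_def M_def by (simp add: add_mono)
  qed
  show thesis using C main by (rule that)
qed

text \<open>Covers A = 0, by an additive epsilon, and tests with Borel functions only, since every
  Lebesgue measurable function agrees almost everywhere with a Borel one.\<close>

lemma bb_duality0:
  fixes F :: "'a::euclidean_space \<Rightarrow> ennreal"
  assumes N: "ball_banach N" and F: "F \<in> borel_measurable lebesgue" and A: "A < \<infinity>"
    and dual: "\<And>g. g \<in> borel_measurable borel \<Longrightarrow> associate N g \<le> 1 \<Longrightarrow>
        (\<integral>\<^sup>+ x. F x * g x \<partial>lborel) \<le> A"
  shows "N F \<le> A"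
proof (rule ennreal_le_epsilon)
  fix e :: real assume e: "0 < e"
  obtain a where a: "A = ennreal a" "a \<ge> 0" using A by (cases A) auto
  have "N F \<le> ennreal (a + e)"
  proof (rule bb_duality[OF N F])
    fix g :: "'a \<Rightarrow> ennreal" assume g: "g \<in> borel_measurable lebesgue" "associate N g \<le> 1"
    obtain g' where g': "g' \<in> borel_measurable lborel" "AE x in lborel. g x = g' x"
      using completion_ex_borel_measurable[OF g(1)] by auto
    have ae: "AE x in lebesgue. g x = g' x" using g'(2) by (rule AE_completion)
    have "associate N g' \<le> associate N g" using ae by (intro associate_mono) (auto elim: eventually_mono)
    then have "(\<integral>\<^sup>+ x. F x * g' x \<partial>lborel) \<le> A" using g g' by (intro dual) auto
    moreover have "(\<integral>\<^sup>+ x. F x * g x \<partial>lebesgue) = (\<integral>\<^sup>+ x. F x * g' x \<partial>lebesgue)"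
      using ae by (intro nn_integral_cong_AE) (auto elim: eventually_mono)
    ultimately show "(\<integral>\<^sup>+ x. F x * g x \<partial>lebesgue) \<le> ennreal (a + e)"
      using a e by (simp add: nn_integral_completion add_increasing2)
  qed (use a e in auto)
  then show "N F \<le> A + ennreal e" using a e by simp
qed

text \<open>In Y = \<open>convexification N p\<close> the norm of the level set integral is the p-th
  power of the X-norm of its p-th root. A test function g of associate norm at most 1 yields the
  weight g + M g of norm at most 1 + CM. For p > 1 the Fefferman-Stein inequality puts one more M on
  this weight, so the boundedness of M on the associate space is used twice.\<close>

theorem BSVY_upper:
  fixes N :: "('a::euclidean_space) bnorm"
  assumes N: "ball_banach N" and p: "p \<ge> 1" and \<gamma>: "\<gamma> \<noteq> 0"
    and Y: "ball_banach (convexification N p)"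
    and mY: "maximal_bounded (associate (convexification N p))"
    and mN: "p = 1 \<longrightarrow> maximal_bounded N"
  obtains C :: real where "C > 0"
    "\<And>f G. loc_L1 f \<Longrightarrow> loc_L1 G \<Longrightarrow> weak_gradient f G \<Longrightarrow> N (\<lambda>x. ennreal (norm (G x))) < \<infinity> \<Longrightarrow>
       BSVY N p \<gamma> f \<le> ennreal C * N (\<lambda>x. ennreal (norm (G x)))"
proof -
  define Y where "Y = convexification N p"
  have bY: "ball_banach Y" using Y unfolding Y_def .
  have p0: "p > 0" using p by simp
  obtain C1 :: real where C1: "C1 > 0"
    "\<And>(f :: 'a \<Rightarrow> real) G g lam. loc_L1 f \<Longrightarrow> loc_L1 G \<Longrightarrow> weak_gradient f G \<Longrightarrow>
       g \<in> borel_measurable borel \<Longrightarrow> lam > 0 \<Longrightarrow>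
       (\<integral>\<^sup>+ x. (\<integral>\<^sup>+ y. indicator (E_set lam (\<gamma> / p) f) (x, y) * ennreal (dist x y powr (\<gamma> - real DIM('a))) \<partial>lborel) * g x \<partial>lborel)
       \<le> ennreal (C1 * lam powr (- p)) * (\<integral>\<^sup>+ x. epowr (maximal (\<lambda>z. ennreal (norm (G z))) x) p * (g x + maximal g x) \<partial>lborel)"
    using level_set_dual_bound[OF p0 \<gamma>, where 'a='a] by blast
  obtain CM :: real where CM: "CM > 0" "\<And>f. f \<in> borel_measurable lebesgue \<Longrightarrow> associate Y (maximal f) \<le> ennreal CM * associate Y f"
    using mY unfolding maximal_bounded_def Y_def by blast
  have Ypow: "Y (\<lambda>x. epowr (h x) p) = epowr (N h) p" for h
    unfolding Y_def convexification_def using p by (simp add: epowr_epowr)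
  have w_assoc: "associate Y (\<lambda>x. g x + maximal g x) \<le> ennreal (1 + CM)" if g: "g \<in> borel_measurable borel" "associate Y g \<le> 1" for g
  proof -
    have gl: "g \<in> borel_measurable lebesgue" using g by (intro borel_imp_lebesgue_measurable)
    have "associate Y (\<lambda>x. g x + maximal g x) \<le> associate Y g + associate Y (maximal g)"
      by (rule associate_add[OF gl]) (rule borel_imp_lebesgue_measurable, rule measurable_maximal)
    also have "\<dots> \<le> 1 + ennreal CM * 1"
      using g by (intro add_mono order_trans[OF CM(2)[OF gl]] mult_left_mono) auto
    finally show ?thesis using CM(1) by simp
  qed
  have "\<exists>C2>0. \<forall>h g. h \<in> borel_measurable borel \<longrightarrow> g \<in> borel_measurable borel \<longrightarrow> associate Y g \<le> 1 \<longrightarrow> N h < \<infinity> \<longrightarrow>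
     (\<integral>\<^sup>+ x. epowr (maximal h x) p * (g x + maximal g x) \<partial>lborel) \<le> ennreal C2 * epowr (N h) p"
  proof (cases "p = 1")
    case True
    \<comment> \<open>For p = 1 the operator M stays on the gradient and is removed by its
      boundedness on X.\<close>
    have YN: "Y = N" unfolding Y_def convexification_def True by simp
    obtain CN :: real where CN: "CN > 0" "\<And>f. f \<in> borel_measurable lebesgue \<Longrightarrow> N (maximal f) \<le> ennreal CN * N f"
      using mN True unfolding maximal_bounded_def by blast
    show ?thesis
    proof (intro exI[of _ "CN * (1 + CM)"] conjI allI impI)
      fix h g :: "'a \<Rightarrow> ennreal"
      assume h: "h \<in> borel_measurable borel" and g: "g \<in> borel_measurable borel" "associate Y g \<le> 1" and fin: "N h < \<infinity>"
      have mh: "N (maximal h) \<le> ennreal CN * N h" using h by (intro CN borel_imp_lebesgue_measurable)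
      have "(\<integral>\<^sup>+ x. maximal h x * (g x + maximal g x) \<partial>lebesgue) \<le> N (maximal h) * associate N (\<lambda>x. g x + maximal g x)"
      proof (rule bb_Hoelder[OF N])
        show "maximal h \<in> borel_measurable lebesgue" "(\<lambda>x. g x + maximal g x) \<in> borel_measurable lebesgue"
          using g by (auto intro!: borel_imp_lebesgue_measurable borel_measurable_add measurable_maximal)
        show "N (maximal h) < \<infinity>" using fin by (intro le_less_trans[OF mh]) (simp add: ennreal_mult_less_top)
      qed
      also have "\<dots> \<le> (ennreal CN * N h) * ennreal (1 + CM)"
        using w_assoc[OF g] unfolding YN by (intro mult_mono mh) auto
      also have "\<dots> = ennreal (CN * (1 + CM)) * N h" using CN CM by (simp add: ennreal_mult mult_ac)
      finally show "(\<integral>\<^sup>+ x. epowr (maximal h x) p * (g x + maximal g x) \<partial>lborel) \<le> ennreal (CN * (1 + CM)) * epowr (N h) p"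
        using True by (simp add: nn_integral_completion)
    qed (use CN CM in simp)
  next
    case False
    then have p1: "p > 1" using p by simp
    define CF where "CF = p / (p - 1) * 2 powr p * 5 ^ DIM('a)"
    have CF: "CF > 0" unfolding CF_def using p1 by simp
    show ?thesis
    proof (intro exI[of _ "CF * (CM * (1 + CM))"] conjI allI impI)
      fix h g :: "'a \<Rightarrow> ennreal"
      assume h[measurable]: "h \<in> borel_measurable borel" and g[measurable]: "g \<in> borel_measurable borel" and g1: "associate Y g \<le> 1" and fin: "N h < \<infinity>"
      define w where "w = (\<lambda>x. g x + maximal g x)"
      have w[measurable]: "w \<in> borel_measurable borel" unfolding w_def by measurable
      have "(\<integral>\<^sup>+ x. epowr (maximal h x) p * w x \<partial>lborel) \<le> ennreal CF * (\<integral>\<^sup>+ x. epowr (h x) p * maximal w x \<partial>lborel)"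
        unfolding CF_def by (rule Fefferman_Stein[OF p1 h w])
      also have "(\<integral>\<^sup>+ x. epowr (h x) p * maximal w x \<partial>lborel) = (\<integral>\<^sup>+ x. epowr (h x) p * maximal w x \<partial>lebesgue)"
        by (simp add: nn_integral_completion)
      also have "\<dots> \<le> Y (\<lambda>x. epowr (h x) p) * associate Y (maximal w)"
      proof (rule bb_Hoelder[OF bY])
        show "(\<lambda>x. epowr (h x) p) \<in> borel_measurable lebesgue" by (rule borel_imp_lebesgue_measurable) measurable
        show "maximal w \<in> borel_measurable lebesgue" by (rule borel_imp_lebesgue_measurable) measurable
        show "Y (\<lambda>x. epowr (h x) p) < \<infinity>" unfolding Ypow using fin by simp
      qed
      also have "\<dots> \<le> epowr (N h) p * (ennreal CM * ennreal (1 + CM))"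
        unfolding Ypow w_def using w_assoc[OF g g1] borel_imp_lebesgue_measurable[OF w]
        by (intro mult_left_mono order_trans[OF CM(2)]) (auto simp: w_def)
      also have "ennreal CF * (epowr (N h) p * (ennreal CM * ennreal (1 + CM))) = ennreal (CF * (CM * (1 + CM))) * epowr (N h) p"
        using CF CM by (simp add: ennreal_mult mult_ac)
      finally show "(\<integral>\<^sup>+ x. epowr (maximal h x) p * (g x + maximal g x) \<partial>lborel) \<le> ennreal (CF * (CM * (1 + CM))) * epowr (N h) p"
        unfolding w_def by (simp add: mult_left_mono)
    qed (use CF CM in simp)
  qed
  then obtain C2 :: real where C2pos: "C2 > 0" and C2all: "\<forall>h g. h \<in> borel_measurable borel \<longrightarrow> g \<in> borel_measurable borel \<longrightarrow> associate Y g \<le> 1 \<longrightarrow> N h < \<infinity> \<longrightarrow>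
     (\<integral>\<^sup>+ x. epowr (maximal h x) p * (g x + maximal g x) \<partial>lborel) \<le> ennreal C2 * epowr (N h) p" by blast
  note C2 = C2pos C2all[rule_format]
  define C where "C = (C1 * C2) powr (1 / p)"
  have C: "C > 0" unfolding C_def using C1 C2 by simp
  have main: "BSVY N p \<gamma> f \<le> ennreal C * N (\<lambda>x. ennreal (norm (G x)))"
    if f: "loc_L1 f" and G: "loc_L1 G" and wg: "weak_gradient f G" and fin: "N (\<lambda>x. ennreal (norm (G x))) < \<infinity>" for f G
    unfolding BSVY_def
  proof (rule SUP_least)
    fix lam :: real assume "lam \<in> {0<..}"
    then have lam: "lam > 0" by simp
    have [measurable]: "f \<in> borel_measurable borel" "G \<in> borel_measurable borel" using f G by (auto dest: loc_L1_measurable)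
    define \<Phi> where "\<Phi> = (\<lambda>x. \<integral>\<^sup>+ y. indicator (E_set lam (\<gamma> / p) f) (x, y) * ennreal (dist x y powr (\<gamma> - real DIM('a))) \<partial>lborel)"
    have [measurable]: "\<Phi> \<in> borel_measurable borel" unfolding \<Phi>_def by measurable
    define T where "T = N (\<lambda>x. ennreal (norm (G x)))"
    have "Y \<Phi> \<le> ennreal (C1 * lam powr (- p)) * (ennreal C2 * epowr T p)"
    proof (rule bb_duality0[OF bY])
      show "\<Phi> \<in> borel_measurable lebesgue" by (rule borel_imp_lebesgue_measurable) measurable
      show "ennreal (C1 * lam powr (- p)) * (ennreal C2 * epowr T p) < \<infinity>"
        using fin unfolding T_def by (simp add: ennreal_mult_less_top)
      fix g :: "'a \<Rightarrow> ennreal" assume g: "g \<in> borel_measurable borel" "associate Y g \<le> 1"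
      have "(\<integral>\<^sup>+ x. \<Phi> x * g x \<partial>lborel) \<le> ennreal (C1 * lam powr (- p)) * (\<integral>\<^sup>+ x. epowr (maximal (\<lambda>z. ennreal (norm (G z))) x) p * (g x + maximal g x) \<partial>lborel)"
        unfolding \<Phi>_def by (rule C1(2)[OF f G wg g(1) lam])
      also have "\<dots> \<le> ennreal (C1 * lam powr (- p)) * (ennreal C2 * epowr T p)"
        unfolding T_def using g fin by (intro mult_left_mono C2(2)) auto
      finally show "(\<integral>\<^sup>+ x. \<Phi> x * g x \<partial>lborel) \<le> ennreal (C1 * lam powr (- p)) * (ennreal C2 * epowr T p)" .
    qed
    also have "\<dots> = epowr (ennreal (C / lam) * T) p"
    proof -
      have "epowr (ennreal (C / lam)) p = ennreal (C1 * lam powr (- p)) * ennreal C2"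
        using C lam C1 C2 p unfolding C_def by (simp flip: ennreal_mult add: powr_divide powr_powr powr_minus field_simps)
      then show ?thesis using p0 by (simp add: epowr_mult mult.assoc)
    qed
    finally have "epowr (N (\<lambda>x. epowr (\<Phi> x) (1 / p))) p \<le> epowr (ennreal (C / lam) * T) p"
      unfolding Y_def convexification_def .
    then have "N (\<lambda>x. epowr (\<Phi> x) (1 / p)) \<le> ennreal (C / lam) * T" using p0 by (simp add: epowr_le_iff)
    then have "ennreal lam * N (\<lambda>x. epowr (\<Phi> x) (1 / p)) \<le> ennreal lam * (ennreal (C / lam) * T)" by (rule mult_left_mono) simp
    also have "\<dots> = ennreal C * T" using lam C by (simp flip: ennreal_mult mult.assoc)
    finally show "ennreal lam * N (\<lambda>x. epowr (\<integral>\<^sup>+ y. indicator (E_set lam (\<gamma> / p) f) (x, y)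
                         * ennreal (dist x y powr (\<gamma> - real DIM('a))) \<partial>lebesgue) (1 / p)) \<le> ennreal C * N (\<lambda>x. ennreal (norm (G x)))"
      unfolding \<Phi>_def T_def by (simp add: nn_integral_completion)
  qed
  show thesis using C main by (rule that)
qed

section \<open>The lower bound\<close>

text \<open>In units of the scale, the affine part at distance \<tau> in the direction of the
  gradient is \<tau>, and the threshold of the level set is \<tau> powr (1 + \<beta>). So \<tau>
  powr \<beta> < 1 is wanted: \<tau> < 1 for \<beta> > 0 and \<tau> > 1 for \<beta> < 0. Continuity
  then gives a neighbourhood.\<close>

lemma gap_radius:
  fixes \<beta> :: real
  assumes "\<beta> \<noteq> 0"
  obtains \<tau> g \<delta> :: real where "\<tau> > 0" "g > 0" "\<delta> > 0" "\<delta> \<le> \<tau> / 2"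
    "\<And>s. \<bar>s - \<tau>\<bar> < \<delta> \<Longrightarrow> s powr (1 + \<beta>) < \<tau> - \<delta> - g"
proof -
  define \<tau> where "\<tau> = (if \<beta> > 0 then 1/2 else 2 :: real)"
  have \<tau>: "\<tau> > 0" unfolding \<tau>_def by simp
  have "\<tau> powr \<beta> < 1"
  proof (cases "\<beta> > 0")
    case True then show ?thesis unfolding \<tau>_def using powr_less_mono2[of \<beta> "1/2" 1] by simp
  next
    case False
    then have "\<beta> < 0" using assms by simp
    then show ?thesis unfolding \<tau>_def using powr_less_mono[of \<beta> 0 2] by simp
  qed
  then have lt: "\<tau> powr (1 + \<beta>) < \<tau>" using \<tau> by (simp add: powr_add)
  \<comment> \<open>A quarter of the gap each for the margin g, for the radius \<delta> and for the
    oscillation of the power.\<close>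
  define g where "g = (\<tau> - \<tau> powr (1 + \<beta>)) / 4"
  have g: "g > 0" unfolding g_def using lt by simp
  have "isCont (\<lambda>s. s powr (1 + \<beta>)) \<tau>" using \<tau> by (intro continuous_intros) auto
  then obtain d where d: "d > 0" "\<And>s. dist s \<tau> < d \<Longrightarrow> dist (s powr (1 + \<beta>)) (\<tau> powr (1 + \<beta>)) < g"
    unfolding continuous_at_eps_delta using g by (metis)
  define \<delta> where "\<delta> = min d (min g (\<tau> / 2))"
  show thesis
  proof (rule that[OF \<tau> g])
    show "\<delta> > 0" "\<delta> \<le> \<tau> / 2" unfolding \<delta>_def using d g \<tau> by auto
    fix s assume "\<bar>s - \<tau>\<bar> < \<delta>"
    then have "\<bar>s powr (1 + \<beta>) - \<tau> powr (1 + \<beta>)\<bar> < g" using d(2)[of s] unfolding \<delta>_def dist_real_def by simp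
    moreover have "\<delta> \<le> g" unfolding \<delta>_def by simp
    moreover have "4 * g = \<tau> - \<tau> powr (1 + \<beta>)" unfolding g_def by simp
    ultimately show "s powr (1 + \<beta>) < \<tau> - \<delta> - g" by (simp add: abs_less_iff)
  qed
qed

text \<open>The coupling \<open>lam * \<rho> powr (\<gamma> / p) = norm (G x)\<close> makes the
  threshold at distance \<rho> s equal to norm (G x) \<rho> s powr (1 + \<gamma> / p), comparable
  with the affine part. On a ball of radius \<rho> \<delta> around x + \<rho> \<tau> e the affine
  part exceeds it by a margin, which the Taylor error uses up on at most half of the ball.\<close>

lemma slice_lower_bound:
  assumes p: "p > 0" and \<gamma>: "\<gamma> \<noteq> 0"
  obtains c :: real where "c > 0"
    "\<And>(f :: 'a::euclidean_space \<Rightarrow> real) G x. loc_L1 f \<Longrightarrow> loc_L1 G \<Longrightarrow> weak_gradient f G \<Longrightarrow>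
      lebesgue_point f x \<Longrightarrow> lebesgue_point G x \<Longrightarrow> G x \<noteq> 0 \<Longrightarrow>
      \<exists>\<rho>0>0. \<forall>\<rho> lam. 0 < \<rho> \<longrightarrow> \<rho> < \<rho>0 \<longrightarrow> lam > 0 \<longrightarrow> lam * \<rho> powr (\<gamma> / p) = norm (G x) \<longrightarrow>
        ennreal (c * (norm (G x) / lam) powr p) \<le> (\<integral>\<^sup>+ y. indicator (E_set lam (\<gamma> / p) f) (x, y) * ennreal (dist x y powr (\<gamma> - real DIM('a))) \<partial>lborel)"
proof -
  define n where "n = DIM('a)"
  define \<beta> where "\<beta> = \<gamma> / p"
  have \<beta>: "\<beta> \<noteq> 0" unfolding \<beta>_def using p \<gamma> by simp
  obtain \<tau> g \<delta> :: real where \<tau>: "\<tau> > 0" and g: "g > 0" and \<delta>: "\<delta> > 0" "\<delta> \<le> \<tau> / 2"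
    and gap: "\<And>s. \<bar>s - \<tau>\<bar> < \<delta> \<Longrightarrow> s powr (1 + \<beta>) < \<tau> - \<delta> - g"
    by (rule gap_radius[OF \<beta>]) (erule that)
  obtain C :: real where C: "C > 0"
    "\<And>(f :: 'a \<Rightarrow> real) G x v r K. loc_L1 f \<Longrightarrow> loc_L1 G \<Longrightarrow> weak_gradient f G \<Longrightarrow> lebesgue_point f x \<Longrightarrow>
       r > 0 \<Longrightarrow> K \<ge> 0 \<Longrightarrow>
       (\<And>s. 0 < s \<Longrightarrow> s \<le> 2 * r \<Longrightarrow> (\<integral>\<^sup>+ z \<in> ball x s. ennreal (norm (G z - v)) \<partial>lborel) \<le> ennreal (K * s ^ DIM('a))) \<Longrightarrow>
       (\<integral>\<^sup>+ y \<in> ball x r. ennreal \<bar>f y - f x - v \<bullet> (y - x)\<bar> \<partial>lborel) \<le> ennreal (C * K * r ^ Suc (DIM('a)))"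
    using weak_gradient_affine_bound[where 'a='a] by blast
  define V where "V = unit_vol TYPE('a)"
  have V: "V > 0" unfolding V_def by (rule unit_vol_pos)
  define \<kappa> where "\<kappa> = min ((\<tau>/2) powr (\<gamma> - real n)) ((2*\<tau>) powr (\<gamma> - real n))"
  have \<kappa>: "\<kappa> > 0" unfolding \<kappa>_def using \<tau> by simp
  have kern: "\<kappa> \<le> s powr (\<gamma> - real n)" if s: "\<bar>s - \<tau>\<bar> < \<delta>" for s
  proof -
    have s2: "\<tau>/2 \<le> s" "s \<le> 2 * \<tau>" using s \<delta> \<tau> by (auto simp: abs_less_iff)
    show ?thesis
    proof (cases "\<gamma> - real n \<ge> 0")
      case True
      have "(\<tau>/2) powr (\<gamma> - real n) \<le> s powr (\<gamma> - real n)" using s2 \<tau> True by (intro powr_mono2) auto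
      then show ?thesis unfolding \<kappa>_def by simp
    next
      case False
      have "(2*\<tau>) powr (\<gamma> - real n) \<le> s powr (\<gamma> - real n)" using s2 \<tau> False by (intro powr_mono2') auto
      then show ?thesis unfolding \<kappa>_def by simp
    qed
  qed
  define c where "c = \<kappa> * V * \<delta> ^ n / 2"
  have c: "c > 0" unfolding c_def using \<kappa> V \<delta> by simp
  have main: "\<exists>\<rho>0>0. \<forall>\<rho> lam. 0 < \<rho> \<longrightarrow> \<rho> < \<rho>0 \<longrightarrow> lam > 0 \<longrightarrow> lam * \<rho> powr (\<gamma> / p) = norm (G x) \<longrightarrow>
        ennreal (c * (norm (G x) / lam) powr p) \<le> (\<integral>\<^sup>+ y. indicator (E_set lam (\<gamma> / p) f) (x, y) * ennreal (dist x y powr (\<gamma> - real DIM('a))) \<partial>lborel)"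
    if f: "loc_L1 f" and G: "loc_L1 G" and wg: "weak_gradient f G" and x: "lebesgue_point f x" and xG: "lebesgue_point G x" and G0: "G x \<noteq> 0"
    for f :: "'a \<Rightarrow> real" and G x
  proof -
    have [measurable]: "f \<in> borel_measurable borel" using f by (rule loc_L1_measurable)
    define l where "l = norm (G x)"
    have l: "l > 0" unfolding l_def using G0 by simp
    define e where "e = G x /\<^sub>R l"
    have e: "norm e = 1" "G x = l *\<^sub>R e" unfolding e_def l_def using G0 by auto
    \<comment> \<open>Solves C K r ^ (n + 1) = (g l \<rho>) (w / 2), so that Chebyshev's inequality
      confines \<open>Bad\<close> to half the volume of W.\<close>
    define K where "K = g * l * V * \<delta> ^ n / (2 * C * (2 * \<tau>) ^ Suc n)"
    have K: "K > 0" unfolding K_def using g l V \<delta> C(1) \<tau> by simp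
    obtain d where d: "d > 0" "\<And>s. 0 < s \<Longrightarrow> s < d \<Longrightarrow>
      (\<integral>\<^sup>+ y \<in> ball x s. ennreal (norm (G y - G x)) \<partial>lborel) \<le> ennreal (K * s ^ DIM('a))"
      using xG K unfolding lebesgue_point_def by meson
    have "ennreal (c * (l / lam) powr p) \<le> (\<integral>\<^sup>+ y. indicator (E_set lam (\<gamma> / p) f) (x, y) * ennreal (dist x y powr (\<gamma> - real DIM('a))) \<partial>lborel)"
      if \<rho>: "0 < \<rho>" "\<rho> < d / (4 * \<tau>)" and lam: "lam > 0" and eq: "lam * \<rho> powr (\<gamma> / p) = l" for \<rho> lam
    proof -
      define r where "r = 2 * \<tau> * \<rho>"
      have r: "r > 0" unfolding r_def using \<tau> \<rho> by simp
      have rd: "2 * r < d" unfolding r_def using \<rho> \<tau> by (simp add: field_simps)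
      define D where "D = (\<lambda>y. f y - f x - G x \<bullet> (y - x))"
      have [measurable]: "D \<in> borel_measurable borel" unfolding D_def by measurable
      have Dint: "(\<integral>\<^sup>+ y \<in> ball x r. ennreal \<bar>D y\<bar> \<partial>lborel) \<le> ennreal (C * K * r ^ Suc n)"
        unfolding D_def n_def using rd K by (intro C(2)[OF f G wg x r]) (auto intro!: d(2))
      define W where "W = ball (x + (\<rho> * \<tau>) *\<^sub>R e) (\<rho> * \<delta>)"
      define Bad where "Bad = W \<inter> {y. \<bar>D y\<bar> > g * l * \<rho>}"
      have [measurable]: "W \<in> sets borel" "Bad \<in> sets borel" unfolding W_def Bad_def by measurable
      have near: "norm ((y - x) - (\<rho> * \<tau>) *\<^sub>R e) < \<rho> * \<delta>" if "y \<in> W" for y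
        using that unfolding W_def by (simp add: dist_norm norm_minus_commute algebra_simps)
      have sW: "\<bar>norm (y - x) / \<rho> - \<tau>\<bar> < \<delta>" if "y \<in> W" for y
      proof -
        have "\<bar>norm (y - x) - norm ((\<rho> * \<tau>) *\<^sub>R e)\<bar> \<le> norm ((y - x) - (\<rho> * \<tau>) *\<^sub>R e)" by (rule norm_triangle_ineq3)
        then have "\<bar>norm (y - x) - \<rho> * \<tau>\<bar> < \<rho> * \<delta>" using near[OF that] e \<rho> \<tau> by simp
        moreover have "norm (y - x) / \<rho> - \<tau> = (norm (y - x) - \<rho> * \<tau>) / \<rho>" using \<rho> by (simp add: field_simps)
        ultimately show ?thesis using \<rho> by (simp add: abs_divide pos_divide_less_eq mult.commute)
      qed
      have Wr: "W \<subseteq> ball x r"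
      proof
        fix y assume "y \<in> W"
        then have "norm (y - x) / \<rho> < 2 * \<tau>" using sW[of y] \<delta> \<tau> by (auto simp: abs_less_iff)
        then show "y \<in> ball x r" unfolding r_def using \<rho> by (simp add: dist_norm norm_minus_commute pos_divide_less_eq)
      qed
      have inner: "l * \<rho> * (\<tau> - \<delta>) \<le> G x \<bullet> (y - x)" if "y \<in> W" for y
      proof -
        define z where "z = (y - x) - (\<rho> * \<tau>) *\<^sub>R e"
        have "y - x = (\<rho> * \<tau>) *\<^sub>R e + z" unfolding z_def by simp
        then have "e \<bullet> (y - x) = \<rho> * \<tau> + e \<bullet> z"
          using e(1) by (simp add: inner_add_right dot_square_norm)
        moreover have "\<bar>e \<bullet> z\<bar> \<le> norm z" using Cauchy_Schwarz_ineq2[of e z] e(1) by simp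
        moreover have "norm z < \<rho> * \<delta>" unfolding z_def by (rule near[OF that])
        ultimately have "\<rho> * (\<tau> - \<delta>) \<le> e \<bullet> (y - x)" unfolding right_diff_distrib by linarith
        then have "l * (\<rho> * (\<tau> - \<delta>)) \<le> l * (e \<bullet> (y - x))" using l by (intro mult_left_mono) auto
        then show ?thesis by (simp add: e(2) mult.assoc)
      qed
      have good: "(x, y) \<in> E_set lam (\<gamma> / p) f \<and> ennreal (\<kappa> * \<rho> powr (\<gamma> - real n)) \<le> ennreal (dist x y powr (\<gamma> - real n))"
        if y: "y \<in> W - Bad" for y
      proof -
        define s where "s = norm (y - x) / \<rho>"
        have s: "\<bar>s - \<tau>\<bar> < \<delta>" unfolding s_def using sW y by blast
        have s0: "s > 0" using s \<delta> \<tau> by (auto simp: abs_less_iff)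
        have ds: "dist x y = \<rho> * s" unfolding s_def using \<rho> by (simp add: dist_norm norm_minus_commute)
        have "lam * dist x y powr (1 + \<beta>) = (lam * \<rho> powr \<beta>) * \<rho> * s powr (1 + \<beta>)"
          unfolding ds using \<rho> s0 by (simp add: powr_mult powr_add)
        also have "\<dots> = l * \<rho> * s powr (1 + \<beta>)" using eq unfolding \<beta>_def by simp
        also have "\<dots> < l * \<rho> * (\<tau> - \<delta> - g)" using gap[OF s] l \<rho> by (intro mult_strict_left_mono) auto
        also have "\<dots> = l * \<rho> * (\<tau> - \<delta>) - g * l * \<rho>" by (simp add: algebra_simps)
        also have "\<dots> \<le> \<bar>f x - f y\<bar>"
        proof -
          have "\<bar>D y\<bar> \<le> g * l * \<rho>" using y unfolding Bad_def by (auto simp: not_less)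
          moreover have "l * \<rho> * (\<tau> - \<delta>) \<le> G x \<bullet> (y - x)" using inner y by blast
          ultimately show ?thesis unfolding D_def by linarith
        qed
        finally have E: "(x, y) \<in> E_set lam (\<gamma> / p) f" unfolding E_set_def \<beta>_def using s0 ds \<rho> by auto
        have "\<kappa> * \<rho> powr (\<gamma> - real n) \<le> s powr (\<gamma> - real n) * \<rho> powr (\<gamma> - real n)" by (intro mult_right_mono kern s) simp
        also have "\<dots> = dist x y powr (\<gamma> - real n)" unfolding ds using \<rho> s0 by (simp add: powr_mult mult.commute)
        finally show ?thesis using E by (auto intro: ennreal_leI)
      qed
      define w where "w = V * (\<rho> * \<delta>) ^ n"
      have eW: "emeasure lborel W = ennreal w" unfolding W_def w_def V_def n_def using \<rho> \<delta> by (intro emeasure_lborel_ball) auto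
      have w: "w > 0" unfolding w_def using V \<rho> \<delta> by simp
      have eBad: "emeasure lborel Bad \<le> ennreal (w / 2)"
      proof -
        have "ennreal (g * l * \<rho>) * emeasure lborel Bad = (\<integral>\<^sup>+ y. ennreal (g * l * \<rho>) * indicator Bad y \<partial>lborel)"
          by (rule nn_integral_cmult_indicator[symmetric]) simp
        also have "\<dots> \<le> (\<integral>\<^sup>+ y \<in> ball x r. ennreal \<bar>D y\<bar> \<partial>lborel)"
          using Wr by (intro nn_integral_mono) (auto simp: Bad_def indicator_def intro!: ennreal_leI)
        also have "\<dots> \<le> ennreal (C * K * r ^ Suc n)" by (rule Dint)
        also have "C * K * r ^ Suc n = (g * l * \<rho>) * (w / 2)"
        proof -
          have "C * K * (2 * \<tau>) ^ Suc n = g * l * V * \<delta> ^ n / 2" unfolding K_def using C(1) \<tau> by simp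
          then have "C * K * (2 * \<tau>) ^ Suc n * \<rho> ^ Suc n = g * l * V * \<delta> ^ n / 2 * \<rho> ^ Suc n" by simp
          then show ?thesis unfolding r_def w_def by (simp add: power_mult_distrib mult_ac)
        qed
        also have "ennreal \<dots> = ennreal (g * l * \<rho>) * ennreal (w / 2)" using g l \<rho> w by (simp flip: ennreal_mult)
        finally show ?thesis using g l \<rho> by (subst (asm) ennreal_mult_le_mult_iff) (auto simp: ennreal_eq_0_iff not_le)
      qed
      have half: "ennreal (w / 2) \<le> emeasure lborel (W - Bad)"
      proof -
        have BW: "Bad \<subseteq> W" unfolding Bad_def by blast
        have "emeasure lborel (W - Bad) = emeasure lborel W - emeasure lborel Bad"
          using eBad by (intro emeasure_Diff BW) (auto simp: top_unique)
        also have "\<dots> \<ge> ennreal w - ennreal (w / 2)" unfolding eW using eBad by (rule ennreal_minus_mono[OF order_refl])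
        finally show ?thesis using w by (simp add: ennreal_minus)
      qed
      have "ennreal (c * (l / lam) powr p) = ennreal (\<kappa> * \<rho> powr (\<gamma> - real n)) * ennreal (w / 2)"
      proof -
        have "\<rho> powr \<beta> = l / lam" using eq lam unfolding \<beta>_def by (simp add: field_simps)
        then have "(l / lam) powr p = \<rho> powr \<gamma>" unfolding \<beta>_def using p by (metis powr_powr nonzero_eq_divide_eq order_less_irrefl)
        also have "\<dots> = \<rho> powr (\<gamma> - real n) * \<rho> ^ n" using \<rho> by (simp add: powr_realpow[symmetric] powr_add[symmetric])
        finally show ?thesis unfolding c_def w_def using \<kappa> V \<rho> \<delta> by (simp flip: ennreal_mult add: power_mult_distrib mult_ac)
      qed
      also have "\<dots> \<le> ennreal (\<kappa> * \<rho> powr (\<gamma> - real n)) * emeasure lborel (W - Bad)" by (intro mult_left_mono half) simp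
      also have "\<dots> = (\<integral>\<^sup>+ y. ennreal (\<kappa> * \<rho> powr (\<gamma> - real n)) * indicator (W - Bad) y \<partial>lborel)"
        by (rule nn_integral_cmult_indicator[symmetric]) simp
      also have "\<dots> \<le> (\<integral>\<^sup>+ y. indicator (E_set lam (\<gamma> / p) f) (x, y) * ennreal (dist x y powr (\<gamma> - real DIM('a))) \<partial>lborel)"
      proof (rule nn_integral_mono)
        fix y
        show "ennreal (\<kappa> * \<rho> powr (\<gamma> - real n)) * indicator (W - Bad) y \<le> indicator (E_set lam (\<gamma> / p) f) (x, y) * ennreal (dist x y powr (\<gamma> - real DIM('a)))"
        proof (cases "y \<in> W - Bad")
          case True then show ?thesis using good[OF True] unfolding n_def by simp
        qed simp
      qed
      finally show ?thesis .
    qed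
    then show ?thesis unfolding l_def using d(1) \<tau> by (intro exI[of _ "d / (4 * \<tau>)"]) auto
  qed
  show thesis using c main by (rule that)
qed

theorem BSVY_lower:
  fixes N :: "('a::euclidean_space) bnorm"
  assumes N: "ball_banach N" and p: "p \<ge> 1" and \<gamma>: "\<gamma> \<noteq> 0"
  obtains c :: real where "c > 0"
    "\<And>f G. loc_L1 f \<Longrightarrow> loc_L1 G \<Longrightarrow> weak_gradient f G \<Longrightarrow>
       ennreal c * N (\<lambda>x. ennreal (norm (G x))) \<le> BSVY N p \<gamma> f"
proof -
  have p0: "p > 0" using p by simp
  define \<beta> where "\<beta> = \<gamma> / p"
  have \<beta>: "\<beta> \<noteq> 0" unfolding \<beta>_def using p \<gamma> by simp
  obtain c :: real where c: "c > 0"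
    "\<And>(f :: 'a \<Rightarrow> real) G x. loc_L1 f \<Longrightarrow> loc_L1 G \<Longrightarrow> weak_gradient f G \<Longrightarrow>
      lebesgue_point f x \<Longrightarrow> lebesgue_point G x \<Longrightarrow> G x \<noteq> 0 \<Longrightarrow>
      \<exists>\<rho>0>0. \<forall>\<rho> lam. 0 < \<rho> \<longrightarrow> \<rho> < \<rho>0 \<longrightarrow> lam > 0 \<longrightarrow> lam * \<rho> powr (\<gamma> / p) = norm (G x) \<longrightarrow>
        ennreal (c * (norm (G x) / lam) powr p) \<le> (\<integral>\<^sup>+ y. indicator (E_set lam (\<gamma> / p) f) (x, y) * ennreal (dist x y powr (\<gamma> - real DIM('a))) \<partial>lborel)"
    by (rule slice_lower_bound[OF p0 \<gamma>, where 'a='a]) (erule that)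
  define c' where "c' = c powr (1 / p)"
  have c': "c' > 0" unfolding c'_def using c(1) by simp
  have main: "ennreal c' * N (\<lambda>x. ennreal (norm (G x))) \<le> BSVY N p \<gamma> f"
    if f: "loc_L1 f" and G: "loc_L1 G" and wg: "weak_gradient f G" for f G
  proof -
    have [measurable]: "f \<in> borel_measurable borel" "G \<in> borel_measurable borel" using f G by (auto dest: loc_L1_measurable)
    \<comment> \<open>One sequence of levels serves all x: the radii coupled to it are l powr (1 /
      \<beta>) / (i + 1) and tend to 0 for either sign of \<gamma>.\<close>
    define lam where "lam = (\<lambda>i. real (Suc i) powr \<beta>)"
    have lam: "lam i > 0" for i unfolding lam_def by simp
    define \<Phi> where "\<Phi> = (\<lambda>i x. \<integral>\<^sup>+ y. indicator (E_set (lam i) (\<gamma> / p) f) (x, y) * ennreal (dist x y powr (\<gamma> - real DIM('a))) \<partial>lborel)"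
    have [measurable]: "\<Phi> i \<in> borel_measurable borel" for i unfolding \<Phi>_def by measurable
    have \<Phi>l: "(\<lambda>x. epowr (\<Phi> i x) (1 / p)) \<in> borel_measurable lebesgue" for i
      by (rule borel_imp_lebesgue_measurable) measurable
    have "N (\<lambda>x. ennreal c' * ennreal (norm (G x))) \<le> BSVY N p \<gamma> f"
    proof (rule bb_fatou[OF N, where F = "\<lambda>i x. ennreal (lam i) * epowr (\<Phi> i x) (1 / p)"])
      show "(\<lambda>x. ennreal (lam i) * epowr (\<Phi> i x) (1 / p)) \<in> borel_measurable lebesgue" for i
        by (rule borel_imp_lebesgue_measurable) measurable
      show "(\<lambda>x. ennreal c' * ennreal (norm (G x))) \<in> borel_measurable lebesgue"
        by (rule borel_imp_lebesgue_measurable) measurable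
      fix i
      have "N (\<lambda>x. ennreal (lam i) * epowr (\<Phi> i x) (1 / p)) = ennreal (lam i) * N (\<lambda>x. epowr (\<Phi> i x) (1 / p))"
        using lam[of i] by (intro bb_scale[OF N \<Phi>l]) simp
      also have "\<dots> \<le> BSVY N p \<gamma> f"
        unfolding BSVY_def \<Phi>_def using lam[of i] by (intro SUP_upper2[of "lam i"]) (auto simp: nn_integral_completion)
      finally show "N (\<lambda>x. ennreal (lam i) * epowr (\<Phi> i x) (1 / p)) \<le> BSVY N p \<gamma> f" .
    next
      have "AE x in lborel. ennreal c' * ennreal (norm (G x)) \<le> liminf (\<lambda>i. ennreal (lam i) * epowr (\<Phi> i x) (1 / p))"
        using AE_lebesgue_point[OF f] AE_lebesgue_point[OF G]
      proof eventually_elim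
        case (elim x)
        show ?case
        proof (cases "G x = 0")
          case False
          define l where "l = norm (G x)"
          have l: "l > 0" unfolding l_def using False by simp
          obtain \<rho>0 where \<rho>0: "\<rho>0 > 0" "\<And>\<rho> lam. 0 < \<rho> \<Longrightarrow> \<rho> < \<rho>0 \<Longrightarrow> lam > 0 \<Longrightarrow> lam * \<rho> powr (\<gamma> / p) = norm (G x) \<Longrightarrow>
            ennreal (c * (norm (G x) / lam) powr p) \<le> (\<integral>\<^sup>+ y. indicator (E_set lam (\<gamma> / p) f) (x, y) * ennreal (dist x y powr (\<gamma> - real DIM('a))) \<partial>lborel)"
            using c(2)[OF f G wg elim False] by meson
          define \<rho> where "\<rho> = (\<lambda>i. l powr (1 / \<beta>) * inverse (real (Suc i)))"
          have \<rho>: "\<rho> i > 0" for i unfolding \<rho>_def using l by simp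
          have \<rho>lam: "lam i * \<rho> i powr (\<gamma> / p) = norm (G x)" for i
          proof -
            have "\<rho> i powr \<beta> = (l powr (1 / \<beta>)) powr \<beta> * inverse (real (Suc i)) powr \<beta>"
              unfolding \<rho>_def by (rule powr_mult)
            also have "(l powr (1 / \<beta>)) powr \<beta> = l" using l \<beta> by (simp add: powr_powr)
            also have "inverse (real (Suc i)) powr \<beta> = inverse (lam i)" unfolding lam_def by (rule inverse_powr)
            finally show ?thesis using lam[of i] unfolding \<beta>_def[symmetric] l_def[symmetric] by simp
          qed
          have "\<rho> \<longlonglongrightarrow> l powr (1 / \<beta>) * 0" unfolding \<rho>_def by (intro tendsto_intros LIMSEQ_inverse_real_of_nat)
          then have "eventually (\<lambda>i. \<rho> i < \<rho>0) sequentially" using \<rho>0(1) by (intro order_tendstoD) auto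
          then have "eventually (\<lambda>i. ennreal c' * ennreal (norm (G x)) \<le> ennreal (lam i) * epowr (\<Phi> i x) (1 / p)) sequentially"
          proof eventually_elim
            case (elim i)
            have "ennreal (c * (l / lam i) powr p) \<le> \<Phi> i x"
              unfolding \<Phi>_def l_def by (rule \<rho>0(2)[OF \<rho> elim lam \<rho>lam])
            then have "epowr (ennreal (c * (l / lam i) powr p)) (1 / p) \<le> epowr (\<Phi> i x) (1 / p)"
              using p by (intro epowr_mono) auto
            also have "epowr (ennreal (c * (l / lam i) powr p)) (1 / p) = ennreal (c' * (l / lam i))"
            proof -
              have "(c * (l / lam i) powr p) powr (1 / p) = c' * (l / lam i)"
                unfolding c'_def using c(1) l lam[of i] p0 by (subst powr_mult) (auto simp: powr_powr)
              then show ?thesis using c(1) by simp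
            qed
            finally have "ennreal (lam i) * ennreal (c' * (l / lam i)) \<le> ennreal (lam i) * epowr (\<Phi> i x) (1 / p)"
              by (rule mult_left_mono) simp
            moreover have "ennreal (lam i) * ennreal (c' * (l / lam i)) = ennreal c' * ennreal l"
              using lam[of i] c' l by (simp flip: ennreal_mult)
            ultimately show ?case unfolding l_def by simp
          qed
          then show ?thesis by (rule Liminf_bounded)
        qed simp
      qed
      then show "AE x in lebesgue. ennreal c' * ennreal (norm (G x)) \<le> liminf (\<lambda>i. ennreal (lam i) * epowr (\<Phi> i x) (1 / p))"
        by (rule AE_completion)
    qed
    also have "N (\<lambda>x. ennreal c' * ennreal (norm (G x))) = ennreal c' * N (\<lambda>x. ennreal (norm (G x)))"
      using c' by (intro bb_scale[OF N] borel_imp_lebesgue_measurable) auto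
    finally show ?thesis .
  qed
  show thesis using c' main by (rule that)
qed

section \<open>Existence of the weak gradient\<close>

lemma integral_lborel_affine:
  fixes F :: "'a::euclidean_space \<Rightarrow> real"
  assumes [measurable]: "F \<in> borel_measurable borel" and c: "c \<noteq> 0"
  shows "(\<integral>x. F x \<partial>lborel) = \<bar>c\<bar> ^ DIM('a) * (\<integral>x. F (t + c *\<^sub>R x) \<partial>lborel)"
  by (subst lborel_affine[OF c, of t])
     (simp add: integral_density integral_distr)

text \<open>Young's inequality with exponents p and p / (p - 1); it is the supporting line of t powr
  p at a.\<close>

lemma powr_tangent:
  fixes a t p :: real
  assumes p: "p \<ge> 1" and a: "a > 0" and t: "t \<ge> 0"
  shows "p * a powr (p - 1) * t \<le> t powr p + (p - 1) * a powr p"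
proof (cases "p = 1")
  case True
  then show ?thesis using a t by simp
next
  case False
  then have p1: "p > 1" using p by simp
  define q where "q = p / (p - 1)"
  have q: "q > 1" "1 / p + 1 / q = 1" unfolding q_def using p1 by (auto simp: field_simps)
  have "t * a powr (p - 1) \<le> t powr p / p + (a powr (p - 1)) powr q / q"
    using p1 q a t by (intro Youngs_inequality) auto
  also have "(a powr (p - 1)) powr q = a powr p" unfolding q_def using p1 by (simp add: powr_powr)
  finally have "p * (t * a powr (p - 1)) \<le> p * (t powr p / p + a powr p / q)" using p1 by (intro mult_left_mono) auto
  also have "\<dots> = t powr p + (p - 1) * a powr p" unfolding q_def using p1 by (simp add: field_simps)
  finally show ?thesis by (simp add: mult_ac)
qed

text \<open>The supporting line at the mean a = I / v is integrated. Both the counting measure on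
  the scales and Lebesgue measure on \<open>avg_set\<close> are put in later.\<close>

lemma nn_integral_Jensen_powr:
  assumes v: "emeasure M (space M) = ennreal v" "v > 0" and p: "p \<ge> 1" and [measurable]: "h \<in> borel_measurable M"
  shows "epowr (\<integral>\<^sup>+ x. h x \<partial>M) p \<le> ennreal (v powr (p - 1)) * (\<integral>\<^sup>+ x. epowr (h x) p \<partial>M)"
proof -
  have tan: "ennreal (p * a powr (p - 1)) * h x \<le> epowr (h x) p + ennreal ((p - 1) * a powr p)" if a: "a > 0" for a x
  proof (cases "h x")
    case (real t)
    have "ennreal (p * a powr (p - 1) * t) \<le> ennreal (t powr p + (p - 1) * a powr p)"
      using real by (intro ennreal_leI powr_tangent p a) auto
    then show ?thesis using real p by (simp add: ennreal_mult)
  qed simp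
  have int: "ennreal (p * a powr (p - 1)) * (\<integral>\<^sup>+ x. h x \<partial>M) \<le> (\<integral>\<^sup>+ x. epowr (h x) p \<partial>M) + ennreal ((p - 1) * a powr p * v)" if a: "a > 0" for a
  proof -
    have "ennreal (p * a powr (p - 1)) * (\<integral>\<^sup>+ x. h x \<partial>M) = (\<integral>\<^sup>+ x. ennreal (p * a powr (p - 1)) * h x \<partial>M)"
      by (rule nn_integral_cmult[symmetric]) measurable
    also have "\<dots> \<le> (\<integral>\<^sup>+ x. epowr (h x) p + ennreal ((p - 1) * a powr p) \<partial>M)"
      by (intro nn_integral_mono tan a)
    also have "\<dots> = (\<integral>\<^sup>+ x. epowr (h x) p \<partial>M) + ennreal ((p - 1) * a powr p) * ennreal v"
      by (subst nn_integral_add) (auto simp: v)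
    finally show ?thesis using p v by (simp add: ennreal_mult)
  qed
  show ?thesis
  proof (cases "\<integral>\<^sup>+ x. h x \<partial>M")
    case top
    have "(\<integral>\<^sup>+ x. epowr (h x) p \<partial>M) = top"
      using int[of 1] top p by (simp add: ennreal_mult_top top_unique ennreal_add_eq_top)
    then show ?thesis using v by (simp add: ennreal_mult_top)
  next
    case (real I)
    show ?thesis
    proof (cases "I = 0")
      case True then show ?thesis using real by simp
    next
      case False
      then have I: "I > 0" using real by simp
      define a where "a = I / v"
      have a: "a > 0" unfolding a_def using I v by simp
      have aI: "p * a powr (p - 1) * I = a powr p * v + (p - 1) * a powr p * v"
      proof -
        have "a powr (p - 1) * I = a powr p * v" using a v I unfolding a_def by (simp add: powr_diff)
        then show ?thesis by (simp add: algebra_simps)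
      qed
      have "ennreal (a powr p * v) + ennreal ((p - 1) * a powr p * v) = ennreal (p * a powr (p - 1) * I)"
        unfolding aI using p v by (simp flip: ennreal_plus)
      also have "\<dots> = ennreal (p * a powr (p - 1)) * (\<integral>\<^sup>+ x. h x \<partial>M)" using real p by (simp add: ennreal_mult)
      also have "\<dots> \<le> (\<integral>\<^sup>+ x. epowr (h x) p \<partial>M) + ennreal ((p - 1) * a powr p * v)" by (rule int[OF a])
      finally have le: "ennreal (a powr p * v) \<le> (\<integral>\<^sup>+ x. epowr (h x) p \<partial>M)"
        by (simp add: ennreal_add_left_cancel_le add.commute)
      have "epowr (\<integral>\<^sup>+ x. h x \<partial>M) p = ennreal (v powr (p - 1)) * ennreal (a powr p * v)"
      proof -
        have "v powr (p - 1) * (a powr p * v) = I powr p" unfolding a_def using v I by (simp add: powr_divide powr_diff)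
        then show ?thesis using real v by (simp flip: ennreal_mult)
      qed
      also have "\<dots> \<le> ennreal (v powr (p - 1)) * (\<integral>\<^sup>+ x. epowr (h x) p \<partial>M)" by (intro mult_left_mono le) simp
      finally show ?thesis .
    qed
  qed
qed

text \<open>A single summand suffices, that of the level with 2 powr i < t \<le> 2 powr (i + 1).
  Values of t below the lowest level go into the last term.\<close>

lemma dyadic_levels:
  fixes t p :: real and I :: nat
  assumes p: "p > 0" and t: "0 \<le> t" "t \<le> 2 ^ Suc I"
  shows "t powr p \<le> (\<Sum>i\<in>{- int I..int I}. 2 powr p * 2 powr (real_of_int i * p) * (if 2 powr real_of_int i < t then 1 else 0)) + 2 powr (- real I * p)"
proof (cases "t \<le> 2 powr (- real I)")
  case True
  have "t powr p \<le> (2 powr (- real I)) powr p" using True t p by (intro powr_mono2) auto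
  then show ?thesis by (simp add: powr_powr sum_nonneg add_increasing)
next
  case False
  then have tpos: "t > 0" "2 powr (- real I) < t" by (auto intro: less_trans[of _ "2 powr (- real I)"])
  \<comment> \<open>Ceiling minus one keeps the lower inequality strict, as in the definition of the
    level sets.\<close>
  define i where "i = \<lceil>log 2 t\<rceil> - 1"
  have i1: "real_of_int i < log 2 t" "log 2 t \<le> real_of_int i + 1" unfolding i_def by linarith+
  have lt: "2 powr real_of_int i < t" using i1(1) tpos(1) by (simp add: less_log_iff)
  have le: "t \<le> 2 powr (real_of_int i + 1)" using i1(2) tpos(1) by (simp add: log_le_iff)
  have "- real I < log 2 t" using tpos by (simp add: less_log_iff)
  then have ge: "- int I \<le> i" using i1(2) by linarith
  have "log 2 t \<le> real (Suc I)" using t(2) tpos(1) by (simp add: log_le_iff powr_realpow del: of_nat_Suc power_Suc)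
  then have "i \<le> int I" using i1(1) by linarith
  with ge have mem: "i \<in> {- int I..int I}" by simp
  have "t powr p \<le> (2 powr (real_of_int i + 1)) powr p" using le tpos p by (intro powr_mono2) auto
  also have "\<dots> = 2 powr p * 2 powr (real_of_int i * p)"
  proof -
    have "(real_of_int i + 1) * p = p + real_of_int i * p" by (simp add: algebra_simps)
    then have "(2 powr (real_of_int i + 1)) powr p = 2 powr (p + real_of_int i * p)" by (simp only: powr_powr)
    then show ?thesis by (simp only: powr_add[of 2 p])
  qed
  also have "\<dots> = 2 powr p * 2 powr (real_of_int i * p) * (if 2 powr real_of_int i < t then 1 else 0)" using lt by simp
  also have "\<dots> \<le> (\<Sum>i\<in>{- int I..int I}. 2 powr p * 2 powr (real_of_int i * p) * (if 2 powr real_of_int i < t then 1 else 0))"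
    using mem by (intro member_le_sum) auto
  finally show ?thesis by (simp add: add_increasing2)
qed

text \<open>Controls one scale. Since F is at most 2 ^ M and distances are at least (1/2) ^ (2 M),
  the ratio of the increment to h powr (1 + \<gamma> / p) stays below 2 ^ (K M + 1), so O(M) dyadic
  levels account for it. Substituting y = x + (1/2) ^ j u turns the average over W into an integral
  over a shell.\<close>

lemma shell_estimate:
  fixes f F :: "'a::euclidean_space \<Rightarrow> real"
  assumes p: "p \<ge> 1" and [measurable]: "f \<in> borel_measurable borel" "F \<in> borel_measurable borel"
    and Ff: "\<And>x y. \<bar>F x - F y\<bar> \<le> \<bar>f x - f y\<bar>" and F: "\<And>x. \<bar>F x\<bar> \<le> 2 ^ M"
    and W: "W \<in> sets borel" "\<And>u. u \<in> W \<Longrightarrow> 1/2 < norm u \<and> norm u < 1"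
    and w: "emeasure lborel W = ennreal w" "w \<ge> 0"
    and j: "j \<in> {M..<2*M}" and K: "real K \<ge> 3 + 2 * \<bar>\<gamma> / p\<bar> + 2 * \<bar>\<gamma>\<bar>"
  shows "(\<integral>\<^sup>+ u \<in> W. epowr (ennreal (2 ^ j * \<bar>F (x + (1/2) ^ j *\<^sub>R u) - F x\<bar>)) p \<partial>lborel)
    \<le> (\<Sum>i\<in>{- int (K * M)..int (K * M)}. ennreal (2 powr p * 2 powr (real_of_int i * p)) *
         (\<integral>\<^sup>+ y. indicator (E_set (2 powr real_of_int i) (\<gamma> / p) f) (x, y) * ennreal (dist x y powr (\<gamma> - real DIM('a)))
            * indicator {y. (1/2) ^ Suc j < dist x y \<and> dist x y < (1/2) ^ j} y \<partial>lborel))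
      + ennreal (w * (1/2) ^ M)"
proof -
  define \<epsilon> where "\<epsilon> = (1/2::real) ^ j"
  define \<beta> where "\<beta> = \<gamma> / p"
  define n where "n = DIM('a)"
  have \<epsilon>: "\<epsilon> > 0" unfolding \<epsilon>_def by simp
  have \<epsilon>inv: "2 ^ j = 1 / \<epsilon>" unfolding \<epsilon>_def by (simp add: power_divide)
  have \<epsilon>1: "\<epsilon> \<le> 1" unfolding \<epsilon>_def by (simp add: power_le_one)
  have [measurable]: "W \<in> sets borel" by (rule W)
  define c where "c = (\<lambda>i::int. 2 powr p * 2 powr (real_of_int i * p))"
  define H where "H = (\<lambda>i y. indicator (E_set (2 powr real_of_int i) (\<gamma> / p) f) (x, y) * ennreal (dist x y powr (\<gamma> - real n))
            * indicator {y. (1/2) ^ Suc j < dist x y \<and> dist x y < (1/2) ^ j} y)"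
  have [measurable]: "H i \<in> borel_measurable borel" for i unfolding H_def by measurable
  define S where "S = {- int (K * M)..int (K * M)}"
  have pt: "epowr (ennreal (2 ^ j * \<bar>F (x + \<epsilon> *\<^sub>R u) - F x\<bar>)) p
      \<le> (\<Sum>i\<in>S. ennreal (c i) * (ennreal (\<epsilon> ^ n) * H i (x + \<epsilon> *\<^sub>R u))) + ennreal ((1/2) ^ M)" if u: "u \<in> W" for u
  proof -
    define y where "y = x + \<epsilon> *\<^sub>R u"
    define h where "h = dist x y"
    have h_eq: "h = \<epsilon> * norm u" unfolding h_def y_def using \<epsilon> by (simp add: dist_norm)
    have "norm u > 0" using W(2)[OF u] by linarith
    then have hb: "\<epsilon> / 2 < h" "h < \<epsilon>" "h > 0" using W(2)[OF u] \<epsilon> unfolding h_eq by auto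
    have hM: "(1/2) ^ (2 * M) \<le> h"
    proof -
      have "(1/2::real) ^ (2 * M) \<le> (1/2) ^ Suc j" using j by (intro power_decreasing) auto
      also have "\<dots> = \<epsilon> / 2" unfolding \<epsilon>_def by simp
      finally show ?thesis using hb by simp
    qed
    have h1: "h < 1" using hb \<epsilon>1 by simp
    have hpow: "h powr e \<le> 2 powr (2 * real M * \<bar>e\<bar>)" for e
    proof -
      have "h powr e \<le> h powr (- \<bar>e\<bar>)" using hb h1 by (intro powr_mono') auto
      also have "\<dots> \<le> ((1/2) ^ (2 * M)) powr (- \<bar>e\<bar>)" using hM by (intro powr_mono2') auto
      also have "((1/2::real) ^ (2 * M)) = 2 powr (- (2 * real M))"
        by (simp add: powr_minus powr_realpow[symmetric] power_one_over inverse_eq_divide)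
      also have "(2 powr (- (2 * real M))) powr (- \<bar>e\<bar>) = 2 powr (2 * real M * \<bar>e\<bar>)" by (simp add: powr_powr)
      finally show ?thesis .
    qed
    \<comment> \<open>The critical level: \<open>(x, y)\<close> lies in the level set of f for every
      level below t.\<close>
    define t where "t = \<bar>F y - F x\<bar> * h powr (- (1 + \<beta>))"
    have t0: "t \<ge> 0" unfolding t_def by simp
    have tle: "t \<le> 2 ^ Suc (K * M)"
    proof -
      have "\<bar>F y - F x\<bar> \<le> 2 * 2 ^ M" using F[of y] F[of x] by linarith
      then have "t \<le> (2 * 2 ^ M) * 2 powr (2 * real M * \<bar>- (1 + \<beta>)\<bar>)"
        unfolding t_def using hpow by (intro mult_mono) auto
      also have "\<dots> \<le> (2 * 2 ^ M) * 2 powr (2 * real M * (1 + \<bar>\<beta>\<bar>))"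
        by (intro mult_left_mono powr_mono mult_left_mono) auto
      also have "\<dots> = 2 powr (1 + real M + 2 * real M * (1 + \<bar>\<beta>\<bar>))"
        by (simp add: powr_add powr_realpow)
      also have "\<dots> \<le> 2 powr (real (Suc (K * M)))"
      proof (intro powr_mono)
        \<comment> \<open>Of the 3, one comes from the height 2 ^ M of F and two from h \<ge> (1/2)
          ^ (2 M).\<close>
        have "real M * (3 + 2 * \<bar>\<beta>\<bar>) \<le> real M * real K" using K unfolding \<beta>_def by (intro mult_left_mono) auto
        then show "1 + real M + 2 * real M * (1 + \<bar>\<beta>\<bar>) \<le> real (Suc (K * M))" by (simp add: algebra_simps)
      qed simp
      also have "\<dots> = 2 ^ Suc (K * M)" by (rule powr_realpow) simp
      finally show ?thesis .
    qed
    have d_le: "2 ^ j * \<bar>F y - F x\<bar> \<le> t * h powr \<beta>"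
    proof -
      have "t * h powr \<beta> = \<bar>F y - F x\<bar> * h powr (-1)" unfolding t_def using hb by (simp add: powr_add[symmetric] mult.assoc)
      also have "\<dots> = \<bar>F y - F x\<bar> / h" using hb by (simp add: powr_minus_divide)
      also have "\<dots> \<ge> \<bar>F y - F x\<bar> / \<epsilon>" using hb by (intro divide_left_mono) auto
      finally show ?thesis unfolding \<epsilon>inv by simp
    qed
    have "epowr (ennreal (2 ^ j * \<bar>F y - F x\<bar>)) p = ennreal ((2 ^ j * \<bar>F y - F x\<bar>) powr p)" by simp
    also have "\<dots> \<le> ennreal ((t * h powr \<beta>) powr p)" using d_le p by (intro ennreal_leI powr_mono2) auto
    also have "(t * h powr \<beta>) powr p = t powr p * h powr \<gamma>" unfolding \<beta>_def using p by (simp add: powr_mult powr_powr)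
    also have "\<dots> \<le> ((\<Sum>i\<in>S. c i * (if 2 powr real_of_int i < t then 1 else 0)) + 2 powr (- real (K * M) * p)) * h powr \<gamma>"
      unfolding S_def c_def using p t0 tle by (intro mult_right_mono dyadic_levels) auto
    also have "ennreal (((\<Sum>i\<in>S. c i * (if 2 powr real_of_int i < t then 1 else 0)) + 2 powr (- real (K * M) * p)) * h powr \<gamma>)
       = ennreal (\<Sum>i\<in>S. c i * (if 2 powr real_of_int i < t then 1 else 0) * h powr \<gamma>) + ennreal (2 powr (- real (K * M) * p) * h powr \<gamma>)"
      unfolding distrib_right sum_distrib_right by (subst ennreal_plus) (auto intro!: sum_nonneg simp: c_def)
    also have "\<dots> \<le> (\<Sum>i\<in>S. ennreal (c i) * (ennreal (\<epsilon> ^ n) * H i y)) + ennreal ((1/2) ^ M)"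
    proof (rule add_mono)
      have "ennreal (c i * (if 2 powr real_of_int i < t then 1 else 0) * h powr \<gamma>) \<le> ennreal (c i) * (ennreal (\<epsilon> ^ n) * H i y)" for i
      proof (cases "2 powr real_of_int i < t")
        case True
        have "2 powr real_of_int i * h powr (1 + \<beta>) < t * h powr (1 + \<beta>)" using True hb by simp
        also have "\<dots> = \<bar>F y - F x\<bar>" unfolding t_def using hb by (simp add: powr_add[symmetric] mult.assoc)
        also have "\<dots> \<le> \<bar>f x - f y\<bar>" using Ff[of y x] by (simp add: abs_minus_commute)
        finally have E: "(x, y) \<in> E_set (2 powr real_of_int i) (\<gamma> / p) f"
          unfolding E_set_def \<beta>_def h_def using hb unfolding h_def by auto
        have shell: "y \<in> {y. (1/2) ^ Suc j < dist x y \<and> dist x y < (1/2) ^ j}"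
          using hb unfolding h_def \<epsilon>_def by simp
        have "h powr \<gamma> = h ^ n * h powr (\<gamma> - real n)" using hb by (simp add: powr_realpow[symmetric] powr_add[symmetric])
        also have "\<dots> \<le> \<epsilon> ^ n * h powr (\<gamma> - real n)" using hb by (intro mult_right_mono power_mono) auto
        finally have "c i * h powr \<gamma> \<le> c i * (\<epsilon> ^ n * h powr (\<gamma> - real n))" by (intro mult_left_mono) (auto simp: c_def)
        then have "ennreal (c i * h powr \<gamma>) \<le> ennreal (c i) * (ennreal (\<epsilon> ^ n) * ennreal (h powr (\<gamma> - real n)))"
          using \<epsilon> by (simp flip: ennreal_mult add: ennreal_leI c_def)
        then show ?thesis using True E shell unfolding H_def h_def by simp
      qed simp
      then have "(\<Sum>i\<in>S. ennreal (c i * (if 2 powr real_of_int i < t then 1 else 0) * h powr \<gamma>)) \<le> (\<Sum>i\<in>S. ennreal (c i) * (ennreal (\<epsilon> ^ n) * H i y))"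
        by (rule sum_mono)
      moreover have "ennreal (\<Sum>i\<in>S. c i * (if 2 powr real_of_int i < t then 1 else 0) * h powr \<gamma>) = (\<Sum>i\<in>S. ennreal (c i * (if 2 powr real_of_int i < t then 1 else 0) * h powr \<gamma>))"
        by (rule sum_ennreal[symmetric]) (auto simp: c_def)
      ultimately show "ennreal (\<Sum>i\<in>S. c i * (if 2 powr real_of_int i < t then 1 else 0) * h powr \<gamma>) \<le> (\<Sum>i\<in>S. ennreal (c i) * (ennreal (\<epsilon> ^ n) * H i y))" by simp
      have "2 powr (- real (K * M) * p) * h powr \<gamma> \<le> 2 powr (- real (K * M) * p) * 2 powr (2 * real M * \<bar>\<gamma>\<bar>)"
        by (intro mult_left_mono hpow) auto
      also have "\<dots> = 2 powr (- real (K * M) * p + 2 * real M * \<bar>\<gamma>\<bar>)" by (simp only: powr_add)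
      also have "\<dots> \<le> 2 powr (- real M)"
      proof (intro powr_mono)
        have "real (K * M) * 1 \<le> real (K * M) * p" using p by (intro mult_left_mono) auto
        moreover have "real M * (1 + 2 * \<bar>\<gamma>\<bar>) \<le> real M * real K"
        proof (rule mult_left_mono)
          show "1 + 2 * \<bar>\<gamma>\<bar> \<le> real K" using K abs_ge_zero[of "\<gamma> / p"] by linarith
        qed simp
        ultimately show "- real (K * M) * p + 2 * real M * \<bar>\<gamma>\<bar> \<le> - real M" by (simp add: algebra_simps)
      qed simp
      also have "\<dots> = (1/2) ^ M" by (simp add: powr_minus powr_realpow power_one_over inverse_eq_divide)
      finally show "ennreal (2 powr (- real (K * M) * p) * h powr \<gamma>) \<le> ennreal ((1/2) ^ M)" by (rule ennreal_leI)
    qed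
    finally show ?thesis unfolding y_def by (simp add: ennreal_leI)
  qed
  have "(\<integral>\<^sup>+ u \<in> W. epowr (ennreal (2 ^ j * \<bar>F (x + \<epsilon> *\<^sub>R u) - F x\<bar>)) p \<partial>lborel)
    \<le> (\<integral>\<^sup>+ u. (\<Sum>i\<in>S. ennreal (c i) * (ennreal (\<epsilon> ^ n) * H i (x + \<epsilon> *\<^sub>R u))) + ennreal ((1/2) ^ M) * indicator W u \<partial>lborel)"
  proof (rule nn_integral_mono)
    fix u
    show "epowr (ennreal (2 ^ j * \<bar>F (x + \<epsilon> *\<^sub>R u) - F x\<bar>)) p * indicator W u \<le> (\<Sum>i\<in>S. ennreal (c i) * (ennreal (\<epsilon> ^ n) * H i (x + \<epsilon> *\<^sub>R u))) + ennreal ((1/2) ^ M) * indicator W u"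
      using pt[of u] by (cases "u \<in> W") auto
  qed
  also have "\<dots> = (\<integral>\<^sup>+ u. (\<Sum>i\<in>S. ennreal (c i) * (ennreal (\<epsilon> ^ n) * H i (x + \<epsilon> *\<^sub>R u))) \<partial>lborel) + (\<integral>\<^sup>+ u. ennreal ((1/2) ^ M) * indicator W u \<partial>lborel)"
    by (rule nn_integral_add) measurable
  also have "(\<integral>\<^sup>+ u. (\<Sum>i\<in>S. ennreal (c i) * (ennreal (\<epsilon> ^ n) * H i (x + \<epsilon> *\<^sub>R u))) \<partial>lborel)
     = (\<Sum>i\<in>S. ennreal (c i) * (ennreal (\<epsilon> ^ n) * (\<integral>\<^sup>+ u. H i (x + \<epsilon> *\<^sub>R u) \<partial>lborel)))"
    by (subst nn_integral_sum) (auto simp: nn_integral_cmult)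
  also have "\<dots> = (\<Sum>i\<in>S. ennreal (c i) * (\<integral>\<^sup>+ y. H i y \<partial>lborel))"
    using \<epsilon> by (intro sum.cong refl arg_cong2[where f = "(*)"]) (simp add: nn_integral_lborel_affine[of "H _" \<epsilon> x] n_def)
  also have "(\<integral>\<^sup>+ u. ennreal ((1/2) ^ M) * indicator W u \<partial>lborel) = ennreal (w * (1/2) ^ M)"
    using w by (subst nn_integral_cmult_indicator) (auto simp: ennreal_mult mult.commute)
  finally show ?thesis unfolding \<epsilon>_def c_def S_def H_def n_def .
qed

section \<open>Averaged dyadic difference quotients and their norms\<close>

definition clip :: "real \<Rightarrow> real \<Rightarrow> real" where
  "clip m t = max (- m) (min m t)"

lemma clip_bounds: "m \<ge> 0 \<Longrightarrow> \<bar>clip m t\<bar> \<le> m" "\<bar>clip m s - clip m t\<bar> \<le> \<bar>s - t\<bar>" "m \<ge> 0 \<Longrightarrow> \<bar>clip m t\<bar> \<le> \<bar>t\<bar>"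
  unfolding clip_def by linarith+

lemma clip_measurable [measurable]: "clip m \<in> borel_measurable borel"
  unfolding clip_def by measurable

text \<open>For a basis vector b it lies in the shell 1/2 < norm u < 1, so its dyadic dilates stay
  in disjoint shells; the centre (3/4) b off the origin makes the averaged increment see the
  derivative along b.\<close>

definition avg_set :: "'a::euclidean_space \<Rightarrow> 'a set" where
  "avg_set b = ball ((3/4) *\<^sub>R b) (1/4)"

definition dyadic_quotient :: "('a::euclidean_space \<Rightarrow> real) \<Rightarrow> 'a \<Rightarrow> nat \<Rightarrow> 'a \<Rightarrow> real" where
  "dyadic_quotient F b j x = 2 ^ j * (\<integral>u. indicator (avg_set b) u * (F (x + (1/2) ^ j *\<^sub>R u) - F x) \<partial>lborel)"

text \<open>The cut-offs \<open>clip m\<close> and \<open>ball 0 m\<close> only make everything integrable; \<open>m\<close> tends to infinity with \<open>M\<close>.\<close>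

definition scale_average :: "('a::euclidean_space \<Rightarrow> real) \<Rightarrow> 'a \<Rightarrow> real \<Rightarrow> nat \<Rightarrow> 'a \<Rightarrow> real" where
  "scale_average f b m M x = indicator (ball 0 m) x * (1 / real M * (\<Sum>j\<in>{M..<2*M}. dyadic_quotient (\<lambda>x. clip m (f x)) b j x))"

lemma avg_set_measurable [measurable]: "avg_set b \<in> sets borel"
  unfolding avg_set_def by measurable

lemma avg_set_norm:
  assumes "b \<in> Basis" "u \<in> avg_set b" shows "1/2 < norm u" "norm u < 1"
proof -
  have "norm (u - (3/4) *\<^sub>R b) < 1/4" using assms unfolding avg_set_def by (simp add: dist_norm norm_minus_commute)
  moreover have "norm ((3/4) *\<^sub>R b) = 3/4" using assms by simp
  moreover have "\<bar>norm u - norm ((3/4) *\<^sub>R b)\<bar> \<le> norm (u - (3/4) *\<^sub>R b)" by (rule norm_triangle_ineq3)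
  ultimately show "1/2 < norm u" "norm u < 1" by linarith+
qed

definition avg_vol :: "'a::euclidean_space itself \<Rightarrow> real" where
  "avg_vol _ = unit_vol TYPE('a) * (1/4) ^ DIM('a)"

lemma avg_vol_pos: "avg_vol TYPE('a::euclidean_space) > 0"
  unfolding avg_vol_def using unit_vol_pos[where 'a='a] by simp

lemma emeasure_avg_set: "emeasure lborel (avg_set (b::'a::euclidean_space)) = ennreal (avg_vol TYPE('a))"
  unfolding avg_set_def avg_vol_def by (rule emeasure_lborel_ball) simp

lemma dyadic_quotient_measurable [measurable]:
  assumes [measurable]: "F \<in> borel_measurable borel"
  shows "dyadic_quotient F b j \<in> borel_measurable borel"
  unfolding dyadic_quotient_def by measurable

lemma scale_average_measurable [measurable]:
  assumes [measurable]: "f \<in> borel_measurable borel"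
  shows "scale_average f b m M \<in> borel_measurable borel"
  unfolding scale_average_def by measurable

text \<open>Jensen's inequality is applied over the scales and over \<open>avg_set\<close>. Because
  the shells are disjoint, the contributions of all scales to level i add up to at most one level
  set integral \<open>\<Phi> i\<close>, and the factor 1 / M in front survives.\<close>

lemma scale_average_pointwise:
  fixes f :: "'a::euclidean_space \<Rightarrow> real"
  assumes p: "p \<ge> 1" and [measurable]: "f \<in> borel_measurable borel" and b: "b \<in> Basis"
    and m: "0 \<le> m" "m \<le> 2 ^ M" and M: "M \<ge> 1" and K: "real K \<ge> 3 + 2 * \<bar>\<gamma> / p\<bar> + 2 * \<bar>\<gamma>\<bar>"
  defines "w \<equiv> avg_vol TYPE('a)"
  defines "\<Phi> \<equiv> (\<lambda>i x. \<integral>\<^sup>+ y. indicator (E_set (2 powr real_of_int i) (\<gamma> / p) f) (x, y) * ennreal (dist x y powr (\<gamma> - real DIM('a))) \<partial>lborel)"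
  shows "epowr (ennreal \<bar>scale_average f b m M x\<bar>) p \<le>
    ennreal (w powr (p - 1)) * (ennreal (1 / real M) * (\<Sum>i\<in>{- int (K * M)..int (K * M)}. ennreal (2 powr p * 2 powr (real_of_int i * p)) * \<Phi> i x)
      + ennreal (w * (1/2) ^ M) * indicator (ball 0 m) x)"
proof (cases "x \<in> ball 0 m")
  case False
  then show ?thesis unfolding scale_average_def by simp
next
  case True
  have w: "w > 0" unfolding w_def by (rule avg_vol_pos)
  define W where "W = avg_set b"
  have [measurable]: "W \<in> sets borel" unfolding W_def by measurable
  have eW: "emeasure lborel W = ennreal w" unfolding W_def w_def by (rule emeasure_avg_set)
  define F where "F = (\<lambda>x. clip m (f x))"
  have [measurable]: "F \<in> borel_measurable borel" unfolding F_def by measurable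
  define d where "d = (\<lambda>j u. ennreal (2 ^ j * \<bar>F (x + (1/2) ^ j *\<^sub>R u) - F x\<bar>))"
  have [measurable]: "d j \<in> borel_measurable borel" for j unfolding d_def by measurable
  define J where "J = {M..<2*M}"
  have cJ: "card J = M" "finite J" unfolding J_def by auto
  define S where "S = {- int (K * M)..int (K * M)}"
  define c where "c = (\<lambda>i::int. ennreal (2 powr p * 2 powr (real_of_int i * p)))"
  define H where "H = (\<lambda>i j. \<integral>\<^sup>+ y. indicator (E_set (2 powr real_of_int i) (\<gamma> / p) f) (x, y) * ennreal (dist x y powr (\<gamma> - real DIM('a)))
            * indicator {y. (1/2) ^ Suc j < dist x y \<and> dist x y < (1/2) ^ j} y \<partial>lborel)"
  have D_le: "ennreal \<bar>dyadic_quotient F b j x\<bar> \<le> (\<integral>\<^sup>+ u \<in> W. d j u \<partial>lborel)" for j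
  proof -
    have i: "integrable lborel (\<lambda>u. indicator W u * (F (x + (1/2) ^ j *\<^sub>R u) - F x))"
    proof (rule integrableI_bounded_set[where A = W and B = "2 * m"])
      show "AE u in lborel. u \<in> W \<longrightarrow> norm (indicator W u * (F (x + (1/2) ^ j *\<^sub>R u) - F x)) \<le> 2 * m"
      proof (intro AE_I2 impI)
        fix u assume "u \<in> W"
        have "\<bar>F (x + (1/2) ^ j *\<^sub>R u) - F x\<bar> \<le> \<bar>F (x + (1/2) ^ j *\<^sub>R u)\<bar> + \<bar>F x\<bar>" by linarith
        also have "\<dots> \<le> m + m" unfolding F_def by (intro add_mono clip_bounds m)
        finally show "norm (indicator W u * (F (x + (1/2) ^ j *\<^sub>R u) - F x)) \<le> 2 * m" using \<open>u \<in> W\<close> by simp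
      qed
    qed (auto simp: eW)
    have "ennreal \<bar>dyadic_quotient F b j x\<bar> = ennreal (2 ^ j) * ennreal (norm (\<integral>u. indicator W u * (F (x + (1/2) ^ j *\<^sub>R u) - F x) \<partial>lborel))"
      unfolding dyadic_quotient_def W_def by (simp add: abs_mult ennreal_mult)
    also have "\<dots> \<le> ennreal (2 ^ j) * (\<integral>\<^sup>+ u. ennreal (norm (indicator W u * (F (x + (1/2) ^ j *\<^sub>R u) - F x))) \<partial>lborel)"
      by (intro mult_left_mono integral_norm_bound_ennreal i) simp
    also have "\<dots> = (\<integral>\<^sup>+ u. ennreal (2 ^ j) * ennreal (norm (indicator W u * (F (x + (1/2) ^ j *\<^sub>R u) - F x))) \<partial>lborel)"
      by (rule nn_integral_cmult[symmetric]) measurable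
    also have "\<dots> = (\<integral>\<^sup>+ u \<in> W. d j u \<partial>lborel)"
      unfolding d_def by (intro nn_integral_cong) (auto simp: indicator_def ennreal_mult)
    finally show ?thesis .
  qed
  have "ennreal \<bar>scale_average f b m M x\<bar> \<le> ennreal (1 / real M) * (\<Sum>j\<in>J. \<integral>\<^sup>+ u \<in> W. d j u \<partial>lborel)"
  proof -
    have "\<bar>scale_average f b m M x\<bar> = 1 / real M * \<bar>\<Sum>j\<in>J. dyadic_quotient F b j x\<bar>"
      unfolding scale_average_def F_def J_def using True by (simp add: abs_mult)
    also have "\<dots> \<le> 1 / real M * (\<Sum>j\<in>J. \<bar>dyadic_quotient F b j x\<bar>)" by (intro mult_left_mono sum_abs) simp
    finally have "ennreal \<bar>scale_average f b m M x\<bar> \<le> ennreal (1 / real M * (\<Sum>j\<in>J. \<bar>dyadic_quotient F b j x\<bar>))" by (rule ennreal_leI)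
    also have "\<dots> = ennreal (1 / real M) * (\<Sum>j\<in>J. ennreal \<bar>dyadic_quotient F b j x\<bar>)"
      by (subst sum_ennreal, simp, rule ennreal_mult) (auto simp: sum_nonneg)
    also have "\<dots> \<le> ennreal (1 / real M) * (\<Sum>j\<in>J. \<integral>\<^sup>+ u \<in> W. d j u \<partial>lborel)"
      by (intro mult_left_mono sum_mono D_le) simp
    finally show ?thesis .
  qed
  then have "epowr (ennreal \<bar>scale_average f b m M x\<bar>) p \<le> epowr (ennreal (1 / real M) * (\<Sum>j\<in>J. \<integral>\<^sup>+ u \<in> W. d j u \<partial>lborel)) p"
    using p by (intro epowr_mono) auto
  also have "\<dots> = epowr (ennreal (1 / real M)) p * epowr (\<Sum>j\<in>J. \<integral>\<^sup>+ u \<in> W. d j u \<partial>lborel) p"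
    using p by (intro epowr_mult) auto
  also have "epowr (\<Sum>j\<in>J. \<integral>\<^sup>+ u \<in> W. d j u \<partial>lborel) p \<le> ennreal (real M powr (p - 1)) * (\<Sum>j\<in>J. epowr (\<integral>\<^sup>+ u \<in> W. d j u \<partial>lborel) p)"
    using nn_integral_Jensen_powr[of "count_space J" "real M" p "\<lambda>j. \<integral>\<^sup>+ u \<in> W. d j u \<partial>lborel"] p M cJ
    by (simp add: nn_integral_count_space_finite ennreal_of_nat_eq_real_of_nat)
  also have "epowr (ennreal (1 / real M)) p * (ennreal (real M powr (p - 1)) * (\<Sum>j\<in>J. epowr (\<integral>\<^sup>+ u \<in> W. d j u \<partial>lborel) p))
      = ennreal (1 / real M) * (\<Sum>j\<in>J. epowr (\<integral>\<^sup>+ u \<in> W. d j u \<partial>lborel) p)"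
  proof -
    have "(1 / real M) powr p * real M powr (p - 1) = 1 / real M" using M by (simp add: powr_divide powr_diff)
    then show ?thesis by (simp add: mult.assoc[symmetric] ennreal_mult[symmetric])
  qed
  also have "\<dots> \<le> ennreal (1 / real M) * (\<Sum>j\<in>J. ennreal (w powr (p - 1)) * ((\<Sum>i\<in>S. c i * H i j) + ennreal (w * (1/2) ^ M)))"
  proof (intro mult_left_mono sum_mono)
    fix j assume j: "j \<in> J"
    have "epowr (\<integral>\<^sup>+ u \<in> W. d j u \<partial>lborel) p = epowr (\<integral>\<^sup>+ u. d j u \<partial>density lborel (indicator W)) p"
      by (subst nn_integral_density) (auto simp: mult.commute)
    also have "\<dots> \<le> ennreal (w powr (p - 1)) * (\<integral>\<^sup>+ u. epowr (d j u) p \<partial>density lborel (indicator W))"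
      using w p eW by (intro nn_integral_Jensen_powr) (auto simp: emeasure_density)
    also have "(\<integral>\<^sup>+ u. epowr (d j u) p \<partial>density lborel (indicator W)) = (\<integral>\<^sup>+ u \<in> W. epowr (d j u) p \<partial>lborel)"
      by (subst nn_integral_density) (auto simp: mult.commute)
    also have "\<dots> \<le> (\<Sum>i\<in>S. c i * H i j) + ennreal (w * (1/2) ^ M)"
      unfolding d_def S_def c_def H_def
    proof (rule shell_estimate[OF p, where f = f and M = M])
      show "\<bar>F x - F y\<bar> \<le> \<bar>f x - f y\<bar>" for x y unfolding F_def by (rule clip_bounds)
      show "\<bar>F x\<bar> \<le> 2 ^ M" for x unfolding F_def using clip_bounds(1)[OF m(1), of "f x"] m by linarith
      show "1/2 < norm u \<and> norm u < 1" if "u \<in> W" for u using avg_set_norm[OF b] that unfolding W_def by blast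
    qed (use j w eW K in \<open>auto simp: J_def\<close>)
    finally show "epowr (\<integral>\<^sup>+ u \<in> W. d j u \<partial>lborel) p \<le> ennreal (w powr (p - 1)) * ((\<Sum>i\<in>S. c i * H i j) + ennreal (w * (1/2) ^ M))"
      by (simp add: mult_left_mono)
  qed simp
  also have "\<dots> = ennreal (w powr (p - 1)) * (ennreal (1 / real M) * (\<Sum>i\<in>S. c i * (\<Sum>j\<in>J. H i j)) + ennreal (w * (1/2) ^ M))"
  proof -
    have "(\<Sum>j\<in>J. ennreal (w powr (p - 1)) * ((\<Sum>i\<in>S. c i * H i j) + ennreal (w * (1/2) ^ M)))
       = ennreal (w powr (p - 1)) * ((\<Sum>j\<in>J. \<Sum>i\<in>S. c i * H i j) + of_nat M * ennreal (w * (1/2) ^ M))"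
      by (simp add: sum_distrib_left[symmetric] sum.distrib cJ)
    also have "(\<Sum>j\<in>J. \<Sum>i\<in>S. c i * H i j) = (\<Sum>i\<in>S. c i * (\<Sum>j\<in>J. H i j))"
      by (subst sum.swap) (simp add: sum_distrib_left)
    finally have "ennreal (1 / real M) * (\<Sum>j\<in>J. ennreal (w powr (p - 1)) * ((\<Sum>i\<in>S. c i * H i j) + ennreal (w * (1/2) ^ M)))
      = ennreal (w powr (p - 1)) * (ennreal (1 / real M) * (\<Sum>i\<in>S. c i * (\<Sum>j\<in>J. H i j)) + (ennreal (1 / real M) * of_nat M) * ennreal (w * (1/2) ^ M))"
      by (simp add: distrib_left mult_ac)
    also have "ennreal (1 / real M) * of_nat M = 1" using M by (simp add: ennreal_of_nat_eq_real_of_nat ennreal_mult[symmetric])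
    finally show ?thesis by simp
  qed
  also have "\<dots> \<le> ennreal (w powr (p - 1)) * (ennreal (1 / real M) * (\<Sum>i\<in>S. c i * \<Phi> i x) + ennreal (w * (1/2) ^ M))"
  proof (intro mult_left_mono add_right_mono sum_mono)
    fix i
    have "(\<Sum>j\<in>J. H i j) = (\<integral>\<^sup>+ y. (\<Sum>j\<in>J. indicator (E_set (2 powr real_of_int i) (\<gamma> / p) f) (x, y) * ennreal (dist x y powr (\<gamma> - real DIM('a)))
            * indicator {y. (1/2) ^ Suc j < dist x y \<and> dist x y < (1/2) ^ j} y) \<partial>lborel)"
      unfolding H_def by (rule nn_integral_sum[symmetric]) measurable
    also have "\<dots> \<le> \<Phi> i x"
      unfolding \<Phi>_def
    proof (rule nn_integral_mono)
      fix y
      have disj: "disjoint_family_on (\<lambda>j. {y. (1/2) ^ Suc j < dist x y \<and> dist x y < (1/2) ^ j}) J"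
      proof -
        have lt: False if "j < j'" "(1/2) ^ Suc j < r" "r < (1/2) ^ j'" for j j' :: nat and r :: real
        proof -
          have "(1/2::real) ^ j' \<le> (1/2) ^ Suc j" using that(1) by (intro power_decreasing) auto
          then show False using that by linarith
        qed
        show ?thesis unfolding disjoint_family_on_def
        proof (intro ballI impI, rule ccontr)
          fix j j' assume ne: "j \<noteq> j'" and "{y. (1/2) ^ Suc j < dist x y \<and> dist x y < (1/2) ^ j} \<inter> {y. (1/2) ^ Suc j' < dist x y \<and> dist x y < (1/2) ^ j'} \<noteq> {}"
          then obtain y where "(1/2) ^ Suc j < dist x y" "dist x y < (1/2) ^ j" "(1/2) ^ Suc j' < dist x y" "dist x y < (1/2) ^ j'" by blast
          then show False using lt ne by (meson linorder_neqE_nat)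
        qed
      qed
      have "(\<Sum>j\<in>J. indicator {y. (1/2) ^ Suc j < dist x y \<and> dist x y < (1/2) ^ j} y :: ennreal) = indicator (\<Union>j\<in>J. {y. (1/2) ^ Suc j < dist x y \<and> dist x y < (1/2) ^ j}) y"
        by (rule indicator_UN_disjoint[symmetric, OF cJ(2) disj])
      also have "\<dots> \<le> 1" by (auto simp: indicator_def)
      finally have "indicator (E_set (2 powr real_of_int i) (\<gamma> / p) f) (x, y) * ennreal (dist x y powr (\<gamma> - real DIM('a))) * (\<Sum>j\<in>J. indicator {y. (1/2) ^ Suc j < dist x y \<and> dist x y < (1/2) ^ j} y)
         \<le> indicator (E_set (2 powr real_of_int i) (\<gamma> / p) f) (x, y) * ennreal (dist x y powr (\<gamma> - real DIM('a))) * 1"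
        by (rule mult_left_mono) simp
      then show "(\<Sum>j\<in>J. indicator (E_set (2 powr real_of_int i) (\<gamma> / p) f) (x, y) * ennreal (dist x y powr (\<gamma> - real DIM('a)))
            * indicator {y. (1/2) ^ Suc j < dist x y \<and> dist x y < (1/2) ^ j} y) \<le> indicator (E_set (2 powr real_of_int i) (\<gamma> / p) f) (x, y) * ennreal (dist x y powr (\<gamma> - real DIM('a)))"
        by (simp only: sum_distrib_left mult_1_right)
    qed
    finally show "(\<Sum>j\<in>J. H i j) \<le> \<Phi> i x" .
  qed auto
  finally show ?thesis unfolding S_def c_def using True by (simp add: mult_left_mono)
qed

text \<open>There are 2 K M + 1 levels, each contributing at most a multiple of A powr p in the
  convexified norm, and the factor 1 / M compensates for their number. The smallness condition on
  (1/2) ^ M tames the remainder, which is constant on \<open>ball 0 m\<close>.\<close>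

lemma scale_average_norm_bound:
  fixes N :: "('a::euclidean_space) bnorm"
  assumes N: "ball_banach N" and p: "p \<ge> 1" and Y: "ball_banach (convexification N p)"
    and b: "b \<in> Basis" and f[measurable]: "f \<in> borel_measurable borel" and fin: "BSVY N p \<gamma> f < \<infinity>"
  obtains C :: real where
    "\<And>m M. 0 \<le> m \<Longrightarrow> m \<le> 2 ^ M \<Longrightarrow> M \<ge> 1 \<Longrightarrow> ennreal ((1/2) ^ M) * convexification N p (indicator (ball 0 m)) \<le> 1 \<Longrightarrow>
      N (\<lambda>x. ennreal \<bar>scale_average f b m M x\<bar>) \<le> ennreal C"
proof -
  define Y where "Y = convexification N p"
  have bY: "ball_banach Y" using Y unfolding Y_def .
  have Ypow: "Y (\<lambda>x. epowr (h x) p) = epowr (N h) p" for h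
    unfolding Y_def convexification_def using p by (simp add: epowr_epowr)
  obtain A where A: "BSVY N p \<gamma> f = ennreal A" "A \<ge> 0" using fin by (cases "BSVY N p \<gamma> f") auto
  define w where "w = avg_vol TYPE('a)"
  have w: "w > 0" unfolding w_def by (rule avg_vol_pos)
  obtain K :: nat where K: "real K \<ge> 3 + 2 * \<bar>\<gamma> / p\<bar> + 2 * \<bar>\<gamma>\<bar>" using real_arch_simple by blast
  define \<Phi> where "\<Phi> = (\<lambda>i x. \<integral>\<^sup>+ y. indicator (E_set (2 powr real_of_int i) (\<gamma> / p) f) (x, y) * ennreal (dist x y powr (\<gamma> - real DIM('a))) \<partial>lborel)"
  have [measurable]: "\<Phi> i \<in> borel_measurable borel" for i unfolding \<Phi>_def by measurable
  have \<Phi>l: "\<Phi> i \<in> borel_measurable lebesgue" for i by (rule borel_imp_lebesgue_measurable) measurable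
  have Y\<Phi>: "ennreal (2 powr (real_of_int i * p)) * Y (\<Phi> i) \<le> ennreal (A powr p)" for i
  proof -
    have "ennreal (2 powr real_of_int i) * N (\<lambda>x. epowr (\<Phi> i x) (1 / p)) \<le> ennreal A"
      unfolding A(1)[symmetric] BSVY_def \<Phi>_def by (rule SUP_upper2[of "2 powr real_of_int i"]) (auto simp: nn_integral_completion)
    then have "epowr (ennreal (2 powr real_of_int i) * N (\<lambda>x. epowr (\<Phi> i x) (1 / p))) p \<le> epowr (ennreal A) p"
      using p by (intro epowr_mono) auto
    then show ?thesis using p A unfolding Y_def convexification_def by (simp add: epowr_mult powr_powr)
  qed
  define C0 where "C0 = w powr (p - 1) * ((2 * real K + 1) * (2 powr p * A powr p) + w)"
  have C0: "C0 \<ge> 0" unfolding C0_def using w by simp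
  have main: "N (\<lambda>x. ennreal \<bar>scale_average f b m M x\<bar>) \<le> ennreal (C0 powr (1 / p))"
    if m: "0 \<le> m" "m \<le> 2 ^ M" and M: "M \<ge> 1" and small: "ennreal ((1/2) ^ M) * Y (indicator (ball 0 m)) \<le> 1" for m M
  proof -
    define S where "S = {- int (K * M)..int (K * M)}"
    define G where "G = (\<lambda>i x. ennreal (2 powr p * 2 powr (real_of_int i * p)) * \<Phi> i x)"
    have Gl: "G i \<in> borel_measurable lebesgue" for i unfolding G_def by (rule borel_imp_lebesgue_measurable) measurable
    define U where "U = (\<lambda>x. \<Sum>i\<in>S. G i x)"
    have Ul: "U \<in> borel_measurable lebesgue" unfolding U_def using Gl by (intro borel_measurable_sum) auto
    define B where "B = (indicator (ball (0::'a) m) :: 'a \<Rightarrow> ennreal)"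
    have Bl: "B \<in> borel_measurable lebesgue" unfolding B_def by (rule borel_imp_lebesgue_measurable) measurable
    have YG: "Y (G i) \<le> ennreal (2 powr p * A powr p)" for i
    proof -
      have "Y (G i) = ennreal (2 powr p * 2 powr (real_of_int i * p)) * Y (\<Phi> i)"
        unfolding G_def by (rule bb_scale[OF bY \<Phi>l]) simp
      also have "\<dots> = ennreal (2 powr p) * (ennreal (2 powr (real_of_int i * p)) * Y (\<Phi> i))" by (simp add: ennreal_mult mult.assoc)
      also have "\<dots> \<le> ennreal (2 powr p) * ennreal (A powr p)" by (intro mult_left_mono Y\<Phi>) simp
      finally show ?thesis by (simp add: ennreal_mult)
    qed
    have YU: "ennreal (1 / real M) * Y U \<le> ennreal ((2 * real K + 1) * (2 powr p * A powr p))"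
    proof -
      have "Y U \<le> (\<Sum>i\<in>S. Y (G i))" unfolding U_def by (rule bb_sum[OF bY _ Gl]) (simp add: S_def)
      also have "\<dots> \<le> (\<Sum>i\<in>S. ennreal (2 powr p * A powr p))" by (intro sum_mono YG)
      also have "\<dots> = ennreal (real (card S) * (2 powr p * A powr p))"
        by (simp add: ennreal_mult ennreal_of_nat_eq_real_of_nat)
      finally have "ennreal (1 / real M) * Y U \<le> ennreal (1 / real M) * ennreal (real (card S) * (2 powr p * A powr p))" by (rule mult_left_mono) simp
      also have "\<dots> = ennreal (real (card S) / real M * (2 powr p * A powr p))" by (simp flip: ennreal_mult)
      also have "\<dots> \<le> ennreal ((2 * real K + 1) * (2 powr p * A powr p))"
      proof (intro ennreal_leI mult_right_mono)
        have "real (card S) = 2 * real K * real M + 1" unfolding S_def by (simp add: nat_add_distrib)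
        also have "\<dots> \<le> (2 * real K + 1) * real M" using M by (simp add: algebra_simps)
        finally show "real (card S) / real M \<le> 2 * real K + 1" using M by (simp add: pos_divide_le_eq)
      qed simp
      finally show ?thesis .
    qed
    have YB: "ennreal (w * (1/2) ^ M) * Y B \<le> ennreal w"
    proof -
      have "ennreal (w * (1/2) ^ M) * Y B = ennreal w * (ennreal ((1/2) ^ M) * Y B)" using w by (simp add: ennreal_mult mult.assoc)
      also have "\<dots> \<le> ennreal w * 1" using small unfolding B_def by (intro mult_left_mono) auto
      finally show ?thesis by simp
    qed
    define Q where "Q = (\<lambda>x. ennreal (1 / real M) * U x + ennreal (w * (1/2) ^ M) * B x)"
    have Ql: "Q \<in> borel_measurable lebesgue" unfolding Q_def using Ul Bl by measurable
    have "epowr (N (\<lambda>x. ennreal \<bar>scale_average f b m M x\<bar>)) p = Y (\<lambda>x. epowr (ennreal \<bar>scale_average f b m M x\<bar>) p)" by (rule Ypow[symmetric])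
    also have "\<dots> \<le> Y (\<lambda>x. ennreal (w powr (p - 1)) * Q x)"
    proof (rule bb_mono[OF bY])
      show "(\<lambda>x. ennreal (w powr (p - 1)) * Q x) \<in> borel_measurable lebesgue" using Ql by measurable
      show "(\<lambda>x. epowr (ennreal \<bar>scale_average f b m M x\<bar>) p) \<in> borel_measurable lebesgue"
        by (rule borel_imp_lebesgue_measurable) measurable
      show "AE x in lebesgue. epowr (ennreal \<bar>scale_average f b m M x\<bar>) p \<le> ennreal (w powr (p - 1)) * Q x"
        unfolding Q_def U_def G_def B_def S_def \<Phi>_def w_def using scale_average_pointwise[OF p f b m M K] by (intro AE_I2)
    qed
    also have "\<dots> = ennreal (w powr (p - 1)) * Y Q" by (rule bb_scale[OF bY Ql]) simp
    also have "Y Q \<le> Y (\<lambda>x. ennreal (1 / real M) * U x) + Y (\<lambda>x. ennreal (w * (1/2) ^ M) * B x)"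
      unfolding Q_def using Ul Bl by (intro bb_triangle[OF bY]) auto
    also have "\<dots> = ennreal (1 / real M) * Y U + ennreal (w * (1/2) ^ M) * Y B"
      using w by (intro arg_cong2[where f = "(+)"] bb_scale[OF bY] Ul Bl) auto
    also have "\<dots> \<le> ennreal ((2 * real K + 1) * (2 powr p * A powr p)) + ennreal w" by (intro add_mono YU YB)
    also have "\<dots> = ennreal ((2 * real K + 1) * (2 powr p * A powr p) + w)" using w by (intro ennreal_plus[symmetric]) auto
    also have "ennreal (w powr (p - 1)) * ennreal ((2 * real K + 1) * (2 powr p * A powr p) + w) = ennreal C0"
      unfolding C0_def using w by (intro ennreal_mult[symmetric]) auto
    also have "ennreal C0 = epowr (ennreal (C0 powr (1 / p))) p" using C0 p by (simp add: powr_powr)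
    finally have "epowr (N (\<lambda>x. ennreal \<bar>scale_average f b m M x\<bar>)) p \<le> epowr (ennreal (C0 powr (1 / p))) p"
      by (simp add: mult_left_mono)
    then show ?thesis by (subst (asm) epowr_le_iff) (use p in auto)
  qed
  show thesis by (rule that[of "C0 powr (1/p)"]) (use main in \<open>simp add: Y_def\<close>)
qed

section \<open>Test functions and discrete integration by parts\<close>

lemma continuous_compact_support_bounded:
  fixes h :: "'a::euclidean_space \<Rightarrow> real"
  assumes "continuous_on UNIV h" "\<And>x. x \<notin> ball 0 R \<Longrightarrow> h x = 0"
  obtains L where "\<And>x. \<bar>h x\<bar> \<le> L"
proof -
  have "compact (h ` cball 0 R)"
    by (rule compact_continuous_image[OF continuous_on_subset[OF assms(1)]]) auto
  then obtain L where L: "\<forall>y\<in>h ` cball 0 R. norm y \<le> L"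
    using compact_imp_bounded bounded_iff by metis
  have "\<bar>h x\<bar> \<le> max L 0" for x
  proof (cases "x \<in> ball 0 R")
    case True
    then have "h x \<in> h ` cball 0 R" by auto
    then show ?thesis using L by (auto simp: le_max_iff_disj)
  qed (simp add: assms(2))
  then show thesis by (rule that)
qed

lemma test_fun_props:
  fixes \<psi> :: "'a::euclidean_space \<Rightarrow> real"
  assumes "test_fun \<psi>"
  obtains R L :: real where
    "continuous_on UNIV \<psi>" "\<And>x. (\<psi> has_derivative frechet_derivative \<psi> (at x)) (at x)"
    "\<And>b. b \<in> Basis \<Longrightarrow> continuous_on UNIV (\<lambda>x. frechet_derivative \<psi> (at x) b)"
    "\<And>x. x \<notin> ball 0 R \<Longrightarrow> \<psi> x = 0" "\<And>x b. x \<notin> ball 0 R \<Longrightarrow> frechet_derivative \<psi> (at x) b = 0"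
    "\<And>x y. \<bar>\<psi> x - \<psi> y\<bar> \<le> L * norm (x - y)" "\<And>x. \<bar>\<psi> x\<bar> \<le> L"
    "\<And>x b. b \<in> Basis \<Longrightarrow> \<bar>frechet_derivative \<psi> (at x) b\<bar> \<le> L"
proof -
  have sm: "smooth \<psi>" and comp: "compact (closure {x. \<psi> x \<noteq> 0})" using assms unfolding test_fun_def by auto
  have diff: "\<psi> differentiable (at x)" and cont: "continuous_on UNIV \<psi>" for x
    using sm[unfolded smooth_def, rule_format, of "[]"] by auto
  have der: "(\<psi> has_derivative frechet_derivative \<psi> (at x)) (at x)" for x
    using diff frechet_derivative_works by blast
  have contd: "continuous_on UNIV (\<lambda>x. frechet_derivative \<psi> (at x) b)" if "b \<in> Basis" for b
    using sm[unfolded smooth_def, rule_format, of "[b]"] that by auto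
  obtain R where R: "closure {x. \<psi> x \<noteq> 0} \<subseteq> ball 0 R"
    using bounded_subset_ballD[OF compact_imp_bounded[OF comp], of 0] by (elim exE conjE) (rule that)
  have vanish: "\<psi> x = 0" if "x \<notin> closure {x. \<psi> x \<noteq> 0}" for x
    using that subsetD[OF closure_subset[of "{x. \<psi> x \<noteq> 0}"], of x] by auto
  have out: "\<psi> x = 0" if "x \<notin> ball 0 R" for x using vanish subsetD[OF R] that by metis
  have outd: "frechet_derivative \<psi> (at x) v = 0" if "x \<notin> ball 0 R" for x v
  proof -
    define O' where "O' = - closure {x. \<psi> x \<noteq> 0}"
    have "open O'" "x \<in> O'" unfolding O'_def using subsetD[OF R, of x] that by auto
    moreover have "0 = \<psi> y" if "y \<in> O'" for y using that vanish[of y] unfolding O'_def by simp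
    ultimately have "(\<psi> has_derivative (\<lambda>_. 0)) (at x)"
      using has_derivative_transform_within_open[of "\<lambda>_. 0" "\<lambda>_. 0" x UNIV O' \<psi>] by auto
    then show ?thesis using frechet_derivative_at by metis
  qed
  obtain L1 where L1: "\<And>x. \<bar>\<psi> x\<bar> \<le> L1" using continuous_compact_support_bounded[OF cont out] by blast
  have "\<exists>L. \<forall>x. \<bar>frechet_derivative \<psi> (at x) b\<bar> \<le> L" if "b \<in> Basis" for b
    using continuous_compact_support_bounded[OF contd[OF that] outd] by blast
  then obtain Lb where Lb: "\<And>b x. b \<in> Basis \<Longrightarrow> \<bar>frechet_derivative \<psi> (at x) b\<bar> \<le> Lb b" by metis
  define L2 where "L2 = (\<Sum>b\<in>Basis. Lb b)"
  have Lb0: "0 \<le> Lb b" if "b \<in> Basis" for b using Lb[OF that, of 0] by linarith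
  have L2: "Lb b \<le> L2" if "b \<in> Basis" for b unfolding L2_def using that Lb0 by (intro member_le_sum) auto
  have fd: "\<bar>frechet_derivative \<psi> (at x) v\<bar> \<le> L2 * norm v" for x v
  proof -
    have lin: "linear (frechet_derivative \<psi> (at x))" using der has_derivative_linear by blast
    have "frechet_derivative \<psi> (at x) v = frechet_derivative \<psi> (at x) (\<Sum>b\<in>Basis. (v \<bullet> b) *\<^sub>R b)" by (simp add: euclidean_representation)
    also have "\<dots> = (\<Sum>b\<in>Basis. (v \<bullet> b) * frechet_derivative \<psi> (at x) b)"
      by (simp add: linear_sum[OF lin] linear_scale[OF lin])
    also have "\<bar>\<dots>\<bar> \<le> (\<Sum>b\<in>Basis. \<bar>(v \<bullet> b) * frechet_derivative \<psi> (at x) b\<bar>)" by (rule sum_abs)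
    also have "\<dots> \<le> (\<Sum>b\<in>Basis. norm v * Lb b)"
      unfolding abs_mult by (intro sum_mono mult_mono Basis_le_norm Lb) auto
    also have "\<dots> = L2 * norm v" unfolding L2_def by (simp add: sum_distrib_left mult.commute)
    finally show ?thesis .
  qed
  have lip: "\<bar>\<psi> x - \<psi> y\<bar> \<le> L2 * norm (x - y)" for x y
  proof -
    have "norm (\<psi> x - \<psi> y) \<le> L2 * norm (x - y)"
    proof (rule differentiable_bound[of UNIV \<psi> "\<lambda>x. frechet_derivative \<psi> (at x)"])
      show "onorm (frechet_derivative \<psi> (at x)) \<le> L2" for x using fd by (intro onorm_le) auto
    qed (use der in auto)
    then show ?thesis by simp
  qed
  define L where "L = max L1 L2"
  show thesis
  proof (rule that[of R L])
    show "\<bar>\<psi> x - \<psi> y\<bar> \<le> L * norm (x - y)" for x y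
      using lip[of x y] mult_right_mono[of L2 L "norm (x - y)"] unfolding L_def by simp
    show "\<bar>\<psi> x\<bar> \<le> L" for x using L1[of x] unfolding L_def by simp
    show "\<bar>frechet_derivative \<psi> (at x) b\<bar> \<le> L" if "b \<in> Basis" for x b
      using Lb[OF that, of x] L2[OF that] unfolding L_def by simp
  qed (use cont der contd out outd in auto)
qed

lemma tendsto_dyadic_average:
  fixes X :: "nat \<Rightarrow> real"
  assumes X: "X \<longlonglongrightarrow> l" and M: "\<And>k. M k \<ge> k" "\<And>k. M k \<ge> 1"
  shows "(\<lambda>k. 1 / real (M k) * (\<Sum>j\<in>{M k..<2 * M k}. X j)) \<longlonglongrightarrow> l"
proof (rule LIMSEQ_I)
  fix r :: real assume r: "r > 0"
  then obtain k0 where k0: "\<And>j. j \<ge> k0 \<Longrightarrow> norm (X j - l) < r / 2" using LIMSEQ_D[OF X, of "r/2"] by auto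
  have "norm (1 / real (M k) * (\<Sum>j\<in>{M k..<2 * M k}. X j) - l) < r" if k: "k \<ge> k0" for k
  proof -
    have Mk: "real (M k) > 0" using M(2)[of k] by simp
    have "1 / real (M k) * (\<Sum>j\<in>{M k..<2 * M k}. X j) - l = 1 / real (M k) * (\<Sum>j\<in>{M k..<2 * M k}. X j - l)"
      using Mk by (simp add: sum_subtractf field_simps)
    also have "norm \<dots> \<le> 1 / real (M k) * (\<Sum>j\<in>{M k..<2 * M k}. norm (X j - l))"
      using Mk by (simp add: abs_mult divide_right_mono sum_abs)
    also have "\<dots> \<le> 1 / real (M k) * (\<Sum>j\<in>{M k..<2 * M k}. r / 2)"
      using k M(1)[of k] by (intro mult_left_mono sum_mono k0[THEN less_imp_le]) auto
    also have "\<dots> = r / 2" using Mk by simp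
    finally show ?thesis using r by simp
  qed
  then show "\<exists>no. \<forall>k\<ge>no. norm (1 / real (M k) * (\<Sum>j\<in>{M k..<2 * M k}. X j) - l) < r" by blast
qed

lemma integrable_product_bounded:
  fixes g :: "'a::euclidean_space \<Rightarrow> 'a \<Rightarrow> real"
  assumes "(\<lambda>(x, u). g x u) \<in> borel_measurable (lborel \<Otimes>\<^sub>M lborel)"
    and bd: "\<And>x u. \<bar>g x u\<bar> \<le> D" and supp: "\<And>x u. x \<notin> ball 0 R \<Longrightarrow> g x u = 0" "\<And>x u. u \<notin> avg_set b \<Longrightarrow> g x u = 0"
  shows "integrable (lborel \<Otimes>\<^sub>M lborel) (\<lambda>(x, u). g x u)"
proof (rule integrableI_bounded_set[where A = "ball 0 R \<times> avg_set b" and B = D])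
  have "emeasure (lborel \<Otimes>\<^sub>M lborel) (ball (0::'a) R \<times> avg_set b) = emeasure lborel (ball (0::'a) R) * emeasure lborel (avg_set b)"
    by (rule lborel.emeasure_pair_measure_Times) auto
  also have "\<dots> < \<infinity>" using emeasure_lborel_ball_finite[of "0::'a" R] by (simp add: emeasure_avg_set ennreal_mult_less_top)
  finally show "emeasure (lborel \<Otimes>\<^sub>M lborel) (ball (0::'a) R \<times> avg_set b) < \<infinity>" .
  have s: "x \<in> ball 0 R" "u \<in> avg_set b" if "g x u \<noteq> 0" for x u using supp that by blast+
  show "AE p in lborel \<Otimes>\<^sub>M lborel. p \<notin> ball 0 R \<times> avg_set b \<longrightarrow> (case p of (x, u) \<Rightarrow> g x u) = 0"
    using s by (intro AE_I2) (auto split: prod.splits)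
qed (use assms(1) bd in \<open>auto intro!: AE_I2\<close>)

text \<open>The formal adjoint of \<open>dyadic_quotient\<close>: the translation is
  reversed.\<close>

definition dual_quotient :: "('a::euclidean_space \<Rightarrow> real) \<Rightarrow> 'a \<Rightarrow> nat \<Rightarrow> 'a \<Rightarrow> real" where
  "dual_quotient \<psi> b j x = 2 ^ j * (\<integral>u. indicator (avg_set b) u * (\<psi> (x - (1/2) ^ j *\<^sub>R u) - \<psi> x) \<partial>lborel)"

text \<open>Translation invariance of Lebesgue measure carries the shift from F to \<psi>, that is
  \<open>A1\<close> to \<open>A3\<close>, for each fixed u; the unshifted term \<open>A2\<close> is
  common to both sides.\<close>

lemma dyadic_quotient_dual:
  fixes F \<psi> :: "'a::euclidean_space \<Rightarrow> real"
  assumes [measurable]: "F \<in> borel_measurable borel" "\<psi> \<in> borel_measurable borel"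
    and F: "\<And>x. \<bar>F x\<bar> \<le> B" and \<psi>: "\<And>x. \<bar>\<psi> x\<bar> \<le> L" and supp: "\<And>x. x \<notin> ball 0 R \<Longrightarrow> \<psi> x = 0" and b: "b \<in> Basis"
  shows "integrable lborel (\<lambda>x. dyadic_quotient F b j x * \<psi> x)"
    "integrable lborel (\<lambda>x. F x * dual_quotient \<psi> b j x)"
    "(\<integral>x. dyadic_quotient F b j x * \<psi> x \<partial>lborel) = (\<integral>x. F x * dual_quotient \<psi> b j x \<partial>lborel)"
proof -
  define \<epsilon> where "\<epsilon> = (1/2::real) ^ j"
  have \<epsilon>: "0 < \<epsilon>" "\<epsilon> \<le> 1" unfolding \<epsilon>_def by (auto simp: power_le_one)
  define I where "I = (indicator (avg_set b) :: 'a \<Rightarrow> real)"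
  have [measurable]: "I \<in> borel_measurable borel" unfolding I_def by measurable
  have I01: "\<bar>I u\<bar> \<le> 1" "u \<notin> avg_set b \<Longrightarrow> I u = 0" for u unfolding I_def by (auto simp: indicator_def)
  define A1 where "A1 = (\<lambda>x u. I u * F (x + \<epsilon> *\<^sub>R u) * \<psi> x)"
  define A2 where "A2 = (\<lambda>x u. I u * F x * \<psi> x)"
  define A3 where "A3 = (\<lambda>x u. I u * F x * \<psi> (x - \<epsilon> *\<^sub>R u))"
  have bd: "\<bar>I u * s * t\<bar> \<le> B * L" if "\<bar>s\<bar> \<le> B" "\<bar>t\<bar> \<le> L" for u s t
  proof -
    have "\<bar>I u * s * t\<bar> \<le> (1 * B) * L" unfolding abs_mult using that I01 by (intro mult_mono) auto
    then show ?thesis by simp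
  qed
  have i1: "integrable (lborel \<Otimes>\<^sub>M lborel) (\<lambda>(x, u). A1 x u)"
    unfolding A1_def by (rule integrable_product_bounded[where D = "B * L" and R = R and b = b])
      (measurable, auto intro!: bd F \<psi> simp: supp I01)
  have i2: "integrable (lborel \<Otimes>\<^sub>M lborel) (\<lambda>(x, u). A2 x u)"
    unfolding A2_def by (rule integrable_product_bounded[where D = "B * L" and R = R and b = b])
      (measurable, auto intro!: bd F \<psi> simp: supp I01)
  \<comment> \<open>Shifts have length below 1, whence the radius R + 1.\<close>
  have i3: "integrable (lborel \<Otimes>\<^sub>M lborel) (\<lambda>(x, u). A3 x u)"
  proof (rule integrable_product_bounded[where D = "B * L" and R = "R + 1" and b = b])
    show "(\<lambda>(x, u). A3 x u) \<in> borel_measurable (lborel \<Otimes>\<^sub>M lborel)" unfolding A3_def by measurable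
    show "\<bar>A3 x u\<bar> \<le> B * L" for x u unfolding A3_def by (intro bd F \<psi>)
    show "A3 x u = 0" if "u \<notin> avg_set b" for x u unfolding A3_def using I01(2)[OF that] by simp
    show "A3 x u = 0" if x: "x \<notin> ball 0 (R + 1)" for x u
    proof (cases "u \<in> avg_set b")
      case True
      have "norm (\<epsilon> *\<^sub>R u) \<le> 1 * 1" unfolding norm_scaleR using \<epsilon> avg_set_norm(2)[OF b True] by (intro mult_mono) auto
      then have "norm (x - \<epsilon> *\<^sub>R u) \<ge> R" using x norm_triangle_ineq2[of x "\<epsilon> *\<^sub>R u"] by simp
      then have "\<psi> (x - \<epsilon> *\<^sub>R u) = 0" by (intro supp) simp
      then show ?thesis unfolding A3_def by simp
    qed (simp add: A3_def I01(2))
  qed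
  have s: "integrable lborel (\<lambda>u. I u * h u)" if [measurable]: "h \<in> borel_measurable borel" and h: "\<And>u. \<bar>h u\<bar> \<le> D" for h D
  proof (rule integrableI_bounded_set[where A = "avg_set b" and B = D])
    show "AE u in lborel. u \<in> avg_set b \<longrightarrow> norm (I u * h u) \<le> D"
      using h by (intro AE_I2) (auto simp: I_def)
  qed (auto simp: I_def emeasure_avg_set)
  have q1: "dyadic_quotient F b j x * \<psi> x = 2 ^ j * ((\<integral>u. A1 x u \<partial>lborel) - (\<integral>u. A2 x u \<partial>lborel))" for x
  proof -
    have "(\<integral>u. I u * (F (x + \<epsilon> *\<^sub>R u) - F x) \<partial>lborel) = (\<integral>u. I u * F (x + \<epsilon> *\<^sub>R u) \<partial>lborel) - (\<integral>u. I u * F x \<partial>lborel)"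
      unfolding right_diff_distrib
    proof (rule Bochner_Integration.integral_diff)
      show "integrable lborel (\<lambda>u. I u * F (x + \<epsilon> *\<^sub>R u))" by (rule s[where D = B]) (use F in auto)
      show "integrable lborel (\<lambda>u. I u * F x)" by (rule s[where D = B]) (use F in auto)
    qed
    moreover have "(\<integral>u. A1 x u \<partial>lborel) = (\<integral>u. I u * F (x + \<epsilon> *\<^sub>R u) \<partial>lborel) * \<psi> x" "(\<integral>u. A2 x u \<partial>lborel) = (\<integral>u. I u * F x \<partial>lborel) * \<psi> x"
      unfolding A1_def A2_def by (rule integral_mult_left_zero)+
    moreover have "2 ^ j * X * \<psi> x = 2 ^ j * (P' - Q')" if "X = P - Q" "P' = P * \<psi> x" "Q' = Q * \<psi> x" for X P Q P' Q'
      unfolding that by (simp add: algebra_simps)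
    ultimately show ?thesis unfolding dyadic_quotient_def I_def[symmetric] \<epsilon>_def[symmetric] by blast
  qed
  have q2: "F x * dual_quotient \<psi> b j x = 2 ^ j * ((\<integral>u. A3 x u \<partial>lborel) - (\<integral>u. A2 x u \<partial>lborel))" for x
  proof -
    have "(\<integral>u. I u * (\<psi> (x - \<epsilon> *\<^sub>R u) - \<psi> x) \<partial>lborel) = (\<integral>u. I u * \<psi> (x - \<epsilon> *\<^sub>R u) \<partial>lborel) - (\<integral>u. I u * \<psi> x \<partial>lborel)"
      unfolding right_diff_distrib
    proof (rule Bochner_Integration.integral_diff)
      show "integrable lborel (\<lambda>u. I u * \<psi> (x - \<epsilon> *\<^sub>R u))" by (rule s[where D = L]) (use \<psi> in auto)
      show "integrable lborel (\<lambda>u. I u * \<psi> x)" by (rule s[where D = L]) (use \<psi> in auto)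
    qed
    moreover have "(\<integral>u. A3 x u \<partial>lborel) = F x * (\<integral>u. I u * \<psi> (x - \<epsilon> *\<^sub>R u) \<partial>lborel)"
      unfolding A3_def by (subst integral_mult_right_zero[symmetric]) (simp add: mult_ac)
    moreover have "(\<integral>u. A2 x u \<partial>lborel) = F x * (\<integral>u. I u * \<psi> x \<partial>lborel)"
      unfolding A2_def by (subst integral_mult_right_zero[symmetric]) (simp add: mult_ac)
    moreover have "F x * (2 ^ j * X) = 2 ^ j * (P' - Q')" if "X = P - Q" "P' = F x * P" "Q' = F x * Q" for X P Q P' Q'
      unfolding that by (simp add: algebra_simps)
    ultimately show ?thesis unfolding dual_quotient_def I_def[symmetric] \<epsilon>_def[symmetric] by blast
  qed
  note f1 = lborel_pair.integrable_fst[OF i1] and f2 = lborel_pair.integrable_fst[OF i2] and f3 = lborel_pair.integrable_fst[OF i3]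
  show "integrable lborel (\<lambda>x. dyadic_quotient F b j x * \<psi> x)" unfolding q1 using f1 f2 by auto
  show "integrable lborel (\<lambda>x. F x * dual_quotient \<psi> b j x)" unfolding q2 using f3 f2 by auto
  have "(\<integral>x. (\<integral>u. A1 x u \<partial>lborel) \<partial>lborel) = (\<integral>u. (\<integral>x. A1 x u \<partial>lborel) \<partial>lborel)"
    by (rule lborel_pair.Fubini_integral[OF i1, symmetric])
  also have "\<dots> = (\<integral>u. (\<integral>x. A3 x u \<partial>lborel) \<partial>lborel)"
  proof (rule Bochner_Integration.integral_cong[OF refl])
    fix u
    have "(\<integral>x. A3 x u \<partial>lborel) = \<bar>1\<bar> ^ DIM('a) * (\<integral>x. A3 (\<epsilon> *\<^sub>R u + 1 *\<^sub>R x) u \<partial>lborel)"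
      by (rule integral_lborel_affine) (auto simp: A3_def)
    then show "(\<integral>x. A1 x u \<partial>lborel) = (\<integral>x. A3 x u \<partial>lborel)" unfolding A1_def A3_def by (simp add: add.commute)
  qed
  also have "\<dots> = (\<integral>x. (\<integral>u. A3 x u \<partial>lborel) \<partial>lborel)" by (rule lborel_pair.Fubini_integral[OF i3])
  finally show "(\<integral>x. dyadic_quotient F b j x * \<psi> x \<partial>lborel) = (\<integral>x. F x * dual_quotient \<psi> b j x \<partial>lborel)"
    unfolding q1 q2 using f1 f2 f3 by simp
qed

text \<open>Reflection in the centre c preserves the ball and turns l u into 2 l c - l u, so the
  mean value is l c, with c = (3/4) b.\<close>

lemma integral_linear_avg_set:
  fixes l :: "'a::euclidean_space \<Rightarrow> real"
  assumes l: "bounded_linear l"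
  shows "integrable lborel (\<lambda>u. indicator (avg_set b) u * l u)"
    "(\<integral>u. indicator (avg_set b) u * l u \<partial>lborel) = avg_vol TYPE('a) * (3/4 * l b)"
proof -
  interpret bounded_linear l by fact
  have [measurable]: "l \<in> borel_measurable borel"
    using l by (intro borel_measurable_continuous_onI linear_continuous_on)
  define c where "c = (3/4) *\<^sub>R b"
  have avg: "u \<in> avg_set b \<longleftrightarrow> norm (u - c) < 1/4" for u unfolding avg_set_def c_def by (simp add: dist_norm norm_minus_commute)
  obtain K where K: "\<And>u. norm (l u) \<le> norm u * K" using bounded by blast
  have K0: "norm (l u) \<le> norm u * \<bar>K\<bar>" for u using K[of u] mult_left_mono[of K "\<bar>K\<bar>" "norm u"] by (meson abs_ge_self norm_ge_zero order_trans)
  show int: "integrable lborel (\<lambda>u. indicator (avg_set b) u * l u)"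
  proof (rule integrableI_bounded_set[where A = "avg_set b" and B = "(norm c + 1/4) * \<bar>K\<bar>"])
    show "AE u in lborel. u \<in> avg_set b \<longrightarrow> norm (indicator (avg_set b) u * l u) \<le> (norm c + 1/4) * \<bar>K\<bar>"
    proof (intro AE_I2 impI)
      fix u assume u: "u \<in> avg_set b"
      have "norm u \<le> norm c + norm (u - c)" using norm_triangle_ineq[of c "u - c"] by simp
      then have "norm u \<le> norm c + 1/4" using u unfolding avg by simp
      then have "norm u * \<bar>K\<bar> \<le> (norm c + 1/4) * \<bar>K\<bar>" by (rule mult_right_mono) simp
      then show "norm (indicator (avg_set b) u * l u) \<le> (norm c + 1/4) * \<bar>K\<bar>" using K0[of u] u by simp
    qed
  qed (auto simp: emeasure_avg_set)
  have m: "measure lborel (avg_set b) = avg_vol TYPE('a)"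
    using emeasure_avg_set[of b] avg_vol_pos[where 'a='a] by (simp add: measure_def)
  have fin: "emeasure lborel (avg_set b) < \<infinity>" by (simp add: emeasure_avg_set)
  have "(\<integral>u. indicator (avg_set b) u * l u \<partial>lborel) = \<bar>-1\<bar> ^ DIM('a) * (\<integral>u. indicator (avg_set b) (2 *\<^sub>R c + (-1) *\<^sub>R u) * l (2 *\<^sub>R c + (-1) *\<^sub>R u) \<partial>lborel)"
    by (rule integral_lborel_affine) auto
  also have "\<dots> = (\<integral>u. indicator (avg_set b) u * (2 * l c) - indicator (avg_set b) u * l u \<partial>lborel)"
  proof -
    have "indicator (avg_set b) (2 *\<^sub>R c + (-1) *\<^sub>R u) * l (2 *\<^sub>R c + (-1) *\<^sub>R u) = indicator (avg_set b) u * (2 * l c) - indicator (avg_set b) u * l u" for u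
    proof -
      have "(2 *\<^sub>R c + (-1) *\<^sub>R u) - c = - (u - c)" by (simp add: scaleR_2)
      then have "2 *\<^sub>R c + (-1) *\<^sub>R u \<in> avg_set b \<longleftrightarrow> u \<in> avg_set b" unfolding avg by (metis norm_minus_cancel)
      then show ?thesis by (simp add: indicator_def diff scaleR)
    qed
    then show ?thesis by simp
  qed
  also have "\<dots> = avg_vol TYPE('a) * (2 * l c) - (\<integral>u. indicator (avg_set b) u * l u \<partial>lborel)"
    using int fin m by (subst Bochner_Integration.integral_diff) auto
  finally show "(\<integral>u. indicator (avg_set b) u * l u \<partial>lborel) = avg_vol TYPE('a) * (3/4 * l b)"
    unfolding c_def by (simp add: scaleR)
qed

text \<open>After duality f is multiplied by averaged quotients of \<psi>. The Lipschitz bound keeps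
  these below w L, and they live on a fixed ball, so that the modulus of f times a constant
  dominates there.\<close>

lemma scale_average_limit:
  fixes f :: "'a::euclidean_space \<Rightarrow> real"
  assumes f: "loc_L1 f" and b: "b \<in> Basis" and \<psi>: "test_fun \<psi>"
    and M: "\<And>k. M k \<ge> k" "\<And>k. M k \<ge> 1"
  shows "(\<lambda>k. \<integral>x. scale_average f b (real k) (M k) x * \<psi> x \<partial>lborel)
    \<longlonglongrightarrow> - (avg_vol TYPE('a) * (3/4)) * (\<integral>x. f x * frechet_derivative \<psi> (at x) b \<partial>lborel)"
proof -
  have [measurable]: "f \<in> borel_measurable borel" using f by (rule loc_L1_measurable)
  obtain R L where cont: "continuous_on UNIV \<psi>" and der: "\<And>x. (\<psi> has_derivative frechet_derivative \<psi> (at x)) (at x)"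
    and supp: "\<And>x. x \<notin> ball 0 R \<Longrightarrow> \<psi> x = 0"
    and lip: "\<And>x y. \<bar>\<psi> x - \<psi> y\<bar> \<le> L * norm (x - y)" and bd: "\<And>x. \<bar>\<psi> x\<bar> \<le> L"
    using test_fun_props[OF \<psi>] by metis
  have [measurable]: "\<psi> \<in> borel_measurable borel" using cont by (rule borel_measurable_continuous_onI)
  have L0: "L \<ge> 0" using bd[of 0] by linarith
  define w where "w = avg_vol TYPE('a)"
  have w: "w > 0" unfolding w_def by (rule avg_vol_pos)
  define W where "W = avg_set b"
  have [measurable]: "W \<in> sets borel" unfolding W_def by measurable
  have mW: "measure lborel W = w" "emeasure lborel W < \<infinity>" unfolding W_def w_def
    using emeasure_avg_set[of b] avg_vol_pos[where 'a='a] by (simp_all add: measure_def)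
  have [measurable]: "dual_quotient \<psi> b j \<in> borel_measurable borel" for j unfolding dual_quotient_def by measurable
  have pw_bd: "\<bar>2 ^ j * (indicator W u * (\<psi> (x - (1/2) ^ j *\<^sub>R u) - \<psi> x))\<bar> \<le> indicator W u * L" for j u x
  proof (cases "u \<in> W")
    case True
    have "\<bar>\<psi> (x - (1/2) ^ j *\<^sub>R u) - \<psi> x\<bar> \<le> L * norm ((1/2) ^ j *\<^sub>R u)" using lip[of "x - (1/2) ^ j *\<^sub>R u" x] by simp
    also have "\<dots> = (1/2) ^ j * (L * norm u)" by simp
    also have "\<dots> \<le> (1/2) ^ j * (L * 1)" using L0 avg_set_norm(2)[OF b] True unfolding W_def by (intro mult_left_mono) (auto intro: less_imp_le)
    finally have "2 ^ j * \<bar>\<psi> (x - (1/2) ^ j *\<^sub>R u) - \<psi> x\<bar> \<le> 2 ^ j * ((1/2) ^ j * L)" by (intro mult_left_mono) auto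
    also have "2 ^ j * ((1/2) ^ j * L) = L" by (simp add: power_divide)
    finally show ?thesis using True by (simp add: abs_mult)
  qed simp
  have dq_eq: "dual_quotient \<psi> b j x = (\<integral>u. 2 ^ j * (indicator W u * (\<psi> (x - (1/2) ^ j *\<^sub>R u) - \<psi> x)) \<partial>lborel)" for j x
    unfolding dual_quotient_def W_def by simp
  have iL: "integrable lborel (\<lambda>u. indicator W u * L)" using mW by auto
  have dq_bd: "\<bar>dual_quotient \<psi> b j x\<bar> \<le> w * L" for j x
  proof -
    have "norm (\<integral>u. 2 ^ j * (indicator W u * (\<psi> (x - (1/2) ^ j *\<^sub>R u) - \<psi> x)) \<partial>lborel) \<le> (\<integral>u. indicator W u * L \<partial>lborel)"
    proof (rule Bochner_Integration.integral_norm_bound_integral[OF _ iL])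
      show "integrable lborel (\<lambda>u. 2 ^ j * (indicator W u * (\<psi> (x - (1/2) ^ j *\<^sub>R u) - \<psi> x)))"
        by (rule Bochner_Integration.integrable_bound[OF iL]) (measurable, use pw_bd order_trans[OF pw_bd abs_ge_self] in auto)
      show "norm (2 ^ j * (indicator W u * (\<psi> (x - (1/2) ^ j *\<^sub>R u) - \<psi> x))) \<le> indicator W u * L" for u
        using pw_bd by simp
    qed
    then show ?thesis unfolding dq_eq using mW by simp
  qed
  have dq_supp: "dual_quotient \<psi> b j x = 0" if x: "x \<notin> ball 0 (R + 1)" for j x
  proof -
    have "indicator W u * (\<psi> (x - (1/2) ^ j *\<^sub>R u) - \<psi> x) = 0" for u
    proof (cases "u \<in> W")
      case True
      have "norm ((1/2) ^ j *\<^sub>R u) \<le> 1 * 1" unfolding norm_scaleR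
        using avg_set_norm(2)[OF b] True unfolding W_def by (intro mult_mono) (auto simp: power_le_one intro: less_imp_le)
      then have "norm (x - (1/2) ^ j *\<^sub>R u) \<ge> R" using x norm_triangle_ineq2[of x "(1/2) ^ j *\<^sub>R u"] by simp
      then have "\<psi> (x - (1/2) ^ j *\<^sub>R u) = 0" by (intro supp) simp
      moreover have "\<psi> x = 0" using x by (intro supp) simp
      ultimately show ?thesis by simp
    qed simp
    then show ?thesis unfolding dq_eq by (simp only: mult_zero_right Bochner_Integration.integral_zero)
  qed
  \<comment> \<open>The sign stems from the reversed shift, the factor 3/4 from the centre of
    \<open>avg_set\<close>.\<close>
  define D where "D = (\<lambda>x. - (w * (3/4) * frechet_derivative \<psi> (at x) b))"
  have dq_lim: "(\<lambda>j. dual_quotient \<psi> b j x) \<longlonglongrightarrow> D x" for x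
  proof -
    define l where "l = frechet_derivative \<psi> (at x)"
    have bl: "bounded_linear l" unfolding l_def using der has_derivative_bounded_linear by blast
    have "(\<lambda>j. \<integral>u. 2 ^ j * (indicator W u * (\<psi> (x - (1/2) ^ j *\<^sub>R u) - \<psi> x)) \<partial>lborel) \<longlonglongrightarrow> (\<integral>u. indicator W u * l (- u) \<partial>lborel)"
    proof (rule integral_dominated_convergence[where w = "\<lambda>u. indicator W u * L"])
      have "l \<in> borel_measurable borel" using bl by (intro borel_measurable_continuous_onI linear_continuous_on)
      then show "(\<lambda>u. indicator W u * l (- u)) \<in> borel_measurable lborel" by measurable
      show "AE u in lborel. (\<lambda>j. 2 ^ j * (indicator W u * (\<psi> (x - (1/2) ^ j *\<^sub>R u) - \<psi> x))) \<longlonglongrightarrow> indicator W u * l (- u)"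
      proof (rule AE_I2)
        fix u
        have "((\<lambda>t::real. x + t *\<^sub>R (- u)) has_derivative (\<lambda>t. t *\<^sub>R (- u))) (at 0)" by (auto intro!: derivative_eq_intros)
        moreover have "(\<psi> has_derivative l) (at (x + 0 *\<^sub>R (- u)))" unfolding l_def using der by simp
        ultimately have "((\<lambda>t. \<psi> (x + t *\<^sub>R (- u))) has_derivative (\<lambda>t. l (t *\<^sub>R (- u)))) (at 0)"
          by (rule has_derivative_compose)
        moreover have "(\<lambda>t. l (t *\<^sub>R (- u))) = (\<lambda>t. t * l (- u))"
          using bl by (simp only: linear_scale[OF bounded_linear.linear[OF bl]] real_scaleR_def)
        ultimately have "DERIV (\<lambda>t. \<psi> (x + t *\<^sub>R (- u))) 0 :> l (- u)"
          by (simp add: has_field_derivative_def mult_commute_abs)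
        then have lim: "((\<lambda>h. (\<psi> (x + (0 + h) *\<^sub>R (- u)) - \<psi> (x + 0 *\<^sub>R (- u))) / h) \<longlongrightarrow> l (- u)) (at 0)"
          unfolding DERIV_def .
        have "filterlim (\<lambda>j. (1/2::real) ^ j) (at 0) sequentially"
          unfolding filterlim_at by (auto intro!: LIMSEQ_power_zero)
        from filterlim_compose[OF lim this]
        have "(\<lambda>j. (\<psi> (x - (1/2) ^ j *\<^sub>R u) - \<psi> x) / (1/2) ^ j) \<longlonglongrightarrow> l (- u)" by simp
        then have "(\<lambda>j. indicator W u * ((\<psi> (x - (1/2) ^ j *\<^sub>R u) - \<psi> x) / (1/2) ^ j)) \<longlonglongrightarrow> indicator W u * l (- u)"
          by (intro tendsto_mult tendsto_const)
        then show "(\<lambda>j. 2 ^ j * (indicator W u * (\<psi> (x - (1/2) ^ j *\<^sub>R u) - \<psi> x))) \<longlonglongrightarrow> indicator W u * l (- u)"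
          by (simp add: power_divide mult_ac)
      qed
      show "AE u in lborel. norm (2 ^ j * (indicator W u * (\<psi> (x - (1/2) ^ j *\<^sub>R u) - \<psi> x))) \<le> indicator W u * L" for j
        using pw_bd by (intro AE_I2) simp
    qed (use iL in measurable)
    moreover have "(\<integral>u. indicator W u * l (- u) \<partial>lborel) = D x"
    proof -
      have "(\<lambda>u. indicator W u * l (- u)) = (\<lambda>u. - (indicator W u * l u))"
        using linear_neg[OF bounded_linear.linear[OF bl]] by simp
      then show ?thesis using integral_linear_avg_set(2)[OF bl, of b] unfolding W_def D_def w_def l_def by simp
    qed
    ultimately show ?thesis unfolding dq_eq by simp
  qed
  define avg where "avg = (\<lambda>k x. 1 / real (M k) * (\<Sum>j\<in>{M k..<2 * M k}. dual_quotient \<psi> b j x))"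
  have avg_lim: "(\<lambda>k. avg k x) \<longlonglongrightarrow> D x" for x
    unfolding avg_def by (rule tendsto_dyadic_average[OF dq_lim M])
  have avg_bd: "\<bar>avg k x\<bar> \<le> w * L" for k x
  proof -
    have Mk: "real (M k) > 0" using M(2)[of k] by simp
    have "\<bar>avg k x\<bar> \<le> 1 / real (M k) * (\<Sum>j\<in>{M k..<2 * M k}. \<bar>dual_quotient \<psi> b j x\<bar>)"
      unfolding avg_def using Mk by (simp add: abs_mult divide_right_mono sum_abs)
    also have "\<dots> \<le> 1 / real (M k) * (\<Sum>j\<in>{M k..<2 * M k}. w * L)" by (intro mult_left_mono sum_mono dq_bd) simp
    also have "\<dots> = w * L" using Mk by simp
    finally show ?thesis .
  qed
  have avg_supp: "avg k x = 0" if "x \<notin> ball 0 (R + 1)" for k x unfolding avg_def using dq_supp[OF that] by simp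
  have "(\<lambda>k. \<integral>x. clip (real k) (f x) * avg k x \<partial>lborel) \<longlonglongrightarrow> (\<integral>x. f x * D x \<partial>lborel)"
  proof (rule integral_dominated_convergence[where w = "\<lambda>x. \<bar>f x\<bar> * (w * L * indicator (ball 0 (R + 1)) x)"])
    show "AE x in lborel. (\<lambda>k. clip (real k) (f x) * avg k x) \<longlonglongrightarrow> f x * D x"
    proof (intro AE_I2 tendsto_mult avg_lim)
      fix x
      obtain k0 :: nat where "\<bar>f x\<bar> < real k0" using reals_Archimedean2 by blast
      then have "clip (real k) (f x) = f x" if "k \<ge> k0" for k using that unfolding clip_def by auto
      then show "(\<lambda>k. clip (real k) (f x)) \<longlonglongrightarrow> f x"
        by (intro tendsto_eventually) (auto simp: eventually_sequentially)
    qed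
    show "AE x in lborel. norm (clip (real k) (f x) * avg k x) \<le> \<bar>f x\<bar> * (w * L * indicator (ball 0 (R + 1)) x)" for k
    proof (rule AE_I2)
      fix x
      show "norm (clip (real k) (f x) * avg k x) \<le> \<bar>f x\<bar> * (w * L * indicator (ball 0 (R + 1)) x)"
      proof (cases "x \<in> ball 0 (R + 1)")
        case True
        have "\<bar>clip (real k) (f x)\<bar> * \<bar>avg k x\<bar> \<le> \<bar>f x\<bar> * (w * L)" by (intro mult_mono clip_bounds(3) avg_bd) auto
        then show ?thesis using True by (simp add: abs_mult)
      qed (simp add: avg_supp)
    qed
    show "(\<lambda>x. clip (real k) (f x) * avg k x) \<in> borel_measurable lborel" for k unfolding avg_def by measurable
    have "D \<in> borel_measurable borel" by (rule borel_measurable_LIMSEQ_real[OF avg_lim]) (unfold avg_def, measurable)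
    then show "(\<lambda>x. f x * D x) \<in> borel_measurable lborel" by measurable
    have "loc_L1 (\<lambda>x. \<bar>f x\<bar>)" using f unfolding loc_L1_def by auto
    then show "integrable lborel (\<lambda>x. \<bar>f x\<bar> * (w * L * indicator (ball 0 (R + 1)) x))"
      by (rule loc_L1_integrable_mult[where M = "w * L" and c = 0 and r = "R + 1"]) (use w L0 in \<open>auto simp: indicator_def\<close>)
  qed
  moreover have "(\<integral>x. f x * D x \<partial>lborel) = - (avg_vol TYPE('a) * (3/4)) * (\<integral>x. f x * frechet_derivative \<psi> (at x) b \<partial>lborel)"
  proof -
    have "(\<lambda>x. f x * D x) = (\<lambda>x. - (w * (3/4)) * (f x * frechet_derivative \<psi> (at x) b))" unfolding D_def by (simp add: fun_eq_iff)
    then show ?thesis unfolding w_def by (simp only: integral_mult_right_zero)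
  qed
  \<comment> \<open>Once k exceeds R, the cut-off to the ball of radius k does not affect the
    pairing with \<psi>.\<close>
  moreover have "eventually (\<lambda>k. (\<integral>x. clip (real k) (f x) * avg k x \<partial>lborel) = (\<integral>x. scale_average f b (real k) (M k) x * \<psi> x \<partial>lborel)) sequentially"
  proof -
    obtain k0 :: nat where k0: "R < real k0" using reals_Archimedean2 by blast
    have "(\<integral>x. clip (real k) (f x) * avg k x \<partial>lborel) = (\<integral>x. scale_average f b (real k) (M k) x * \<psi> x \<partial>lborel)" if k: "k \<ge> k0" for k
    proof -
      define F where "F = (\<lambda>x. clip (real k) (f x))"
      have [measurable]: "F \<in> borel_measurable borel" unfolding F_def by measurable
      have Fb: "\<bar>F x\<bar> \<le> real k" for x unfolding F_def by (rule clip_bounds) simp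
      have dual: "integrable lborel (\<lambda>x. dyadic_quotient F b j x * \<psi> x)" "integrable lborel (\<lambda>x. F x * dual_quotient \<psi> b j x)"
        "(\<integral>x. dyadic_quotient F b j x * \<psi> x \<partial>lborel) = (\<integral>x. F x * dual_quotient \<psi> b j x \<partial>lborel)" for j
        by (rule dyadic_quotient_dual[OF _ _ Fb bd supp b], measurable)+
      have "(\<integral>x. scale_average f b (real k) (M k) x * \<psi> x \<partial>lborel) = (\<integral>x. 1 / real (M k) * (\<Sum>j\<in>{M k..<2 * M k}. dyadic_quotient F b j x * \<psi> x) \<partial>lborel)"
      proof (intro Bochner_Integration.integral_cong refl)
        fix x
        show "scale_average f b (real k) (M k) x * \<psi> x = 1 / real (M k) * (\<Sum>j\<in>{M k..<2 * M k}. dyadic_quotient F b j x * \<psi> x)"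
        proof (cases "x \<in> ball 0 R")
          case True
          then have "x \<in> ball 0 (real k)" using k0 k by simp
          then show ?thesis unfolding scale_average_def F_def[symmetric] by (simp add: sum_distrib_right)
        qed (simp add: supp)
      qed
      also have "\<dots> = 1 / real (M k) * (\<Sum>j\<in>{M k..<2 * M k}. \<integral>x. F x * dual_quotient \<psi> b j x \<partial>lborel)"
        using dual by (simp add: Bochner_Integration.integral_sum)
      also have "\<dots> = (\<integral>x. 1 / real (M k) * (\<Sum>j\<in>{M k..<2 * M k}. F x * dual_quotient \<psi> b j x) \<partial>lborel)"
        using dual by (simp add: Bochner_Integration.integral_sum)
      also have "\<dots> = (\<integral>x. clip (real k) (f x) * avg k x \<partial>lborel)"
        unfolding avg_def F_def by (simp add: sum_distrib_left mult_ac)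
      finally show ?thesis by simp
    qed
    then show ?thesis unfolding eventually_sequentially by blast
  qed
  ultimately show ?thesis using Lim_transform_eventually by fastforce
qed

section \<open>Lebesgue and Borel measurable representatives\<close>

lemma loc_L1_imp_loc_integrable:
  assumes u: "loc_L1 u" shows "loc_integrable u"
  unfolding loc_integrable_def set_integrable_def
proof (intro allI impI)
  fix K :: "'a set" assume K: "compact K"
  have [measurable]: "u \<in> borel_measurable borel" using u by (rule loc_L1_measurable)
  have [measurable]: "K \<in> sets borel" using K by (rule borel_compact)
  obtain R where R: "K \<subseteq> ball 0 R" using bounded_subset_ballD[OF compact_imp_bounded[OF K], of 0] by auto
  have "integrable lborel (\<lambda>x. indicator K x *\<^sub>R u x)"
  proof (rule integrableI_bounded)
    have "(\<integral>\<^sup>+ x. ennreal (norm (indicator K x *\<^sub>R u x)) \<partial>lborel) \<le> (\<integral>\<^sup>+ x \<in> ball 0 R. ennreal (norm (u x)) \<partial>lborel)"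
      using R by (intro nn_integral_mono) (auto simp: indicator_def)
    also have "\<dots> < \<infinity>" by (rule loc_L1_ball[OF u])
    finally show "(\<integral>\<^sup>+ x. ennreal (norm (indicator K x *\<^sub>R u x)) \<partial>lborel) < \<infinity>" .
  qed measurable
  then show "integrable lebesgue (\<lambda>x. indicat_real K x *\<^sub>R u x)" by (subst integrable_completion) auto
qed

lemma loc_integrable_measurable:
  fixes u :: "'a::euclidean_space \<Rightarrow> 'b::euclidean_space"
  assumes u: "loc_integrable u" shows "u \<in> borel_measurable lebesgue"
proof (rule borel_measurable_LIMSEQ_metric)
  show "(\<lambda>x. indicator (cball 0 (real k)) x *\<^sub>R u x) \<in> borel_measurable lebesgue" for k
    using u unfolding loc_integrable_def set_integrable_def by (metis borel_measurable_integrable compact_cball)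
  fix x :: 'a
  obtain k0 :: nat where "norm x < real k0" using reals_Archimedean2 by blast
  then have "indicator (cball 0 (real k)) x *\<^sub>R u x = u x" if "k \<ge> k0" for k using that by simp
  then show "(\<lambda>k. indicator (cball 0 (real k)) x *\<^sub>R u x) \<longlonglongrightarrow> u x"
    by (intro tendsto_eventually) (auto simp: eventually_sequentially)
qed

lemma lebesgue_borel_representative:
  fixes u :: "'a::euclidean_space \<Rightarrow> 'b::euclidean_space"
  assumes [measurable]: "u \<in> borel_measurable lebesgue"
  obtains u' where "u' \<in> borel_measurable borel" "AE x in lebesgue. u x = u' x"
proof -
  have "\<exists>v. v \<in> borel_measurable lborel \<and> (AE x in lborel. u x \<bullet> b = v x)" for b
    using completion_ex_borel_measurable_real[of "\<lambda>x. u x \<bullet> b" lborel] by auto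
  then obtain v where v: "\<And>b. v b \<in> borel_measurable lborel" "\<And>b. AE x in lborel. u x \<bullet> b = v b x" by metis
  have [measurable]: "v b \<in> borel_measurable borel" for b using v(1)[of b] by simp
  have "AE x in lborel. \<forall>b\<in>Basis. u x \<bullet> b = v b x" by (rule AE_finite_allI) (auto simp: v)
  then have "AE x in lborel. u x = (\<Sum>b\<in>Basis. v b x *\<^sub>R b)"
  proof eventually_elim
    case (elim x)
    have "u x = (\<Sum>b\<in>Basis. (u x \<bullet> b) *\<^sub>R b)" by (simp add: euclidean_representation)
    also have "\<dots> = (\<Sum>b\<in>Basis. v b x *\<^sub>R b)" using elim by (intro sum.cong) auto
    finally show ?case .
  qed
  then have "AE x in lebesgue. u x = (\<Sum>b\<in>Basis. v b x *\<^sub>R b)" by (rule AE_completion)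
  then show thesis by (intro that[of "\<lambda>x. \<Sum>b\<in>Basis. v b x *\<^sub>R b"]) auto
qed

lemma loc_L1_representative:
  fixes u :: "'a::euclidean_space \<Rightarrow> 'b::euclidean_space"
  assumes u: "loc_integrable u"
  obtains u' where "loc_L1 u'" "AE x in lebesgue. u x = u' x"
proof -
  have [measurable]: "u \<in> borel_measurable lebesgue" using u by (rule loc_integrable_measurable)
  obtain u' where [measurable]: "u' \<in> borel_measurable borel" and ae: "AE x in lebesgue. u x = u' x"
    using lebesgue_borel_representative[of u] by auto
  have "(\<integral>\<^sup>+ x \<in> ball 0 R. ennreal (norm (u' x)) \<partial>lborel) < \<infinity>" for R
  proof -
    have "(\<integral>\<^sup>+ x \<in> ball 0 R. ennreal (norm (u' x)) \<partial>lborel) = (\<integral>\<^sup>+ x \<in> ball 0 R. ennreal (norm (u' x)) \<partial>lebesgue)"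
      by (simp add: nn_integral_completion)
    also have "\<dots> \<le> (\<integral>\<^sup>+ x. ennreal (norm (indicator (cball 0 R) x *\<^sub>R u x)) \<partial>lebesgue)"
      using ae by (intro nn_integral_mono_AE) (auto elim!: eventually_mono simp: indicator_def)
    also have "\<dots> < \<infinity>"
      using u unfolding loc_integrable_def set_integrable_def integrable_iff_bounded by (metis compact_cball)
    finally show ?thesis .
  qed
  then show thesis using ae by (intro that[of u']) (auto simp: loc_L1_def)
qed

lemma weak_gradient_cong_AE:
  fixes f f' :: "'a::euclidean_space \<Rightarrow> real" and G G' :: "'a \<Rightarrow> 'a"
  assumes wg: "weak_gradient f G" and f: "AE x in lebesgue. f x = f' x" and G: "AE x in lebesgue. G x = G' x"
    and [measurable]: "f \<in> borel_measurable lebesgue" "f' \<in> borel_measurable lebesgue" "G \<in> borel_measurable lebesgue"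
    and G': "loc_integrable G'"
  shows "weak_gradient f' G'"
  unfolding weak_gradient_def
proof (intro conjI allI impI ballI G')
  fix \<phi> :: "'a \<Rightarrow> real" and b :: 'a assume \<phi>: "test_fun \<phi>" and b: "b \<in> Basis"
  obtain R L where cont: "continuous_on UNIV \<phi>"
    and contd: "\<And>b. b \<in> Basis \<Longrightarrow> continuous_on UNIV (\<lambda>x. frechet_derivative \<phi> (at x) b)"
    using test_fun_props[OF \<phi>] by metis
  have [measurable]: "\<phi> \<in> borel_measurable lebesgue" "(\<lambda>x. frechet_derivative \<phi> (at x) b) \<in> borel_measurable lebesgue"
    using cont contd[OF b] by (auto intro!: borel_imp_lebesgue_measurable borel_measurable_continuous_onI)
  have [measurable]: "G' \<in> borel_measurable lebesgue" using G' by (rule loc_integrable_measurable)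
  have "(\<integral>x. f' x * frechet_derivative \<phi> (at x) b \<partial>lebesgue) = (\<integral>x. f x * frechet_derivative \<phi> (at x) b \<partial>lebesgue)"
    using f by (intro integral_cong_AE) (auto elim!: eventually_mono)
  also have "\<dots> = - (\<integral>x. (G x \<bullet> b) * \<phi> x \<partial>lebesgue)" using wg \<phi> b unfolding weak_gradient_def by blast
  also have "(\<integral>x. (G x \<bullet> b) * \<phi> x \<partial>lebesgue) = (\<integral>x. (G' x \<bullet> b) * \<phi> x \<partial>lebesgue)"
    using G by (intro integral_cong_AE) (auto elim!: eventually_mono)
  finally show "(\<integral>x. f' x * frechet_derivative \<phi> (at x) b \<partial>lebesgue) = - (\<integral>x. (G' x \<bullet> b) * \<phi> x \<partial>lebesgue)" .
qed

lemma measurable_lebesgue_AE_eq: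
  fixes g h :: "'a::euclidean_space \<Rightarrow> ennreal"
  assumes g: "g \<in> borel_measurable lebesgue" and ae: "AE x in lebesgue. g x = h x"
  shows "h \<in> borel_measurable lebesgue"
proof (rule measurableI)
  fix A :: "ennreal set" assume A: "A \<in> sets borel"
  have "g -` A \<inter> space lebesgue \<in> sets lebesgue" using g A by (rule measurable_sets)
  moreover have "AE x in lebesgue. x \<in> g -` A \<inter> space lebesgue \<longleftrightarrow> x \<in> h -` A \<inter> space lebesgue"
    using ae by (auto elim!: eventually_mono)
  ultimately show "h -` A \<inter> space lebesgue \<in> sets lebesgue"
    using completion.in_sets_AE[where M = lborel and A = "g -` A \<inter> space lebesgue" and B = "h -` A \<inter> space lebesgue"] by blast
qed auto

text \<open>For almost every x the sections of the two level sets agree almost everywhere.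
  Measurability of the section integral is known for the Borel function f' and passes to f by
  completeness of Lebesgue measure.\<close>

lemma BSVY_cong_AE:
  fixes N :: "('a::euclidean_space) bnorm" and f f' :: "'a \<Rightarrow> real"
  assumes N: "ball_banach N" and ae: "AE x in lebesgue. f x = f' x" and [measurable]: "f' \<in> borel_measurable borel"
  shows "BSVY N p \<gamma> f = BSVY N p \<gamma> f'"
  unfolding BSVY_def
proof (intro SUP_cong refl arg_cong2[where f = "(*)"])
  fix lam :: real
  define \<Phi> where "\<Phi> = (\<lambda>(f::'a \<Rightarrow> real) x. epowr (\<integral>\<^sup>+ y. indicator (E_set lam (\<gamma> / p) f) (x, y) * ennreal (dist x y powr (\<gamma> - real DIM('a))) \<partial>lebesgue) (1 / p))"
  have eq: "\<Phi> f' x = \<Phi> f x" if "f x = f' x" for x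
  proof -
    have "(\<integral>\<^sup>+ y. indicator (E_set lam (\<gamma> / p) f') (x, y) * ennreal (dist x y powr (\<gamma> - real DIM('a))) \<partial>lebesgue)
       = (\<integral>\<^sup>+ y. indicator (E_set lam (\<gamma> / p) f) (x, y) * ennreal (dist x y powr (\<gamma> - real DIM('a))) \<partial>lebesgue)"
      using ae that by (intro nn_integral_cong_AE) (auto elim!: eventually_mono simp: E_set_def indicator_def)
    then show ?thesis unfolding \<Phi>_def by simp
  qed
  have m: "\<Phi> f' \<in> borel_measurable lebesgue"
    unfolding \<Phi>_def nn_integral_completion by (rule borel_imp_lebesgue_measurable) measurable
  have ae': "AE x in lebesgue. \<Phi> f' x = \<Phi> f x" using ae eq by (auto elim!: eventually_mono)
  have "N (\<Phi> f) = N (\<Phi> f')"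
    using ae' by (intro bb_cong[OF N m measurable_lebesgue_AE_eq[OF m ae']]) (auto elim!: eventually_mono)
  then show "N (\<lambda>x. epowr (\<integral>\<^sup>+ y. indicator (E_set lam (\<gamma> / p) f) (x, y) * ennreal (dist x y powr (\<gamma> - real DIM('a))) \<partial>lebesgue) (1 / p))
    = N (\<lambda>x. epowr (\<integral>\<^sup>+ y. indicator (E_set lam (\<gamma> / p) f') (x, y) * ennreal (dist x y powr (\<gamma> - real DIM('a))) \<partial>lebesgue) (1 / p))"
    unfolding \<Phi>_def .
qed

text \<open>Each partial derivative arises separately, up to the factor w, as a weak limit of scale
  averages; convergence against test functions comes from \<open>scale_average_limit\<close>. That
  the norm of G is finite is recovered afterwards from the lower bound.\<close>

theorem weak_gradient_exists:
  fixes N :: "('a::euclidean_space) bnorm"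
  assumes N: "ball_banach N" and p: "p \<ge> 1" and Y: "ball_banach (convexification N p)"
    and ac: "abs_cont_norm (associate N)"
    and f: "loc_L1 f" and fin: "BSVY N p \<gamma> f < \<infinity>"
  obtains G where "loc_L1 G" "weak_gradient f G"
proof -
  have [measurable]: "f \<in> borel_measurable borel" using f by (rule loc_L1_measurable)
  define w where "w = avg_vol TYPE('a) * (3/4)"
  have w: "w > 0" unfolding w_def using avg_vol_pos[where 'a='a] by simp
  \<comment> \<open>M k is so large that (1/2) ^ M k compensates for the norm of the ball of radius
    k; by k \<le> M k the clipping height k also stays below 2 ^ M k.\<close>
  have "\<exists>M\<ge>1. k \<le> M \<and> ennreal ((1/2) ^ M) * convexification N p (indicator (ball 0 (real k))) \<le> 1" for k :: nat
  proof -
    obtain y where y: "convexification N p (indicator (ball 0 (real k))) = ennreal y" "y \<ge> 0"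
      using bb_ball[OF Y, of 0 "real k"] by (cases "convexification N p (indicator (ball 0 (real k)))") auto
    obtain M0 :: nat where M0: "y < 2 ^ M0" using real_arch_pow[of 2 y] by auto
    define M where "M = max 1 (max k M0)"
    have "M0 \<le> M" unfolding M_def by simp
    then have "(2::real) ^ M0 \<le> 2 ^ M" by (intro power_increasing) auto
    then have "y \<le> 2 ^ M" using M0 by linarith
    then have "(1/2) ^ M * y \<le> 1" by (simp add: power_divide)
    then have "ennreal ((1/2) ^ M) * ennreal y \<le> 1" using y by (simp flip: ennreal_mult)
    then show ?thesis using y unfolding M_def by (intro exI[of _ M]) (auto simp: M_def)
  qed
  then obtain M where M: "\<And>k. M k \<ge> 1" "\<And>k. M k \<ge> k"
    "\<And>k. ennreal ((1/2) ^ M k) * convexification N p (indicator (ball 0 (real k))) \<le> 1" by metis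
  have kM: "real k \<le> 2 ^ M k" for k
  proof -
    have "k \<le> 2 ^ M k" using M(2)[of k] less_exp[of "M k"] by linarith
    then show ?thesis by (metis of_nat_le_iff of_nat_numeral of_nat_power)
  qed
  have "\<forall>b\<in>Basis. \<exists>g. g \<in> borel_measurable borel \<and> N (\<lambda>x. ennreal \<bar>g x\<bar>) < \<infinity> \<and>
     (\<forall>\<psi>. test_fun \<psi> \<longrightarrow> (\<integral>x. g x * \<psi> x \<partial>lborel) = - w * (\<integral>x. f x * frechet_derivative \<psi> (at x) b \<partial>lborel))"
  proof
    fix b :: 'a assume b: "b \<in> Basis"
    define q where "q = (\<lambda>k. scale_average f b (real k) (M k))"
    have [measurable]: "q k \<in> borel_measurable borel" for k unfolding q_def by measurable
    obtain C where C: "\<And>m M. 0 \<le> m \<Longrightarrow> m \<le> 2 ^ M \<Longrightarrow> M \<ge> 1 \<Longrightarrow> ennreal ((1/2) ^ M) * convexification N p (indicator (ball 0 m)) \<le> 1 \<Longrightarrow>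
      N (\<lambda>x. ennreal \<bar>scale_average f b m M x\<bar>) \<le> ennreal C"
      by (rule scale_average_norm_bound[OF N p Y b _ fin]) auto
    have qN: "N (\<lambda>x. ennreal \<bar>q k x\<bar>) \<le> ennreal C" for k unfolding q_def using M kM by (intro C) auto
    have ql: "q k \<in> borel_measurable lebesgue" for k by (rule borel_imp_lebesgue_measurable) measurable
    obtain g where gl: "g \<in> borel_measurable lebesgue" and gN: "N (\<lambda>x. ennreal \<bar>g x\<bar>) \<le> ennreal C"
      and g: "\<And>\<psi> l. bdd_supp \<psi> \<Longrightarrow> (\<lambda>k. \<integral>x. q k x * \<psi> x \<partial>lebesgue) \<longlonglongrightarrow> l \<Longrightarrow> (\<integral>x. g x * \<psi> x \<partial>lebesgue) = l"
      by (rule bb_weak_limit[OF N ac, where q = q, OF ql qN]) (erule that)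
    obtain g' where [measurable]: "g' \<in> borel_measurable borel" and ae: "AE x in lebesgue. g x = g' x"
      using lebesgue_borel_representative[OF gl] by blast
    have g'l: "g' \<in> borel_measurable lebesgue" by (rule borel_imp_lebesgue_measurable) measurable
    have "N (\<lambda>x. ennreal \<bar>g' x\<bar>) = N (\<lambda>x. ennreal \<bar>g x\<bar>)"
      using ae gl g'l by (intro bb_cong[OF N]) (auto elim!: eventually_mono)
    then have fin': "N (\<lambda>x. ennreal \<bar>g' x\<bar>) < \<infinity>" using gN by (simp add: le_less_trans)
    have "(\<integral>x. g' x * \<psi> x \<partial>lborel) = - w * (\<integral>x. f x * frechet_derivative \<psi> (at x) b \<partial>lborel)" if \<psi>: "test_fun \<psi>" for \<psi>
    proof -
      obtain R L where cont: "continuous_on UNIV \<psi>" and supp: "\<And>x. x \<notin> ball 0 R \<Longrightarrow> \<psi> x = 0" and bd: "\<And>x. \<bar>\<psi> x\<bar> \<le> L"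
        using test_fun_props[OF \<psi>] by metis
      have [measurable]: "\<psi> \<in> borel_measurable borel" using cont by (rule borel_measurable_continuous_onI)
      have \<psi>l: "\<psi> \<in> borel_measurable lebesgue" by (rule borel_imp_lebesgue_measurable) measurable
      have bs: "bdd_supp \<psi>" unfolding bdd_supp_def
      proof (intro conjI \<psi>l exI[of _ "max R L"] allI impI)
        show "\<bar>\<psi> x\<bar> \<le> max R L" for x using bd[of x] by simp
        show "\<psi> x = 0" if "x \<notin> ball 0 (max R L)" for x using that by (intro supp) auto
      qed
      have "(\<lambda>k. \<integral>x. q k x * \<psi> x \<partial>lebesgue) \<longlonglongrightarrow> - w * (\<integral>x. f x * frechet_derivative \<psi> (at x) b \<partial>lborel)"
        using scale_average_limit[OF f b \<psi> M(2) M(1)] by (simp add: integral_completion q_def w_def)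
      then have "(\<integral>x. g x * \<psi> x \<partial>lebesgue) = - w * (\<integral>x. f x * frechet_derivative \<psi> (at x) b \<partial>lborel)" by (rule g[OF bs])
      moreover have "(\<integral>x. g x * \<psi> x \<partial>lebesgue) = (\<integral>x. g' x * \<psi> x \<partial>lebesgue)"
        using ae gl g'l \<psi>l by (intro integral_cong_AE) (auto elim!: eventually_mono)
      ultimately show ?thesis by (simp add: integral_completion)
    qed
    then show "\<exists>g. g \<in> borel_measurable borel \<and> N (\<lambda>x. ennreal \<bar>g x\<bar>) < \<infinity> \<and>
      (\<forall>\<psi>. test_fun \<psi> \<longrightarrow> (\<integral>x. g x * \<psi> x \<partial>lborel) = - w * (\<integral>x. f x * frechet_derivative \<psi> (at x) b \<partial>lborel))"
      using fin' by (intro exI[of _ g']) auto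
  qed
  from bchoice[OF this] obtain g where g: "\<And>b. b \<in> Basis \<Longrightarrow> g b \<in> borel_measurable borel" "\<And>b. b \<in> Basis \<Longrightarrow> N (\<lambda>x. ennreal \<bar>g b x\<bar>) < \<infinity>"
     "\<And>b \<psi>. b \<in> Basis \<Longrightarrow> test_fun \<psi> \<Longrightarrow> (\<integral>x. g b x * \<psi> x \<partial>lborel) = - w * (\<integral>x. f x * frechet_derivative \<psi> (at x) b \<partial>lborel)"
    by blast
  \<comment> \<open>Division by w, which is 3/4 of the volume of \<open>avg_set\<close>, undoes the
    constant of \<open>scale_average_limit\<close>.\<close>
  define G where "G = (\<lambda>x. \<Sum>b\<in>Basis. (g b x / w) *\<^sub>R b)"
  have [measurable]: "G \<in> borel_measurable borel" unfolding G_def using g(1) by (intro borel_measurable_sum) auto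
  have Gb: "G x \<bullet> b = g b x / w" if "b \<in> Basis" for x b
    unfolding G_def using that by (simp add: inner_sum_left inner_Basis if_distrib sum.delta cong: if_cong)
  have LG: "loc_L1 G" unfolding loc_L1_def
  proof (intro conjI allI)
    fix R :: real
    have "(\<integral>\<^sup>+ x \<in> ball 0 R. ennreal (norm (G x)) \<partial>lborel) \<le> (\<integral>\<^sup>+ x. (\<Sum>b\<in>Basis. ennreal (1/w) * (ennreal \<bar>g b x\<bar> * indicator (ball 0 R) x)) \<partial>lborel)"
    proof (rule nn_integral_mono)
      fix x
      have "norm (G x) \<le> (\<Sum>b\<in>Basis. 1/w * \<bar>g b x\<bar>)"
        using norm_le_l1[of "G x"] w by (simp add: Gb cong: sum.cong)
      then have "ennreal (norm (G x)) \<le> (\<Sum>b\<in>Basis. ennreal (1/w * \<bar>g b x\<bar>))"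
        using w by (subst sum_ennreal) (auto intro: ennreal_leI)
      also have "\<dots> = (\<Sum>b\<in>Basis. ennreal (1/w) * ennreal \<bar>g b x\<bar>)" using w by (intro sum.cong refl ennreal_mult) auto
      finally show "ennreal (norm (G x)) * indicator (ball 0 R) x \<le> (\<Sum>b\<in>Basis. ennreal (1/w) * (ennreal \<bar>g b x\<bar> * indicator (ball 0 R) x))"
        by (cases "x \<in> ball 0 R") auto
    qed
    also have "\<dots> = (\<Sum>b\<in>Basis. ennreal (1/w) * (\<integral>\<^sup>+ x \<in> ball 0 R. ennreal \<bar>g b x\<bar> \<partial>lborel))"
      using g(1) by (subst nn_integral_sum) (auto simp: nn_integral_cmult)
    also have "\<dots> < \<infinity>"
    proof -
      have "(\<integral>\<^sup>+ x \<in> ball 0 R. ennreal \<bar>g b x\<bar> \<partial>lborel) < top" if b: "b \<in> Basis" for b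
      proof -
        obtain C where "(\<integral>\<^sup>+ x \<in> ball 0 R. ennreal \<bar>g b x\<bar> \<partial>lebesgue) \<le> ennreal C * N (\<lambda>x. ennreal \<bar>g b x\<bar>)"
          using bb_local[OF N, of 0 R] borel_imp_lebesgue_measurable[OF g(1)[OF b]]
          by (metis borel_measurable_abs measurable_compose measurable_ennreal)
        also have "\<dots> < top" using g(2)[OF b] by (simp add: ennreal_mult_less_top)
        finally show ?thesis by (simp add: nn_integral_completion)
      qed
      then show ?thesis by (simp add: ennreal_mult_less_top)
    qed
    finally show "(\<integral>\<^sup>+ x \<in> ball 0 R. ennreal (norm (G x)) \<partial>lborel) < \<infinity>" .
  qed measurable
  have "weak_gradient f G" unfolding weak_gradient_def
  proof (intro conjI allI impI ballI loc_L1_imp_loc_integrable[OF LG])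
    fix \<phi> :: "'a \<Rightarrow> real" and b :: 'a assume \<phi>: "test_fun \<phi>" and b: "b \<in> Basis"
    obtain R L where cont: "continuous_on UNIV \<phi>"
      and contd: "\<And>b. b \<in> Basis \<Longrightarrow> continuous_on UNIV (\<lambda>x. frechet_derivative \<phi> (at x) b)"
      using test_fun_props[OF \<phi>] by metis
    have [measurable]: "\<phi> \<in> borel_measurable borel" "(\<lambda>x. frechet_derivative \<phi> (at x) b) \<in> borel_measurable borel"
      using cont contd[OF b] by (auto intro!: borel_measurable_continuous_onI)
    have [measurable]: "g b \<in> borel_measurable borel" using g(1)[OF b] .
    have "(\<integral>x. (G x \<bullet> b) * \<phi> x \<partial>lborel) = (\<integral>x. 1/w * (g b x * \<phi> x) \<partial>lborel)" by (simp add: Gb[OF b])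
    also have "\<dots> = 1/w * (\<integral>x. g b x * \<phi> x \<partial>lborel)" by (rule integral_mult_right_zero)
    also have "\<dots> = - (\<integral>x. f x * frechet_derivative \<phi> (at x) b \<partial>lborel)" unfolding g(3)[OF b \<phi>] using w by simp
    finally show "(\<integral>x. f x * frechet_derivative \<phi> (at x) b \<partial>lebesgue) = - (\<integral>x. (G x \<bullet> b) * \<phi> x \<partial>lebesgue)"
      by (simp add: integral_completion)
  qed
  then show thesis using LG that by blast
qed

theorem theorem3p1:
  fixes N :: "('a::euclidean_space) bnorm" and p \<gamma> :: real
  assumes "ball_banach N"
    and "p \<ge> 1" and "\<gamma> \<noteq> 0"
    and "ball_banach (convexification N p)"
    and "abs_cont_norm N" and "abs_cont_norm (associate N)"
    and "maximal_bounded (associate (convexification N p))"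
    and "p = 1 \<longrightarrow> maximal_bounded N"
  shows "\<exists>c C::real. c > 0 \<and> C > 0 \<and>
    (\<forall>f::'a \<Rightarrow> real.
       (sobolev N f \<longleftrightarrow> loc_integrable f \<and> BSVY N p \<gamma> f < \<infinity>) \<and>
       (\<forall>G. loc_integrable f \<and> weak_gradient f G \<and> N (\<lambda>x. ennreal (norm (G x))) < \<infinity> \<longrightarrow>
          ennreal c * N (\<lambda>x. ennreal (norm (G x))) \<le> BSVY N p \<gamma> f \<and>
          BSVY N p \<gamma> f \<le> ennreal C * N (\<lambda>x. ennreal (norm (G x)))))"
proof -
  note N = assms(1)
  obtain C :: real where C: "C > 0"
    "\<And>f G. loc_L1 f \<Longrightarrow> loc_L1 G \<Longrightarrow> weak_gradient f G \<Longrightarrow> N (\<lambda>x. ennreal (norm (G x))) < \<infinity> \<Longrightarrow>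
       BSVY N p \<gamma> f \<le> ennreal C * N (\<lambda>x. ennreal (norm (G x)))"
    using BSVY_upper[OF assms(1,2,3,4,7,8)] by blast
  obtain c :: real where c: "c > 0"
    "\<And>f G. loc_L1 f \<Longrightarrow> loc_L1 G \<Longrightarrow> weak_gradient f G \<Longrightarrow>
       ennreal c * N (\<lambda>x. ennreal (norm (G x))) \<le> BSVY N p \<gamma> f"
    using BSVY_lower[OF assms(1,2,3)] by blast
  \<comment> \<open>The estimates are available for Borel functions; f and G are replaced by
    representatives, which changes neither the functional nor the norm of the gradient.\<close>
  have equiv: "ennreal c * N (\<lambda>x. ennreal (norm (G x))) \<le> BSVY N p \<gamma> f \<and> BSVY N p \<gamma> f \<le> ennreal C * N (\<lambda>x. ennreal (norm (G x)))"
    if f: "loc_integrable f" and wg: "weak_gradient f G" and fin: "N (\<lambda>x. ennreal (norm (G x))) < \<infinity>" for f G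
  proof -
    have G: "loc_integrable G" using wg unfolding weak_gradient_def by blast
    obtain f' where f': "loc_L1 f'" "AE x in lebesgue. f x = f' x" using loc_L1_representative[OF f] by blast
    obtain G' where G': "loc_L1 G'" "AE x in lebesgue. G x = G' x" using loc_L1_representative[OF G] by blast
    have m: "f \<in> borel_measurable lebesgue" "G \<in> borel_measurable lebesgue"
      using f G by (auto intro: loc_integrable_measurable)
    have m': "f' \<in> borel_measurable lebesgue" "G' \<in> borel_measurable lebesgue"
      using f' G' by (auto intro: borel_imp_lebesgue_measurable loc_L1_measurable)
    have wg': "weak_gradient f' G'"
      using wg f'(2) G'(2) m(1) m'(1) m(2) loc_L1_imp_loc_integrable[OF G'(1)] by (rule weak_gradient_cong_AE)
    have NG: "N (\<lambda>x. ennreal (norm (G x))) = N (\<lambda>x. ennreal (norm (G' x)))"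
      using m m' G'(2) by (intro bb_cong[OF N]) (auto elim!: eventually_mono)
    have B: "BSVY N p \<gamma> f = BSVY N p \<gamma> f'"
      using N f'(2) loc_L1_measurable[OF f'(1)] by (rule BSVY_cong_AE)
    show ?thesis unfolding NG B using c(2)[OF f'(1) G'(1) wg'] C(2)[OF f'(1) G'(1) wg'] fin unfolding NG by simp
  qed
  have iff: "sobolev N f \<longleftrightarrow> loc_integrable f \<and> BSVY N p \<gamma> f < \<infinity>" for f
  proof
    assume "sobolev N f"
    then obtain G where f: "loc_integrable f" and G: "weak_gradient f G" "N (\<lambda>x. ennreal (norm (G x))) < \<infinity>"
      unfolding sobolev_def by blast
    have "BSVY N p \<gamma> f \<le> ennreal C * N (\<lambda>x. ennreal (norm (G x)))" using equiv[OF f G] by blast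
    also have "\<dots> < \<infinity>" using G(2) by (simp add: ennreal_mult_less_top)
    finally show "loc_integrable f \<and> BSVY N p \<gamma> f < \<infinity>" using f by blast
  next
    assume "loc_integrable f \<and> BSVY N p \<gamma> f < \<infinity>"
    then have f: "loc_integrable f" and fin: "BSVY N p \<gamma> f < \<infinity>" by auto
    obtain f' where f': "loc_L1 f'" "AE x in lebesgue. f x = f' x" using loc_L1_representative[OF f] by blast
    have B: "BSVY N p \<gamma> f = BSVY N p \<gamma> f'"
      using N f'(2) loc_L1_measurable[OF f'(1)] by (rule BSVY_cong_AE)
    obtain G where G: "loc_L1 G" "weak_gradient f' G"
      using weak_gradient_exists[OF N assms(2,4,6) f'(1)] fin unfolding B by blast
    \<comment> \<open>The lower bound converts finiteness of the functional into finiteness of the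
      gradient norm.\<close>
    have "ennreal c * N (\<lambda>x. ennreal (norm (G x))) < top"
      using c(2)[OF f'(1) G] fin unfolding B by (simp add: le_less_trans)
    then have NG: "N (\<lambda>x. ennreal (norm (G x))) < \<infinity>"
      using c(1) by (auto simp: ennreal_mult_less_top)
    have "weak_gradient f G"
    proof (rule weak_gradient_cong_AE[OF G(2)])
      show "AE x in lebesgue. f' x = f x" using f'(2) by (auto elim!: eventually_mono)
      show "f' \<in> borel_measurable lebesgue" "G \<in> borel_measurable lebesgue"
        using f'(1) G(1) by (auto intro: borel_imp_lebesgue_measurable loc_L1_measurable)
    qed (use f G loc_integrable_measurable loc_L1_imp_loc_integrable in auto)
    then show "sobolev N f" unfolding sobolev_def using f NG by blast
  qed
  show ?thesis using c(1) C(1) equiv iff by blast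
qed

end
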